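(* Let $n\ge 0$ be an integer, let $A$ be an artin algebra and let $I$ be an injective $A$-module with $\operatorname{pd} I\le 1$. Then $I\text{-}\operatorname{domdim} A\ge n+1$ if and only if there exists an integer $d$ with $0\le d\le \min\{\operatorname{id} A, n+1\}$ such that there is a unique basic tilting $A$-module whose projective dimension is exactly $d$ and which is contained in $\mathsf{Fac}_{d}(I)\cap \mathsf{Sub}^{n+1-d}(I)$.
   Context: Throughout, $A$ is a basic, non-semisimple artin algebra; $\mathsf{mod}\,A$ is the category of finitely generated right $A$-modules and "module" means object of $\mathsf{mod}\,A$; $\operatorname{pd}$ and $\operatorname{id}$ denote projective and injective dimension (possibly $\infty$), and $\operatorname{id}A$ is the injective dimension of $A$ as a right module. $\mathsf{add}\,Q$ is the full subcategory of direct summands of finite direct sums of $Q$. A module is basic if it is a direct sum of pairwise non-isomorphic indecomposable modules; uniqueness is up to isomorphism. For a module $Q$ and $m\ge 1$, $\mathsf{Sub}^{m}(Q)$ is the full subcategory of modules $X$ for which there is an exact sequence $0\to X\to Q^0\to Q^1\to\cdots\to Q^{m-1}$ with all $Q^i\in\mathsf{add}\,Q$; $\mathsf{Fac}_{m}(Q)$ is the full subcategory of modules $Y$ for which there is an exact sequence $Q_{m-1}\to\cdots\to Q_1\to Q_0\to Y\to 0$ with all $Q_i\in\mathsf{add}\,Q$. Put $\mathsf{Sub}^0(Q)=\mathsf{Fac}_0(Q)=\mathsf{mod}\,A$. For an injective module $I$ and a module $X$, $I\text{-}\operatorname{domdim}X\ge m$ means $X\in\mathsf{Sub}^m(I)$.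 A module $T$ is a tilting module if $\operatorname{pd}T<\infty$, $\operatorname{Ext}_A^i(T,T)=0$ for all $i\ge1$, and there is an exact sequence $0\to A\to T^0\to\cdots\to T^r\to 0$ for some $r\ge0$ with all $T^i\in\mathsf{add}\,T$. *)

theory Defs
  imports "HOL-Algebra.Module" "HOL-Algebra.Ideal" "HOL-Algebra.Elementary_Groups" "HOL-Library.Extended_Nat"
begin

text \<open>
  All algebra is carrier-based, in the style of HOL-Algebra. A right module over a
  (noncommutative) ring \<open>A\<close> is a record of the library type of modules, whose field
  \<open>a \<odot> x\<close> is read as the right action \<open>x a\<close>; this is why associativity reads
  \<open>(a \<otimes> b) \<odot> x = b \<odot> (a \<odot> x)\<close>. The record fields \<open>mult\<close> and \<open>one\<close> of a module
  carry no meaning.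
\<close>

section \<open>Finitely generated right modules\<close>

locale right_module = R?: ring R + M?: abelian_group M
  for R :: "'a ring" (structure) and M :: "('a, 'm) module" (structure) +
  assumes smult_closed: "\<lbrakk>a \<in> carrier R; x \<in> carrier M\<rbrakk> \<Longrightarrow> a \<odot>\<^bsub>M\<^esub> x \<in> carrier M"
    and smult_l_distr: "\<lbrakk>a \<in> carrier R; b \<in> carrier R; x \<in> carrier M\<rbrakk> \<Longrightarrow>
      (a \<oplus>\<^bsub>R\<^esub> b) \<odot>\<^bsub>M\<^esub> x = a \<odot>\<^bsub>M\<^esub> x \<oplus>\<^bsub>M\<^esub> b \<odot>\<^bsub>M\<^esub> x"
    and smult_r_distr: "\<lbrakk>a \<in> carrier R; x \<in> carrier M; y \<in> carrier M\<rbrakk> \<Longrightarrow>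
      a \<odot>\<^bsub>M\<^esub> (x \<oplus>\<^bsub>M\<^esub> y) = a \<odot>\<^bsub>M\<^esub> x \<oplus>\<^bsub>M\<^esub> a \<odot>\<^bsub>M\<^esub> y"
    and smult_assoc: "\<lbrakk>a \<in> carrier R; b \<in> carrier R; x \<in> carrier M\<rbrakk> \<Longrightarrow>
      (a \<otimes>\<^bsub>R\<^esub> b) \<odot>\<^bsub>M\<^esub> x = b \<odot>\<^bsub>M\<^esub> (a \<odot>\<^bsub>M\<^esub> x)"
    and smult_one: "x \<in> carrier M \<Longrightarrow> \<one>\<^bsub>R\<^esub> \<odot>\<^bsub>M\<^esub> x = x"

definition fg_module :: "'a ring \<Rightarrow> ('a, 'm) module \<Rightarrow> bool" where
  "fg_module A M \<longleftrightarrow> right_module A M \<and>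
     (\<exists>S. finite S \<and> S \<subseteq> carrier M \<and>
          carrier M = {finsum M (\<lambda>s. c s \<odot>\<^bsub>M\<^esub> s) S | c. c \<in> S \<rightarrow> carrier A})"

definition module_hom :: "'a ring \<Rightarrow> ('a, 'm) module \<Rightarrow> ('a, 'p) module \<Rightarrow> ('m \<Rightarrow> 'p) set" where
  "module_hom A M N = {f \<in> carrier M \<rightarrow> carrier N.
     (\<forall>x\<in>carrier M. \<forall>y\<in>carrier M. f (x \<oplus>\<^bsub>M\<^esub> y) = f x \<oplus>\<^bsub>N\<^esub> f y) \<and>
     (\<forall>a\<in>carrier A. \<forall>x\<in>carrier M. f (a \<odot>\<^bsub>M\<^esub> x) = a \<odot>\<^bsub>N\<^esub> f x)}"

definition module_iso :: "'a ring \<Rightarrow> ('a, 'm) module \<Rightarrow> ('a, 'p) module \<Rightarrow> bool" where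
  "module_iso A M N \<longleftrightarrow> (\<exists>f\<in>module_hom A M N. bij_betw f (carrier M) (carrier N))"

definition zero_module :: "('a, 'm) module \<Rightarrow> bool" where
  "zero_module M \<longleftrightarrow> carrier M = {\<zero>\<^bsub>M\<^esub>}"

definition regular_module :: "'a ring \<Rightarrow> ('a, 'a) module" where
  "regular_module A = \<lparr>carrier = carrier A, mult = mult A, one = one A,
     zero = zero A, add = add A, smult = (\<lambda>a x. x \<otimes>\<^bsub>A\<^esub> a)\<rparr>"

definition restrict_module :: "('a, 'm) module \<Rightarrow> 'm set \<Rightarrow> ('a, 'm) module" where
  "restrict_module M H = M\<lparr>carrier := H\<rparr>"

definition power_module :: "('a, 'm) module \<Rightarrow> nat \<Rightarrow> ('a, nat \<Rightarrow> 'm) module" where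
  "power_module M n = \<lparr>carrier = {..<n} \<rightarrow>\<^sub>E carrier M, mult = undefined, one = undefined,
     zero = (\<lambda>i\<in>{..<n}. \<zero>\<^bsub>M\<^esub>), add = (\<lambda>x y. \<lambda>i\<in>{..<n}. x i \<oplus>\<^bsub>M\<^esub> y i),
     smult = (\<lambda>a x. \<lambda>i\<in>{..<n}. a \<odot>\<^bsub>M\<^esub> x i)\<rparr>"

text \<open>
  Quantification over modules needs a fixed type for their elements. Every finitely
  generated \<open>A\<close>-module is isomorphic to one whose elements are sets of sequences in
  \<open>A\<close> (an element becomes the set of its coordinate vectors with respect to a
  generating sequence), so that modules of the following type exhaust \<open>mod A\<close> up to
  isomorphism. This is the lemma \<open>fg_module_representable\<close>.
\<close>

type_synonym 'a umodule = "('a, (nat \<Rightarrow> 'a) set) module"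

lemma fg_module_representable:
  fixes A :: "'a ring" and M :: "('a, 'm) module"
  assumes fg: "fg_module A M"
  shows "\<exists>U :: 'a umodule. fg_module A U \<and> module_iso A M U"
proof -
  interpret right_module A M
    using fg by (simp add: fg_module_def)
  obtain S where S: "finite S" "S \<subseteq> carrier M"
    "carrier M = {finsum M (\<lambda>s. c s \<odot>\<^bsub>M\<^esub> s) S | c. c \<in> S \<rightarrow> carrier A}"
    using fg by (auto simp: fg_module_def)
  obtain idx :: "'m \<Rightarrow> nat" where idx: "inj_on idx S"
    using finite_imp_inj_to_nat_seg[OF S(1)] by blast
  define h :: "'m \<Rightarrow> (nat \<Rightarrow> 'a) set" where
    "h x = {v. (\<forall>s\<in>S. v (idx s) \<in> carrier A) \<and> finsum M (\<lambda>s. v (idx s) \<odot>\<^bsub>M\<^esub> s) S = x}" for x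
  have ne: "h x \<noteq> {}" if x: "x \<in> carrier M" for x
  proof -
    obtain c where c: "c \<in> S \<rightarrow> carrier A" "x = finsum M (\<lambda>s. c s \<odot>\<^bsub>M\<^esub> s) S"
      using x S(3) by blast
    have "finsum M (\<lambda>s. c (the_inv_into S idx (idx s)) \<odot>\<^bsub>M\<^esub> s) S = x"
      unfolding c(2) using c(1) S(2)
      by (intro M.finsum_cong') (auto simp: the_inv_into_f_f[OF idx] intro!: smult_closed)
    then have "(\<lambda>j. c (the_inv_into S idx j)) \<in> h x"
      using c(1) by (auto simp: h_def the_inv_into_f_f[OF idx])
    then show ?thesis by blast
  qed
  have inj: "inj_on h (carrier M)"
  proof (rule inj_onI)
    fix x y assume "x \<in> carrier M" "y \<in> carrier M" and eq: "h x = h y"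
    then obtain v where "v \<in> h x" "v \<in> h y" using ne by fastforce
    then show "x = y" by (simp add: h_def)
  qed
  define g where "g = the_inv_into (carrier M) h"
  have gh [simp]: "g (h x) = x" if "x \<in> carrier M" for x
    using that inj by (simp add: g_def the_inv_into_f_f)
  define U :: "'a umodule" where
    "U = \<lparr>carrier = h ` carrier M, mult = undefined, one = undefined, zero = h \<zero>\<^bsub>M\<^esub>,
       add = (\<lambda>X Y. h (g X \<oplus>\<^bsub>M\<^esub> g Y)), smult = (\<lambda>a X. h (a \<odot>\<^bsub>M\<^esub> g X))\<rparr>"
  have carU: "carrier U = h ` carrier M" and zeroU: "\<zero>\<^bsub>U\<^esub> = h \<zero>\<^bsub>M\<^esub>"
    and addU: "\<And>X Y. X \<oplus>\<^bsub>U\<^esub> Y = h (g X \<oplus>\<^bsub>M\<^esub> g Y)"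
    and smultU: "\<And>a X. a \<odot>\<^bsub>U\<^esub> X = h (a \<odot>\<^bsub>M\<^esub> g X)"
    by (simp_all add: U_def)
  have "abelian_group U"
  proof (rule abelian_groupI)
    fix X assume "X \<in> carrier U"
    then obtain x where "x \<in> carrier M" "X = h x" by (auto simp: carU)
    then show "\<exists>Y\<in>carrier U. Y \<oplus>\<^bsub>U\<^esub> X = \<zero>\<^bsub>U\<^esub>"
      by (intro bexI[of _ "h (\<ominus>\<^bsub>M\<^esub> x)"]) (auto simp: carU addU zeroU M.l_neg)
  qed (auto simp: carU zeroU addU M.a_ac)
  moreover have "right_module_axioms A U"
    by unfold_locales
      (auto simp: carU zeroU addU smultU smult_closed smult_l_distr smult_r_distr
         smult_assoc smult_one)
  ultimately have rmU: "right_module A U"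
    by (simp add: right_module_def R.ring_axioms)
  then interpret U: right_module A U .
  have hom: "h \<in> module_hom A M U"
    by (auto simp: module_hom_def carU addU smultU)
  have hsum: "h (finsum M f T) = finsum U (\<lambda>s. h (f s)) T"
    if "finite T" "f \<in> T \<rightarrow> carrier M" for f :: "'m \<Rightarrow> 'm" and T
    using that
  proof (induction T)
    case empty
    then show ?case by (simp add: zeroU)
  next
    case (insert t T)
    have "(\<lambda>s. h (f s)) \<in> T \<rightarrow> carrier U" "h (f t) \<in> carrier U" "f t \<in> carrier M"
      "f \<in> T \<rightarrow> carrier M" "finsum M f T \<in> carrier M"
      using insert by (auto simp: carU intro!: M.finsum_closed)
    with insert show ?case
      by (simp add: addU flip: insert.IH)
  qed
  have injS: "inj_on h S" using inj S(2) by (rule inj_on_subset)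
  have gen: "h (finsum M (\<lambda>s. c s \<odot>\<^bsub>M\<^esub> s) S) = finsum U (\<lambda>s. c (g s) \<odot>\<^bsub>U\<^esub> s) (h ` S)"
    if "c \<in> S \<rightarrow> carrier A" for c
  proof -
    have "h (finsum M (\<lambda>s. c s \<odot>\<^bsub>M\<^esub> s) S) = finsum U (\<lambda>s. h (c s \<odot>\<^bsub>M\<^esub> s)) S"
      using that S(1,2) by (intro hsum) (auto intro!: smult_closed)
    also have "\<dots> = finsum U (\<lambda>s. c (g (h s)) \<odot>\<^bsub>U\<^esub> h s) S"
      using that S(2) by (intro U.M.finsum_cong') (auto simp: smultU carU subset_iff intro!: smult_closed)
    also have "\<dots> = finsum U (\<lambda>s. c (g s) \<odot>\<^bsub>U\<^esub> s) (h ` S)"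
      using that S(2) injS
      by (subst U.M.finsum_reindex) (auto simp: smultU carU subset_iff intro!: smult_closed imageI)
    finally show ?thesis .
  qed
  have "carrier U = {finsum U (\<lambda>s. c s \<odot>\<^bsub>U\<^esub> s) (h ` S) | c. c \<in> h ` S \<rightarrow> carrier A}"
  proof (intro equalityI subsetI)
    fix X assume "X \<in> carrier U"
    then obtain c where c: "c \<in> S \<rightarrow> carrier A" "X = h (finsum M (\<lambda>s. c s \<odot>\<^bsub>M\<^esub> s) S)"
      using S(3) carU by auto
    then have "X = finsum U (\<lambda>s. (c \<circ> g) s \<odot>\<^bsub>U\<^esub> s) (h ` S)" "c \<circ> g \<in> h ` S \<rightarrow> carrier A"
      using gen[OF c(1)] S(2) by (auto simp: subset_iff)
    then show "X \<in> {finsum U (\<lambda>s. c s \<odot>\<^bsub>U\<^esub> s) (h ` S) | c. c \<in> h ` S \<rightarrow> carrier A}" by blast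
  next
    fix X assume "X \<in> {finsum U (\<lambda>s. c s \<odot>\<^bsub>U\<^esub> s) (h ` S) | c. c \<in> h ` S \<rightarrow> carrier A}"
    then show "X \<in> carrier U"
      using S(2) by (auto simp: carU[symmetric] intro!: U.M.finsum_closed U.smult_closed)
        (auto simp: carU)
  qed
  moreover have "finite (h ` S)" "h ` S \<subseteq> carrier U"
    using S(1,2) by (auto simp: carU)
  ultimately have "fg_module A U"
    unfolding fg_module_def using rmU by blast
  moreover have "module_iso A M U"
    unfolding module_iso_def using hom inj by (auto simp: bij_betw_def carU)
  ultimately show ?thesis by blast
qed


section \<open>Direct sums\<close>

definition direct_summand :: "'a ring \<Rightarrow> ('a, 'm) module \<Rightarrow> ('a, 'p) module \<Rightarrow> bool" where
  "direct_summand A X M \<longleftrightarrow> (\<exists>Y Z. submodule Y A M \<and> submodule Z A M \<and>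
     bij_betw (\<lambda>(y, z). y \<oplus>\<^bsub>M\<^esub> z) (Y \<times> Z) (carrier M) \<and>
     module_iso A X (restrict_module M Y))"

definition in_add :: "'a ring \<Rightarrow> ('a, 'q) module \<Rightarrow> ('a, 'm) module \<Rightarrow> bool" where
  "in_add A Q X \<longleftrightarrow> fg_module A X \<and> (\<exists>n. direct_summand A X (power_module Q n))"

definition indecomposable_module :: "'a ring \<Rightarrow> ('a, 'm) module \<Rightarrow> bool" where
  "indecomposable_module A M \<longleftrightarrow> \<not> zero_module M \<and>
     (\<forall>Y Z. submodule Y A M \<and> submodule Z A M \<and>
        bij_betw (\<lambda>(y, z). y \<oplus>\<^bsub>M\<^esub> z) (Y \<times> Z) (carrier M) \<longrightarrow>
        Y = {\<zero>\<^bsub>M\<^esub>} \<or> Z = {\<zero>\<^bsub>M\<^esub>})"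

definition simple_module :: "'a ring \<Rightarrow> ('a, 'm) module \<Rightarrow> bool" where
  "simple_module A M \<longleftrightarrow> \<not> zero_module M \<and>
     (\<forall>Y. submodule Y A M \<longrightarrow> Y = {\<zero>\<^bsub>M\<^esub>} \<or> Y = carrier M)"

definition direct_sum_of :: "'a ring \<Rightarrow> ('a, 'm) module \<Rightarrow> nat \<Rightarrow> (nat \<Rightarrow> 'm set) \<Rightarrow> bool" where
  "direct_sum_of A M n S \<longleftrightarrow> (\<forall>i<n. submodule (S i) A M) \<and>
     bij_betw (\<lambda>x. finsum M x {..<n}) (\<Pi>\<^sub>E i\<in>{..<n}. S i) (carrier M)"

definition basic_module :: "'a ring \<Rightarrow> ('a, 'm) module \<Rightarrow> bool" where
  "basic_module A M \<longleftrightarrow> fg_module A M \<and> (\<exists>n S. direct_sum_of A M n S \<and>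
     (\<forall>i<n. indecomposable_module A (restrict_module M (S i))) \<and>
     (\<forall>i<n. \<forall>j<n. i \<noteq> j \<longrightarrow>
        \<not> module_iso A (restrict_module M (S i)) (restrict_module M (S j))))"

definition semisimple_module :: "'a ring \<Rightarrow> ('a, 'm) module \<Rightarrow> bool" where
  "semisimple_module A M \<longleftrightarrow> fg_module A M \<and> (\<exists>n S. direct_sum_of A M n S \<and>
     (\<forall>i<n. simple_module A (restrict_module M (S i))))"


section \<open>Artin algebras\<close>

locale artinian_cring = cring +
  assumes descending_chain: "\<lbrakk>\<And>i::nat. ideal (J i) R; \<And>i. J (Suc i) \<subseteq> J i\<rbrakk> \<Longrightarrow>
    \<exists>m. \<forall>i\<ge>m. J i = J m"

text \<open>The algebra structure over \<open>k\<close> is given by a structure map \<open>\<phi>\<close> into the centre.\<close>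

locale artin_algebra = k: artinian_cring k + ring A
  for k :: "'k ring" and \<phi> :: "'k \<Rightarrow> 'a" and A :: "'a ring" (structure) +
  assumes structure_map: "\<phi> \<in> ring_hom k A"
    and central: "\<lbrakk>r \<in> carrier k; a \<in> carrier A\<rbrakk> \<Longrightarrow> \<phi> r \<otimes> a = a \<otimes> \<phi> r"
    and finite_over_k: "\<exists>S. finite S \<and> S \<subseteq> carrier A \<and>
      carrier A = {finsum A (\<lambda>s. \<phi> (c s) \<otimes> s) S | c. c \<in> S \<rightarrow> carrier k}"

definition basic_algebra :: "'a ring \<Rightarrow> bool" where
  "basic_algebra A \<longleftrightarrow> basic_module A (regular_module A)"

definition semisimple_algebra :: "'a ring \<Rightarrow> bool" where
  "semisimple_algebra A \<longleftrightarrow> semisimple_module A (regular_module A)"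


section \<open>Exact sequences\<close>

text \<open>
  \<open>left_exact_seq A m X Q e d\<close>: the sequence \<open>0 \<rightarrow> X \<rightarrow> Q 0 \<rightarrow> \<dots> \<rightarrow> Q (m - 1)\<close> of
  finitely generated modules with maps \<open>e\<close>, \<open>d 0\<close>, \<open>\<dots>\<close>, \<open>d (m - 2)\<close> is exact
  (at every term but the last one, if \<open>m \<ge> 1\<close>).
\<close>

definition left_exact_seq :: "'a ring \<Rightarrow> nat \<Rightarrow> ('a, 'x) module \<Rightarrow> (nat \<Rightarrow> ('a, 'q) module) \<Rightarrow>
    ('x \<Rightarrow> 'q) \<Rightarrow> (nat \<Rightarrow> 'q \<Rightarrow> 'q) \<Rightarrow> bool" where
  "left_exact_seq A m X Q e d \<longleftrightarrow> fg_module A X \<and> (\<forall>i<m. fg_module A (Q i)) \<and>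
     (0 < m \<longrightarrow> e \<in> module_hom A X (Q 0) \<and> inj_on e (carrier X)) \<and>
     (\<forall>i. Suc i < m \<longrightarrow> d i \<in> module_hom A (Q i) (Q (Suc i)) \<and>
        a_kernel (Q i) (Q (Suc i)) (d i) =
          (case i of 0 \<Rightarrow> e ` carrier X | Suc j \<Rightarrow> d j ` carrier (Q j)))"

text \<open>Dually, \<open>Q (m - 1) \<rightarrow> \<dots> \<rightarrow> Q 0 \<rightarrow> Y \<rightarrow> 0\<close> is exact, with \<open>d i : Q (i + 1) \<rightarrow> Q i\<close>.\<close>

definition right_exact_seq :: "'a ring \<Rightarrow> nat \<Rightarrow> ('a, 'y) module \<Rightarrow> (nat \<Rightarrow> ('a, 'q) module) \<Rightarrow>
    ('q \<Rightarrow> 'y) \<Rightarrow> (nat \<Rightarrow> 'q \<Rightarrow> 'q) \<Rightarrow> bool" where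
  "right_exact_seq A m Y Q e d \<longleftrightarrow> fg_module A Y \<and> (\<forall>i<m. fg_module A (Q i)) \<and>
     (0 < m \<longrightarrow> e \<in> module_hom A (Q 0) Y \<and> e ` carrier (Q 0) = carrier Y) \<and>
     (\<forall>i. Suc i < m \<longrightarrow> d i \<in> module_hom A (Q (Suc i)) (Q i) \<and>
        d i ` carrier (Q (Suc i)) =
          (case i of 0 \<Rightarrow> a_kernel (Q 0) Y e | Suc j \<Rightarrow> a_kernel (Q (Suc j)) (Q j) (d j)))"

text \<open>Infinite exact sequences; a finite one is continued by zero modules.\<close>

definition coresolution :: "'a ring \<Rightarrow> ('a, 'x) module \<Rightarrow> (nat \<Rightarrow> ('a, 'q) module) \<Rightarrow>
    ('x \<Rightarrow> 'q) \<Rightarrow> (nat \<Rightarrow> 'q \<Rightarrow> 'q) \<Rightarrow> bool" where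
  "coresolution A X Q e d \<longleftrightarrow> (\<forall>m. left_exact_seq A m X Q e d)"

definition resolution :: "'a ring \<Rightarrow> ('a, 'y) module \<Rightarrow> (nat \<Rightarrow> ('a, 'q) module) \<Rightarrow>
    ('q \<Rightarrow> 'y) \<Rightarrow> (nat \<Rightarrow> 'q \<Rightarrow> 'q) \<Rightarrow> bool" where
  "resolution A Y Q e d \<longleftrightarrow> (\<forall>m. right_exact_seq A m Y Q e d)"

definition in_Sub :: "'a ring \<Rightarrow> nat \<Rightarrow> ('a, 'q) module \<Rightarrow> ('a, 'x) module \<Rightarrow> bool" where
  "in_Sub A m Q X \<longleftrightarrow> (\<exists>(P :: nat \<Rightarrow> 'a umodule) e d.
     left_exact_seq A m X P e d \<and> (\<forall>i<m. in_add A Q (P i)))"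

definition in_Fac :: "'a ring \<Rightarrow> nat \<Rightarrow> ('a, 'q) module \<Rightarrow> ('a, 'y) module \<Rightarrow> bool" where
  "in_Fac A m Q Y \<longleftrightarrow> (\<exists>(P :: nat \<Rightarrow> 'a umodule) e d.
     right_exact_seq A m Y P e d \<and> (\<forall>i<m. in_add A Q (P i)))"

definition domdim_ge :: "'a ring \<Rightarrow> ('a, 'i) module \<Rightarrow> ('a, 'x) module \<Rightarrow> nat \<Rightarrow> bool" where
  "domdim_ge A I X m \<longleftrightarrow> in_Sub A m I X"


section \<open>Homological dimensions and Ext\<close>

definition projective_module :: "'a ring \<Rightarrow> ('a, 'm) module \<Rightarrow> bool" where
  "projective_module A P \<longleftrightarrow> fg_module A P \<and>
     (\<forall>(X :: 'a umodule) (Y :: 'a umodule) p f.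
        fg_module A X \<and> fg_module A Y \<and> p \<in> module_hom A X Y \<and> p ` carrier X = carrier Y \<and>
        f \<in> module_hom A P Y \<longrightarrow>
        (\<exists>g\<in>module_hom A P X. \<forall>x\<in>carrier P. p (g x) = f x))"

definition injective_module :: "'a ring \<Rightarrow> ('a, 'm) module \<Rightarrow> bool" where
  "injective_module A I \<longleftrightarrow> fg_module A I \<and>
     (\<forall>(X :: 'a umodule) (Y :: 'a umodule) j f.
        fg_module A X \<and> fg_module A Y \<and> j \<in> module_hom A X Y \<and> inj_on j (carrier X) \<and>
        f \<in> module_hom A X I \<longrightarrow>
        (\<exists>g\<in>module_hom A Y I. \<forall>x\<in>carrier X. g (j x) = f x))"

definition projective_resolution :: "'a ring \<Rightarrow> ('a, 'm) module \<Rightarrow> (nat \<Rightarrow> 'a umodule) \<Rightarrow>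
    ((nat \<Rightarrow> 'a) set \<Rightarrow> 'm) \<Rightarrow> (nat \<Rightarrow> (nat \<Rightarrow> 'a) set \<Rightarrow> (nat \<Rightarrow> 'a) set) \<Rightarrow> bool" where
  "projective_resolution A M P e d \<longleftrightarrow> resolution A M P e d \<and> (\<forall>i. projective_module A (P i))"

definition injective_coresolution :: "'a ring \<Rightarrow> ('a, 'm) module \<Rightarrow> (nat \<Rightarrow> 'a umodule) \<Rightarrow>
    ('m \<Rightarrow> (nat \<Rightarrow> 'a) set) \<Rightarrow> (nat \<Rightarrow> (nat \<Rightarrow> 'a) set \<Rightarrow> (nat \<Rightarrow> 'a) set) \<Rightarrow> bool" where
  "injective_coresolution A M E e d \<longleftrightarrow> coresolution A M E e d \<and> (\<forall>i. injective_module A (E i))"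

definition proj_dim :: "'a ring \<Rightarrow> ('a, 'm) module \<Rightarrow> enat" where
  "proj_dim A M = Inf {enat n | n. \<exists>P e d. projective_resolution A M P e d \<and>
     (\<forall>i>n. zero_module (P i))}"

definition inj_dim :: "'a ring \<Rightarrow> ('a, 'm) module \<Rightarrow> enat" where
  "inj_dim A M = Inf {enat n | n. \<exists>E e d. injective_coresolution A M E e d \<and>
     (\<forall>i>n. zero_module (E i))}"

definition hom_group :: "'a ring \<Rightarrow> ('a, 'm) module \<Rightarrow> ('a, 'p) module \<Rightarrow> ('m \<Rightarrow> 'p) monoid" where
  "hom_group A M N = \<lparr>carrier = module_hom A M N \<inter> extensional (carrier M),
     mult = (\<lambda>f g. \<lambda>x\<in>carrier M. f x \<oplus>\<^bsub>N\<^esub> g x), one = (\<lambda>x\<in>carrier M. \<zero>\<^bsub>N\<^esub>)\<rparr>"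

text \<open>
  The cohomology in degree \<open>i\<close> of the complex
  \<open>0 \<rightarrow> Hom(P 0, N) \<rightarrow> Hom(P 1, N) \<rightarrow> \<dots>\<close> obtained from \<open>d i : P (i + 1) \<rightarrow> P i\<close>.
\<close>

definition hom_differential :: "(nat \<Rightarrow> ('a, 'q) module) \<Rightarrow> (nat \<Rightarrow> 'q \<Rightarrow> 'q) \<Rightarrow>
    nat \<Rightarrow> ('q \<Rightarrow> 'n) \<Rightarrow> 'q \<Rightarrow> 'n" where
  "hom_differential P d i f = compose (carrier (P (Suc i))) f (d i)"

definition hom_cohomology :: "'a ring \<Rightarrow> (nat \<Rightarrow> ('a, 'q) module) \<Rightarrow> (nat \<Rightarrow> 'q \<Rightarrow> 'q) \<Rightarrow>
    nat \<Rightarrow> ('a, 'n) module \<Rightarrow> ('q \<Rightarrow> 'n) set monoid" where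
  "hom_cohomology A P d i N =
     (hom_group A (P i) N)\<lparr>carrier :=
        kernel (hom_group A (P i) N) (hom_group A (P (Suc i)) N) (hom_differential P d i)\<rparr>
     Mod (case i of 0 \<Rightarrow> {\<one>\<^bsub>hom_group A (P 0) N\<^esub>}
          | Suc j \<Rightarrow> hom_differential P d j ` carrier (hom_group A (P j) N))"

definition Ext :: "'a ring \<Rightarrow> nat \<Rightarrow> ('a, 'm) module \<Rightarrow> ('a, 'n) module \<Rightarrow>
    ((nat \<Rightarrow> 'a) set \<Rightarrow> 'n) set monoid" where
  "Ext A i M N = (let (P, e, d) = (SOME (P, e, d). projective_resolution A M P e d)
                  in hom_cohomology A P d i N)"


section \<open>Tilting modules\<close>

definition tilting_module :: "'a ring \<Rightarrow> ('a, 'm) module \<Rightarrow> bool" where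
  "tilting_module A T \<longleftrightarrow> fg_module A T \<and> proj_dim A T < \<infinity> \<and>
     (\<forall>i\<ge>1. trivial_group (Ext A i T T)) \<and>
     (\<exists>r (Q :: nat \<Rightarrow> 'a umodule) e d. coresolution A (regular_module A) Q e d \<and>
        (\<forall>i\<le>r. in_add A T (Q i)) \<and> (\<forall>i>r. zero_module (Q i)))"

end

theory Submission
  imports Defs
begin

text \<open>
  If \<open>I\<close>-domdim \<open>A \<ge> n + 1\<close>, take \<open>d = 0\<close>: a basic tilting module that is projective is isomorphic to \<open>A\<close>.

  Conversely let \<open>T\<close> be as in the statement for some \<open>d\<close>; if \<open>d = 0\<close> then \<open>T\<close> is \<open>A\<close>. Let \<open>d \<ge> 1\<close> and let
  \<open>perp\<close> be the class of modules \<open>X\<close> with \<open>Ext\<close>-groups \<open>Ext\<^sup>i(T, X) = 0\<close> for all \<open>i \<ge> 1\<close>. Every \<open>X\<close> in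
  \<open>perp\<close> is the quotient of a module in \<open>add T\<close> by a module in \<open>perp\<close>, and \<open>T\<close> is a quotient of a module
  in \<open>add I\<close>. Together with \<open>pd I \<le> 1\<close> this shows that \<open>Ext\<^sup>1(I, -)\<close> vanishes on \<open>perp\<close> and on \<open>Fac\<^sub>1(I)\<close>.
  Starting with \<open>C = A\<close>, maps from \<open>C\<close> to \<open>perp\<close> factor through \<open>add I\<close>; as \<open>C\<close> embeds into a module in
  \<open>perp\<close>, it embeds into a module in \<open>add I\<close> with a cokernel that inherits these properties. After \<open>d\<close>
  steps, each of which lowers by one the degree from which on \<open>Ext(T, C)\<close> vanishes, the cosyzygy lies
  in \<open>perp\<close> and is a direct summand of a module in \<open>add T\<close>, whence in \<open>Sub\<^sup>n\<^sup>+\<^sup>1\<^sup>-\<^sup>d(I)\<close>.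
\<close>

section \<open>Modules and homomorphisms\<close>

text \<open>The bound pd I <= 1 is spent as follows. In a presentation K -> P -> I every Ext out of
  K vanishes, so a map from K to X in \<open>perp\<close> lifts first to an add T cover of X and
  then to an add I cover of T; a map passing through add I extends from K to P because I is
  injective. The main obstacle is injectivity: factoring maps from a cosyzygy C through add I does
  not yet embed C anywhere. Hence each C carries an embedding into some W in \<open>perp\<close>
  whose cokernel is a cosyzygy of the tilting coresolution of A. The factor C -> add I of this
  embedding is mono, and a horseshoe supplies the next W, so no injective envelopes are formed. The
  identification of T with A for d = 0 rests on Krull-Schmidt, hence on Fitting's lemma and both
  chain conditions; since k is only given as artinian, the ascending one comes from Hopkins'
  theorem. \<open>Ext\<close> is defined by an arbitrary chosen resolution; the arguments use
  instead the extension property \<open>ext1_zero\<close>, shifted along syzygies. Membership in add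
  Q becomes a decomposition of the identity into maps through Q
  (\<open>factors_add\<close>).\<close>

context abelian_group
begin

lemma minus_add_minus_cancel:
  assumes "x \<in> carrier G" "y \<in> carrier G" "z \<in> carrier G"
  shows "(x \<ominus> y) \<oplus> (y \<ominus> z) = x \<ominus> z"
proof -
  have "(x \<ominus> y) \<oplus> (y \<ominus> z) = x \<oplus> (\<ominus> y \<oplus> (y \<oplus> \<ominus> z))"
    using assms by (simp add: a_minus_def a_assoc)
  also have "\<dots> = x \<ominus> z"
    using assms by (simp add: r_neg1 a_minus_def)
  finally show ?thesis .
qed

lemma neg_minus:
  assumes "x \<in> carrier G" "y \<in> carrier G"
  shows "\<ominus> (x \<ominus> y) = y \<ominus> x"
  using assms by (simp add: a_minus_def minus_add a_comm)

lemma minus_cancel_right: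
  assumes "x \<in> carrier G" "y \<in> carrier G" "z \<in> carrier G"
  shows "(x \<ominus> z) \<ominus> (y \<ominus> z) = x \<ominus> y"
  using assms minus_add_minus_cancel[of x z y] by (simp add: neg_minus minus_eq[of _ "y \<ominus> z"])

lemma minus_minus_cancel:
  assumes "x \<in> carrier G" "y \<in> carrier G" "z \<in> carrier G"
  shows "(x \<ominus> z) \<ominus> (x \<ominus> y) = y \<ominus> z"
  using assms minus_add_minus_cancel[of y x z] by (simp add: neg_minus minus_eq[of _ "x \<ominus> y"] a_comm)

lemma minus_add_cancel:
  assumes "x \<in> carrier G" "y \<in> carrier G"
  shows "(x \<ominus> y) \<oplus> y = x"
  using assms by (simp add: a_minus_def a_assoc l_neg)

lemma add_minus_cancel:
  assumes "x \<in> carrier G" "y \<in> carrier G"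
  shows "(x \<oplus> y) \<ominus> y = x"
  using assms by (simp add: a_minus_def a_assoc r_neg)

lemma neg_zero: "\<ominus> \<zero> = \<zero>"
  using l_neg[OF zero_closed] by simp

lemma minus_zero_iff:
  assumes "x \<in> carrier G" "y \<in> carrier G"
  shows "x \<ominus> y = \<zero> \<longleftrightarrow> x = y"
  using assms minus_add_cancel[of x y] by (auto simp: a_minus_def r_neg)

lemma minus_self: "x \<in> carrier G \<Longrightarrow> x \<ominus> x = \<zero>"
  by (simp add: a_minus_def r_neg)

end

lemma fg_module_right_module: "fg_module A M \<Longrightarrow> right_module A M"
  by (simp add: fg_module_def)

lemma module_hom_closed: "f \<in> module_hom A M N \<Longrightarrow> x \<in> carrier M \<Longrightarrow> f x \<in> carrier N"
  by (auto simp: module_hom_def)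

lemma module_hom_add:
  "f \<in> module_hom A M N \<Longrightarrow> x \<in> carrier M \<Longrightarrow> y \<in> carrier M \<Longrightarrow> f (x \<oplus>\<^bsub>M\<^esub> y) = f x \<oplus>\<^bsub>N\<^esub> f y"
  by (auto simp: module_hom_def)

lemma module_hom_smult:
  "f \<in> module_hom A M N \<Longrightarrow> a \<in> carrier A \<Longrightarrow> x \<in> carrier M \<Longrightarrow> f (a \<odot>\<^bsub>M\<^esub> x) = a \<odot>\<^bsub>N\<^esub> f x"
  by (auto simp: module_hom_def)

lemma module_homI:
  assumes "\<And>x. x \<in> carrier M \<Longrightarrow> f x \<in> carrier N"
    and "\<And>x y. x \<in> carrier M \<Longrightarrow> y \<in> carrier M \<Longrightarrow> f (x \<oplus>\<^bsub>M\<^esub> y) = f x \<oplus>\<^bsub>N\<^esub> f y"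
    and "\<And>a x. a \<in> carrier A \<Longrightarrow> x \<in> carrier M \<Longrightarrow> f (a \<odot>\<^bsub>M\<^esub> x) = a \<odot>\<^bsub>N\<^esub> f x"
  shows "f \<in> module_hom A M N"
  using assms by (auto simp: module_hom_def)

lemma module_hom_comp:
  "f \<in> module_hom A L M \<Longrightarrow> g \<in> module_hom A M N \<Longrightarrow> (\<lambda>x. g (f x)) \<in> module_hom A L N"
  by (simp add: module_hom_def Pi_iff)

lemma module_hom_id: "(\<lambda>x. x) \<in> module_hom A M M"
  by (auto simp: module_hom_def)

lemma module_hom_cong:
  assumes "right_module A M" "f \<in> module_hom A M N" "\<And>x. x \<in> carrier M \<Longrightarrow> g x = f x"
  shows "g \<in> module_hom A M N"
proof -
  interpret right_module A M by fact
  show ?thesis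
    using assms(2,3) by (auto simp: module_hom_def smult_closed)
qed

context right_module
begin

lemma smult_zero_right: "a \<in> carrier R \<Longrightarrow> a \<odot>\<^bsub>M\<^esub> \<zero>\<^bsub>M\<^esub> = \<zero>\<^bsub>M\<^esub>"
  by (metis M.add.r_cancel_one' M.zero_closed M.l_zero smult_closed smult_r_distr)

lemma smult_zero_left: "x \<in> carrier M \<Longrightarrow> \<zero>\<^bsub>R\<^esub> \<odot>\<^bsub>M\<^esub> x = \<zero>\<^bsub>M\<^esub>"
  by (metis M.add.r_cancel_one' R.zero_closed R.l_zero smult_closed smult_l_distr)

lemma smult_minus_right:
  assumes "a \<in> carrier R" "x \<in> carrier M"
  shows "a \<odot>\<^bsub>M\<^esub> (\<ominus>\<^bsub>M\<^esub> x) = \<ominus>\<^bsub>M\<^esub> (a \<odot>\<^bsub>M\<^esub> x)"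
proof -
  have "a \<odot>\<^bsub>M\<^esub> (\<ominus>\<^bsub>M\<^esub> x) \<oplus>\<^bsub>M\<^esub> a \<odot>\<^bsub>M\<^esub> x = \<zero>\<^bsub>M\<^esub>"
    using assms by (simp flip: smult_r_distr add: M.l_neg smult_zero_right)
  then show ?thesis
    using assms by (simp add: smult_closed M.minus_equality)
qed

lemma smult_minus_one:
  assumes "x \<in> carrier M"
  shows "(\<ominus>\<^bsub>R\<^esub> \<one>\<^bsub>R\<^esub>) \<odot>\<^bsub>M\<^esub> x = \<ominus>\<^bsub>M\<^esub> x"
proof -
  have "(\<ominus>\<^bsub>R\<^esub> \<one>\<^bsub>R\<^esub>) \<odot>\<^bsub>M\<^esub> x \<oplus>\<^bsub>M\<^esub> x = (\<ominus>\<^bsub>R\<^esub> \<one>\<^bsub>R\<^esub> \<oplus>\<^bsub>R\<^esub> \<one>\<^bsub>R\<^esub>) \<odot>\<^bsub>M\<^esub> x"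
    using assms by (simp add: smult_l_distr smult_one)
  also have "\<dots> = \<zero>\<^bsub>M\<^esub>"
    using assms by (simp add: R.l_neg smult_zero_left)
  finally show ?thesis
    using assms by (simp add: smult_closed M.minus_equality)
qed

text \<open>The negative of an element is its multiple by minus one, so the subgroup condition
  inside \<open>submodule\<close> follows from closure under sums and scalars.\<close>

lemma rm_submoduleI:
  assumes "H \<subseteq> carrier M" "\<zero>\<^bsub>M\<^esub> \<in> H"
    and "\<And>x y. x \<in> H \<Longrightarrow> y \<in> H \<Longrightarrow> x \<oplus>\<^bsub>M\<^esub> y \<in> H"
    and sm: "\<And>a x. a \<in> carrier R \<Longrightarrow> x \<in> H \<Longrightarrow> a \<odot>\<^bsub>M\<^esub> x \<in> H"
  shows "submodule H R M"
proof -
  have "\<ominus>\<^bsub>M\<^esub> x \<in> H" if "x \<in> H" for x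
    using sm[OF _ that, of "\<ominus>\<^bsub>R\<^esub> \<one>\<^bsub>R\<^esub>"] that assms(1) by (auto simp: smult_minus_one)
  then show ?thesis
    using assms
    by (intro submodule.intro subgroup.intro) (auto simp: submodule_axioms_def a_inv_def)
qed

lemma rm_submoduleD:
  assumes "submodule H R M"
  shows "H \<subseteq> carrier M" "\<zero>\<^bsub>M\<^esub> \<in> H"
    and "\<And>x y. x \<in> H \<Longrightarrow> y \<in> H \<Longrightarrow> x \<oplus>\<^bsub>M\<^esub> y \<in> H"
    and "\<And>a x. a \<in> carrier R \<Longrightarrow> x \<in> H \<Longrightarrow> a \<odot>\<^bsub>M\<^esub> x \<in> H"
    and "\<And>x. x \<in> H \<Longrightarrow> \<ominus>\<^bsub>M\<^esub> x \<in> H"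
    and "\<And>x y. x \<in> H \<Longrightarrow> y \<in> H \<Longrightarrow> x \<ominus>\<^bsub>M\<^esub> y \<in> H"
proof -
  interpret H: submodule H R M by fact
  show "H \<subseteq> carrier M" "\<zero>\<^bsub>M\<^esub> \<in> H"
    and *: "\<And>x y. x \<in> H \<Longrightarrow> y \<in> H \<Longrightarrow> x \<oplus>\<^bsub>M\<^esub> y \<in> H"
    and "\<And>a x. a \<in> carrier R \<Longrightarrow> x \<in> H \<Longrightarrow> a \<odot>\<^bsub>M\<^esub> x \<in> H"
    and **: "\<And>x. x \<in> H \<Longrightarrow> \<ominus>\<^bsub>M\<^esub> x \<in> H"
    using H.subset H.one_closed H.m_closed H.smult_closed H.m_inv_closed by (auto simp: a_inv_def)
  then show "\<And>x y. x \<in> H \<Longrightarrow> y \<in> H \<Longrightarrow> x \<ominus>\<^bsub>M\<^esub> y \<in> H"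
    by (simp add: a_minus_def)
qed

lemma submodule_carrier: "submodule (carrier M) R M"
  by (intro rm_submoduleI) (auto simp: smult_closed)

lemma submodule_zero: "submodule {\<zero>\<^bsub>M\<^esub>} R M"
  by (intro rm_submoduleI) (auto simp: smult_zero_right)

lemma submodule_Int: "submodule H R M \<Longrightarrow> submodule H' R M \<Longrightarrow> submodule (H \<inter> H') R M"
  by (intro rm_submoduleI) (auto dest: rm_submoduleD)

lemma submodule_finsum:
  assumes "submodule H R M" "finite S" "\<And>s. s \<in> S \<Longrightarrow> f s \<in> H"
  shows "finsum M f S \<in> H"
  using assms(2,3)
proof (induction S)
  case empty
  then show ?case using rm_submoduleD[OF assms(1)] by simp
next
  case (insert s S)
  then have "f \<in> S \<rightarrow> carrier M" "f s \<in> carrier M" using rm_submoduleD(1)[OF assms(1)] by auto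
  with insert show ?case using rm_submoduleD(3)[OF assms(1)] by simp
qed

lemma smult_finsum:
  assumes "finite S" "f \<in> S \<rightarrow> carrier M" "a \<in> carrier R"
  shows "a \<odot>\<^bsub>M\<^esub> finsum M f S = finsum M (\<lambda>s. a \<odot>\<^bsub>M\<^esub> f s) S"
  using assms(1,2)
proof (induction S)
  case empty
  then show ?case using assms(3) by (simp add: smult_zero_right)
next
  case (insert s S)
  then have "f \<in> S \<rightarrow> carrier M" "f s \<in> carrier M" "(\<lambda>s. a \<odot>\<^bsub>M\<^esub> f s) \<in> S \<rightarrow> carrier M"
    "a \<odot>\<^bsub>M\<^esub> f s \<in> carrier M"
    using assms(3) by (auto intro!: smult_closed)
  with insert assms(3) show ?case by (simp add: smult_r_distr)
qed

text \<open>Generation by \<open>S\<close> is expressed through submodules instead of coefficients.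
  This form passes along homomorphisms by taking preimages, so later arguments handle no linear
  combinations.\<close>

lemma fg_module_iff:
  "fg_module R M \<longleftrightarrow> (\<exists>S. finite S \<and> S \<subseteq> carrier M \<and>
     (\<forall>H. submodule H R M \<and> S \<subseteq> H \<longrightarrow> H = carrier M))"
proof
  assume "fg_module R M"
  then obtain S where S: "finite S" "S \<subseteq> carrier M"
    "carrier M = {finsum M (\<lambda>s. c s \<odot>\<^bsub>M\<^esub> s) S | c. c \<in> S \<rightarrow> carrier R}"
    by (auto simp: fg_module_def)
  have "H = carrier M" if H: "submodule H R M" "S \<subseteq> H" for H
  proof
    show "H \<subseteq> carrier M" using rm_submoduleD(1)[OF H(1)] .
    show "carrier M \<subseteq> H"
    proof
      fix x assume "x \<in> carrier M"
      then obtain c where c: "c \<in> S \<rightarrow> carrier R" "x = finsum M (\<lambda>s. c s \<odot>\<^bsub>M\<^esub> s) S"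
        using S(3) by blast
      show "x \<in> H"
        unfolding c(2) using c(1) H(2) S(1)
        by (intro submodule_finsum[OF H(1)] rm_submoduleD(4)[OF H(1)]) auto
    qed
  qed
  then show "\<exists>S. finite S \<and> S \<subseteq> carrier M \<and>
     (\<forall>H. submodule H R M \<and> S \<subseteq> H \<longrightarrow> H = carrier M)" using S(1,2) by blast
next
  assume "\<exists>S. finite S \<and> S \<subseteq> carrier M \<and>
     (\<forall>H. submodule H R M \<and> S \<subseteq> H \<longrightarrow> H = carrier M)"
  then obtain S where *: "finite S \<and> S \<subseteq> carrier M \<and>
     (\<forall>H. submodule H R M \<and> S \<subseteq> H \<longrightarrow> H = carrier M)" by (rule exE)
  have S: "finite S" "S \<subseteq> carrier M" using * by simp_all
  have gen: "H = carrier M" if "submodule H R M" "S \<subseteq> H" for H using * that by simp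
  let ?H = "{finsum M (\<lambda>s. c s \<odot>\<^bsub>M\<^esub> s) S | c. c \<in> S \<rightarrow> carrier R}"
  have cl: "(\<lambda>s. c s \<odot>\<^bsub>M\<^esub> s) \<in> S \<rightarrow> carrier M" if "c \<in> S \<rightarrow> carrier R" for c
    using that S(2) by (auto intro!: smult_closed)
  have "submodule ?H R M"
  proof (rule rm_submoduleI)
    show "?H \<subseteq> carrier M" using cl by (auto intro!: M.finsum_closed)
    have "finsum M (\<lambda>s. \<zero>\<^bsub>R\<^esub> \<odot>\<^bsub>M\<^esub> s) S = \<zero>\<^bsub>M\<^esub>"
      using S(2) by (intro M.add.finprod_one_eqI) (auto simp: smult_zero_left)
    moreover have "(\<lambda>s. \<zero>\<^bsub>R\<^esub>) \<in> S \<rightarrow> carrier R" by simp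
    ultimately show "\<zero>\<^bsub>M\<^esub> \<in> ?H" by (intro CollectI exI[of _ "\<lambda>s. \<zero>\<^bsub>R\<^esub>"]) simp
  next
    fix x y assume "x \<in> ?H" "y \<in> ?H"
    then obtain c d where c: "c \<in> S \<rightarrow> carrier R" "x = finsum M (\<lambda>s. c s \<odot>\<^bsub>M\<^esub> s) S"
      and d: "d \<in> S \<rightarrow> carrier R" "y = finsum M (\<lambda>s. d s \<odot>\<^bsub>M\<^esub> s) S" by blast
    have "x \<oplus>\<^bsub>M\<^esub> y = finsum M (\<lambda>s. c s \<odot>\<^bsub>M\<^esub> s \<oplus>\<^bsub>M\<^esub> d s \<odot>\<^bsub>M\<^esub> s) S"
      using cl[OF c(1)] cl[OF d(1)] c(2) d(2) by (simp add: M.finsum_addf)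
    also have "\<dots> = finsum M (\<lambda>s. (c s \<oplus>\<^bsub>R\<^esub> d s) \<odot>\<^bsub>M\<^esub> s) S"
      using c(1) d(1) S(2) by (intro M.finsum_cong') (auto simp: smult_l_distr smult_closed subset_iff Pi_iff)
    finally show "x \<oplus>\<^bsub>M\<^esub> y \<in> ?H" using c(1) d(1)
      by (auto intro!: exI[of _ "\<lambda>s. c s \<oplus>\<^bsub>R\<^esub> d s"])
  next
    fix a x assume a: "a \<in> carrier R" and "x \<in> ?H"
    then obtain c where c: "c \<in> S \<rightarrow> carrier R" "x = finsum M (\<lambda>s. c s \<odot>\<^bsub>M\<^esub> s) S" by blast
    have "a \<odot>\<^bsub>M\<^esub> x = finsum M (\<lambda>s. a \<odot>\<^bsub>M\<^esub> (c s \<odot>\<^bsub>M\<^esub> s)) S"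
      using cl[OF c(1)] c(2) a S(1) by (simp add: smult_finsum)
    also have "\<dots> = finsum M (\<lambda>s. (c s \<otimes>\<^bsub>R\<^esub> a) \<odot>\<^bsub>M\<^esub> s) S"
      using c(1) a S(2) by (intro M.finsum_cong') (auto simp: smult_assoc smult_closed subset_iff Pi_iff)
    finally show "a \<odot>\<^bsub>M\<^esub> x \<in> ?H" using c(1) a
      by (auto intro!: exI[of _ "\<lambda>s. c s \<otimes>\<^bsub>R\<^esub> a"])
  qed
  moreover have "S \<subseteq> ?H"
  proof
    fix t assume t: "t \<in> S"
    let ?c = "\<lambda>s. if t = s then \<one>\<^bsub>R\<^esub> else \<zero>\<^bsub>R\<^esub>"
    have "finsum M (\<lambda>s. ?c s \<odot>\<^bsub>M\<^esub> s) S = finsum M (\<lambda>s. if t = s then s else \<zero>\<^bsub>M\<^esub>) S"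
      using S(2) by (intro M.finsum_cong') (auto simp: smult_one smult_zero_left)
    also have "\<dots> = t"
      using t S by (intro M.finsum_singleton) auto
    finally show "t \<in> ?H"
      by (auto intro!: exI[of _ ?c])
  qed
  ultimately have "carrier M = ?H" using gen[of ?H] by simp
  then show "fg_module R M"
    unfolding fg_module_def using S right_module_axioms by blast
qed

lemma right_module_restrict:
  assumes "submodule H R M"
  shows "right_module R (restrict_module M H)"
proof -
  note H = rm_submoduleD[OF assms]
  have "abelian_group (restrict_module M H)"
  proof (rule abelian_groupI)
    fix x assume x: "x \<in> carrier (restrict_module M H)"
    then show "\<exists>y\<in>carrier (restrict_module M H). y \<oplus>\<^bsub>restrict_module M H\<^esub> x = \<zero>\<^bsub>restrict_module M H\<^esub>"
      using H by (intro bexI[of _ "\<ominus>\<^bsub>M\<^esub> x"]) (auto simp: restrict_module_def M.l_neg subset_iff)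
  qed (use H in \<open>auto simp: restrict_module_def M.a_ac subset_iff\<close>)
  moreover have "right_module_axioms R (restrict_module M H)"
    using H by unfold_locales
      (auto simp: restrict_module_def smult_l_distr smult_r_distr smult_assoc smult_one subset_iff)
  ultimately show ?thesis
    by (simp add: right_module_def R.ring_axioms)
qed

end

lemma restrict_module_simps [simp]:
  "carrier (restrict_module M H) = H" "\<zero>\<^bsub>restrict_module M H\<^esub> = \<zero>\<^bsub>M\<^esub>"
  "x \<oplus>\<^bsub>restrict_module M H\<^esub> y = x \<oplus>\<^bsub>M\<^esub> y" "a \<odot>\<^bsub>restrict_module M H\<^esub> x = a \<odot>\<^bsub>M\<^esub> x"
  by (simp_all add: restrict_module_def)

lemma module_hom_zero:
  assumes "right_module A M" "right_module A N" "f \<in> module_hom A M N"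
  shows "f \<zero>\<^bsub>M\<^esub> = \<zero>\<^bsub>N\<^esub>"
proof -
  interpret M: right_module A M by fact
  interpret N: right_module A N by fact
  have "f \<zero>\<^bsub>M\<^esub> \<oplus>\<^bsub>N\<^esub> f \<zero>\<^bsub>M\<^esub> = f \<zero>\<^bsub>M\<^esub>"
    by (simp flip: module_hom_add[OF assms(3)])
  then show ?thesis
    using module_hom_closed[OF assms(3)] by (simp add: N.M.add.r_cancel_one)
qed

lemma module_hom_uminus:
  assumes "right_module A M" "right_module A N" "f \<in> module_hom A M N" "x \<in> carrier M"
  shows "f (\<ominus>\<^bsub>M\<^esub> x) = \<ominus>\<^bsub>N\<^esub> f x"
proof -
  interpret M: right_module A M by fact
  interpret N: right_module A N by fact
  have "f (\<ominus>\<^bsub>M\<^esub> x) \<oplus>\<^bsub>N\<^esub> f x = \<zero>\<^bsub>N\<^esub>"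
    using assms by (simp flip: module_hom_add[OF assms(3)] add: M.M.l_neg module_hom_zero)
  then show ?thesis
    using module_hom_closed[OF assms(3)] assms(4) by (simp add: N.M.minus_equality)
qed

lemma module_hom_minus:
  assumes "right_module A M" "right_module A N" "f \<in> module_hom A M N" "x \<in> carrier M" "y \<in> carrier M"
  shows "f (x \<ominus>\<^bsub>M\<^esub> y) = f x \<ominus>\<^bsub>N\<^esub> f y"
proof -
  interpret M: right_module A M by fact
  show ?thesis using assms by (simp add: a_minus_def module_hom_add module_hom_uminus)
qed

lemma module_hom_plus:
  assumes "right_module A M" "right_module A N" "f \<in> module_hom A M N" "g \<in> module_hom A M N"
  shows "(\<lambda>x. f x \<oplus>\<^bsub>N\<^esub> g x) \<in> module_hom A M N"
proof -
  interpret M: right_module A M by fact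
  interpret N: right_module A N by fact
  note c = module_hom_closed[OF assms(3)] module_hom_closed[OF assms(4)]
  show ?thesis
    by (rule module_homI)
      (auto simp: c module_hom_add[OF assms(3)] module_hom_add[OF assms(4)]
        module_hom_smult[OF assms(3)] module_hom_smult[OF assms(4)] N.smult_r_distr N.M.a_ac)
qed

lemma module_hom_neg:
  assumes "right_module A M" "right_module A N" "f \<in> module_hom A M N"
  shows "(\<lambda>x. \<ominus>\<^bsub>N\<^esub> f x) \<in> module_hom A M N"
proof -
  interpret M: right_module A M by fact
  interpret N: right_module A N by fact
  note c = module_hom_closed[OF assms(3)]
  show ?thesis
    by (rule module_homI)
      (auto simp: c module_hom_add[OF assms(3)] module_hom_smult[OF assms(3)]
         N.smult_minus_right N.M.minus_add N.M.a_ac)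
qed

lemma module_hom_diff:
  assumes "right_module A M" "right_module A N" "f \<in> module_hom A M N" "g \<in> module_hom A M N"
  shows "(\<lambda>x. f x \<ominus>\<^bsub>N\<^esub> g x) \<in> module_hom A M N"
  unfolding a_minus_def by (intro module_hom_plus module_hom_neg assms)

lemma module_hom_0:
  assumes "right_module A N"
  shows "(\<lambda>x. \<zero>\<^bsub>N\<^esub>) \<in> module_hom A M N"
proof -
  interpret N: right_module A N by fact
  show ?thesis by (rule module_homI) (auto simp: N.smult_zero_right)
qed

lemma submodule_vimage:
  assumes "right_module A M" "right_module A N" "f \<in> module_hom A M N" "submodule H A N"
  shows "submodule {x \<in> carrier M. f x \<in> H} A M"
proof -
  interpret M: right_module A M by fact
  interpret N: right_module A N by fact
  note H = N.rm_submoduleD[OF assms(4)]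
  show ?thesis
    by (rule M.rm_submoduleI)
      (auto simp: module_hom_zero[OF assms(1-3)] module_hom_add[OF assms(3)]
         module_hom_smult[OF assms(3)] H M.smult_closed)
qed

lemma submodule_image:
  assumes "right_module A M" "right_module A N" "f \<in> module_hom A M N" "submodule H A M"
  shows "submodule (f ` H) A N"
proof -
  interpret M: right_module A M by fact
  interpret N: right_module A N by fact
  note H = M.rm_submoduleD[OF assms(4)]
  show ?thesis
  proof (rule N.rm_submoduleI)
    show "f ` H \<subseteq> carrier N" using H(1) module_hom_closed[OF assms(3)] by auto
    show "\<zero>\<^bsub>N\<^esub> \<in> f ` H" using H(2) module_hom_zero[OF assms(1-3)] by (metis imageI)
  next
    fix x y assume "x \<in> f ` H" "y \<in> f ` H"
    then show "x \<oplus>\<^bsub>N\<^esub> y \<in> f ` H"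
      using H(1,3) by (auto simp: subset_iff simp flip: module_hom_add[OF assms(3)])
  next
    fix a x assume "a \<in> carrier A" "x \<in> f ` H"
    then show "a \<odot>\<^bsub>N\<^esub> x \<in> f ` H"
      using H(1,4) by (auto simp: subset_iff simp flip: module_hom_smult[OF assms(3)])
  qed
qed

lemma submodule_ker:
  assumes "right_module A M" "right_module A N" "f \<in> module_hom A M N"
  shows "submodule {x \<in> carrier M. f x = \<zero>\<^bsub>N\<^esub>} A M"
  using submodule_vimage[OF assms right_module.submodule_zero[OF assms(2)]] by simp

text \<open>\<open>N\<close> enters as a bare record and inherits every module law from
  \<open>M\<close> through the surjection. This turns the structure on representatives in the next
  construction into a module.\<close>

lemma right_module_surj_image:
  assumes "right_module A M" "f \<in> module_hom A M N" "f ` carrier M = carrier N" "f \<zero>\<^bsub>M\<^esub> = \<zero>\<^bsub>N\<^esub>"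
  shows "right_module A N"
proof -
  interpret M: right_module A M by fact
  note f = module_hom_add[OF assms(2), symmetric] module_hom_smult[OF assms(2), symmetric]
  have ab: "abelian_group N"
  proof (rule abelian_groupI)
    fix y assume "y \<in> carrier N"
    then obtain x where "x \<in> carrier M" "y = f x" using assms(3) by blast
    then show "\<exists>z\<in>carrier N. z \<oplus>\<^bsub>N\<^esub> y = \<zero>\<^bsub>N\<^esub>"
      using assms(3,4) by (intro bexI[of _ "f (\<ominus>\<^bsub>M\<^esub> x)"]) (auto simp: f M.M.l_neg)
  qed (auto simp: f M.M.a_ac simp flip: assms(3,4))
  have "right_module_axioms A N"
  proof
    fix a x assume "a \<in> carrier A" "x \<in> carrier N"
    then show "a \<odot>\<^bsub>N\<^esub> x \<in> carrier N" by (auto simp: f M.smult_closed simp flip: assms(3))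
  next
    fix a b x assume "a \<in> carrier A" "b \<in> carrier A" "x \<in> carrier N"
    then show "(a \<oplus>\<^bsub>A\<^esub> b) \<odot>\<^bsub>N\<^esub> x = a \<odot>\<^bsub>N\<^esub> x \<oplus>\<^bsub>N\<^esub> b \<odot>\<^bsub>N\<^esub> x"
      by (auto simp: f M.smult_l_distr M.smult_closed simp flip: assms(3))
  next
    fix a x y assume "a \<in> carrier A" "x \<in> carrier N" "y \<in> carrier N"
    then show "a \<odot>\<^bsub>N\<^esub> (x \<oplus>\<^bsub>N\<^esub> y) = a \<odot>\<^bsub>N\<^esub> x \<oplus>\<^bsub>N\<^esub> a \<odot>\<^bsub>N\<^esub> y"
      by (auto simp: f M.smult_r_distr M.smult_closed simp flip: assms(3))
  next
    fix a b x assume "a \<in> carrier A" "b \<in> carrier A" "x \<in> carrier N"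
    then show "(a \<otimes>\<^bsub>A\<^esub> b) \<odot>\<^bsub>N\<^esub> x = b \<odot>\<^bsub>N\<^esub> (a \<odot>\<^bsub>N\<^esub> x)"
      by (auto simp: f M.smult_assoc M.smult_closed simp flip: assms(3))
  next
    fix x assume "x \<in> carrier N"
    then show "\<one>\<^bsub>A\<^esub> \<odot>\<^bsub>N\<^esub> x = x"
      by (auto simp: f M.smult_one simp flip: assms(3))
  qed
  with ab show ?thesis by (simp add: right_module_def M.R.ring_axioms)
qed

lemma fg_module_surj_image:
  assumes "fg_module A M" "f \<in> module_hom A M N" "f ` carrier M = carrier N" "right_module A N"
  shows "fg_module A N"
proof -
  interpret M: right_module A M using assms(1) by (rule fg_module_right_module)
  interpret N: right_module A N by fact
  obtain S where S: "finite S" "S \<subseteq> carrier M"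
    and gen: "\<And>H. submodule H A M \<Longrightarrow> S \<subseteq> H \<Longrightarrow> H = carrier M"
    using assms(1) by (auto simp: M.fg_module_iff)
  have "H = carrier N" if H: "submodule H A N" "f ` S \<subseteq> H" for H
  proof -
    have "{x \<in> carrier M. f x \<in> H} = carrier M"
      using H(2) S(2) submodule_vimage[OF M.right_module_axioms assms(4,2) H(1)] by (intro gen) auto
    then show ?thesis using N.rm_submoduleD(1)[OF H(1)] by (auto simp flip: assms(3))
  qed
  moreover have "f ` S \<subseteq> carrier N" using S(2) assms(3) by auto
  ultimately show ?thesis
    unfolding N.fg_module_iff using S(1) by (intro exI[of _ "f ` S"]) auto
qed

text \<open>The elements of the quotient are chosen representatives instead of cosets. Thus the
  quotient has the element type of \<open>M\<close>, and modules of one fixed type are closed under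
  cokernels.\<close>

lemma quotient_module_exists:
  fixes M :: "('a, 'm) module"
  assumes "right_module A M" "submodule H A M"
  shows "\<exists>(Q :: ('a, 'm) module) q. right_module A Q \<and> q \<in> module_hom A M Q \<and>
    q ` carrier M = carrier Q \<and> (\<forall>x\<in>carrier M. q x = \<zero>\<^bsub>Q\<^esub> \<longleftrightarrow> x \<in> H)"
proof -
  interpret M: right_module A M by fact
  note H = M.rm_submoduleD[OF assms(2)]
  define r where "r x = (SOME y. y \<in> carrier M \<and> x \<ominus>\<^bsub>M\<^esub> y \<in> H)" for x
  have r: "r x \<in> carrier M" "x \<ominus>\<^bsub>M\<^esub> r x \<in> H" if "x \<in> carrier M" for x
  proof -
    have "x \<in> carrier M \<and> x \<ominus>\<^bsub>M\<^esub> x \<in> H" using that H(2) by (simp add: M.M.r_neg a_minus_def)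
    then have "r x \<in> carrier M \<and> x \<ominus>\<^bsub>M\<^esub> r x \<in> H" unfolding r_def by (rule someI)
    then show "r x \<in> carrier M" "x \<ominus>\<^bsub>M\<^esub> r x \<in> H" by auto
  qed
  have req: "r x = r y \<longleftrightarrow> x \<ominus>\<^bsub>M\<^esub> y \<in> H" if xy: "x \<in> carrier M" "y \<in> carrier M" for x y
  proof
    assume "r x = r y"
    then have "(x \<ominus>\<^bsub>M\<^esub> r x) \<ominus>\<^bsub>M\<^esub> (y \<ominus>\<^bsub>M\<^esub> r x) \<in> H" using r xy H(6) by metis
    also have "(x \<ominus>\<^bsub>M\<^esub> r x) \<ominus>\<^bsub>M\<^esub> (y \<ominus>\<^bsub>M\<^esub> r x) = x \<ominus>\<^bsub>M\<^esub> y"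
      using xy r(1)[of x] by (simp add: M.M.minus_cancel_right)
    finally show "x \<ominus>\<^bsub>M\<^esub> y \<in> H" .
  next
    assume d: "x \<ominus>\<^bsub>M\<^esub> y \<in> H"
    have "x \<ominus>\<^bsub>M\<^esub> z \<in> H \<longleftrightarrow> y \<ominus>\<^bsub>M\<^esub> z \<in> H" if z: "z \<in> carrier M" for z
    proof -
      have "x \<ominus>\<^bsub>M\<^esub> z = (x \<ominus>\<^bsub>M\<^esub> y) \<oplus>\<^bsub>M\<^esub> (y \<ominus>\<^bsub>M\<^esub> z)" "y \<ominus>\<^bsub>M\<^esub> z = (x \<ominus>\<^bsub>M\<^esub> z) \<ominus>\<^bsub>M\<^esub> (x \<ominus>\<^bsub>M\<^esub> y)"
        using xy z by (simp_all add: M.M.minus_add_minus_cancel M.M.minus_minus_cancel)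
      then show ?thesis using H(3,6) d by metis
    qed
    \<comment> \<open>Elements congruent modulo \<open>H\<close> define the same predicate under the
      choice operator, hence receive the same representative.\<close>
    then have "(z \<in> carrier M \<and> x \<ominus>\<^bsub>M\<^esub> z \<in> H) = (z \<in> carrier M \<and> y \<ominus>\<^bsub>M\<^esub> z \<in> H)" for z by blast
    then show "r x = r y" by (simp add: r_def)
  qed
  define Q :: "('a, 'm) module" where
    "Q = \<lparr>carrier = r ` carrier M, mult = undefined, one = undefined, zero = r \<zero>\<^bsub>M\<^esub>,
       add = (\<lambda>x y. r (x \<oplus>\<^bsub>M\<^esub> y)), smult = (\<lambda>a x. r (a \<odot>\<^bsub>M\<^esub> x))\<rparr>"
  have addr: "r (x \<oplus>\<^bsub>M\<^esub> y) = r (r x \<oplus>\<^bsub>M\<^esub> r y)" if xy: "x \<in> carrier M" "y \<in> carrier M" for x y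
  proof -
    have "(x \<ominus>\<^bsub>M\<^esub> r x) \<oplus>\<^bsub>M\<^esub> (y \<ominus>\<^bsub>M\<^esub> r y) \<in> H" using r xy H(3) by blast
    also have "(x \<ominus>\<^bsub>M\<^esub> r x) \<oplus>\<^bsub>M\<^esub> (y \<ominus>\<^bsub>M\<^esub> r y) = (x \<oplus>\<^bsub>M\<^esub> y) \<ominus>\<^bsub>M\<^esub> (r x \<oplus>\<^bsub>M\<^esub> r y)"
      using xy r(1) by (simp add: a_minus_def M.M.minus_add M.M.a_ac)
    finally show ?thesis using xy r(1) by (simp add: req)
  qed
  have smr: "r (a \<odot>\<^bsub>M\<^esub> x) = r (a \<odot>\<^bsub>M\<^esub> r x)" if ax: "a \<in> carrier A" "x \<in> carrier M" for a x
  proof -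
    have "a \<odot>\<^bsub>M\<^esub> (x \<ominus>\<^bsub>M\<^esub> r x) \<in> H" using r ax H(4) by blast
    also have "a \<odot>\<^bsub>M\<^esub> (x \<ominus>\<^bsub>M\<^esub> r x) = a \<odot>\<^bsub>M\<^esub> x \<ominus>\<^bsub>M\<^esub> a \<odot>\<^bsub>M\<^esub> r x"
      using ax r(1) by (simp add: a_minus_def M.smult_r_distr M.smult_minus_right)
    finally show ?thesis using ax r(1) by (simp add: req M.smult_closed)
  qed
  have hom: "r \<in> module_hom A M Q"
    by (rule module_homI) (auto simp: Q_def addr smr)
  have im: "r ` carrier M = carrier Q" by (simp add: Q_def)
  have "r x = \<zero>\<^bsub>Q\<^esub> \<longleftrightarrow> x \<in> H" if x: "x \<in> carrier M" for x
    using req[OF x M.M.zero_closed] x by (simp add: Q_def a_minus_def M.M.neg_zero)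
  moreover have "right_module A Q"
    by (rule right_module_surj_image[OF assms(1) hom im]) (simp add: Q_def)
  ultimately show ?thesis using hom im by blast
qed

section \<open>Products and the regular module\<close>

definition prod_module :: "('a, 'm) module \<Rightarrow> ('a, 'n) module \<Rightarrow> ('a, 'm \<times> 'n) module" where
  "prod_module M N = \<lparr>carrier = carrier M \<times> carrier N, mult = undefined, one = undefined,
     zero = (\<zero>\<^bsub>M\<^esub>, \<zero>\<^bsub>N\<^esub>), add = (\<lambda>(x, y) (x', y'). (x \<oplus>\<^bsub>M\<^esub> x', y \<oplus>\<^bsub>N\<^esub> y')),
     smult = (\<lambda>a (x, y). (a \<odot>\<^bsub>M\<^esub> x, a \<odot>\<^bsub>N\<^esub> y))\<rparr>"

lemma prod_module_simps [simp]:
  "carrier (prod_module M N) = carrier M \<times> carrier N" "\<zero>\<^bsub>prod_module M N\<^esub> = (\<zero>\<^bsub>M\<^esub>, \<zero>\<^bsub>N\<^esub>)"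
  "(x, y) \<oplus>\<^bsub>prod_module M N\<^esub> (x', y') = (x \<oplus>\<^bsub>M\<^esub> x', y \<oplus>\<^bsub>N\<^esub> y')"
  "a \<odot>\<^bsub>prod_module M N\<^esub> (x, y) = (a \<odot>\<^bsub>M\<^esub> x, a \<odot>\<^bsub>N\<^esub> y)"
  by (simp_all add: prod_module_def)

lemma right_module_prod:
  assumes "right_module A M" "right_module A N"
  shows "right_module A (prod_module M N)"
proof -
  interpret M: right_module A M by fact
  interpret N: right_module A N by fact
  have "abelian_group (prod_module M N)"
  proof (rule abelian_groupI)
    fix x assume "x \<in> carrier (prod_module M N)"
    then obtain m n where "x = (m, n)" "m \<in> carrier M" "n \<in> carrier N" by auto
    then show "\<exists>y\<in>carrier (prod_module M N). y \<oplus>\<^bsub>prod_module M N\<^esub> x = \<zero>\<^bsub>prod_module M N\<^esub>"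
      by (intro bexI[of _ "(\<ominus>\<^bsub>M\<^esub> m, \<ominus>\<^bsub>N\<^esub> n)"]) (auto simp: M.M.l_neg N.M.l_neg)
  qed (auto simp: M.M.a_ac N.M.a_ac)
  moreover have "right_module_axioms A (prod_module M N)"
    by unfold_locales
      (auto simp: M.smult_closed N.smult_closed M.smult_l_distr N.smult_l_distr M.smult_r_distr
        N.smult_r_distr M.smult_assoc N.smult_assoc M.smult_one N.smult_one)
  ultimately show ?thesis by (simp add: right_module_def M.R.ring_axioms)
qed

lemma fg_module_prod:
  assumes "fg_module A M" "fg_module A N"
  shows "fg_module A (prod_module M N)"
proof -
  interpret M: right_module A M using assms(1) by (rule fg_module_right_module)
  interpret N: right_module A N using assms(2) by (rule fg_module_right_module)
  interpret P: right_module A "prod_module M N"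
    by (intro right_module_prod M.right_module_axioms N.right_module_axioms)
  obtain S where S: "finite S" "S \<subseteq> carrier M"
    and gS: "\<And>H. submodule H A M \<Longrightarrow> S \<subseteq> H \<Longrightarrow> H = carrier M"
    using assms(1) by (auto simp: M.fg_module_iff)
  obtain S' where S': "finite S'" "S' \<subseteq> carrier N"
    and gS': "\<And>H. submodule H A N \<Longrightarrow> S' \<subseteq> H \<Longrightarrow> H = carrier N"
    using assms(2) by (auto simp: N.fg_module_iff)
  let ?S = "(\<lambda>x. (x, \<zero>\<^bsub>N\<^esub>)) ` S \<union> (\<lambda>y. (\<zero>\<^bsub>M\<^esub>, y)) ` S'"
  have i: "(\<lambda>x. (x, \<zero>\<^bsub>N\<^esub>)) \<in> module_hom A M (prod_module M N)"
    "(\<lambda>y. (\<zero>\<^bsub>M\<^esub>, y)) \<in> module_hom A N (prod_module M N)"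
    by (auto simp: module_hom_def M.smult_zero_right N.smult_zero_right)
  have "H = carrier (prod_module M N)" if H: "submodule H A (prod_module M N)" "?S \<subseteq> H" for H
  proof -
    have 1: "{x \<in> carrier M. (x, \<zero>\<^bsub>N\<^esub>) \<in> H} = carrier M"
      using H(2) S(2) submodule_vimage[OF M.right_module_axioms P.right_module_axioms i(1) H(1)]
      by (intro gS) auto
    have 2: "{y \<in> carrier N. (\<zero>\<^bsub>M\<^esub>, y) \<in> H} = carrier N"
      using H(2) S'(2) submodule_vimage[OF N.right_module_axioms P.right_module_axioms i(2) H(1)]
      by (intro gS') auto
    have "(x, y) \<in> H" if "x \<in> carrier M" "y \<in> carrier N" for x y
    proof -
      have "(x, \<zero>\<^bsub>N\<^esub>) \<oplus>\<^bsub>prod_module M N\<^esub> (\<zero>\<^bsub>M\<^esub>, y) \<in> H"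
        using that 1 2 P.rm_submoduleD(3)[OF H(1)] by blast
      then show ?thesis using that by simp
    qed
    then show ?thesis using P.rm_submoduleD(1)[OF H(1)] by auto
  qed
  moreover have "finite ?S" "?S \<subseteq> carrier (prod_module M N)" using S S' by auto
  ultimately show ?thesis unfolding P.fg_module_iff by blast
qed

lemma right_module_regular:
  assumes "ring A"
  shows "right_module A (regular_module A)"
proof -
  interpret ring A by fact
  have "abelian_group (regular_module A)"
  proof (rule abelian_groupI)
    fix x assume "x \<in> carrier (regular_module A)"
    then show "\<exists>y\<in>carrier (regular_module A). y \<oplus>\<^bsub>regular_module A\<^esub> x = \<zero>\<^bsub>regular_module A\<^esub>"
      by (intro bexI[of _ "\<ominus>\<^bsub>A\<^esub> x"]) (auto simp: regular_module_def l_neg)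
  qed (auto simp: regular_module_def a_ac)
  moreover have "right_module_axioms A (regular_module A)"
    by unfold_locales (auto simp: regular_module_def r_distr l_distr m_assoc)
  ultimately show ?thesis by (simp add: right_module_def ring_axioms)
qed

lemma regular_module_simps [simp]:
  "carrier (regular_module A) = carrier A" "\<zero>\<^bsub>regular_module A\<^esub> = \<zero>\<^bsub>A\<^esub>"
  "x \<oplus>\<^bsub>regular_module A\<^esub> y = x \<oplus>\<^bsub>A\<^esub> y" "a \<odot>\<^bsub>regular_module A\<^esub> x = x \<otimes>\<^bsub>A\<^esub> a"
  by (simp_all add: regular_module_def)

lemma fg_module_regular:
  assumes "ring A"
  shows "fg_module A (regular_module A)"
proof -
  interpret ring A by fact
  interpret M: right_module A "regular_module A" using assms by (rule right_module_regular)
  have "H = carrier A" if H: "submodule H A (regular_module A)" "\<one>\<^bsub>A\<^esub> \<in> H" for H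
  proof
    show "H \<subseteq> carrier A" using M.rm_submoduleD(1)[OF H(1)] by simp
    show "carrier A \<subseteq> H" using M.rm_submoduleD(4)[OF H(1) _ H(2)] by auto
  qed
  then show ?thesis unfolding M.fg_module_iff by (intro exI[of _ "{\<one>\<^bsub>A\<^esub>}"]) auto
qed

section \<open>Factoring homomorphisms through injections and surjections\<close>

lemma lift_along_inj:
  assumes "right_module A X" "right_module A Y" "right_module A Z"
    and "i \<in> module_hom A X Y" "inj_on i (carrier X)" "h \<in> module_hom A Z Y"
    and "\<And>z. z \<in> carrier Z \<Longrightarrow> h z \<in> i ` carrier X"
  shows "\<exists>h'\<in>module_hom A Z X. \<forall>z\<in>carrier Z. i (h' z) = h z"
proof -
  interpret X: right_module A X by fact
  interpret Z: right_module A Z by fact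
  define h' where "h' z = inv_into (carrier X) i (h z)" for z
  have h': "h' z \<in> carrier X" "i (h' z) = h z" if "z \<in> carrier Z" for z
    using assms(7)[OF that] by (auto simp: h'_def f_inv_into_f inv_into_into)
  have "h' \<in> module_hom A Z X"
  proof (rule module_homI)
    fix x y assume xy: "x \<in> carrier Z" "y \<in> carrier Z"
    show "h' (x \<oplus>\<^bsub>Z\<^esub> y) = h' x \<oplus>\<^bsub>X\<^esub> h' y"
      by (rule inj_onD[OF assms(5)])
        (use xy in \<open>auto simp: h' module_hom_add[OF assms(4)] module_hom_add[OF assms(6)]\<close>)
  next
    fix a x assume ax: "a \<in> carrier A" "x \<in> carrier Z"
    show "h' (a \<odot>\<^bsub>Z\<^esub> x) = a \<odot>\<^bsub>X\<^esub> h' x"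
      by (rule inj_onD[OF assms(5)])
        (use ax in \<open>auto simp: h' module_hom_smult[OF assms(4)] module_hom_smult[OF assms(6)]
          X.smult_closed Z.smult_closed\<close>)
  qed (simp add: h')
  then show ?thesis using h'(2) by blast
qed

lemma factor_through_surj:
  assumes "right_module A X" "right_module A Y" "right_module A Z"
    and "p \<in> module_hom A X Y" "p ` carrier X = carrier Y" "h \<in> module_hom A X Z"
    and "\<And>x. x \<in> carrier X \<Longrightarrow> p x = \<zero>\<^bsub>Y\<^esub> \<Longrightarrow> h x = \<zero>\<^bsub>Z\<^esub>"
  shows "\<exists>h'\<in>module_hom A Y Z. \<forall>x\<in>carrier X. h' (p x) = h x"
proof -
  interpret X: right_module A X by fact
  interpret Y: right_module A Y by fact
  interpret Z: right_module A Z by fact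
  define h' where "h' y = h (inv_into (carrier X) p y)" for y
  have eq: "h x = h x'" if "x \<in> carrier X" "x' \<in> carrier X" "p x = p x'" for x x'
  proof -
    have "p (x \<ominus>\<^bsub>X\<^esub> x') = \<zero>\<^bsub>Y\<^esub>"
      using that module_hom_closed[OF assms(4)]
      by (simp add: module_hom_minus[OF assms(1,2,4)] Y.M.minus_self)
    then have "h x \<ominus>\<^bsub>Z\<^esub> h x' = \<zero>\<^bsub>Z\<^esub>"
      using that assms(7) by (simp flip: module_hom_minus[OF assms(1,3,6)])
    then show ?thesis
      using that module_hom_closed[OF assms(6)] by (simp add: Z.M.minus_zero_iff)
  qed
  have h': "h' (p x) = h x" if x: "x \<in> carrier X" for x
    unfolding h'_def using x by (intro eq) (auto simp: f_inv_into_f inv_into_into)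
  have "h' \<in> module_hom A Y Z"
    by (rule module_homI)
      (auto simp: h' module_hom_closed[OF assms(6)] module_hom_add[OF assms(6)] module_hom_smult[OF assms(6)]
       X.smult_closed simp flip: assms(5) module_hom_add[OF assms(4)] module_hom_smult[OF assms(4)])
  then show ?thesis using h' by blast
qed

section \<open>Chain conditions\<close>

text \<open>The condition is relative to a subset \<open>H\<close> of an ambient module, so that
  passing to submodules, images and kernels does not change the module structure.\<close>

definition acc_on :: "'a ring \<Rightarrow> ('a, 'm) module \<Rightarrow> 'm set \<Rightarrow> bool" where
  "acc_on R M H \<longleftrightarrow> (\<forall>X :: nat \<Rightarrow> 'm set. (\<forall>i. submodule (X i) R M \<and> X i \<subseteq> H \<and> X i \<subseteq> X (Suc i)) \<longrightarrow>
     (\<exists>m. \<forall>i\<ge>m. X i = X m))"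

definition dcc_on :: "'a ring \<Rightarrow> ('a, 'm) module \<Rightarrow> 'm set \<Rightarrow> bool" where
  "dcc_on R M H \<longleftrightarrow> (\<forall>X :: nat \<Rightarrow> 'm set. (\<forall>i. submodule (X i) R M \<and> X i \<subseteq> H \<and> X (Suc i) \<subseteq> X i) \<longrightarrow>
     (\<exists>m. \<forall>i\<ge>m. X i = X m))"

lemma acc_onD:
  assumes "acc_on R M H" "\<And>i::nat. submodule (X i) R M" "\<And>i. X i \<subseteq> H" "\<And>i. X i \<subseteq> X (Suc i)"
  obtains m where "\<And>i. i \<ge> m \<Longrightarrow> X i = X m"
  using assms unfolding acc_on_def by meson

lemma dcc_onD:
  assumes "dcc_on R M H" "\<And>i::nat. submodule (X i) R M" "\<And>i. X i \<subseteq> H" "\<And>i. X (Suc i) \<subseteq> X i"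
  obtains m where "\<And>i. i \<ge> m \<Longrightarrow> X i = X m"
  using assms unfolding dcc_on_def by meson

lemma acc_on_maximal:
  assumes acc: "acc_on R M H" and F: "X0 \<in> F" "\<And>X. X \<in> F \<Longrightarrow> submodule X R M \<and> X \<subseteq> H"
  shows "\<exists>X\<in>F. \<forall>Y\<in>F. X \<subseteq> Y \<longrightarrow> Y = X"
proof (rule ccontr)
  assume "\<not> ?thesis"
  then have "\<forall>X. \<exists>Y. X \<in> F \<longrightarrow> Y \<in> F \<and> X \<subseteq> Y \<and> Y \<noteq> X" by blast
  then obtain f where f: "\<And>X. X \<in> F \<Longrightarrow> f X \<in> F \<and> X \<subseteq> f X \<and> f X \<noteq> X" by metis
  have in_F: "(f ^^ i) X0 \<in> F" for i :: nat using F(1) f by (induction i) auto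
  then obtain m where "\<And>i. i \<ge> m \<Longrightarrow> (f ^^ i) X0 = (f ^^ m) X0"
    using F(2)[OF in_F] f[OF in_F] by (elim acc_onD[OF acc, rotated -1]) simp_all
  from this[of "Suc m"] show False using f[OF in_F[of m]] by auto
qed

lemma dcc_on_minimal:
  assumes dcc: "dcc_on R M H" and F: "X0 \<in> F" "\<And>X. X \<in> F \<Longrightarrow> submodule X R M \<and> X \<subseteq> H"
  shows "\<exists>X\<in>F. \<forall>Y\<in>F. Y \<subseteq> X \<longrightarrow> Y = X"
proof (rule ccontr)
  assume "\<not> ?thesis"
  then have "\<forall>X. \<exists>Y. X \<in> F \<longrightarrow> Y \<in> F \<and> Y \<subseteq> X \<and> Y \<noteq> X" by blast
  then obtain f where f: "\<And>X. X \<in> F \<Longrightarrow> f X \<in> F \<and> f X \<subseteq> X \<and> f X \<noteq> X" by metis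
  have in_F: "(f ^^ i) X0 \<in> F" for i :: nat using F(1) f by (induction i) auto
  then obtain m where "\<And>i. i \<ge> m \<Longrightarrow> (f ^^ i) X0 = (f ^^ m) X0"
    using F(2)[OF in_F] f[OF in_F] by (elim dcc_onD[OF dcc, rotated -1]) simp_all
  from this[of "Suc m"] show False using f[OF in_F[of m]] by auto
qed

text \<open>Nested submodules with the same image under \<open>f\<close> and the same intersection
  with the kernel coincide, and along an ascending chain both data become stationary.\<close>

lemma acc_on_hom:
  assumes "right_module R M" "right_module R N" "f \<in> module_hom R M N" "H \<subseteq> carrier M"
    and im: "acc_on R N (f ` H)" and ker: "acc_on R M {x \<in> H. f x = \<zero>\<^bsub>N\<^esub>}"
  shows "acc_on R M H"
  unfolding acc_on_def
proof (intro allI impI)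
  fix X :: "nat \<Rightarrow> _" assume X: "\<forall>i. submodule (X i) R M \<and> X i \<subseteq> H \<and> X i \<subseteq> X (Suc i)"
  interpret M: right_module R M by fact
  interpret N: right_module R N by fact
  let ?K = "{x \<in> carrier M. f x = \<zero>\<^bsub>N\<^esub>}"
  obtain m1 where m1: "\<And>i. i \<ge> m1 \<Longrightarrow> f ` X i = f ` X m1"
    using X by (elim acc_onD[OF im, rotated -1]) (auto intro: submodule_image[OF assms(1-3)])
  have K: "submodule ?K R M" by (rule submodule_ker[OF assms(1-3)])
  obtain m2 where m2: "\<And>i. i \<ge> m2 \<Longrightarrow> X i \<inter> ?K = X m2 \<inter> ?K"
    using X by (elim acc_onD[OF ker, rotated -1]) (auto intro!: M.submodule_Int K)
  have mono: "X i \<subseteq> X j" if "i \<le> j" for i j using X that by (meson lift_Suc_mono_le)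
  have "X i = X (max m1 m2)" if i: "i \<ge> max m1 m2" for i
  proof
    show "X (max m1 m2) \<subseteq> X i" using i by (rule mono)
    show "X i \<subseteq> X (max m1 m2)"
    proof
      fix x assume x: "x \<in> X i"
      have si: "submodule (X i) R M" and sm: "submodule (X (max m1 m2)) R M" using X by auto
      have "f x \<in> f ` X (max m1 m2)"
        using x m1[of i] m1[of "max m1 m2"] i by auto
      then obtain y where y: "y \<in> X (max m1 m2)" "f x = f y" by auto
      have xy: "x \<in> carrier M" "y \<in> carrier M"
        using x y(1) M.rm_submoduleD(1)[OF si] M.rm_submoduleD(1)[OF sm] by auto
      have "y \<in> X i" using y(1) mono[OF i] by auto
      then have "x \<ominus>\<^bsub>M\<^esub> y \<in> X i" using x M.rm_submoduleD(6)[OF si] by auto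
      moreover have "x \<ominus>\<^bsub>M\<^esub> y \<in> ?K"
        using xy y(2) module_hom_closed[OF assms(3)]
        by (simp add: module_hom_minus[OF assms(1-3)] N.M.minus_self)
      ultimately have "x \<ominus>\<^bsub>M\<^esub> y \<in> X (max m1 m2)"
        using m2[of i] m2[of "max m1 m2"] i by auto
      then have "(x \<ominus>\<^bsub>M\<^esub> y) \<oplus>\<^bsub>M\<^esub> y \<in> X (max m1 m2)"
        using y(1) M.rm_submoduleD(3)[OF sm] by auto
      then show "x \<in> X (max m1 m2)" using xy by (simp add: M.M.minus_add_cancel)
    qed
  qed
  then show "\<exists>m. \<forall>i\<ge>m. X i = X m" by blast
qed

context right_module
begin

text \<open>The image of \<open>H\<close> in the quotient by \<open>N\<close>, pulled back to
  \<open>R\<close> along the map sending \<open>a\<close> to the class of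
  \<open>a \<odot> s\<close>. It gives access to that quotient without forming it.\<close>

definition coeff_ideal :: "'m set \<Rightarrow> 'm \<Rightarrow> 'm set \<Rightarrow> 'a set" where
  "coeff_ideal N s H = {a \<in> carrier R. \<exists>n\<in>N. n \<oplus>\<^bsub>M\<^esub> a \<odot>\<^bsub>M\<^esub> s \<in> H}"

lemma submodule_adjoin:
  assumes N: "submodule N R M" and s: "s \<in> carrier M"
  shows "submodule {n \<oplus>\<^bsub>M\<^esub> a \<odot>\<^bsub>M\<^esub> s | n a. n \<in> N \<and> a \<in> carrier R} R M"
proof (rule rm_submoduleI)
  note N' = rm_submoduleD[OF N]
  show "{n \<oplus>\<^bsub>M\<^esub> a \<odot>\<^bsub>M\<^esub> s | n a. n \<in> N \<and> a \<in> carrier R} \<subseteq> carrier M"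
    using N'(1) s by (auto simp: smult_closed)
  show "\<zero>\<^bsub>M\<^esub> \<in> {n \<oplus>\<^bsub>M\<^esub> a \<odot>\<^bsub>M\<^esub> s | n a. n \<in> N \<and> a \<in> carrier R}"
    using N'(2) s by (intro CollectI exI[of _ "\<zero>\<^bsub>M\<^esub>"] exI[of _ "\<zero>\<^bsub>R\<^esub>"]) (auto simp: smult_zero_left)
next
  note N' = rm_submoduleD[OF N]
  fix x y assume "x \<in> {n \<oplus>\<^bsub>M\<^esub> a \<odot>\<^bsub>M\<^esub> s | n a. n \<in> N \<and> a \<in> carrier R}"
    "y \<in> {n \<oplus>\<^bsub>M\<^esub> a \<odot>\<^bsub>M\<^esub> s | n a. n \<in> N \<and> a \<in> carrier R}"
  then obtain n a n' a' where *: "x = n \<oplus>\<^bsub>M\<^esub> a \<odot>\<^bsub>M\<^esub> s" "n \<in> N" "a \<in> carrier R"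
    "y = n' \<oplus>\<^bsub>M\<^esub> a' \<odot>\<^bsub>M\<^esub> s" "n' \<in> N" "a' \<in> carrier R" by blast
  then have "x \<oplus>\<^bsub>M\<^esub> y = (n \<oplus>\<^bsub>M\<^esub> n') \<oplus>\<^bsub>M\<^esub> (a \<oplus>\<^bsub>R\<^esub> a') \<odot>\<^bsub>M\<^esub> s"
    using N'(1) s by (simp add: smult_l_distr smult_closed M.a_ac subset_iff)
  then show "x \<oplus>\<^bsub>M\<^esub> y \<in> {n \<oplus>\<^bsub>M\<^esub> a \<odot>\<^bsub>M\<^esub> s | n a. n \<in> N \<and> a \<in> carrier R}"
    using * N'(3) by blast
next
  note N' = rm_submoduleD[OF N]
  fix b x assume b: "b \<in> carrier R" and "x \<in> {n \<oplus>\<^bsub>M\<^esub> a \<odot>\<^bsub>M\<^esub> s | n a. n \<in> N \<and> a \<in> carrier R}"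
  then obtain n a where *: "x = n \<oplus>\<^bsub>M\<^esub> a \<odot>\<^bsub>M\<^esub> s" "n \<in> N" "a \<in> carrier R" by blast
  then have "b \<odot>\<^bsub>M\<^esub> x = b \<odot>\<^bsub>M\<^esub> n \<oplus>\<^bsub>M\<^esub> (a \<otimes>\<^bsub>R\<^esub> b) \<odot>\<^bsub>M\<^esub> s"
    using N'(1) s b by (simp add: smult_r_distr smult_assoc smult_closed subset_iff)
  then show "b \<odot>\<^bsub>M\<^esub> x \<in> {n \<oplus>\<^bsub>M\<^esub> a \<odot>\<^bsub>M\<^esub> s | n a. n \<in> N \<and> a \<in> carrier R}"
    using * b N'(4) by blast
qed

lemma submodule_coeff_ideal:
  assumes N: "submodule N R M" and s: "s \<in> carrier M" and H: "submodule H R M"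
  shows "submodule (coeff_ideal N s H) R (regular_module R)"
proof -
  interpret reg: right_module R "regular_module R" by (rule right_module_regular[OF R.ring_axioms])
  note N' = rm_submoduleD[OF N] and H' = rm_submoduleD[OF H]
  show ?thesis
  proof (rule reg.rm_submoduleI)
    show "\<zero>\<^bsub>regular_module R\<^esub> \<in> coeff_ideal N s H"
      using N'(2) H'(2) s by (auto simp: coeff_ideal_def smult_zero_left intro!: bexI[of _ "\<zero>\<^bsub>M\<^esub>"])
  next
    fix a b assume "a \<in> coeff_ideal N s H" "b \<in> coeff_ideal N s H"
    then obtain n n' where *: "a \<in> carrier R" "b \<in> carrier R" "n \<in> N" "n' \<in> N"
      "n \<oplus>\<^bsub>M\<^esub> a \<odot>\<^bsub>M\<^esub> s \<in> H" "n' \<oplus>\<^bsub>M\<^esub> b \<odot>\<^bsub>M\<^esub> s \<in> H" by (auto simp: coeff_ideal_def)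
    have "(n \<oplus>\<^bsub>M\<^esub> a \<odot>\<^bsub>M\<^esub> s) \<oplus>\<^bsub>M\<^esub> (n' \<oplus>\<^bsub>M\<^esub> b \<odot>\<^bsub>M\<^esub> s) = (n \<oplus>\<^bsub>M\<^esub> n') \<oplus>\<^bsub>M\<^esub> (a \<oplus>\<^bsub>R\<^esub> b) \<odot>\<^bsub>M\<^esub> s"
      using * N'(1) s by (simp add: smult_l_distr smult_closed M.a_ac subset_iff)
    then have "(n \<oplus>\<^bsub>M\<^esub> n') \<oplus>\<^bsub>M\<^esub> (a \<oplus>\<^bsub>R\<^esub> b) \<odot>\<^bsub>M\<^esub> s \<in> H" using * H'(3) by metis
    then show "a \<oplus>\<^bsub>regular_module R\<^esub> b \<in> coeff_ideal N s H"
      using * N'(3) by (auto simp: coeff_ideal_def)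
  next
    fix b a assume b: "b \<in> carrier R" and "a \<in> coeff_ideal N s H"
    then obtain n where *: "a \<in> carrier R" "n \<in> N" "n \<oplus>\<^bsub>M\<^esub> a \<odot>\<^bsub>M\<^esub> s \<in> H"
      by (auto simp: coeff_ideal_def)
    have "b \<odot>\<^bsub>M\<^esub> (n \<oplus>\<^bsub>M\<^esub> a \<odot>\<^bsub>M\<^esub> s) = b \<odot>\<^bsub>M\<^esub> n \<oplus>\<^bsub>M\<^esub> (a \<otimes>\<^bsub>R\<^esub> b) \<odot>\<^bsub>M\<^esub> s"
      using * N'(1) s b by (simp add: smult_r_distr smult_assoc smult_closed subset_iff)
    then have "b \<odot>\<^bsub>M\<^esub> n \<oplus>\<^bsub>M\<^esub> (a \<otimes>\<^bsub>R\<^esub> b) \<odot>\<^bsub>M\<^esub> s \<in> H" using * b H'(4) by metis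
    then show "b \<odot>\<^bsub>regular_module R\<^esub> a \<in> coeff_ideal N s H"
      using * b N'(4) by (auto simp: coeff_ideal_def)
  qed (auto simp: coeff_ideal_def)
qed

lemma coeff_ideal_subset: "coeff_ideal N s H \<subseteq> carrier R"
  by (auto simp: coeff_ideal_def)

lemma coeff_ideal_mono: "H \<subseteq> H' \<Longrightarrow> coeff_ideal N s H \<subseteq> coeff_ideal N s H'"
  by (auto simp: coeff_ideal_def)

text \<open>An element of \<open>H'\<close> and an element of \<open>H\<close> with the same
  coefficient of \<open>s\<close> differ by an element of \<open>H' \<inter> N\<close>, which lies
  in \<open>H\<close>. This is the modular law, read off from the trace on \<open>N\<close> and the
  image modulo \<open>N\<close>.\<close>

lemma coeff_ideal_eq_imp_subset:
  assumes N: "submodule N R M" and s: "s \<in> carrier M"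
    and H: "submodule H R M" "submodule H' R M" "H \<subseteq> H'"
    and H': "H' \<subseteq> {n \<oplus>\<^bsub>M\<^esub> a \<odot>\<^bsub>M\<^esub> s | n a. n \<in> N \<and> a \<in> carrier R}"
    and eq: "coeff_ideal N s H = coeff_ideal N s H'" "H \<inter> N = H' \<inter> N"
  shows "H' = H"
proof (intro equalityI subsetI)
  fix x assume x: "x \<in> H'"
  then obtain n a where na: "x = n \<oplus>\<^bsub>M\<^esub> a \<odot>\<^bsub>M\<^esub> s" "n \<in> N" "a \<in> carrier R" using H' by blast
  then have "a \<in> coeff_ideal N s H" unfolding eq(1) using x by (auto simp: coeff_ideal_def)
  then obtain n' where n': "n' \<in> N" "n' \<oplus>\<^bsub>M\<^esub> a \<odot>\<^bsub>M\<^esub> s \<in> H" by (auto simp: coeff_ideal_def)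
  let ?y = "n' \<oplus>\<^bsub>M\<^esub> a \<odot>\<^bsub>M\<^esub> s"
  have c: "n \<in> carrier M" "n' \<in> carrier M" "a \<odot>\<^bsub>M\<^esub> s \<in> carrier M"
    using na n' s rm_submoduleD(1)[OF N] by (auto intro: smult_closed)
  have "x \<ominus>\<^bsub>M\<^esub> ?y \<in> H'" using x n'(2) H(3) rm_submoduleD(6)[OF H(2)] by auto
  moreover have "x \<ominus>\<^bsub>M\<^esub> ?y = n \<ominus>\<^bsub>M\<^esub> n'"
    using c M.minus_cancel_right[of n n' "\<ominus>\<^bsub>M\<^esub> (a \<odot>\<^bsub>M\<^esub> s)"]
    by (simp add: na(1) a_minus_def)
  moreover have "n \<ominus>\<^bsub>M\<^esub> n' \<in> N" using na n' rm_submoduleD(6)[OF N] by auto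
  ultimately have "x \<ominus>\<^bsub>M\<^esub> ?y \<in> H" using eq(2) by auto
  then have "(x \<ominus>\<^bsub>M\<^esub> ?y) \<oplus>\<^bsub>M\<^esub> ?y \<in> H" using n'(2) rm_submoduleD(3)[OF H(1)] by auto
  then show "x \<in> H" using c by (simp add: na(1) M.minus_add_cancel)
qed (use H in auto)

lemma acc_on_adjoin:
  assumes reg: "acc_on R (regular_module R) (carrier R)"
    and N: "submodule N R M" "acc_on R M N" and s: "s \<in> carrier M"
  shows "acc_on R M {n \<oplus>\<^bsub>M\<^esub> a \<odot>\<^bsub>M\<^esub> s | n a. n \<in> N \<and> a \<in> carrier R}"
  unfolding acc_on_def
proof (intro allI impI)
  fix X :: "nat \<Rightarrow> _" assume X: "\<forall>i. submodule (X i) R M \<and>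
    X i \<subseteq> {n \<oplus>\<^bsub>M\<^esub> a \<odot>\<^bsub>M\<^esub> s | n a. n \<in> N \<and> a \<in> carrier R} \<and> X i \<subseteq> X (Suc i)"
  obtain m1 where m1: "\<And>i. i \<ge> m1 \<Longrightarrow> coeff_ideal N s (X i) = coeff_ideal N s (X m1)"
    using X by (elim acc_onD[OF reg, rotated -1])
      (auto intro!: submodule_coeff_ideal[OF N(1) s] dest: coeff_ideal_mono coeff_ideal_subset[THEN subsetD])
  obtain m2 where m2: "\<And>i. i \<ge> m2 \<Longrightarrow> X i \<inter> N = X m2 \<inter> N"
    using X by (elim acc_onD[OF N(2), rotated -1]) (auto intro!: submodule_Int N)
  have mono: "X i \<subseteq> X j" if "i \<le> j" for i j using X that by (meson lift_Suc_mono_le)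
  have "X i = X (max m1 m2)" if i: "i \<ge> max m1 m2" for i
    by (rule coeff_ideal_eq_imp_subset[OF N(1) s]) (use X mono[OF i] i m1[of i] m1[of "max m1 m2"] m2[of i] m2[of "max m1 m2"] in auto)
  then show "\<exists>m. \<forall>i\<ge>m. X i = X m" by blast
qed

lemma dcc_on_adjoin:
  assumes reg: "dcc_on R (regular_module R) (carrier R)"
    and N: "submodule N R M" "dcc_on R M N" and s: "s \<in> carrier M"
  shows "dcc_on R M {n \<oplus>\<^bsub>M\<^esub> a \<odot>\<^bsub>M\<^esub> s | n a. n \<in> N \<and> a \<in> carrier R}"
  unfolding dcc_on_def
proof (intro allI impI)
  fix X :: "nat \<Rightarrow> _" assume X: "\<forall>i. submodule (X i) R M \<and>
    X i \<subseteq> {n \<oplus>\<^bsub>M\<^esub> a \<odot>\<^bsub>M\<^esub> s | n a. n \<in> N \<and> a \<in> carrier R} \<and> X (Suc i) \<subseteq> X i"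
  obtain m1 where m1: "\<And>i. i \<ge> m1 \<Longrightarrow> coeff_ideal N s (X i) = coeff_ideal N s (X m1)"
    using X by (elim dcc_onD[OF reg, rotated -1])
      (auto intro!: submodule_coeff_ideal[OF N(1) s] dest: coeff_ideal_mono coeff_ideal_subset[THEN subsetD])
  obtain m2 where m2: "\<And>i. i \<ge> m2 \<Longrightarrow> X i \<inter> N = X m2 \<inter> N"
    using X by (elim dcc_onD[OF N(2), rotated -1]) (auto intro!: submodule_Int N)
  have mono: "X j \<subseteq> X i" if "i \<le> j" for i j using X that by (meson lift_Suc_antimono_le)
  have "X (max m1 m2) = X i" if i: "i \<ge> max m1 m2" for i
    by (rule coeff_ideal_eq_imp_subset[OF N(1) s]) (use X mono[OF i] i m1[of i] m1[of "max m1 m2"] m2[of i] m2[of "max m1 m2"] in auto)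
  then show "\<exists>m. \<forall>i\<ge>m. X i = X m" by metis
qed

lemma acc_on_zero: "acc_on R M {\<zero>\<^bsub>M\<^esub>}" and dcc_on_zero: "dcc_on R M {\<zero>\<^bsub>M\<^esub>}"
proof -
  have "X i = {\<zero>\<^bsub>M\<^esub>}" if "submodule (X i) R M" "X i \<subseteq> {\<zero>\<^bsub>M\<^esub>}" for X and i :: nat
    using that rm_submoduleD(2)[OF that(1)] by auto
  then show "acc_on R M {\<zero>\<^bsub>M\<^esub>}" "dcc_on R M {\<zero>\<^bsub>M\<^esub>}"
    unfolding acc_on_def dcc_on_def by blast+
qed

text \<open>The span is built by adjoining one generator at a time, each step preserving the chain
  conditions. They stay implications because the same span serves for either condition and also
  without them.\<close>

lemma submodule_span_exists:
  assumes "finite S" "S \<subseteq> carrier M"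
  shows "\<exists>N. submodule N R M \<and> S \<subseteq> N \<and> (\<forall>H. submodule H R M \<and> S \<subseteq> H \<longrightarrow> N \<subseteq> H) \<and>
    (acc_on R (regular_module R) (carrier R) \<longrightarrow> acc_on R M N) \<and>
    (dcc_on R (regular_module R) (carrier R) \<longrightarrow> dcc_on R M N)"
  using assms
proof (induction S)
  case empty
  show ?case using acc_on_zero dcc_on_zero submodule_zero rm_submoduleD(2) by (intro exI[of _ "{\<zero>\<^bsub>M\<^esub>}"]) auto
next
  case (insert s S)
  then obtain N where N: "submodule N R M" "S \<subseteq> N" "\<And>H. submodule H R M \<Longrightarrow> S \<subseteq> H \<Longrightarrow> N \<subseteq> H"
    "acc_on R (regular_module R) (carrier R) \<Longrightarrow> acc_on R M N"
    "dcc_on R (regular_module R) (carrier R) \<Longrightarrow> dcc_on R M N" by auto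
  have s: "s \<in> carrier M" using insert by simp
  let ?N = "{n \<oplus>\<^bsub>M\<^esub> a \<odot>\<^bsub>M\<^esub> s | n a. n \<in> N \<and> a \<in> carrier R}"
  have "s \<in> ?N"
    using rm_submoduleD(2)[OF N(1)] s
    by (intro CollectI exI[of _ "\<zero>\<^bsub>M\<^esub>"] exI[of _ "\<one>\<^bsub>R\<^esub>"]) (simp add: smult_one)
  moreover have "N \<subseteq> ?N"
  proof
    fix x assume "x \<in> N"
    then show "x \<in> ?N" using rm_submoduleD(1)[OF N(1)] s
      by (intro CollectI exI[of _ x] exI[of _ "\<zero>\<^bsub>R\<^esub>"]) (auto simp add: smult_zero_left)
  qed
  moreover have "?N \<subseteq> H" if "submodule H R M" "insert s S \<subseteq> H" for H
    using that N(3)[of H] rm_submoduleD(3,4)[OF that(1)] by auto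
  ultimately have "insert s S \<subseteq> ?N" "\<forall>H. submodule H R M \<and> insert s S \<subseteq> H \<longrightarrow> ?N \<subseteq> H"
    using N(2) by blast+
  then show ?case
    using submodule_adjoin[OF N(1) s] acc_on_adjoin[OF _ N(1) N(4) s] dcc_on_adjoin[OF _ N(1) N(5) s]
    by (intro exI[of _ ?N] conjI impI) assumption+
qed

text \<open>A maximal member among the spans of finite subsets of \<open>H\<close> is all of
  \<open>H\<close>, since adjoining a further element of \<open>H\<close> cannot enlarge it.\<close>

lemma acc_on_fg_submodule:
  assumes acc: "acc_on R M (carrier M)" and H: "submodule H R M"
  shows "\<exists>S. finite S \<and> S \<subseteq> H \<and> (\<forall>H'. submodule H' R M \<and> S \<subseteq> H' \<longrightarrow> H \<subseteq> H')"
proof -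
  define sp where "sp S N \<longleftrightarrow> submodule N R M \<and> S \<subseteq> N \<and> (\<forall>H. submodule H R M \<and> S \<subseteq> H \<longrightarrow> N \<subseteq> H)"
    for S N
  let ?F = "{N. \<exists>S. finite S \<and> S \<subseteq> H \<and> sp S N}"
  note H' = rm_submoduleD[OF H]
  have ex: "\<exists>N. sp S N" if "finite S" "S \<subseteq> H" for S
  proof -
    have "S \<subseteq> carrier M" using that(2) H'(1) by simp
    from submodule_span_exists[OF that(1) this] show ?thesis
      unfolding sp_def by (elim exE conjE) (rule exI, intro conjI)
  qed
  obtain N0 where "sp {} N0" using ex[of "{}"] by auto
  then have "N0 \<in> ?F" by blast
  moreover have "submodule N R M \<and> N \<subseteq> carrier M" if "N \<in> ?F" for N
    using that rm_submoduleD(1) unfolding sp_def by blast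
  ultimately have "\<exists>X\<in>?F. \<forall>Y\<in>?F. X \<subseteq> Y \<longrightarrow> Y = X"
    by (rule acc_on_maximal[OF acc])
  then obtain N where N: "N \<in> ?F" "\<forall>Y\<in>?F. N \<subseteq> Y \<longrightarrow> Y = N" by (rule bexE)
  then obtain S where S: "finite S" "S \<subseteq> H" "sp S N" by auto
  have "H \<subseteq> N"
  proof
    fix x assume x: "x \<in> H"
    obtain Y where Y: "sp (insert x S) Y" using ex[of "insert x S"] S(1,2) x by auto
    then have "Y \<in> ?F" using S(1,2) x by (intro CollectI exI[of _ "insert x S"]) auto
    moreover have "N \<subseteq> Y" using Y S(3) by (simp add: sp_def)
    ultimately have "Y = N" using N(2) by blast
    then show "x \<in> N" using Y by (simp add: sp_def)
  qed
  moreover have "N \<subseteq> H'" if "submodule H' R M" "S \<subseteq> H'" for H'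
    using S(3) that by (simp add: sp_def)
  ultimately show ?thesis using S(1,2) by (intro exI[of _ S]) blast
qed

end

section \<open>Commutative artinian rings are noetherian\<close>

lemma regular_module_minus [simp]:
  "\<ominus>\<^bsub>regular_module A\<^esub> x = \<ominus>\<^bsub>A\<^esub> x" "x \<ominus>\<^bsub>regular_module A\<^esub> y = x \<ominus>\<^bsub>A\<^esub> y"
  by (simp_all add: a_minus_def a_inv_def regular_module_def m_inv_def)

text \<open>Hopkins' theorem for commutative rings. An ideal \<open>J\<close> minimal among those
  violating the ascending chain condition turns out to be a vector space over the field
  \<open>R / ann J\<close>. A subspace maximal among those missing a nonzero vector has codimension
  one and satisfies the condition by minimality, so \<open>J\<close> satisfies it too.\<close>

lemma artinian_imp_noetherian:
  fixes R :: "'a ring" (structure)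
  assumes "cring R" and dcc: "dcc_on R (regular_module R) (carrier R)"
  shows "acc_on R (regular_module R) (carrier R)"
proof (rule ccontr)
  interpret cring R by fact
  interpret reg: right_module R "regular_module R" by (rule right_module_regular[OF ring_axioms])
  let ?M = "regular_module R"
  assume nacc: "\<not> acc_on R ?M (carrier R)"
  let ?F = "{J. submodule J R ?M \<and> \<not> acc_on R ?M J}"
  have "carrier R \<in> ?F" using nacc reg.submodule_carrier by simp
  moreover have "submodule X R ?M \<and> X \<subseteq> carrier R" if "X \<in> ?F" for X
    using that reg.rm_submoduleD(1)[of X] by auto
  ultimately have "\<exists>J\<in>?F. \<forall>Y\<in>?F. Y \<subseteq> J \<longrightarrow> Y = J" by (rule dcc_on_minimal[OF dcc])
  then obtain J where J: "submodule J R ?M" "\<not> acc_on R ?M J"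
    and "\<forall>Y\<in>?F. Y \<subseteq> J \<longrightarrow> Y = J" by blast
  then have Jmin: "acc_on R ?M Y" if "submodule Y R ?M" "Y \<subseteq> J" "Y \<noteq> J" for Y
    using that by blast
  note J' = reg.rm_submoduleD[OF J(1), simplified]
  have homx: "(\<lambda>j. j \<otimes> x) \<in> module_hom R ?M ?M" if "x \<in> carrier R" for x
    using that by (intro module_homI) (simp_all add: l_distr, simp add: m_ac)
  \<comment> \<open>The image and the kernel of multiplication by \<open>x\<close> on
    \<open>J\<close> cannot both be proper: by minimality both would satisfy the ascending chain
    condition, and then so would \<open>J\<close>.\<close>
  have dich: "(\<lambda>j. j \<otimes> x) ` J = J \<or> (\<forall>j\<in>J. j \<otimes> x = \<zero>)" if x: "x \<in> carrier R" for x
  proof (rule ccontr)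
    assume "\<not> ?thesis"
    then have ne: "(\<lambda>j. j \<otimes> x) ` J \<noteq> J" "{j \<in> J. j \<otimes> x = \<zero>} \<noteq> J" by auto
    have im: "submodule ((\<lambda>j. j \<otimes> x) ` J) R ?M"
      by (rule submodule_image[OF reg.right_module_axioms reg.right_module_axioms homx[OF x] J(1)])
    have "{j \<in> J. j \<otimes> x = \<zero>} = J \<inter> {j \<in> carrier ?M. j \<otimes> x = \<zero>\<^bsub>?M\<^esub>}" using J'(1) by auto
    moreover have "submodule \<dots> R ?M"
      by (intro reg.submodule_Int J(1)
          submodule_ker[OF reg.right_module_axioms reg.right_module_axioms homx[OF x]])
    ultimately have ker: "submodule {j \<in> J. j \<otimes> x = \<zero>} R ?M" by simp
    have "(\<lambda>j. j \<otimes> x) ` J \<subseteq> J" using J'(4) x by auto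
    then have "acc_on R ?M ((\<lambda>j. j \<otimes> x) ` J)" using im ne(1) by (intro Jmin) auto
    moreover have "acc_on R ?M {j \<in> J. j \<otimes> x = \<zero>\<^bsub>?M\<^esub>}" using ker ne(2) by (intro Jmin) auto
    ultimately have "acc_on R ?M J"
      using acc_on_hom[OF reg.right_module_axioms reg.right_module_axioms homx[OF x], of J] J'(1) by simp
    with J(2) show False by simp
  qed
  \<comment> \<open>An \<open>x\<close> that does not annihilate \<open>J\<close> even acts
    invertibly. The descending chain of the principal ideals of the powers of \<open>x\<close>
    yields \<open>x^m = y x^(m+1)\<close>, and every element of \<open>J\<close> is a multiple of
    \<open>x^m\<close>, so \<open>y\<close> undoes \<open>x\<close> on \<open>J\<close>.\<close>
  have unit: "\<exists>y\<in>carrier R. \<forall>j\<in>J. (j \<otimes> x) \<otimes> y = j"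
    if x: "x \<in> carrier R" and xJ: "(\<lambda>j. j \<otimes> x) ` J = J" for x
  proof -
    let ?X = "\<lambda>m::nat. (\<lambda>r. r \<otimes> x [^] m) ` carrier R"
    have "submodule (?X m) R ?M" for m
      using submodule_image[OF reg.right_module_axioms reg.right_module_axioms homx reg.submodule_carrier] x
      by simp
    moreover have "?X (Suc m) \<subseteq> ?X m" for m
    proof
      fix z assume "z \<in> ?X (Suc m)"
      then obtain r where "r \<in> carrier R" "z = r \<otimes> x [^] Suc m" by auto
      then have "z = (r \<otimes> x) \<otimes> x [^] m" using x by (simp add: m_ac)
      then show "z \<in> ?X m" using \<open>r \<in> carrier R\<close> x by auto
    qed
    moreover have "?X m \<subseteq> carrier R" for m using x by auto
    ultimately obtain m where m: "\<And>i. i \<ge> m \<Longrightarrow> ?X i = ?X m"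
      using dcc_onD[OF dcc, of ?X] by blast
    have "\<one> \<otimes> x [^] m \<in> ?X m" by (intro imageI) simp
    then have "x [^] m \<in> ?X (Suc m)" using m[of "Suc m"] x by auto
    then obtain y where y: "y \<in> carrier R" "x [^] m = y \<otimes> x [^] Suc m" by auto
    have pow: "\<exists>j'\<in>J. j = j' \<otimes> x [^] i" if "j \<in> J" for j and i :: nat
      using that
    proof (induction i arbitrary: j)
      case 0
      then show ?case using J'(1) by (intro bexI[of _ j]) auto
    next
      case (Suc i)
      then obtain j1 where j1: "j1 \<in> J" "j = j1 \<otimes> x" using xJ by blast
      with Suc.IH[of j1] obtain j2 where "j2 \<in> J" "j1 = j2 \<otimes> x [^] i" by blast
      then show ?case using j1 x J'(1) by (intro bexI[of _ j2]) (auto simp: m_ac)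
    qed
    have "(j \<otimes> x) \<otimes> y = j" if j: "j \<in> J" for j
    proof -
      obtain j' where j': "j' \<in> J" "j = j' \<otimes> x [^] m" using pow[OF j] by blast
      have c: "j' \<in> carrier R" using j'(1) J'(1) by auto
      have "(j \<otimes> x) \<otimes> y = j' \<otimes> (y \<otimes> x [^] Suc m)" unfolding j'(2) using x y(1) c by (simp add: m_ac)
      also have "\<dots> = j" unfolding j'(2) y(2)[symmetric] ..
      finally show ?thesis .
    qed
    with y(1) show ?thesis by blast
  qed
  have "J \<noteq> {\<zero>}"
  proof
    assume "J = {\<zero>}"
    then show False using J(2) reg.acc_on_zero by simp
  qed
  then obtain j0 where j0: "j0 \<in> J" "j0 \<noteq> \<zero>" using J'(2) by blast
  \<comment> \<open>A hyperplane: a subideal of \<open>J\<close> maximal among those that miss the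
    nonzero element \<open>j0\<close>.\<close>
  let ?H = "{H. submodule H R ?M \<and> H \<subseteq> J \<and> j0 \<notin> H}"
  have "\<exists>H\<in>?H. \<forall>X\<in>?H. H \<subseteq> X \<longrightarrow> X = H"
  proof (rule subset_Zorn_nonempty)
    have "{\<zero>} \<in> ?H" using reg.submodule_zero j0 J'(2) by simp
    then show "?H \<noteq> {}" by blast
  next
    fix C assume C: "C \<noteq> {}" "subset.chain ?H C"
    then have CH: "\<And>X. X \<in> C \<Longrightarrow> submodule X R ?M \<and> X \<subseteq> J \<and> j0 \<notin> X"
      and lin: "\<And>X Y. X \<in> C \<Longrightarrow> Y \<in> C \<Longrightarrow> X \<subseteq> Y \<or> Y \<subseteq> X"
      by (auto simp: subset_chain_def)
    have "submodule (\<Union>C) R ?M"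
    proof (rule reg.rm_submoduleI)
      show "\<Union>C \<subseteq> carrier ?M" using CH J'(1) by fastforce
      show "\<zero>\<^bsub>?M\<^esub> \<in> \<Union>C" using C(1) CH reg.rm_submoduleD(2) by blast
    next
      fix x y assume "x \<in> \<Union>C" "y \<in> \<Union>C"
      then obtain X where "X \<in> C" "x \<in> X" "y \<in> X" using lin by blast
      then show "x \<oplus>\<^bsub>?M\<^esub> y \<in> \<Union>C" using CH reg.rm_submoduleD(3)[of X] by blast
    next
      fix a x assume "a \<in> carrier R" "x \<in> \<Union>C"
      then show "a \<odot>\<^bsub>?M\<^esub> x \<in> \<Union>C" using CH reg.rm_submoduleD(4) by blast
    qed
    then show "\<Union>C \<in> ?H" using CH by blast
  qed
  then obtain H where H0: "H \<in> ?H" "\<forall>X\<in>?H. H \<subseteq> X \<longrightarrow> X = H" by (rule bexE)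
  then have H: "submodule H R ?M" "H \<subseteq> J" "j0 \<notin> H" by simp_all
  have Hmax: "X = H" if "submodule X R ?M" "X \<subseteq> J" "j0 \<notin> X" "H \<subseteq> X" for X
    using H0(2) that by simp
  note H' = reg.rm_submoduleD[OF H(1), simplified]
  have accH: "acc_on R ?M H" using H j0 by (intro Jmin) auto
  have j0_in: "\<exists>h\<in>H. \<exists>c\<in>carrier R. j0 = h \<oplus> y \<otimes> c" if y: "y \<in> J" "y \<notin> H" for y
  proof -
    let ?Y = "{n \<oplus>\<^bsub>?M\<^esub> a \<odot>\<^bsub>?M\<^esub> y | n a. n \<in> H \<and> a \<in> carrier R}"
    have yc: "y \<in> carrier R" using y J'(1) by auto
    have s: "submodule ?Y R ?M" using reg.submodule_adjoin[OF H(1), of y] yc by simp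
    have "?Y \<subseteq> J" using H(2) y J'(3,4) by auto
    moreover have "H \<subseteq> ?Y"
    proof
      fix h assume "h \<in> H"
      then show "h \<in> ?Y" using H'(1) yc by (intro CollectI exI[of _ h] exI[of _ \<zero>]) auto
    qed
    moreover have "y \<in> ?Y"
      using H'(2) yc by (intro CollectI exI[of _ \<zero>] exI[of _ \<one>]) auto
    ultimately have "j0 \<in> ?Y" using Hmax[OF s] y(2) by blast
    then show ?thesis by auto
  qed
  \<comment> \<open>Codimension one. By maximality both \<open>y\<close> and \<open>z\<close> reach
    \<open>j0\<close> modulo \<open>H\<close>, say by coefficients \<open>c\<close> and
    \<open>c'\<close>. As \<open>z c'\<close> is nonzero, \<open>c'\<close> acts invertibly on
    \<open>J\<close>, so \<open>z\<close> can be solved for in terms of \<open>y\<close>.\<close>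
  have decomp: "\<exists>h\<in>H. \<exists>r\<in>carrier R. z = h \<oplus> y \<otimes> r" if y: "y \<in> J" "y \<notin> H" and z: "z \<in> J" for y z
  proof (cases "z \<in> H")
    case True
    moreover have "z = z \<oplus> y \<otimes> \<zero>" using True H'(1) y(1) J'(1) by (simp add: subset_iff)
    ultimately show ?thesis by blast
  next
    case False
    obtain h c where h: "h \<in> H" "c \<in> carrier R" "j0 = h \<oplus> y \<otimes> c" using j0_in[OF y] by blast
    obtain h' c' where h': "h' \<in> H" "c' \<in> carrier R" "j0 = h' \<oplus> z \<otimes> c'" using j0_in[OF z False] by blast
    have car: "y \<in> carrier R" "z \<in> carrier R" "h \<in> carrier R" "h' \<in> carrier R"
      using y z h h' J'(1) H'(1) by auto
    have "z \<otimes> c' \<noteq> \<zero>" using h' H(3) car by auto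
    then have "(\<lambda>j. j \<otimes> c') ` J = J" using dich[OF h'(2)] z by auto
    from unit[OF h'(2) this] obtain d where d: "d \<in> carrier R" "(z \<otimes> c') \<otimes> d = z" using z by auto
    have "z \<otimes> c' = (h \<ominus> h') \<oplus> y \<otimes> c"
    proof -
      have "z \<otimes> c' = j0 \<ominus> h'" using h' car add_minus_cancel[of "z \<otimes> c'" h']
        by (simp add: a_comm[of h'])
      also have "\<dots> = (h \<ominus> h') \<oplus> y \<otimes> c" using h car h'(1) by (simp add: a_minus_def a_ac)
      finally show ?thesis .
    qed
    then have "z = ((h \<ominus> h') \<oplus> y \<otimes> c) \<otimes> d" using d(2) by simp
    also have "\<dots> = (h \<ominus> h') \<otimes> d \<oplus> y \<otimes> (c \<otimes> d)" using car h(2) d(1) by (simp add: l_distr m_assoc)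
    finally have "z = (h \<ominus> h') \<otimes> d \<oplus> y \<otimes> (c \<otimes> d)" .
    moreover have "h \<ominus> h' \<in> H" using reg.rm_submoduleD(3,5)[OF H(1)] h h' H'(6)
      by (simp add: a_minus_def a_inv_def)
    then have "(h \<ominus> h') \<otimes> d \<in> H" using H'(4) d(1) by simp
    ultimately show ?thesis using h(2) d(1) by blast
  qed
  have "acc_on R ?M J"
    unfolding acc_on_def
  proof (intro allI impI)
    fix X :: "nat \<Rightarrow> _" assume X: "\<forall>i. submodule (X i) R ?M \<and> X i \<subseteq> J \<and> X i \<subseteq> X (Suc i)"
    have mono: "X i \<subseteq> X j" if "i \<le> j" for i j using X that by (meson lift_Suc_mono_le)
    obtain m where m: "\<And>i. i \<ge> m \<Longrightarrow> X i \<inter> H = X m \<inter> H"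
      using X by (elim acc_onD[OF accH, rotated -1]) (auto intro!: reg.submodule_Int H(1))
    show "\<exists>m. \<forall>i\<ge>m. X i = X m"
    proof (cases "\<forall>i. X i \<subseteq> H")
      case True
      then show ?thesis using m by (metis inf.absorb1)
    next
      case False
      then obtain l0 y where y: "y \<in> X l0" "y \<notin> H" by blast
      let ?l = "max l0 m"
      have yl: "y \<in> X ?l" using y(1) mono[of l0 ?l] by auto
      \<comment> \<open>Once the chain contains \<open>y\<close> outside \<open>H\<close>, a member
        is determined by its intersection with \<open>H\<close>, since every \<open>z\<close> is a
        multiple of \<open>y\<close> up to an element of \<open>H\<close>.\<close>
      have "X i = X ?l" if i: "i \<ge> ?l" for i
      proof
        show "X ?l \<subseteq> X i" using i by (rule mono)
        show "X i \<subseteq> X ?l"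
        proof
          fix z assume z: "z \<in> X i"
          have si: "submodule (X i) R ?M" and sl: "submodule (X ?l) R ?M" using X by auto
          have yJ: "y \<in> J" and zJ: "z \<in> J" using y z X by auto
          obtain h r where h: "h \<in> H" "r \<in> carrier R" "z = h \<oplus> y \<otimes> r" using decomp[OF yJ y(2) zJ] by blast
          have car: "y \<in> carrier R" "z \<in> carrier R" "h \<in> carrier R" using yJ zJ J'(1) h(1) H'(1) by auto
          have yr: "y \<otimes> r \<in> X ?l" using reg.rm_submoduleD(4)[OF sl h(2) yl] by simp
          then have "y \<otimes> r \<in> X i" using mono[OF i] by auto
          then have "z \<ominus>\<^bsub>?M\<^esub> y \<otimes> r \<in> X i" using reg.rm_submoduleD(6)[OF si z] by simp
          also have "z \<ominus>\<^bsub>?M\<^esub> y \<otimes> r = h"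
            using h car reg.M.add_minus_cancel[of h "y \<otimes> r"] by simp
          finally have "h \<in> X i" .
          then have "h \<in> X ?l" using h(1) m[of i] m[of ?l] i by auto
          then show "z \<in> X ?l" using reg.rm_submoduleD(3)[OF sl _ yr] h(3) by simp
        qed
      qed
      then show ?thesis by blast
    qed
  qed
  with J(2) show False by simp
qed

section \<open>Restriction of scalars to \<open>k\<close> and chain conditions over the artin
  algebra\<close>

definition scalar_module :: "('k \<Rightarrow> 'a) \<Rightarrow> ('a, 'm) module \<Rightarrow> ('k, 'm) module" where
  "scalar_module \<phi> M = \<lparr>carrier = carrier M, mult = undefined, one = undefined,
     zero = zero M, add = add M, smult = (\<lambda>r x. \<phi> r \<odot>\<^bsub>M\<^esub> x)\<rparr>"

lemma scalar_module_simps [simp]: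
  "carrier (scalar_module \<phi> M) = carrier M" "\<zero>\<^bsub>scalar_module \<phi> M\<^esub> = \<zero>\<^bsub>M\<^esub>"
  "x \<oplus>\<^bsub>scalar_module \<phi> M\<^esub> y = x \<oplus>\<^bsub>M\<^esub> y" "r \<odot>\<^bsub>scalar_module \<phi> M\<^esub> x = \<phi> r \<odot>\<^bsub>M\<^esub> x"
  by (simp_all add: scalar_module_def)

lemma submodule_restrict_iff:
  assumes M: "right_module A M" and H: "submodule H A M"
  shows "submodule K A (restrict_module M H) \<longleftrightarrow> submodule K A M \<and> K \<subseteq> H"
proof -
  interpret M: right_module A M by fact
  interpret N: right_module A "restrict_module M H" by (rule M.right_module_restrict[OF H])
  show ?thesis
  proof
    assume K: "submodule K A (restrict_module M H)"
    note K' = N.rm_submoduleD[OF K]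
    have "submodule K A M"
      using K' M.rm_submoduleD(1)[OF H] by (intro M.rm_submoduleI) auto
    then show "submodule K A M \<and> K \<subseteq> H" using K'(1) by simp
  next
    assume K: "submodule K A M \<and> K \<subseteq> H"
    then show "submodule K A (restrict_module M H)"
      using M.rm_submoduleD[of K] by (intro N.rm_submoduleI) auto
  qed
qed

lemma ring_hom_axioms_simps:
  assumes "\<phi> \<in> ring_hom k A" "x \<in> carrier k" "y \<in> carrier k"
  shows "\<phi> x \<in> carrier A" "\<phi> (x \<oplus>\<^bsub>k\<^esub> y) = \<phi> x \<oplus>\<^bsub>A\<^esub> \<phi> y" "\<phi> (x \<otimes>\<^bsub>k\<^esub> y) = \<phi> x \<otimes>\<^bsub>A\<^esub> \<phi> y"
  using assms by (auto simp: ring_hom_def)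

context artin_algebra
begin

lemma dcc_base: "dcc_on k (regular_module k) (carrier k)"
  unfolding dcc_on_def
proof (intro allI impI)
  fix X :: "nat \<Rightarrow> _"
  assume X: "\<forall>i. submodule (X i) k (regular_module k) \<and> X i \<subseteq> carrier k \<and> X (Suc i) \<subseteq> X i"
  interpret reg: right_module k "regular_module k" by (rule right_module_regular[OF k.ring_axioms])
  have "ideal (X i) k" for i
  proof -
    have Xi: "submodule (X i) k (regular_module k)" using X by simp
    note X' = reg.rm_submoduleD[OF Xi, simplified]
    show ?thesis
    proof (rule idealI[OF k.ring_axioms])
      show "subgroup (X i) (add_monoid k)"
        using X' by (intro k.add.subgroupI) (auto simp: a_inv_def)
      show "x \<otimes>\<^bsub>k\<^esub> a \<in> X i" if "a \<in> X i" "x \<in> carrier k" for a x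
        using X'(1) X'(4)[OF that(2,1)] that by (auto simp: k.m_comm subset_iff)
      show "a \<otimes>\<^bsub>k\<^esub> x \<in> X i" if "a \<in> X i" "x \<in> carrier k" for a x
        using X'(4)[OF that(2,1)] by simp
    qed
  qed
  then show "\<exists>m. \<forall>i\<ge>m. X i = X m" using X by (intro k.descending_chain) auto
qed

lemma acc_base: "acc_on k (regular_module k) (carrier k)"
  by (rule artinian_imp_noetherian[OF k.is_cring dcc_base])

lemma right_module_scalar:
  assumes "right_module A M"
  shows "right_module k (scalar_module \<phi> M)"
proof -
  interpret M: right_module A M by fact
  note \<phi> = ring_hom_axioms_simps[OF structure_map]
  have "abelian_group (scalar_module \<phi> M)"
  proof (rule abelian_groupI)
    fix x assume "x \<in> carrier (scalar_module \<phi> M)"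
    then show "\<exists>y\<in>carrier (scalar_module \<phi> M). y \<oplus>\<^bsub>scalar_module \<phi> M\<^esub> x = \<zero>\<^bsub>scalar_module \<phi> M\<^esub>"
      by (intro bexI[of _ "\<ominus>\<^bsub>M\<^esub> x"]) (auto simp: M.M.l_neg)
  qed (auto simp: M.M.a_ac)
  moreover have "right_module_axioms k (scalar_module \<phi> M)"
    using ring_hom_one[OF structure_map]
    by unfold_locales (auto simp: \<phi> M.smult_closed M.smult_l_distr M.smult_r_distr M.smult_assoc M.smult_one)
  ultimately show ?thesis by (simp add: right_module_def k.ring_axioms)
qed

lemma submodule_scalar:
  assumes "right_module A M" "submodule H A M"
  shows "submodule H k (scalar_module \<phi> M)"
proof -
  interpret M: right_module A M by fact
  interpret N: right_module k "scalar_module \<phi> M" by (rule right_module_scalar[OF assms(1)])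
  show ?thesis
    using M.rm_submoduleD[OF assms(2)] ring_hom_axioms_simps(1)[OF structure_map]
    by (intro N.rm_submoduleI) auto
qed

text \<open>The products of generators of \<open>A\<close> over \<open>k\<close> with generators of
  \<open>M\<close> over \<open>A\<close> generate \<open>M\<close> over \<open>k\<close>. Hence the
  chain conditions of \<open>k\<close> reach \<open>M\<close>.\<close>

lemma scalar_module_chain_conditions:
  assumes "fg_module A M"
  shows "acc_on k (scalar_module \<phi> M) (carrier M)" "dcc_on k (scalar_module \<phi> M) (carrier M)"
proof -
  interpret M: right_module A M using assms by (rule fg_module_right_module)
  interpret N: right_module k "scalar_module \<phi> M" by (rule right_module_scalar[OF M.right_module_axioms])
  interpret reg: right_module A "regular_module A" by (rule right_module_regular[OF ring_axioms])
  note \<phi> = ring_hom_axioms_simps[OF structure_map]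
  obtain S where S: "finite S" "S \<subseteq> carrier M"
    and gen: "\<And>H. submodule H A M \<Longrightarrow> S \<subseteq> H \<Longrightarrow> H = carrier M"
    using assms by (auto simp: M.fg_module_iff)
  obtain B where B: "finite B" "B \<subseteq> carrier A"
    "carrier A = {finsum A (\<lambda>s. \<phi> (c s) \<otimes> s) B | c. c \<in> B \<rightarrow> carrier k}"
    using finite_over_k by blast
  let ?S = "(\<lambda>(b, s). b \<odot>\<^bsub>M\<^esub> s) ` (B \<times> S)"
  have full: "H = carrier M" if H: "submodule H k (scalar_module \<phi> M)" "?S \<subseteq> H" for H
  proof -
    note H' = N.rm_submoduleD[OF H(1), simplified]
    have fin: "finsum A (\<lambda>s. \<phi> (c s) \<otimes> s) B' \<odot>\<^bsub>M\<^esub> s \<in> H"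
      if "B' \<subseteq> B" "c \<in> B \<rightarrow> carrier k" "s \<in> S" for B' c s
      using finite_subset[OF that(1) B(1)] that
    proof (induction B')
      case empty
      then show ?case using S(2) H'(2) by (auto simp: M.smult_zero_left)
    next
      case (insert b B')
      have b: "b \<in> carrier A" "s \<in> carrier M" "\<phi> (c b) \<in> carrier A" "c b \<in> carrier k"
        using insert B(2) S(2) by (auto intro!: \<phi>(1))
      have cl: "(\<lambda>s. \<phi> (c s) \<otimes> s) \<in> B' \<rightarrow> carrier A"
        using insert B(2) by (auto intro!: \<phi>(1))
      have "finsum A (\<lambda>s. \<phi> (c s) \<otimes> s) (insert b B') \<odot>\<^bsub>M\<^esub> s
        = (\<phi> (c b) \<otimes> b) \<odot>\<^bsub>M\<^esub> s \<oplus>\<^bsub>M\<^esub> finsum A (\<lambda>s. \<phi> (c s) \<otimes> s) B' \<odot>\<^bsub>M\<^esub> s"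
        using insert cl b by (simp add: M.smult_l_distr)
      also have "(\<phi> (c b) \<otimes> b) \<odot>\<^bsub>M\<^esub> s = \<phi> (c b) \<odot>\<^bsub>M\<^esub> (b \<odot>\<^bsub>M\<^esub> s)"
        using b by (simp add: central M.smult_assoc)
      finally show ?case
        using H'(3,4) b insert H(2) by auto
    qed
    have AS: "a \<odot>\<^bsub>M\<^esub> s \<in> H" if a: "a \<in> carrier A" and s: "s \<in> S" for a s
    proof -
      obtain c where c: "c \<in> B \<rightarrow> carrier k" "a = finsum A (\<lambda>s. \<phi> (c s) \<otimes> s) B"
        using a B(3) by blast
      show ?thesis unfolding c(2) by (rule fin[OF order_refl c(1) s])
    qed
    \<comment> \<open>The largest \<open>A\<close>-submodule inside the \<open>k\<close>-submodule
      \<open>H\<close>. It contains the \<open>A\<close>-generators of \<open>M\<close>, so it is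
      everything.\<close>
    let ?N = "{x \<in> carrier M. \<forall>a\<in>carrier A. a \<odot>\<^bsub>M\<^esub> x \<in> H}"
    have "submodule ?N A M"
      by (rule M.rm_submoduleI)
        (use H' in \<open>auto simp: M.smult_zero_right M.smult_r_distr M.smult_closed M.smult_assoc[symmetric]\<close>)
    then have N: "?N = carrier M" using AS S(2) by (intro gen) auto
    have "x \<in> H" if x: "x \<in> carrier M" for x
    proof -
      have "\<one> \<odot>\<^bsub>M\<^esub> x \<in> H" using x N by blast
      then show ?thesis using x by (simp add: M.smult_one)
    qed
    then show ?thesis using H'(1) by auto
  qed
  have fS: "finite ?S" "?S \<subseteq> carrier (scalar_module \<phi> M)"
    using B S by (auto intro!: M.smult_closed)
  from N.submodule_span_exists[OF this] obtain N where
    N: "submodule N k (scalar_module \<phi> M)" "?S \<subseteq> N"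
    "acc_on k (scalar_module \<phi> M) N" "dcc_on k (scalar_module \<phi> M) N"
    using acc_base dcc_base by (elim exE conjE) simp
  have "N = carrier M" using full N(1,2) by simp
  then show "acc_on k (scalar_module \<phi> M) (carrier M)" "dcc_on k (scalar_module \<phi> M) (carrier M)"
    using N by simp_all
qed

lemma fg_module_chain_conditions:
  assumes "fg_module A M"
  shows "acc_on A M (carrier M)" "dcc_on A M (carrier M)"
  using scalar_module_chain_conditions[OF assms] submodule_scalar[OF fg_module_right_module[OF assms]]
  unfolding acc_on_def dcc_on_def by meson+

text \<open>By the ascending chain condition kernels stay finitely generated; this is what makes
  \<open>mod A\<close> closed under the syzygies used later.\<close>

lemma fg_module_restrict:
  assumes "fg_module A M" "submodule H A M"
  shows "fg_module A (restrict_module M H)"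
proof -
  interpret M: right_module A M using assms(1) by (rule fg_module_right_module)
  interpret N: right_module A "restrict_module M H" by (rule M.right_module_restrict[OF assms(2)])
  obtain S where S: "finite S" "S \<subseteq> H" "\<And>H'. submodule H' A M \<Longrightarrow> S \<subseteq> H' \<Longrightarrow> H \<subseteq> H'"
    using M.acc_on_fg_submodule[OF fg_module_chain_conditions(1)[OF assms(1)] assms(2)] by auto
  then show ?thesis
    unfolding N.fg_module_iff submodule_restrict_iff[OF M.right_module_axioms assms(2)]
    by (intro exI[of _ S]) auto
qed

text \<open>A \<open>k\<close>-submodule of a Hom group whose elements are functions with arbitrary
  values off the carrier. For this reason the generation statements below compare maps only at
  points of the carrier.\<close>

definition hom_subspace :: "('a, 'm) module \<Rightarrow> ('a, 'n) module \<Rightarrow> ('m \<Rightarrow> 'n) set \<Rightarrow> bool" where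
  "hom_subspace M N V \<longleftrightarrow> V \<subseteq> module_hom A M N \<and> (\<lambda>x. \<zero>\<^bsub>N\<^esub>) \<in> V \<and>
     (\<forall>f\<in>V. \<forall>g\<in>V. (\<lambda>x. f x \<oplus>\<^bsub>N\<^esub> g x) \<in> V) \<and> (\<forall>r\<in>carrier k. \<forall>f\<in>V. (\<lambda>x. \<phi> r \<odot>\<^bsub>N\<^esub> f x) \<in> V)"

text \<open>Induction on the test points. The values at \<open>s\<close> of maps in \<open>V\<close>
  form a \<open>k\<close>-submodule of \<open>N\<close>, which is finitely generated; the maps
  vanishing at \<open>s\<close> fall under the induction hypothesis. Generation by \<open>F\<close>
  is phrased through all subspaces \<open>C\<close> that contain \<open>F\<close>.\<close>

lemma hom_subspace_finite:
  assumes M: "right_module A M" and N: "fg_module A N"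
    and "finite S" "S \<subseteq> carrier M" "hom_subspace M N V"
  shows "\<exists>F. finite F \<and> F \<subseteq> V \<and> (\<forall>C. hom_subspace M N C \<and> F \<subseteq> C \<longrightarrow>
    (\<forall>f\<in>V. \<exists>h\<in>C. \<forall>x\<in>S. h x = f x))"
  using assms(3-5)
proof (induction S arbitrary: V)
  case empty
  show ?case by (rule exI[of _ "{}"]) (auto simp: hom_subspace_def)
next
  case (insert s S)
  interpret N: right_module A N using N by (rule fg_module_right_module)
  interpret K: right_module k "scalar_module \<phi> N" by (rule right_module_scalar[OF N.right_module_axioms])
  note \<phi> = ring_hom_axioms_simps[OF structure_map]
  have s: "s \<in> carrier M" using insert.prems by simp
  have ev: "submodule ((\<lambda>f. f s) ` C) k (scalar_module \<phi> N)" if "hom_subspace M N C" for C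
    using that s unfolding hom_subspace_def
    by (intro K.rm_submoduleI) (auto intro: rev_image_eqI dest: module_hom_closed)
  obtain S0 where S0: "finite S0" "S0 \<subseteq> (\<lambda>f. f s) ` V"
    "\<And>H'. submodule H' k (scalar_module \<phi> N) \<Longrightarrow> S0 \<subseteq> H' \<Longrightarrow> (\<lambda>f. f s) ` V \<subseteq> H'"
    using K.acc_on_fg_submodule[OF _ ev[OF insert.prems(2)]] scalar_module_chain_conditions(1)[OF N] by auto
  obtain F1 where F1: "finite F1" "F1 \<subseteq> V" "S0 = (\<lambda>f. f s) ` F1"
    using finite_subset_image[OF S0(1,2)] by blast
  let ?V0 = "{f \<in> V. f s = \<zero>\<^bsub>N\<^esub>}"
  have V0: "hom_subspace M N ?V0"
    using insert.prems(2) unfolding hom_subspace_def by (auto simp: \<phi> N.smult_zero_right)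
  have "S \<subseteq> carrier M" using insert.prems by simp
  from insert.IH[OF this V0] obtain F2 where F2: "finite F2" "F2 \<subseteq> ?V0"
    "\<forall>C. hom_subspace M N C \<and> F2 \<subseteq> C \<longrightarrow> (\<forall>f\<in>?V0. \<exists>h\<in>C. \<forall>x\<in>S. h x = f x)"
    by (elim exE conjE) (rule that)
  have "\<exists>h\<in>C. \<forall>x\<in>insert s S. h x = f x"
    if C: "hom_subspace M N C" "F1 \<union> F2 \<subseteq> C" and f: "f \<in> V" for C f
  proof -
    have CV: "hom_subspace M N (C \<inter> V)"
      using C(1) insert.prems(2) unfolding hom_subspace_def by auto
    have "(\<lambda>f. f s) ` V \<subseteq> (\<lambda>f. f s) ` (C \<inter> V)"
      using C(2) F1 by (intro S0(3) ev CV) auto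
    then obtain g where g: "g \<in> C" "g \<in> V" "g s = f s" using f by fastforce
    \<comment> \<open>The difference of two maps is written with the scalar
      \<open>\<phi> (-1)\<close>, so that the closure conditions of \<open>hom_subspace\<close>
      apply literally.\<close>
    have minus: "(\<lambda>x. u x \<oplus>\<^bsub>N\<^esub> \<phi> (\<ominus>\<^bsub>k\<^esub> \<one>\<^bsub>k\<^esub>) \<odot>\<^bsub>N\<^esub> v x) \<in> V" if "u \<in> V" "v \<in> V" for u v
      using insert.prems(2) that unfolding hom_subspace_def by auto
    have neg: "\<phi> (\<ominus>\<^bsub>k\<^esub> \<one>\<^bsub>k\<^esub>) \<odot>\<^bsub>N\<^esub> x = \<ominus>\<^bsub>N\<^esub> x" if "x \<in> carrier N" for x
      using K.smult_minus_one[of x] that by (simp add: a_inv_def scalar_module_def m_inv_def)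
    have car: "f x \<in> carrier N" "g x \<in> carrier N" if "x \<in> carrier M" for x
      using f g that insert.prems(2) unfolding hom_subspace_def by (auto dest: module_hom_closed)
    let ?d = "\<lambda>x. f x \<oplus>\<^bsub>N\<^esub> \<phi> (\<ominus>\<^bsub>k\<^esub> \<one>\<^bsub>k\<^esub>) \<odot>\<^bsub>N\<^esub> g x"
    have d: "?d \<in> ?V0" using minus[OF f g(2)] car[OF s] g(3) by (simp add: neg N.M.r_neg)
    have "hom_subspace M N (C \<inter> ?V0)"
      using C(1) V0 unfolding hom_subspace_def by auto
    moreover have "F2 \<subseteq> C \<inter> ?V0" using F2(2) C(2) by auto
    ultimately have "\<exists>h\<in>C \<inter> ?V0. \<forall>x\<in>S. h x = ?d x" 
      by (intro F2(3)[rule_format, OF _ d] conjI)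
    then obtain h where h: "h \<in> C" "h \<in> ?V0" "\<forall>x\<in>S. h x = ?d x" by blast
    have "(\<lambda>x. h x \<oplus>\<^bsub>N\<^esub> g x) \<in> C" using C(1) h(1) g(1) unfolding hom_subspace_def by auto
    moreover have "h x \<oplus>\<^bsub>N\<^esub> g x = f x" if "x \<in> insert s S" for x
    proof (cases "x = s")
      case True
      then show ?thesis using h(2) g(3) car[OF s] by simp
    next
      case False
      then have x: "x \<in> S" "x \<in> carrier M" using that insert.prems by auto
      then show ?thesis using h(3) car[OF x(2)] N.M.minus_add_cancel[of "f x" "g x"]
        by (simp add: neg a_minus_def)
    qed
    ultimately show ?thesis by (intro bexI[of _ "\<lambda>x. h x \<oplus>\<^bsub>N\<^esub> g x"]) auto
  qed
  then show ?case using F1 F2 by (intro exI[of _ "F1 \<union> F2"]) blast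
qed

lemma hom_subspace_all:
  assumes M: "right_module A M" and N: "right_module A N"
  shows "hom_subspace M N (module_hom A M N)"
proof -
  interpret M: right_module A M by fact
  interpret N: right_module A N by fact
  note \<phi> = ring_hom_axioms_simps[OF structure_map]
  have smul: "(\<lambda>x. \<phi> r \<odot>\<^bsub>N\<^esub> f x) \<in> module_hom A M N" if r: "r \<in> carrier k" and f: "f \<in> module_hom A M N" for r f
  proof (rule module_homI)
    fix a x assume ax: "a \<in> carrier A" "x \<in> carrier M"
    have fx: "f x \<in> carrier N" "\<phi> r \<in> carrier A" using ax f r by (auto dest: module_hom_closed simp: \<phi>)
    have "\<phi> r \<odot>\<^bsub>N\<^esub> f (a \<odot>\<^bsub>M\<^esub> x) = (a \<otimes> \<phi> r) \<odot>\<^bsub>N\<^esub> f x"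
      using ax fx by (simp add: module_hom_smult[OF f] N.smult_assoc)
    also have "\<dots> = a \<odot>\<^bsub>N\<^esub> (\<phi> r \<odot>\<^bsub>N\<^esub> f x)"
      using ax fx r by (simp add: central[symmetric] N.smult_assoc)
    finally show "\<phi> r \<odot>\<^bsub>N\<^esub> f (a \<odot>\<^bsub>M\<^esub> x) = a \<odot>\<^bsub>N\<^esub> (\<phi> r \<odot>\<^bsub>N\<^esub> f x)" .
  qed (use r in \<open>auto simp: \<phi> module_hom_add[OF f] module_hom_closed[OF f] N.smult_closed N.smult_r_distr\<close>)
  then show ?thesis
    unfolding hom_subspace_def
    using module_hom_plus[OF M.right_module_axioms N.right_module_axioms] module_hom_0[OF N.right_module_axioms]
    by auto
qed

text \<open>Maps that agree on generators of \<open>M\<close> agree on \<open>M\<close>, so testing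
  at finitely many points is enough. Finite generation of Hom over \<open>k\<close> is what makes
  right approximations by add T exist.\<close>

lemma hom_finitely_generated:
  assumes M: "fg_module A M" and N: "fg_module A N"
  shows "\<exists>F. finite F \<and> F \<subseteq> module_hom A M N \<and>
    (\<forall>C. hom_subspace M N C \<and> F \<subseteq> C \<longrightarrow>
      (\<forall>f\<in>module_hom A M N. \<exists>h\<in>C. \<forall>x\<in>carrier M. h x = f x))"
proof -
  interpret M: right_module A M using M by (rule fg_module_right_module)
  interpret N: right_module A N using N by (rule fg_module_right_module)
  note \<phi> = ring_hom_axioms_simps[OF structure_map]
  obtain S where S: "finite S" "S \<subseteq> carrier M"
    and gen: "\<And>H. submodule H A M \<Longrightarrow> S \<subseteq> H \<Longrightarrow> H = carrier M"
    using M by (auto simp: M.fg_module_iff)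
  have full: "hom_subspace M N (module_hom A M N)"
    by (rule hom_subspace_all[OF M.right_module_axioms N.right_module_axioms])
  from hom_subspace_finite[OF M.right_module_axioms N S full] obtain F where
    F: "finite F" "F \<subseteq> module_hom A M N"
    "\<And>C f. hom_subspace M N C \<Longrightarrow> F \<subseteq> C \<Longrightarrow> f \<in> module_hom A M N \<Longrightarrow> \<exists>h\<in>C. \<forall>x\<in>S. h x = f x" by auto
  have "\<exists>h\<in>C. \<forall>x\<in>carrier M. h x = f x"
    if C: "hom_subspace M N C" "F \<subseteq> C" and f: "f \<in> module_hom A M N" for C f
  proof -
    obtain h where h: "h \<in> C" "\<forall>x\<in>S. h x = f x" using F(3)[OF C f] by blast
    then have hh: "h \<in> module_hom A M N" using C(1) by (auto simp: hom_subspace_def)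
    have "submodule {x \<in> carrier M. h x = f x} A M"
      by (rule M.rm_submoduleI)
       (auto simp: module_hom_add[OF hh] module_hom_add[OF f] module_hom_smult[OF hh] module_hom_smult[OF f] M.smult_closed
         module_hom_zero[OF M.right_module_axioms N.right_module_axioms hh]
         module_hom_zero[OF M.right_module_axioms N.right_module_axioms f])
    then have "{x \<in> carrier M. h x = f x} = carrier M" using h(2) S(2) by (intro gen) auto
    with h(1) show ?thesis by blast
  qed
  with F(1,2) show ?thesis by (intro exI[of _ F]) blast
qed

end

section \<open>Maps factoring through a module\<close>

text \<open>The ideal of maps that factor through add Q, as finite sums of composites
  \<open>M -> Q -> N\<close>. For \<open>M = N\<close> and the identity it expresses that
  \<open>M\<close> lies in add Q, see \<open>in_add_iff\<close>; this permits induction over the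
  summands where direct sums of copies of \<open>Q\<close> would otherwise be handled.\<close>

inductive factors_add :: "'a ring \<Rightarrow> ('a, 'q) module \<Rightarrow> ('a, 'm) module \<Rightarrow> ('a, 'n) module \<Rightarrow> ('m \<Rightarrow> 'n) \<Rightarrow> bool"
  for A Q M N where
  zero: "(\<And>x. x \<in> carrier M \<Longrightarrow> h x = \<zero>\<^bsub>N\<^esub>) \<Longrightarrow> factors_add A Q M N h"
| step: "factors_add A Q M N h \<Longrightarrow> a \<in> module_hom A M Q \<Longrightarrow> b \<in> module_hom A Q N \<Longrightarrow>
    (\<And>x. x \<in> carrier M \<Longrightarrow> h' x = b (a x) \<oplus>\<^bsub>N\<^esub> h x) \<Longrightarrow> factors_add A Q M N h'"

lemma factors_add_cong:
  assumes "factors_add A Q M N h" "\<And>x. x \<in> carrier M \<Longrightarrow> h' x = h x"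
  shows "factors_add A Q M N h'"
  using assms
proof (induction)
  case (zero h)
  then show ?case by (auto intro: factors_add.zero)
next
  case (step h a b h'')
  then show ?case by (auto intro: factors_add.step)
qed

lemma factors_add_hom:
  assumes "right_module A M" "right_module A N" "factors_add A Q M N h"
  shows "h \<in> module_hom A M N"
  using assms(3)
proof (induction)
  case (zero h)
  show ?case
    by (rule module_hom_cong[OF assms(1) module_hom_0[OF assms(2)]]) (use zero in auto)
next
  case (step h a b h')
  show ?case
    by (rule module_hom_cong[OF assms(1) module_hom_plus[OF assms(1,2) module_hom_comp[OF step.hyps(2,3)] step.IH]])
      (use step in auto)
qed

lemma factors_add_basic:
  assumes "right_module A N" "a \<in> module_hom A M Q" "b \<in> module_hom A Q N"
  shows "factors_add A Q M N (\<lambda>x. b (a x))"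
proof -
  interpret N: right_module A N by fact
  show ?thesis
    by (rule factors_add.step[OF factors_add.zero[of M "\<lambda>x. \<zero>\<^bsub>N\<^esub>"] assms(2,3)])
      (use assms(2,3) in \<open>auto dest!: module_hom_closed\<close>)
qed

lemma factors_add_plus:
  assumes "right_module A M" "right_module A N" "factors_add A Q M N h" "factors_add A Q M N g"
  shows "factors_add A Q M N (\<lambda>x. h x \<oplus>\<^bsub>N\<^esub> g x)"
  using assms(3)
proof (induction)
  case (zero h)
  interpret N: right_module A N by fact
  show ?case
    by (rule factors_add_cong[OF assms(4)])
      (use zero module_hom_closed[OF factors_add_hom[OF assms(1,2,4)]] in auto)
next
  case (step h a b h')
  interpret N: right_module A N by fact
  note c = module_hom_closed[OF factors_add_hom[OF assms(1,2,4)]]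
    module_hom_closed[OF factors_add_hom[OF assms(1,2) step.hyps(1)]]
    module_hom_closed[OF step.hyps(2)] module_hom_closed[OF step.hyps(3)]
  show ?case
    by (rule factors_add.step[OF step.IH step.hyps(2,3)]) (use step.hyps(4) in \<open>auto simp: c N.M.a_ac\<close>)
qed

lemma factors_add_comp_left:
  assumes "right_module A M" "right_module A N" "right_module A L" "factors_add A Q M N h"
    "g \<in> module_hom A N L"
  shows "factors_add A Q M L (\<lambda>x. g (h x))"
  using assms(4)
proof (induction)
  case (zero h)
  then show ?case using module_hom_zero[OF assms(2,3,5)] by (auto intro: factors_add.zero)
next
  case (step h a b h')
  note c = module_hom_closed[OF factors_add_hom[OF assms(1,2) step.hyps(1)]]
    module_hom_closed[OF step.hyps(2)] module_hom_closed[OF step.hyps(3)]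
  show ?case
    by (rule factors_add.step[OF step.IH step.hyps(2) module_hom_comp[OF step.hyps(3) assms(5)]])
      (use step.hyps(4) in \<open>auto simp: c module_hom_add[OF assms(5)]\<close>)
qed

lemma factors_add_comp_right:
  assumes "factors_add A Q M N h" "g \<in> module_hom A L M"
  shows "factors_add A Q L N (\<lambda>x. h (g x))"
  using assms(1)
proof (induction)
  case (zero h)
  then show ?case using module_hom_closed[OF assms(2)] by (auto intro: factors_add.zero)
next
  case (step h a b h')
  show ?case
    by (rule factors_add.step[OF step.IH module_hom_comp[OF assms(2) step.hyps(2)] step.hyps(3)])
      (use step.hyps(4) module_hom_closed[OF assms(2)] in auto)
qed

lemma factors_add_trans:
  assumes "right_module A M" "right_module A N" "right_module A Q"
    "factors_add A Q M N h" "factors_add A Q' Q Q (\<lambda>x. x)"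
  shows "factors_add A Q' M N h"
  using assms(4)
proof (induction)
  case (zero h)
  then show ?case by (rule factors_add.zero)
next
  case (step h a b h')
  have "factors_add A Q' M N (\<lambda>x. b (a x))"
    using factors_add_comp_left[OF assms(1,3,2) factors_add_comp_right[OF assms(5) step.hyps(2)] step.hyps(3)] .
  from factors_add_plus[OF assms(1,2) this step.IH] show ?case
    by (rule factors_add_cong) (use step.hyps(4) in auto)
qed

lemma factors_add_finsum:
  assumes "right_module A M" "right_module A N" "finite J" "\<And>j. j \<in> J \<Longrightarrow> factors_add A Q M N (f j)"
  shows "factors_add A Q M N (\<lambda>x. finsum N (\<lambda>j. f j x) J)"
  using assms(3,4)
proof (induction J)
  case empty
  interpret N: right_module A N by fact
  show ?case by (rule factors_add.zero) simp
next
  case (insert j J)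
  interpret N: right_module A N by fact
  have "factors_add A Q M N (\<lambda>x. f j x \<oplus>\<^bsub>N\<^esub> finsum N (\<lambda>j. f j x) J)"
    using insert by (intro factors_add_plus[OF assms(1,2)]) auto
  then show ?case
  proof (rule factors_add_cong)
    fix x assume x: "x \<in> carrier M"
    have "f i x \<in> carrier N" if "i \<in> insert j J" for i
      using module_hom_closed[OF factors_add_hom[OF assms(1,2) insert.prems[OF that]] x] .
    then show "finsum N (\<lambda>j. f j x) (insert j J) = f j x \<oplus>\<^bsub>N\<^esub> finsum N (\<lambda>j. f j x) J"
      using insert.hyps by (subst N.M.finsum_insert) auto
  qed
qed

section \<open>Indecomposable modules and the Krull-Schmidt theorem\<close>

lemma module_hom_finsum:
  assumes "right_module A M" "right_module A N" "f \<in> module_hom A M N" "finite J" "g \<in> J \<rightarrow> carrier M"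
  shows "f (finsum M g J) = finsum N (\<lambda>j. f (g j)) J"
  using assms(4,5)
proof (induction J)
  case empty
  interpret M: right_module A M by fact
  interpret N: right_module A N by fact
  show ?case using module_hom_zero[OF assms(1-3)] by simp
next
  case (insert j J)
  interpret M: right_module A M by fact
  interpret N: right_module A N by fact
  have "g \<in> J \<rightarrow> carrier M" "g j \<in> carrier M" "(\<lambda>j. f (g j)) \<in> J \<rightarrow> carrier N" "f (g j) \<in> carrier N"
    "finsum M g J \<in> carrier M"
    using insert.prems module_hom_closed[OF assms(3)] by auto
  with insert show ?case by (simp add: module_hom_add[OF assms(3)])
qed

lemma module_hom_inv_into:
  assumes "right_module A M" "f \<in> module_hom A M N" "bij_betw f (carrier M) (carrier N)"
  shows "inv_into (carrier M) f \<in> module_hom A N M"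
proof -
  interpret M: right_module A M by fact
  note inj = bij_betw_imp_inj_on[OF assms(3)] and im = bij_betw_imp_surj_on[OF assms(3)]
  show ?thesis
  proof (rule module_homI)
    fix x y assume "x \<in> carrier N" "y \<in> carrier N"
    then obtain u v where "u \<in> carrier M" "x = f u" "v \<in> carrier M" "y = f v" using im by blast
    then show "inv_into (carrier M) f (x \<oplus>\<^bsub>N\<^esub> y) = inv_into (carrier M) f x \<oplus>\<^bsub>M\<^esub> inv_into (carrier M) f y"
      using inj by (simp add: module_hom_add[OF assms(2), symmetric])
  next
    fix a x assume "a \<in> carrier A" "x \<in> carrier N"
    then obtain u where "a \<in> carrier A" "u \<in> carrier M" "x = f u" using im by blast
    then show "inv_into (carrier M) f (a \<odot>\<^bsub>N\<^esub> x) = a \<odot>\<^bsub>M\<^esub> inv_into (carrier M) f x"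
      using inj by (simp add: M.smult_closed module_hom_smult[OF assms(2), symmetric])
  qed (simp add: im inv_into_into)
qed

lemma module_iso_sym:
  assumes "right_module A M" "module_iso A M N"
  shows "module_iso A N M"
proof -
  obtain f where f: "f \<in> module_hom A M N" "bij_betw f (carrier M) (carrier N)"
    using assms(2) by (auto simp: module_iso_def)
  show ?thesis unfolding module_iso_def
    using module_hom_inv_into[OF assms(1) f] bij_betw_inv_into[OF f(2)] by blast
qed

lemma module_iso_trans: "module_iso A L M \<Longrightarrow> module_iso A M N \<Longrightarrow> module_iso A L N"
proof -
  assume "module_iso A L M" "module_iso A M N"
  then obtain f g where f: "f \<in> module_hom A L M" "bij_betw f (carrier L) (carrier M)"
    and g: "g \<in> module_hom A M N" "bij_betw g (carrier M) (carrier N)" by (auto simp: module_iso_def)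
  show ?thesis unfolding module_iso_def
    using module_hom_comp[OF f(1) g(1)] bij_betw_trans[OF f(2) g(2)] by (auto simp: comp_def)
qed

lemma bij_betw_complement:
  assumes "right_module A M" "submodule Y A M" "submodule Z A M" "Y \<inter> Z \<subseteq> {\<zero>\<^bsub>M\<^esub>}"
    and "\<And>x. x \<in> carrier M \<Longrightarrow> \<exists>y\<in>Y. \<exists>z\<in>Z. x = y \<oplus>\<^bsub>M\<^esub> z"
  shows "bij_betw (\<lambda>(y, z). y \<oplus>\<^bsub>M\<^esub> z) (Y \<times> Z) (carrier M)"
proof (rule bij_betw_imageI)
  interpret M: right_module A M by fact
  note Y = M.rm_submoduleD[OF assms(2)] and Z = M.rm_submoduleD[OF assms(3)]
  show "(\<lambda>(y, z). y \<oplus>\<^bsub>M\<^esub> z) ` (Y \<times> Z) = carrier M"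
    using Y(1) Z(1) assms(5) by (auto simp: image_iff)
  show "inj_on (\<lambda>(y, z). y \<oplus>\<^bsub>M\<^esub> z) (Y \<times> Z)"
  proof (rule inj_onI, clarsimp)
    fix y z y' z' assume *: "y \<in> Y" "z \<in> Z" "y' \<in> Y" "z' \<in> Z" and eq: "y \<oplus>\<^bsub>M\<^esub> z = y' \<oplus>\<^bsub>M\<^esub> z'"
    have car: "y \<in> carrier M" "z \<in> carrier M" "y' \<in> carrier M" "z' \<in> carrier M"
      using * Y(1) Z(1) by auto
    have "y \<ominus>\<^bsub>M\<^esub> y' = (y \<oplus>\<^bsub>M\<^esub> z) \<ominus>\<^bsub>M\<^esub> (z \<oplus>\<^bsub>M\<^esub> y')"
      using car M.M.minus_cancel_right[of y y' "\<ominus>\<^bsub>M\<^esub> z"] by (simp add: a_minus_def M.M.a_comm)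
    also have "\<dots> = z' \<ominus>\<^bsub>M\<^esub> z"
      unfolding eq using car M.M.minus_cancel_right[of z' z "\<ominus>\<^bsub>M\<^esub> y'"] by (simp add: a_minus_def M.M.a_comm)
    finally have "y \<ominus>\<^bsub>M\<^esub> y' = z' \<ominus>\<^bsub>M\<^esub> z" .
    moreover have "y \<ominus>\<^bsub>M\<^esub> y' \<in> Y" "z' \<ominus>\<^bsub>M\<^esub> z \<in> Z" using Y(6) Z(6) * by auto
    ultimately have "y \<ominus>\<^bsub>M\<^esub> y' = \<zero>\<^bsub>M\<^esub>" "z' \<ominus>\<^bsub>M\<^esub> z = \<zero>\<^bsub>M\<^esub>" using assms(4) by auto
    then show "y = y' \<and> z = z'" using car M.M.minus_zero_iff by simp
  qed
qed

text \<open>If \<open>b\<close> after \<open>a\<close> is bijective, \<open>Y\<close> is the direct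
  sum of the image of \<open>a\<close> and the kernel of \<open>b\<close>. The image is nonzero, so
  indecomposability kills the kernel.\<close>

lemma indecomposable_retract:
  assumes "right_module A X" "right_module A Y" "indecomposable_module A Y" "\<not> zero_module X"
    and a: "a \<in> module_hom A X Y" and b: "b \<in> module_hom A Y X"
    and bij: "bij_betw (\<lambda>x. b (a x)) (carrier X) (carrier X)"
  shows "bij_betw a (carrier X) (carrier Y)"
proof -
  interpret X: right_module A X by fact
  interpret Y: right_module A Y by fact
  have inj_a: "inj_on a (carrier X)"
    using bij_betw_imp_inj_on[OF bij] by (auto simp: inj_on_def)
  let ?Y = "a ` carrier X" and ?Z = "{y \<in> carrier Y. b y = \<zero>\<^bsub>X\<^esub>}"
  have sub: "submodule ?Y A Y" "submodule ?Z A Y"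
    by (rule submodule_image[OF assms(1,2) a X.submodule_carrier], rule submodule_ker[OF assms(2,1) b])
  have "?Y \<inter> ?Z \<subseteq> {\<zero>\<^bsub>Y\<^esub>}"
  proof clarsimp
    fix x assume x: "x \<in> carrier X" "b (a x) = \<zero>\<^bsub>X\<^esub>"
    moreover have "b (a \<zero>\<^bsub>X\<^esub>) = \<zero>\<^bsub>X\<^esub>"
      using module_hom_zero[OF assms(1,2) a] module_hom_zero[OF assms(2,1) b] by simp
    ultimately have "x = \<zero>\<^bsub>X\<^esub>" using bij_betw_imp_inj_on[OF bij] by (auto simp: inj_on_def)
    then show "a x = \<zero>\<^bsub>Y\<^esub>" using module_hom_zero[OF assms(1,2) a] by simp
  qed
  moreover have "\<exists>y\<in>?Y. \<exists>z\<in>?Z. x = y \<oplus>\<^bsub>Y\<^esub> z" if x: "x \<in> carrier Y" for x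
  proof -
    have "b x \<in> (\<lambda>x. b (a x)) ` carrier X"
      using module_hom_closed[OF b x] bij_betw_imp_surj_on[OF bij] by simp
    then obtain u where u: "u \<in> carrier X" "b x = b (a u)" by blast
    have au: "a u \<in> carrier Y" using module_hom_closed[OF a u(1)] .
    have "b (x \<ominus>\<^bsub>Y\<^esub> a u) = \<zero>\<^bsub>X\<^esub>"
      using x au u(2) module_hom_closed[OF b] by (simp add: module_hom_minus[OF assms(2,1) b] X.M.minus_self)
    then have "x \<ominus>\<^bsub>Y\<^esub> a u \<in> ?Z" using x au by simp
    moreover have "x = a u \<oplus>\<^bsub>Y\<^esub> (x \<ominus>\<^bsub>Y\<^esub> a u)"
      using x au by (simp add: Y.M.a_comm[of "a u"] Y.M.minus_add_cancel)
    ultimately show ?thesis using u(1) by blast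
  qed
  ultimately have "bij_betw (\<lambda>(y, z). y \<oplus>\<^bsub>Y\<^esub> z) (?Y \<times> ?Z) (carrier Y)"
    by (rule bij_betw_complement[OF assms(2) sub])
  then have "?Y = {\<zero>\<^bsub>Y\<^esub>} \<or> ?Z = {\<zero>\<^bsub>Y\<^esub>}"
    using assms(3) sub unfolding indecomposable_module_def by blast
  moreover have "?Y \<noteq> {\<zero>\<^bsub>Y\<^esub>}"
  proof
    assume *: "?Y = {\<zero>\<^bsub>Y\<^esub>}"
    have "x = \<zero>\<^bsub>X\<^esub>" if x: "x \<in> carrier X" for x
    proof (rule inj_onD[OF inj_a _ x X.M.zero_closed])
      have "a x \<in> ?Y" "a \<zero>\<^bsub>X\<^esub> \<in> ?Y" using x by auto
      then show "a x = a \<zero>\<^bsub>X\<^esub>" unfolding * by simp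
    qed
    then show False using assms(4) by (auto simp: zero_module_def)
  qed
  ultimately have Z: "?Z = {\<zero>\<^bsub>Y\<^esub>}" by simp
  have "a ` carrier X = carrier Y"
  proof
    show "carrier Y \<subseteq> a ` carrier X"
    proof
      fix x assume x: "x \<in> carrier Y"
      obtain y z where yz: "y \<in> ?Y" "z \<in> ?Z" "x = y \<oplus>\<^bsub>Y\<^esub> z"
        using \<open>\<And>x. x \<in> carrier Y \<Longrightarrow> \<exists>y\<in>?Y. \<exists>z\<in>?Z. x = y \<oplus>\<^bsub>Y\<^esub> z\<close>[OF x] by blast
      then have "z = \<zero>\<^bsub>Y\<^esub>" using Z by blast
      then show "x \<in> a ` carrier X" using yz module_hom_closed[OF a] by auto
    qed
  qed (use module_hom_closed[OF a] in auto)
  with inj_a show ?thesis by (simp add: bij_betw_def)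
qed

lemma direct_sum_projections:
  assumes "right_module A M" "direct_sum_of A M n S"
  shows "\<exists>p. (\<forall>i<n. p i \<in> module_hom A M (restrict_module M (S i))) \<and>
    (\<forall>x\<in>carrier M. x = finsum M (\<lambda>i. p i x) {..<n}) \<and>
    (\<forall>i<n. \<forall>j<n. \<forall>x\<in>S i. p j x = (if i = j then x else \<zero>\<^bsub>M\<^esub>))"
proof -
  interpret M: right_module A M by fact
  let ?P = "\<Pi>\<^sub>E i\<in>{..<n}. S i" and ?s = "\<lambda>x. finsum M x {..<n}"
  have S: "submodule (S i) A M" if "i < n" for i using assms(2) that by (simp add: direct_sum_of_def)
  have bij: "bij_betw ?s ?P (carrier M)" using assms(2) by (simp add: direct_sum_of_def)
  note inj = bij_betw_imp_inj_on[OF bij]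
  define c where "c = inv_into ?P ?s"
  have c: "c x \<in> ?P" "?s (c x) = x" if "x \<in> carrier M" for x
    using that bij_betw_imp_surj_on[OF bij] inv_into_into[of x ?s ?P] f_inv_into_f[of x ?s ?P]
    unfolding c_def by simp_all
  have uniq: "c x = y" if "y \<in> ?P" "?s y = x" for x y
    unfolding c_def that(2)[symmetric] by (rule inv_into_f_f[OF inj that(1)])
  note SD = M.rm_submoduleD[OF S]
  have ci: "c x i \<in> S i" "c x i \<in> carrier M" if "x \<in> carrier M" "i < n" for x i
    using c(1)[OF that(1)] that(2) SD(1)[OF that(2)] by (auto simp: PiE_iff)
  have "(\<lambda>x. c x i) \<in> module_hom A M (restrict_module M (S i))" if i: "i < n" for i
  proof (rule module_homI)
    fix x y assume xy: "x \<in> carrier M" "y \<in> carrier M"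
    have "c (x \<oplus>\<^bsub>M\<^esub> y) = (\<lambda>i\<in>{..<n}. c x i \<oplus>\<^bsub>M\<^esub> c y i)"
    proof (rule uniq)
      show "(\<lambda>i\<in>{..<n}. c x i \<oplus>\<^bsub>M\<^esub> c y i) \<in> ?P" using ci xy SD(3) by auto
      have "?s (\<lambda>i\<in>{..<n}. c x i \<oplus>\<^bsub>M\<^esub> c y i) = finsum M (\<lambda>i. c x i \<oplus>\<^bsub>M\<^esub> c y i) {..<n}"
        using ci(2) xy by (intro M.M.finsum_cong') auto
      also have "\<dots> = ?s (c x) \<oplus>\<^bsub>M\<^esub> ?s (c y)" using ci(2) xy by (intro M.M.finsum_addf) auto
      finally show "?s (\<lambda>i\<in>{..<n}. c x i \<oplus>\<^bsub>M\<^esub> c y i) = x \<oplus>\<^bsub>M\<^esub> y" using c(2) xy by simp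
    qed
    then show "c (x \<oplus>\<^bsub>M\<^esub> y) i = c x i \<oplus>\<^bsub>restrict_module M (S i)\<^esub> c y i" using i by simp
  next
    fix a x assume ax: "a \<in> carrier A" "x \<in> carrier M"
    have "c (a \<odot>\<^bsub>M\<^esub> x) = (\<lambda>i\<in>{..<n}. a \<odot>\<^bsub>M\<^esub> c x i)"
    proof (rule uniq)
      show "(\<lambda>i\<in>{..<n}. a \<odot>\<^bsub>M\<^esub> c x i) \<in> ?P" using ci ax SD(4) by auto
      have "?s (\<lambda>i\<in>{..<n}. a \<odot>\<^bsub>M\<^esub> c x i) = finsum M (\<lambda>i. a \<odot>\<^bsub>M\<^esub> c x i) {..<n}"
        using ci(2) ax by (intro M.M.finsum_cong') (auto intro: M.smult_closed)
      also have "\<dots> = a \<odot>\<^bsub>M\<^esub> ?s (c x)" using ci(2) ax by (intro M.smult_finsum[symmetric]) auto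
      finally show "?s (\<lambda>i\<in>{..<n}. a \<odot>\<^bsub>M\<^esub> c x i) = a \<odot>\<^bsub>M\<^esub> x" using c(2) ax by simp
    qed
    then show "c (a \<odot>\<^bsub>M\<^esub> x) i = a \<odot>\<^bsub>restrict_module M (S i)\<^esub> c x i" using i by simp
  qed (use ci(1) i in auto)
  moreover have "x = finsum M (\<lambda>i. c x i) {..<n}" if "x \<in> carrier M" for x
    using c(2)[OF that] by simp
  moreover have "c x j = (if i = j then x else \<zero>\<^bsub>M\<^esub>)" if ij: "i < n" "j < n" and x: "x \<in> S i" for i j x
  proof -
    have xc: "x \<in> carrier M" using SD(1) ij(1) x by auto
    have "c x = (\<lambda>j\<in>{..<n}. if i = j then x else \<zero>\<^bsub>M\<^esub>)"
    proof (rule uniq)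
      show "(\<lambda>j\<in>{..<n}. if i = j then x else \<zero>\<^bsub>M\<^esub>) \<in> ?P" using x SD(2) by auto
      have "?s (\<lambda>j\<in>{..<n}. if i = j then x else \<zero>\<^bsub>M\<^esub>) = finsum M (\<lambda>j. if i = j then x else \<zero>\<^bsub>M\<^esub>) {..<n}"
        using xc by (intro M.M.finsum_cong') auto
      also have "\<dots> = x" using ij(1) xc M.M.finsum_singleton[of i "{..<n}" "\<lambda>_. x"] by simp
      finally show "?s (\<lambda>j\<in>{..<n}. if i = j then x else \<zero>\<^bsub>M\<^esub>) = x" .
    qed
    then show ?thesis using ij(2) by simp
  qed
  ultimately show ?thesis by (intro exI[of _ "\<lambda>i x. c x i"]) auto
qed

lemma funpow_module_hom:
  assumes "f \<in> module_hom A M M"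
  shows "(f ^^ n) \<in> module_hom A M M"
proof (induction n)
  case 0
  show ?case by (simp add: module_hom_def)
next
  case (Suc n)
  show ?case using module_hom_comp[OF Suc assms] by (simp add: comp_def)
qed

context artin_algebra
begin

text \<open>Fitting's lemma: for large \<open>m\<close> the module is the direct sum of the kernel and the image of \<open>f ^^ m\<close>.\<close>

lemma fitting:
  assumes M: "fg_module A M" "indecomposable_module A M" and f: "f \<in> module_hom A M M"
  shows "bij_betw f (carrier M) (carrier M) \<or> (\<exists>n. \<forall>x\<in>carrier M. (f ^^ n) x = \<zero>\<^bsub>M\<^esub>)"
proof -
  interpret M: right_module A M using M(1) by (rule fg_module_right_module)
  note rm = M.right_module_axioms
  note fn = funpow_module_hom[OF f]
  let ?K = "\<lambda>n. {x \<in> carrier M. (f ^^ n) x = \<zero>\<^bsub>M\<^esub>}" and ?J = "\<lambda>n. (f ^^ n) ` carrier M"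
  have subK: "submodule (?K n) A M" and subJ: "submodule (?J n) A M" for n
    using submodule_ker[OF rm rm fn] submodule_image[OF rm rm fn M.submodule_carrier] by auto
  have K_mono: "?K i \<subseteq> ?K (Suc i)" for i using module_hom_zero[OF rm rm f] by auto
  have J_mono: "?J (Suc i) \<subseteq> ?J i" for i
    using module_hom_closed[OF f] by (auto simp: funpow_swap1)
  obtain m1 where m1: "\<And>i. i \<ge> m1 \<Longrightarrow> ?K i = ?K m1"
    by (rule acc_onD[where X = ?K, OF fg_module_chain_conditions(1)[OF M(1)] subK _ K_mono]) auto
  obtain m2 where m2: "\<And>i. i \<ge> m2 \<Longrightarrow> ?J i = ?J m2"
    using dcc_onD[where X = ?J, OF fg_module_chain_conditions(2)[OF M(1)] subJ _ J_mono] module_hom_closed[OF fn] by blast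
  \<comment> \<open>The successor makes \<open>m\<close> positive: then the kernel of
    \<open>f\<close> lies in that of \<open>f ^^ m\<close>, and the image of \<open>f ^^ m\<close>
    in that of \<open>f\<close>.\<close>
  define m where "m = Suc (max m1 m2)"
  have Km: "?K (m + m) = ?K m" using m1[of m] m1[of "m + m"] by (simp add: m_def)
  have Jm: "?J (m + m) = ?J m" using m2[of m] m2[of "m + m"] by (simp add: m_def)
  have "?K m \<inter> ?J m \<subseteq> {\<zero>\<^bsub>M\<^esub>}"
  proof
    fix x assume x: "x \<in> ?K m \<inter> ?J m"
    then obtain y where y: "y \<in> carrier M" "x = (f ^^ m) y" by auto
    then have "y \<in> ?K (m + m)" using x by (simp add: funpow_add)
    then show "x \<in> {\<zero>\<^bsub>M\<^esub>}" using y Km by simp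
  qed
  moreover have "\<exists>y\<in>?K m. \<exists>z\<in>?J m. x = y \<oplus>\<^bsub>M\<^esub> z" if x: "x \<in> carrier M" for x
  proof -
    have "(f ^^ m) x \<in> ?J (m + m)" using x Jm by blast
    then obtain u where u: "u \<in> carrier M" "(f ^^ m) x = (f ^^ m) ((f ^^ m) u)" by (auto simp: funpow_add)
    have c: "(f ^^ m) u \<in> carrier M" by (rule module_hom_closed[OF fn u(1)])
    have "x \<ominus>\<^bsub>M\<^esub> (f ^^ m) u \<in> ?K m"
      using x c u(2) module_hom_closed[OF fn] by (simp add: module_hom_minus[OF rm rm fn] M.M.minus_self)
    moreover have "x = (x \<ominus>\<^bsub>M\<^esub> (f ^^ m) u) \<oplus>\<^bsub>M\<^esub> (f ^^ m) u" using x c by (simp add: M.M.minus_add_cancel)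
    ultimately show ?thesis using u(1) by blast
  qed
  ultimately have "bij_betw (\<lambda>(y, z). y \<oplus>\<^bsub>M\<^esub> z) (?K m \<times> ?J m) (carrier M)"
    by (rule bij_betw_complement[OF rm subK subJ])
  then have "?K m = {\<zero>\<^bsub>M\<^esub>} \<or> ?J m = {\<zero>\<^bsub>M\<^esub>}"
    using M(2) subK[of m] subJ[of m] unfolding indecomposable_module_def by blast
  then show ?thesis
  proof
    assume K: "?K m = {\<zero>\<^bsub>M\<^esub>}"
    have "inj_on f (carrier M)"
    proof (rule inj_onI)
      fix x y assume xy: "x \<in> carrier M" "y \<in> carrier M" "f x = f y"
      then have "f (x \<ominus>\<^bsub>M\<^esub> y) = \<zero>\<^bsub>M\<^esub>"
        using module_hom_closed[OF f] by (simp add: module_hom_minus[OF rm rm f] M.M.minus_self)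
      then have "x \<ominus>\<^bsub>M\<^esub> y \<in> ?K 1" using xy by simp
      moreover have "?K 1 \<subseteq> ?K m"
        by (rule lift_Suc_mono_le[of ?K]) (use K_mono in \<open>auto simp: m_def\<close>)
      ultimately have "x \<ominus>\<^bsub>M\<^esub> y = \<zero>\<^bsub>M\<^esub>" using K by blast
      then show "x = y" using xy by (simp add: M.M.minus_zero_iff)
    qed
    moreover have "f ` carrier M = carrier M"
    proof
      show "carrier M \<subseteq> f ` carrier M"
      proof
        fix x assume x: "x \<in> carrier M"
        obtain y z where yz: "y \<in> ?K m" "z \<in> ?J m" "x = y \<oplus>\<^bsub>M\<^esub> z"
          using \<open>\<And>x. x \<in> carrier M \<Longrightarrow> \<exists>y\<in>?K m. \<exists>z\<in>?J m. x = y \<oplus>\<^bsub>M\<^esub> z\<close>[OF x] by blast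
        then have "y = \<zero>\<^bsub>M\<^esub>" using K by blast
        moreover have "z \<in> carrier M" using yz(2) module_hom_closed[OF fn] by auto
        ultimately have "x \<in> ?J m" using yz by simp
        then show "x \<in> f ` carrier M" using module_hom_closed[OF fn] by (auto simp: m_def)
      qed
    qed (use module_hom_closed[OF f] in auto)
    ultimately show ?thesis by (simp add: bij_betw_def)
  next
    assume "?J m = {\<zero>\<^bsub>M\<^esub>}"
    then show ?thesis by blast
  qed
qed

text \<open>Locality of the endomorphism ring. After composition with the inverse \<open>?v\<close>
  of the sum, the two maps add up to the identity. By Fitting's lemma each is bijective or
  nilpotent, and two nilpotent ones cannot add up to the identity of a nonzero module.\<close>

lemma indecomposable_sum_bij:
  assumes M: "fg_module A M" "indecomposable_module A M"
    and f: "f \<in> module_hom A M M" and g: "g \<in> module_hom A M M"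
    and bij: "bij_betw (\<lambda>x. f x \<oplus>\<^bsub>M\<^esub> g x) (carrier M) (carrier M)"
  shows "bij_betw f (carrier M) (carrier M) \<or> bij_betw g (carrier M) (carrier M)"
proof -
  interpret M: right_module A M using M(1) by (rule fg_module_right_module)
  note rm = M.right_module_axioms
  let ?u = "\<lambda>x. f x \<oplus>\<^bsub>M\<^esub> g x"
  let ?v = "inv_into (carrier M) ?u"
  have u: "?u \<in> module_hom A M M" by (rule module_hom_plus[OF rm rm f g])
  have v: "?v \<in> module_hom A M M" by (rule module_hom_inv_into[OF rm u bij])
  have vbij: "bij_betw ?v (carrier M) (carrier M)" by (rule bij_betw_inv_into[OF bij])
  have vu: "?v (f x) \<oplus>\<^bsub>M\<^esub> ?v (g x) = x" if "x \<in> carrier M" for x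
    using that module_hom_closed[OF f that] module_hom_closed[OF g that]
      inv_into_f_f[OF bij_betw_imp_inj_on[OF bij] that] by (simp flip: module_hom_add[OF v])
  have cancel: "bij_betw h (carrier M) (carrier M)"
    if h: "h \<in> module_hom A M M" and "bij_betw (\<lambda>x. ?v (h x)) (carrier M) (carrier M)" for h
  proof -
    have "bij_betw (?u \<circ> (\<lambda>x. ?v (h x))) (carrier M) (carrier M)"
      using that(2) bij by (rule bij_betw_trans)
    then show ?thesis
      by (rule bij_betw_cong[THEN iffD1, rotated])
        (use module_hom_closed[OF h] bij_betw_inv_into_right[OF bij] in auto)
  qed
  note f' = module_hom_comp[OF f v] and g' = module_hom_comp[OF g v]
  show ?thesis
  proof (cases "bij_betw (\<lambda>x. ?v (f x)) (carrier M) (carrier M)")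
    case True
    then show ?thesis using cancel[OF f] by simp
  next
    case False
    then obtain n where n: "\<forall>x\<in>carrier M. ((\<lambda>x. ?v (f x)) ^^ n) x = \<zero>\<^bsub>M\<^esub>" using fitting[OF M f'] by blast
    \<comment> \<open>On the kernel of the second map the first one is the identity; being
      nilpotent, it leaves no room for a nonzero element there.\<close>
    have ker: "x = \<zero>\<^bsub>M\<^esub>" if x: "x \<in> carrier M" "?v (g x) = \<zero>\<^bsub>M\<^esub>" for x
    proof -
      have "?v (f x) = x" using vu[OF x(1)] x module_hom_closed[OF f'] by simp
      then have "((\<lambda>x. ?v (f x)) ^^ n) x = x" by (induction n) auto
      then show ?thesis using n x(1) by simp
    qed
    have "\<not> (\<exists>n. \<forall>x\<in>carrier M. ((\<lambda>x. ?v (g x)) ^^ n) x = \<zero>\<^bsub>M\<^esub>)"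
    proof
      assume "\<exists>n. \<forall>x\<in>carrier M. ((\<lambda>x. ?v (g x)) ^^ n) x = \<zero>\<^bsub>M\<^esub>"
      then obtain n' where n': "\<forall>x\<in>carrier M. ((\<lambda>x. ?v (g x)) ^^ n') x = \<zero>\<^bsub>M\<^esub>" by blast
      have "x = \<zero>\<^bsub>M\<^esub>" if "x \<in> carrier M" "((\<lambda>x. ?v (g x)) ^^ i) x = \<zero>\<^bsub>M\<^esub>" for x i
        using that
      proof (induction i arbitrary: x)
        case (Suc i)
        have "((\<lambda>x. ?v (g x)) ^^ i) (?v (g x)) = \<zero>\<^bsub>M\<^esub>"
          using Suc.prems(2) funpow_swap1[of "\<lambda>x. ?v (g x)" i x] by simp
        then have "?v (g x) = \<zero>\<^bsub>M\<^esub>" using Suc.IH[of "?v (g x)"] module_hom_closed[OF g' Suc.prems(1)] by simp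
        then show ?case using ker Suc.prems(1) by simp
      qed simp
      then have "carrier M = {\<zero>\<^bsub>M\<^esub>}" using n' by auto
      then show False using M(2) by (simp add: indecomposable_module_def zero_module_def)
    qed
    then have "bij_betw (\<lambda>x. ?v (g x)) (carrier M) (carrier M)" using fitting[OF M g'] by blast
    then show ?thesis using cancel[OF g] by simp
  qed
qed

text \<open>By locality a bijective finite sum of endomorphisms has a bijective summand; the
  induction peels off one composite at a time.\<close>

lemma indecomposable_factors_add:
  assumes M: "fg_module A M" "indecomposable_module A M"
    and h: "factors_add A Q M M h" "bij_betw h (carrier M) (carrier M)"
  shows "\<exists>a\<in>module_hom A M Q. \<exists>b\<in>module_hom A Q M. bij_betw (\<lambda>x. b (a x)) (carrier M) (carrier M)"
  using h
proof (induction)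
  case (zero h)
  interpret M: right_module A M using M(1) by (rule fg_module_right_module)
  have "h ` carrier M = {\<zero>\<^bsub>M\<^esub>}" using zero.hyps M.M.zero_closed by (metis (no_types, lifting) image_cong image_constant)
  then have "carrier M = {\<zero>\<^bsub>M\<^esub>}" using bij_betw_imp_surj_on[OF zero.prems] by simp
  then show ?case using M(2) by (simp add: indecomposable_module_def zero_module_def)
next
  case (step h a b h')
  interpret M: right_module A M using M(1) by (rule fg_module_right_module)
  have "bij_betw (\<lambda>x. b (a x) \<oplus>\<^bsub>M\<^esub> h x) (carrier M) (carrier M)"
    using step.prems step.hyps(4) by (subst bij_betw_cong[symmetric]) auto
  from indecomposable_sum_bij[OF M module_hom_comp[OF step.hyps(2,3)]
      factors_add_hom[OF M.right_module_axioms M.right_module_axioms step.hyps(1)] this]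
  show ?case using step by blast
qed

lemma indecomposable_finsum_bij:
  assumes M: "fg_module A M" "indecomposable_module A M" and J: "finite J" "\<And>j. j \<in> J \<Longrightarrow> f j \<in> module_hom A M M"
    and bij: "bij_betw (\<lambda>x. finsum M (\<lambda>j. f j x) J) (carrier M) (carrier M)"
  shows "\<exists>j\<in>J. bij_betw (f j) (carrier M) (carrier M)"
  using J bij
proof (induction J)
  case empty
  interpret M: right_module A M using M(1) by (rule fg_module_right_module)
  have "(\<lambda>x. \<zero>\<^bsub>M\<^esub>) ` carrier M = carrier M" using bij_betw_imp_surj_on[OF empty.prems(2)] by simp
  then have "carrier M = {\<zero>\<^bsub>M\<^esub>}" using M.M.zero_closed by blast
  then show ?case using M(2) by (simp add: indecomposable_module_def zero_module_def)
next
  case (insert j J)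
  interpret M: right_module A M using M(1) by (rule fg_module_right_module)
  note rm = M.right_module_axioms
  have c: "f i x \<in> carrier M" if "i \<in> insert j J" "x \<in> carrier M" for i x
    using module_hom_closed[OF insert.prems(1)] that by blast
  have eq: "finsum M (\<lambda>j. f j x) (insert j J) = f j x \<oplus>\<^bsub>M\<^esub> finsum M (\<lambda>j. f j x) J"
    if "x \<in> carrier M" for x
    using insert.hyps c[OF _ that] by (subst M.M.finsum_insert) auto
  have "factors_add A M M M (\<lambda>x. finsum M (\<lambda>j. f j x) J)"
    by (rule factors_add_finsum[OF rm rm insert.hyps(1)])
      (use factors_add_basic[OF rm _ module_hom_id] insert.prems(1) in auto)
  from factors_add_hom[OF rm rm this] have hom: "(\<lambda>x. finsum M (\<lambda>j. f j x) J) \<in> module_hom A M M" .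
  have "bij_betw (\<lambda>x. f j x \<oplus>\<^bsub>M\<^esub> finsum M (\<lambda>j. f j x) J) (carrier M) (carrier M)"
    using insert.prems(2) eq by (subst bij_betw_cong[symmetric]) auto
  from indecomposable_sum_bij[OF M insert.prems(1) hom this] insert show ?case by blast
qed

text \<open>The exchange step of Krull-Schmidt. The identity of the summand \<open>S i\<close> is a
  sum of maps through \<open>U\<close>, and splitting \<open>U\<close> breaks it up further into
  maps through the \<open>S' j\<close>. Locality singles out one bijective component, and
  \<open>indecomposable_retract\<close> makes it an isomorphism.\<close>

lemma summand_of_direct_sum:
  assumes T: "fg_module A T" "direct_sum_of A T n S" and U: "fg_module A U" "direct_sum_of A U m S'"
    and ind: "\<And>i. i < n \<Longrightarrow> indecomposable_module A (restrict_module T (S i))"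
      "\<And>j. j < m \<Longrightarrow> indecomposable_module A (restrict_module U (S' j))"
    and add: "factors_add A U T T (\<lambda>x. x)" and i: "i < n"
  shows "\<exists>j<m. module_iso A (restrict_module T (S i)) (restrict_module U (S' j))"
proof -
  interpret T: right_module A T using T(1) by (rule fg_module_right_module)
  interpret U: right_module A U using U(1) by (rule fg_module_right_module)
  obtain p where p: "\<And>i. i < n \<Longrightarrow> p i \<in> module_hom A T (restrict_module T (S i))"
    "\<And>i j x. i < n \<Longrightarrow> j < n \<Longrightarrow> x \<in> S i \<Longrightarrow> p j x = (if i = j then x else \<zero>\<^bsub>T\<^esub>)"
    using direct_sum_projections[OF T.right_module_axioms T(2)]
    by (elim exE conjE) (rule that, blast+)
  obtain q where q: "\<And>j. j < m \<Longrightarrow> q j \<in> module_hom A U (restrict_module U (S' j))"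
    "\<And>x. x \<in> carrier U \<Longrightarrow> x = finsum U (\<lambda>j. q j x) {..<m}"
    using direct_sum_projections[OF U.right_module_axioms U(2)]
    by (elim exE conjE) (rule that, blast+)
  have Si: "submodule (S i) A T" and S': "\<And>j. j < m \<Longrightarrow> submodule (S' j) A U"
    using T(2) U(2) i by (auto simp: direct_sum_of_def)
  let ?X = "restrict_module T (S i)"
  have X: "fg_module A ?X" by (rule fg_module_restrict[OF T(1) Si])
  interpret X: right_module A ?X using X by (rule fg_module_right_module)
  have incl: "(\<lambda>x. x) \<in> module_hom A ?X T"
    using T.rm_submoduleD(1)[OF Si] by (auto simp: module_hom_def)
  have "factors_add A U ?X ?X (\<lambda>x. p i x)"
    using factors_add_comp_left[OF X.right_module_axioms T.right_module_axioms X.right_module_axioms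
      factors_add_comp_right[OF add incl] p(1)[OF i]] .
  then have "factors_add A U ?X ?X (\<lambda>x. x)" by (rule factors_add_cong) (use p(2) i in auto)
  moreover have "bij_betw (\<lambda>x. x) (carrier ?X) (carrier ?X)" by (simp add: bij_betw_def)
  ultimately have "\<exists>a\<in>module_hom A ?X U. \<exists>b\<in>module_hom A U ?X. bij_betw (\<lambda>x. b (a x)) (carrier ?X) (carrier ?X)"
    by (rule indecomposable_factors_add[OF X ind(1)[OF i]])
  then obtain a b where a: "a \<in> module_hom A ?X U" and b: "b \<in> module_hom A U ?X"
    and bij: "bij_betw (\<lambda>x. b (a x)) (carrier ?X) (carrier ?X)" by (elim bexE)
  have inclU: "(\<lambda>x. x) \<in> module_hom A (restrict_module U (S' j)) U" if "j < m" for j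
    using U.rm_submoduleD(1)[OF S'[OF that]] by (auto simp: module_hom_def)
  have qU: "(\<lambda>x. q j x) \<in> module_hom A U U" if "j < m" for j
    using module_hom_comp[OF q(1)[OF that] inclU[OF that]] .
  have "b (a x) = finsum ?X (\<lambda>j. b (q j (a x))) {..<m}" if x: "x \<in> carrier ?X" for x
  proof -
    have "a x \<in> carrier U" using module_hom_closed[OF a x] .
    then show ?thesis
      by (subst q(2)[of "a x"], simp, subst module_hom_finsum[OF U.right_module_axioms X.right_module_axioms b])
        (auto intro: module_hom_closed[OF qU])
  qed
  with bij have "bij_betw (\<lambda>x. finsum ?X (\<lambda>j. b (q j (a x))) {..<m}) (carrier ?X) (carrier ?X)"
    by (rule bij_betw_cong[THEN iffD1, rotated]) simp
  then have "\<exists>j\<in>{..<m}. bij_betw (\<lambda>x. b (q j (a x))) (carrier ?X) (carrier ?X)"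
    by (intro indecomposable_finsum_bij[OF X ind(1)[OF i]])
      (auto intro!: module_hom_comp[OF a module_hom_comp[OF qU b]])
  then obtain j where j: "j < m" "bij_betw (\<lambda>x. b (q j (a x))) (carrier ?X) (carrier ?X)" by auto
  have "bij_betw (\<lambda>x. q j (a x)) (carrier ?X) (carrier (restrict_module U (S' j)))"
  proof (rule indecomposable_retract)
    show "right_module A (restrict_module U (S' j))" by (rule U.right_module_restrict[OF S'[OF j(1)]])
    show "\<not> zero_module ?X" using ind(1)[OF i] by (simp add: indecomposable_module_def)
    show "(\<lambda>x. q j (a x)) \<in> module_hom A ?X (restrict_module U (S' j))"
      using module_hom_comp[OF a q(1)[OF j(1)]] .
    show "b \<in> module_hom A (restrict_module U (S' j)) ?X"
      using module_hom_comp[OF inclU[OF j(1)] b] .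
  qed (use j ind(2) X.right_module_axioms in auto)
  then show ?thesis unfolding module_iso_def
    using j(1) module_hom_comp[OF a q(1)[OF j(1)]] by blast
qed

text \<open>Krull-Schmidt for basic modules. Each summand of one module is isomorphic to a summand
  of the other. As summands are pairwise non-isomorphic, the matchings \<open>s\<close> and
  \<open>t\<close> are mutually inverse, and the isomorphisms of matched summands add up.\<close>

lemma basic_module_iso:
  assumes "basic_module A T" "basic_module A U"
    and TU: "factors_add A U T T (\<lambda>x. x)" and UT: "factors_add A T U U (\<lambda>x. x)"
  shows "module_iso A T U"
proof -
  obtain n S where T: "fg_module A T" "direct_sum_of A T n S"
    "\<And>i. i < n \<Longrightarrow> indecomposable_module A (restrict_module T (S i))"
    "\<And>i j. i < n \<Longrightarrow> j < n \<Longrightarrow> i \<noteq> j \<Longrightarrow> \<not> module_iso A (restrict_module T (S i)) (restrict_module T (S j))"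
    using assms(1) by (auto simp: basic_module_def)
  obtain m S' where U: "fg_module A U" "direct_sum_of A U m S'"
    "\<And>i. i < m \<Longrightarrow> indecomposable_module A (restrict_module U (S' i))"
    "\<And>i j. i < m \<Longrightarrow> j < m \<Longrightarrow> i \<noteq> j \<Longrightarrow> \<not> module_iso A (restrict_module U (S' i)) (restrict_module U (S' j))"
    using assms(2) by (auto simp: basic_module_def)
  interpret T: right_module A T using T(1) by (rule fg_module_right_module)
  interpret U: right_module A U using U(1) by (rule fg_module_right_module)
  let ?X = "\<lambda>i. restrict_module T (S i)" and ?Y = "\<lambda>j. restrict_module U (S' j)"
  have S: "submodule (S i) A T" "right_module A (?X i)" if "i < n" for i
    using T(2) that by (auto simp: direct_sum_of_def intro!: T.right_module_restrict)
  have S': "submodule (S' j) A U" "right_module A (?Y j)" if "j < m" for j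
    using U(2) that by (auto simp: direct_sum_of_def intro!: U.right_module_restrict)
  have "\<forall>i. \<exists>j. i < n \<longrightarrow> j < m \<and> module_iso A (?X i) (?Y j)"
    using summand_of_direct_sum[OF T(1,2) U(1,2) T(3) U(3) TU] by blast
  then obtain s where s: "\<And>i. i < n \<Longrightarrow> s i < m \<and> module_iso A (?X i) (?Y (s i))" by metis
  have "\<forall>j. \<exists>i. j < m \<longrightarrow> i < n \<and> module_iso A (?Y j) (?X i)"
    using summand_of_direct_sum[OF U(1,2) T(1,2) U(3) T(3) UT] by blast
  then obtain t where t: "\<And>j. j < m \<Longrightarrow> t j < n \<and> module_iso A (?Y j) (?X (t j))" by metis
  have st: "t (s i) = i" if "i < n" for i
    using that s[OF that] t[of "s i"] T(4)[of i "t (s i)"] module_iso_trans by metis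
  have ts: "s (t j) = j" if "j < m" for j
    using that t[OF that] s[of "t j"] U(4)[of j "s (t j)"] module_iso_trans by metis
  have sbij: "bij_betw s {..<n} {..<m}"
    by (rule bij_betw_byWitness[of _ t]) (use s t st ts in auto)
  have "\<forall>i. \<exists>f. i < n \<longrightarrow> f \<in> module_hom A (?X i) (?Y (s i)) \<and> bij_betw f (S i) (S' (s i))"
    using s by (simp add: module_iso_def) blast
  then obtain \<theta> where \<theta>: "\<And>i. i < n \<Longrightarrow> \<theta> i \<in> module_hom A (?X i) (?Y (s i))"
    "\<And>i. i < n \<Longrightarrow> bij_betw (\<theta> i) (S i) (S' (s i))" by metis
  obtain p where p: "\<And>i. i < n \<Longrightarrow> p i \<in> module_hom A T (?X i)"
    "\<And>x. x \<in> carrier T \<Longrightarrow> x = finsum T (\<lambda>i. p i x) {..<n}"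
    "\<And>i j x. i < n \<Longrightarrow> j < n \<Longrightarrow> x \<in> S i \<Longrightarrow> p j x = (if i = j then x else \<zero>\<^bsub>T\<^esub>)"
    using direct_sum_projections[OF T.right_module_axioms T(2)]
    by (elim exE conjE) (rule that, blast+)
  obtain q where q: "\<And>j. j < m \<Longrightarrow> q j \<in> module_hom A U (?Y j)"
    "\<And>x. x \<in> carrier U \<Longrightarrow> x = finsum U (\<lambda>j. q j x) {..<m}"
    "\<And>i j x. i < m \<Longrightarrow> j < m \<Longrightarrow> x \<in> S' i \<Longrightarrow> q j x = (if i = j then x else \<zero>\<^bsub>U\<^esub>)"
    using direct_sum_projections[OF U.right_module_axioms U(2)]
    by (elim exE conjE) (rule that, blast+)
  have inT: "(\<lambda>x. x) \<in> module_hom A (?X i) T" if "i < n" for i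
    using T.rm_submoduleD(1)[OF S(1)[OF that]] by (auto simp: module_hom_def)
  have inU: "(\<lambda>x. x) \<in> module_hom A (?Y j) U" if "j < m" for j
    using U.rm_submoduleD(1)[OF S'(1)[OF that]] by (auto simp: module_hom_def)
  have pS: "p i x \<in> S i" if "i < n" "x \<in> carrier T" for i x
    using module_hom_closed[OF p(1)[OF that(1)] that(2)] by simp
  have pC: "p i x \<in> carrier T" if "i < n" "x \<in> carrier T" for i x
    using pS[OF that] T.rm_submoduleD(1)[OF S(1)[OF that(1)]] by auto
  have qS: "q j x \<in> S' j" if "j < m" "x \<in> carrier U" for j x
    using module_hom_closed[OF q(1)[OF that(1)] that(2)] by simp
  have qC: "q j x \<in> carrier U" if "j < m" "x \<in> carrier U" for j x
    using qS[OF that] U.rm_submoduleD(1)[OF S'(1)[OF that(1)]] by auto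
  have \<theta>S: "\<theta> i (p i x) \<in> S' (s i)" "\<theta> i (p i x) \<in> carrier U" if "i < n" "x \<in> carrier T" for i x
  proof -
    show *: "\<theta> i (p i x) \<in> S' (s i)" using bij_betw_apply[OF \<theta>(2)[OF that(1)] pS[OF that]] .
    then show "\<theta> i (p i x) \<in> carrier U" using U.rm_submoduleD(1)[OF S'(1)] s[OF that(1)] by auto
  qed
  let ?F = "\<lambda>x. finsum U (\<lambda>i. \<theta> i (p i x)) {..<n}"
  have "factors_add A T T U ?F"
  proof (rule factors_add_finsum[OF T.right_module_axioms U.right_module_axioms])
    fix i assume "i \<in> {..<n}"
    then have i: "i < n" "s i < m" using s by auto
    have "(\<lambda>x. \<theta> i (p i x)) \<in> module_hom A T U"
      using module_hom_comp[OF module_hom_comp[OF p(1)[OF i(1)] \<theta>(1)[OF i(1)]] inU[OF i(2)]] .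
    from factors_add_basic[OF U.right_module_axioms module_hom_id this]
    show "factors_add A T T U (\<lambda>x. \<theta> i (p i x))" .
  qed simp
  then have F: "?F \<in> module_hom A T U" by (rule factors_add_hom[OF T.right_module_axioms U.right_module_axioms])
  \<comment> \<open>Since \<open>s\<close> is injective, the projection to the summand
    \<open>s i\<close> of \<open>U\<close> sees only the \<open>i\<close>-th term. Both injectivity
    and surjectivity of \<open>?F\<close> are checked on these components.\<close>
  have qF: "q (s i) (?F x) = \<theta> i (p i x)" if i: "i < n" and x: "x \<in> carrier T" for i x
  proof -
    have si: "s i < m" using s i by simp
    have "q (s i) (?F x) = finsum U (\<lambda>l. q (s i) (\<theta> l (p l x))) {..<n}"
      by (rule module_hom_finsum[OF U.right_module_axioms U.right_module_axioms module_hom_comp[OF q(1)[OF si] inU[OF si]]])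
        (use \<theta>S(2) x in auto)
    also have "\<dots> = finsum U (\<lambda>l. if i = l then \<theta> l (p l x) else \<zero>\<^bsub>U\<^esub>) {..<n}"
    proof (rule U.M.finsum_cong')
      fix l assume "l \<in> {..<n}"
      then have l: "l < n" "s l < m" using s by auto
      have "s l = s i \<longleftrightarrow> i = l" using st l(1) i by metis
      then show "q (s i) (\<theta> l (p l x)) = (if i = l then \<theta> l (p l x) else \<zero>\<^bsub>U\<^esub>)"
        using q(3)[OF l(2) si \<theta>S(1)[OF l(1) x]] by simp
    qed (use \<theta>S(2) x in auto)
    also have "\<dots> = \<theta> i (p i x)"
      using U.M.finsum_singleton[of i "{..<n}" "\<lambda>l. \<theta> l (p l x)"] i \<theta>S(2) x by simp
    finally show ?thesis .
  qed
  have "inj_on ?F (carrier T)"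
  proof (rule inj_onI)
    fix x y assume xy: "x \<in> carrier T" "y \<in> carrier T" "?F x = ?F y"
    have "p i x = p i y" if i: "i < n" for i
    proof (rule inj_onD[OF bij_betw_imp_inj_on[OF \<theta>(2)[OF i]]])
      show "\<theta> i (p i x) = \<theta> i (p i y)" using qF[OF i xy(1)] qF[OF i xy(2)] xy(3) by simp
    qed (use pS i xy in auto)
    then have "finsum T (\<lambda>i. p i x) {..<n} = finsum T (\<lambda>i. p i y) {..<n}"
      using pC xy by (intro T.M.finsum_cong') auto
    then show "x = y" using p(2) xy by simp
  qed
  moreover have "?F ` carrier T = carrier U"
  proof
    show "carrier U \<subseteq> ?F ` carrier T"
    proof
      fix y assume y: "y \<in> carrier U"
      define w where "w i = inv_into (S i) (\<theta> i) (q (s i) y)" for i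
      have w: "w i \<in> S i" "\<theta> i (w i) = q (s i) y" if i: "i < n" for i
      proof -
        have "q (s i) y \<in> \<theta> i ` S i" using qS[of "s i" y] s i y bij_betw_imp_surj_on[OF \<theta>(2)[OF i]] by auto
        then show "w i \<in> S i" "\<theta> i (w i) = q (s i) y" unfolding w_def by (auto intro: inv_into_into f_inv_into_f)
      qed
      have wC: "w i \<in> carrier T" if "i < n" for i using w(1)[OF that] T.rm_submoduleD(1)[OF S(1)[OF that]] by auto
      let ?x = "finsum T w {..<n}"
      have x: "?x \<in> carrier T" using wC by auto
      have pw: "p i ?x = w i" if i: "i < n" for i
      proof -
        have "p i ?x = finsum T (\<lambda>l. p i (w l)) {..<n}"
          by (rule module_hom_finsum[OF T.right_module_axioms T.right_module_axioms module_hom_comp[OF p(1)[OF i] inT[OF i]]])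
            (use wC in auto)
        also have "\<dots> = finsum T (\<lambda>l. if i = l then w l else \<zero>\<^bsub>T\<^esub>) {..<n}"
          by (rule T.M.finsum_cong') (use p(3) i w(1) wC in auto)
        also have "\<dots> = w i" using T.M.finsum_singleton[of i "{..<n}" w] i wC by simp
        finally show ?thesis .
      qed
      have "?F ?x = finsum U (\<lambda>i. q (s i) y) {..<n}"
        using pw w(2) qC y s by (intro U.M.finsum_cong') auto
      also have "\<dots> = finsum U (\<lambda>j. q j y) (s ` {..<n})"
        using bij_betw_imp_inj_on[OF sbij] qC y s by (subst U.M.finsum_reindex) auto
      also have "\<dots> = y" using bij_betw_imp_surj_on[OF sbij] q(2)[OF y] by simp
      finally show "y \<in> ?F ` carrier T" using x by blast
    qed
  qed (use module_hom_closed[OF F] in auto)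
  ultimately show ?thesis unfolding module_iso_def using F by (auto simp: bij_betw_def)
qed

end

section \<open>Short exact sequences and projective presentations\<close>

definition short_exact ::
  "'a ring \<Rightarrow> ('a, 'x) module \<Rightarrow> ('x \<Rightarrow> 'y) \<Rightarrow> ('a, 'y) module \<Rightarrow> ('y \<Rightarrow> 'z) \<Rightarrow> ('a, 'z) module \<Rightarrow> bool" where
  "short_exact A X f Y g Z \<longleftrightarrow> fg_module A X \<and> fg_module A Y \<and> fg_module A Z \<and>
     f \<in> module_hom A X Y \<and> inj_on f (carrier X) \<and> g \<in> module_hom A Y Z \<and>
     g ` carrier Y = carrier Z \<and> (\<forall>y\<in>carrier Y. g y = \<zero>\<^bsub>Z\<^esub> \<longleftrightarrow> y \<in> f ` carrier X)"

lemma short_exactD: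
  assumes "short_exact A X f Y g Z"
  shows "fg_module A X" "fg_module A Y" "fg_module A Z"
    "f \<in> module_hom A X Y" "inj_on f (carrier X)" "g \<in> module_hom A Y Z"
    "g ` carrier Y = carrier Z" "\<And>y. y \<in> carrier Y \<Longrightarrow> g y = \<zero>\<^bsub>Z\<^esub> \<Longrightarrow> y \<in> f ` carrier X"
    "\<And>x. x \<in> carrier X \<Longrightarrow> g (f x) = \<zero>\<^bsub>Z\<^esub>"
    "right_module A X" "right_module A Y" "right_module A Z"
  using assms module_hom_closed[of f A X Y] by (auto simp: short_exact_def fg_module_right_module)

lemma short_exact_lift:
  assumes "short_exact A X f Y g Z" "right_module A W" "h \<in> module_hom A W Y"
    and "\<And>w. w \<in> carrier W \<Longrightarrow> g (h w) = \<zero>\<^bsub>Z\<^esub>"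
  shows "\<exists>h'\<in>module_hom A W X. \<forall>w\<in>carrier W. f (h' w) = h w"
  using short_exactD[OF assms(1)] assms(2-4) module_hom_closed[OF assms(3)]
  by (intro lift_along_inj) auto

lemma short_exact_factor:
  assumes "short_exact A X f Y g Z" "right_module A W" "h \<in> module_hom A Y W"
    and "\<And>x. x \<in> carrier X \<Longrightarrow> h (f x) = \<zero>\<^bsub>W\<^esub>"
  shows "\<exists>h'\<in>module_hom A Z W. \<forall>y\<in>carrier Y. h' (g y) = h y"
  by (rule factor_through_surj)
    (use short_exactD(6,7,8,11,12)[OF assms(1)] assms(2-4) in blast)+

lemma module_hom_prod:
  assumes "right_module A N" "f \<in> module_hom A X N" "g \<in> module_hom A Y N"
  shows "(\<lambda>(x, y). f x \<oplus>\<^bsub>N\<^esub> g y) \<in> module_hom A (prod_module X Y) N"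
proof -
  interpret N: right_module A N by fact
  note c = module_hom_closed[OF assms(2)] module_hom_closed[OF assms(3)]
  show ?thesis
    by (rule module_homI)
      (auto simp: c module_hom_add[OF assms(2)] module_hom_add[OF assms(3)]
        module_hom_smult[OF assms(2)] module_hom_smult[OF assms(3)] N.smult_r_distr N.M.a_ac)
qed

lemma regular_hom:
  assumes "right_module A M" "x \<in> carrier M"
  shows "(\<lambda>a. a \<odot>\<^bsub>M\<^esub> x) \<in> module_hom A (regular_module A) M"
proof -
  interpret M: right_module A M by fact
  show ?thesis
    using assms(2) by (intro module_homI) (auto simp: M.smult_closed M.smult_l_distr M.smult_assoc)
qed

lemma projective_moduleD:
  fixes X Y :: "'a umodule"
  assumes "projective_module A P" "fg_module A X" "fg_module A Y" "p \<in> module_hom A X Y"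
    "p ` carrier X = carrier Y" "f \<in> module_hom A P Y"
  shows "\<exists>g\<in>module_hom A P X. \<forall>x\<in>carrier P. p (g x) = f x"
  using assms unfolding projective_module_def by blast

lemma projective_fg: "projective_module A P \<Longrightarrow> fg_module A P"
  by (simp add: projective_module_def)

text \<open>The product consists of pairs and so leaves the universal type;
  \<open>fg_module_representable\<close> brings it back. Only the biproduct identities are
  kept.\<close>

lemma biproduct_exists:
  fixes M N :: "'a umodule"
  assumes "fg_module A M" "fg_module A N"
  obtains W :: "'a umodule" and i j p q where "fg_module A W" "i \<in> module_hom A M W" "j \<in> module_hom A N W"
    "p \<in> module_hom A W M" "q \<in> module_hom A W N"
    "\<And>x. x \<in> carrier M \<Longrightarrow> p (i x) = x" "\<And>x. x \<in> carrier N \<Longrightarrow> q (j x) = x"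
    "\<And>x. x \<in> carrier N \<Longrightarrow> p (j x) = \<zero>\<^bsub>M\<^esub>" "\<And>x. x \<in> carrier M \<Longrightarrow> q (i x) = \<zero>\<^bsub>N\<^esub>"
    "\<And>w. w \<in> carrier W \<Longrightarrow> i (p w) \<oplus>\<^bsub>W\<^esub> j (q w) = w"
proof -
  interpret M: right_module A M using assms(1) by (rule fg_module_right_module)
  interpret N: right_module A N using assms(2) by (rule fg_module_right_module)
  let ?P = "prod_module M N"
  have P: "fg_module A ?P" by (rule fg_module_prod[OF assms])
  interpret P: right_module A ?P using P by (rule fg_module_right_module)
  obtain W :: "'a umodule" and \<theta> where W: "fg_module A W" and \<theta>: "\<theta> \<in> module_hom A ?P W"
    "bij_betw \<theta> (carrier ?P) (carrier W)"
    using fg_module_representable[OF P] by (auto simp: module_iso_def)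
  let ?\<psi> = "inv_into (carrier ?P) \<theta>"
  have \<psi>: "?\<psi> \<in> module_hom A W ?P" by (rule module_hom_inv_into[OF P.right_module_axioms \<theta>])
  have \<psi>\<theta>: "?\<psi> (\<theta> x) = x" if "x \<in> carrier ?P" for x
    using inv_into_f_f[OF bij_betw_imp_inj_on[OF \<theta>(2)] that] .
  have \<theta>\<psi>: "\<theta> (?\<psi> w) = w" if "w \<in> carrier W" for w
    using bij_betw_inv_into_right[OF \<theta>(2) that] .
  have 1: "(\<lambda>x. (x, \<zero>\<^bsub>N\<^esub>)) \<in> module_hom A M ?P" "(\<lambda>y. (\<zero>\<^bsub>M\<^esub>, y)) \<in> module_hom A N ?P"
    "fst \<in> module_hom A ?P M" "snd \<in> module_hom A ?P N"
    by (auto simp: module_hom_def M.smult_zero_right N.smult_zero_right)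
  show thesis
  proof (rule that[OF W module_hom_comp[OF 1(1) \<theta>(1)] module_hom_comp[OF 1(2) \<theta>(1)]
        module_hom_comp[OF \<psi> 1(3)] module_hom_comp[OF \<psi> 1(4)]])
    fix w assume w: "w \<in> carrier W"
    obtain x y where xy: "?\<psi> w = (x, y)" "x \<in> carrier M" "y \<in> carrier N"
      using module_hom_closed[OF \<psi> w] by auto
    have "\<theta> (x, \<zero>\<^bsub>N\<^esub>) \<oplus>\<^bsub>W\<^esub> \<theta> (\<zero>\<^bsub>M\<^esub>, y) = \<theta> (x, y)"
      using xy by (simp add: module_hom_add[OF \<theta>(1), symmetric])
    then show "\<theta> (fst (?\<psi> w), \<zero>\<^bsub>N\<^esub>) \<oplus>\<^bsub>W\<^esub> \<theta> (\<zero>\<^bsub>M\<^esub>, snd (?\<psi> w)) = w"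
      using \<theta>\<psi>[OF w] xy by simp
  qed (use \<psi>\<theta> in simp_all)
qed

lemma projective_biproduct:
  fixes M N W :: "'a umodule"
  assumes "projective_module A M" "projective_module A N" "fg_module A W"
    and i: "i \<in> module_hom A M W" and j: "j \<in> module_hom A N W"
    and p: "p \<in> module_hom A W M" and q: "q \<in> module_hom A W N"
    and w: "\<And>w. w \<in> carrier W \<Longrightarrow> i (p w) \<oplus>\<^bsub>W\<^esub> j (q w) = w"
  shows "projective_module A W"
  unfolding projective_module_def
proof (intro conjI allI impI assms(3))
  fix X Y :: "'a umodule" and s f
  assume *: "fg_module A X \<and> fg_module A Y \<and> s \<in> module_hom A X Y \<and> s ` carrier X = carrier Y \<and>
    f \<in> module_hom A W Y"
  then have XY: "fg_module A X" "fg_module A Y" "s \<in> module_hom A X Y" "s ` carrier X = carrier Y"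
    and sh: "s \<in> module_hom A X Y" and fh: "f \<in> module_hom A W Y" by simp_all
  obtain g where g: "g \<in> module_hom A M X" "\<And>x. x \<in> carrier M \<Longrightarrow> s (g x) = f (i x)"
    using projective_moduleD[OF assms(1) XY module_hom_comp[OF i fh]] by blast
  obtain h where h: "h \<in> module_hom A N X" "\<And>x. x \<in> carrier N \<Longrightarrow> s (h x) = f (j x)"
    using projective_moduleD[OF assms(2) XY module_hom_comp[OF j fh]] by blast
  have rm: "right_module A W" "right_module A X" using * assms(3) by (auto simp: fg_module_right_module)
  show "\<exists>g\<in>module_hom A W X. \<forall>x\<in>carrier W. s (g x) = f x"
  proof (intro bexI ballI)
    show "(\<lambda>x. g (p x) \<oplus>\<^bsub>X\<^esub> h (q x)) \<in> module_hom A W X"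
      by (intro module_hom_plus rm module_hom_comp[OF p g(1)] module_hom_comp[OF q h(1)])
    fix x assume x: "x \<in> carrier W"
    note c = module_hom_closed[OF p x] module_hom_closed[OF q x]
    have "s (g (p x) \<oplus>\<^bsub>X\<^esub> h (q x)) = f (i (p x)) \<oplus>\<^bsub>Y\<^esub> f (j (q x))"
      using c g h by (simp add: module_hom_add[OF sh] module_hom_closed[OF g(1)] module_hom_closed[OF h(1)])
    also have "\<dots> = f x"
      using c w[OF x] by (simp add: module_hom_add[OF fh, symmetric] module_hom_closed[OF i] module_hom_closed[OF j])
    finally show "s (g (p x) \<oplus>\<^bsub>X\<^esub> h (q x)) = f x" .
  qed
qed

lemma projective_regular_copy:
  fixes U :: "('a, 'u) module"
  assumes "ring A" and U: "fg_module A U" and \<theta>: "\<theta> \<in> module_hom A (regular_module A) U"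
    "bij_betw \<theta> (carrier A) (carrier U)"
  shows "projective_module A U"
  unfolding projective_module_def
proof (intro conjI allI impI U)
  interpret ring A by fact
  interpret reg: right_module A "regular_module A" by (rule right_module_regular) fact
  fix X Y :: "'a umodule" and s f
  assume *: "fg_module A X \<and> fg_module A Y \<and> s \<in> module_hom A X Y \<and> s ` carrier X = carrier Y \<and>
    f \<in> module_hom A U Y"
  have sh: "s \<in> module_hom A X Y" and fh: "f \<in> module_hom A U Y" using * by auto
  have f\<theta>: "(\<lambda>a. f (\<theta> a)) \<in> module_hom A (regular_module A) Y" by (rule module_hom_comp[OF \<theta>(1) fh])
  have "f (\<theta> \<one>\<^bsub>A\<^esub>) \<in> s ` carrier X" using module_hom_closed[OF f\<theta>, of "\<one>\<^bsub>A\<^esub>"] * by simp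
  then obtain x where x: "x \<in> carrier X" "s x = f (\<theta> \<one>\<^bsub>A\<^esub>)" by (metis imageE)
  let ?\<psi> = "inv_into (carrier A) \<theta>"
  have \<psi>: "?\<psi> \<in> module_hom A U (regular_module A)"
    using module_hom_inv_into[OF reg.right_module_axioms \<theta>(1)] \<theta>(2) by simp
  have rX: "right_module A X" using * by (simp add: fg_module_right_module)
  show "\<exists>g\<in>module_hom A U X. \<forall>x\<in>carrier U. s (g x) = f x"
  proof (intro bexI ballI)
    show "(\<lambda>u. ?\<psi> u \<odot>\<^bsub>X\<^esub> x) \<in> module_hom A U X" by (rule module_hom_comp[OF \<psi> regular_hom[OF rX x(1)]])
    fix u assume u: "u \<in> carrier U"
    have a: "?\<psi> u \<in> carrier A" using module_hom_closed[OF \<psi> u] by simp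
    have "s (?\<psi> u \<odot>\<^bsub>X\<^esub> x) = ?\<psi> u \<odot>\<^bsub>Y\<^esub> f (\<theta> \<one>\<^bsub>A\<^esub>)" using a x by (simp add: module_hom_smult[OF sh])
    also have "\<dots> = f (\<theta> (?\<psi> u))" using module_hom_smult[OF f\<theta> a, of "\<one>\<^bsub>A\<^esub>"] a by simp
    also have "\<dots> = f u" using bij_betw_inv_into_right[OF \<theta>(2) u] by simp
    finally show "s (?\<psi> u \<odot>\<^bsub>X\<^esub> x) = f u" .
  qed
qed

lemma zero_module_hom:
  assumes "right_module A Z" "right_module A N" "zero_module Z" "h \<in> module_hom A Z N" "x \<in> carrier Z"
  shows "h x = \<zero>\<^bsub>N\<^esub>"
  using assms module_hom_zero[OF assms(1,2,4)] by (simp add: zero_module_def)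

lemma zero_umodule_exists:
  assumes "fg_module A M"
  shows "fg_module A (restrict_module M {\<zero>\<^bsub>M\<^esub>})" "zero_module (restrict_module M {\<zero>\<^bsub>M\<^esub>})"
proof -
  interpret M: right_module A M using assms by (rule fg_module_right_module)
  interpret Z: right_module A "restrict_module M {\<zero>\<^bsub>M\<^esub>}"
    by (rule M.right_module_restrict[OF M.submodule_zero])
  show "zero_module (restrict_module M {\<zero>\<^bsub>M\<^esub>})" by (simp add: zero_module_def)
  have "H = {\<zero>\<^bsub>M\<^esub>}" if "submodule H A (restrict_module M {\<zero>\<^bsub>M\<^esub>})" for H
    using Z.rm_submoduleD(1,2)[OF that] by auto
  then show "fg_module A (restrict_module M {\<zero>\<^bsub>M\<^esub>})"
    unfolding Z.fg_module_iff by (intro exI[of _ "{}"]) auto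
qed

lemma cokernel_exists:
  fixes Y :: "('a, 'y) module"
  assumes "fg_module A X" "fg_module A Y" "f \<in> module_hom A X Y" "inj_on f (carrier X)"
  shows "\<exists>(Z :: ('a, 'y) module) g. short_exact A X f Y g Z"
proof -
  interpret X: right_module A X using assms(1) by (rule fg_module_right_module)
  interpret Y: right_module A Y using assms(2) by (rule fg_module_right_module)
  have "submodule (f ` carrier X) A Y"
    by (rule submodule_image[OF X.right_module_axioms Y.right_module_axioms assms(3) X.submodule_carrier])
  from quotient_module_exists[OF Y.right_module_axioms this] obtain Z :: "('a, 'y) module" and g where
    g: "right_module A Z" "g \<in> module_hom A Y Z" "g ` carrier Y = carrier Z"
    "\<forall>y\<in>carrier Y. g y = \<zero>\<^bsub>Z\<^esub> \<longleftrightarrow> y \<in> f ` carrier X" by blast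
  have "fg_module A Z" by (rule fg_module_surj_image[OF assms(2) g(2,3,1)])
  then show ?thesis unfolding short_exact_def using assms g by blast
qed

context artin_algebra
begin

lemma kernel_exact:
  assumes "fg_module A Y" "fg_module A Z" "g \<in> module_hom A Y Z" "g ` carrier Y = carrier Z"
  shows "short_exact A (restrict_module Y {y \<in> carrier Y. g y = \<zero>\<^bsub>Z\<^esub>}) (\<lambda>y. y) Y g Z"
proof -
  have "submodule {y \<in> carrier Y. g y = \<zero>\<^bsub>Z\<^esub>} A Y"
    by (rule submodule_ker[OF fg_module_right_module[OF assms(1)] fg_module_right_module[OF assms(2)] assms(3)])
  from fg_module_restrict[OF assms(1) this] show ?thesis
    using assms by (auto simp: short_exact_def module_hom_def)
qed

lemma regular_copy_exists:
  obtains U :: "'a umodule" and \<theta> where "fg_module A U" "\<theta> \<in> module_hom A (regular_module A) U"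
    "bij_betw \<theta> (carrier A) (carrier U)"
  using fg_module_representable[OF fg_module_regular[OF ring_axioms]] by (auto simp: module_iso_def)

lemma regular_copy_generator:
  assumes \<theta>: "\<theta> \<in> module_hom A (regular_module A) U" "bij_betw \<theta> (carrier A) (carrier U)"
    and M: "right_module A M" and x: "x \<in> carrier M"
  shows "\<exists>h\<in>module_hom A U M. x \<in> h ` carrier U"
proof -
  interpret M: right_module A M by (rule M)
  have \<psi>: "inv_into (carrier A) \<theta> \<in> module_hom A U (regular_module A)"
    using module_hom_inv_into[OF right_module_regular[OF ring_axioms] \<theta>(1)] \<theta>(2) by simp
  have "inv_into (carrier A) \<theta> (\<theta> \<one>) \<odot>\<^bsub>M\<^esub> x = x"
    using inv_into_f_f[OF bij_betw_imp_inj_on[OF \<theta>(2)]] x by (simp add: M.smult_one)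
  moreover have "\<theta> \<one> \<in> carrier U" using bij_betw_apply[OF \<theta>(2)] by simp
  ultimately have "x \<in> (\<lambda>u. inv_into (carrier A) \<theta> u \<odot>\<^bsub>M\<^esub> x) ` carrier U"
    by (intro rev_image_eqI[of "\<theta> \<one>"]) simp_all
  then show ?thesis by (rule bexI[OF _ module_hom_comp[OF \<psi> regular_hom[OF M x]]])
qed

text \<open>One copy of the regular module is added for each generator.\<close>

lemma projective_presentation_exists:
  fixes M :: "'a umodule"
  assumes "fg_module A M"
  obtains P :: "'a umodule" and p where "projective_module A P" "p \<in> module_hom A P M"
    "p ` carrier P = carrier M"
proof -
  interpret M: right_module A M using assms by (rule fg_module_right_module)
  obtain U :: "'a umodule" and \<theta> where U: "fg_module A U" "\<theta> \<in> module_hom A (regular_module A) U"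
    "bij_betw \<theta> (carrier A) (carrier U)" by (rule regular_copy_exists)
  have pU: "projective_module A U" by (rule projective_regular_copy[OF ring_axioms U])
  have hU: "\<exists>h\<in>module_hom A U M. x \<in> h ` carrier U" if "x \<in> carrier M" for x
    by (rule regular_copy_generator[OF U(2,3) M.right_module_axioms that])
  obtain S where S: "finite S" "S \<subseteq> carrier M"
    and gen: "\<And>H. submodule H A M \<Longrightarrow> S \<subseteq> H \<Longrightarrow> H = carrier M"
    using assms by (auto simp: M.fg_module_iff)
  have "\<exists>(P :: 'a umodule) p. projective_module A P \<and> p \<in> module_hom A P M \<and> S \<subseteq> p ` carrier P"
    using S
  proof (induction S)
    case empty
    show ?case using pU module_hom_0[OF M.right_module_axioms] by blast
  next
    case (insert x S)
    then obtain P :: "'a umodule" and p where P: "projective_module A P" "p \<in> module_hom A P M" "S \<subseteq> p ` carrier P"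
      by auto
    have "x \<in> carrier M" using insert.prems by simp
    from hU[OF this] obtain h where h: "h \<in> module_hom A U M" "x \<in> h ` carrier U" by (elim bexE)
    obtain W :: "'a umodule" and i j s t where W: "fg_module A W" "i \<in> module_hom A U W" "j \<in> module_hom A P W"
      "s \<in> module_hom A W U" "t \<in> module_hom A W P"
      "\<And>x. x \<in> carrier U \<Longrightarrow> s (i x) = x" "\<And>x. x \<in> carrier P \<Longrightarrow> t (j x) = x"
      "\<And>x. x \<in> carrier P \<Longrightarrow> s (j x) = \<zero>\<^bsub>U\<^esub>" "\<And>x. x \<in> carrier U \<Longrightarrow> t (i x) = \<zero>\<^bsub>P\<^esub>"
      "\<And>w. w \<in> carrier W \<Longrightarrow> i (s w) \<oplus>\<^bsub>W\<^esub> j (t w) = w"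
      by (rule biproduct_exists[OF U(1) projective_fg[OF P(1)]]) blast
    have rmU: "right_module A U" "right_module A P" "right_module A W"
      using U(1) P(1) W(1) by (auto intro: fg_module_right_module projective_fg)
    let ?p = "\<lambda>w. h (s w) \<oplus>\<^bsub>M\<^esub> p (t w)"
    have "projective_module A W" by (rule projective_biproduct[OF pU P(1) W(1-5) W(10)])
    moreover have "?p \<in> module_hom A W M"
      by (intro module_hom_plus module_hom_comp[OF W(4) h(1)] module_hom_comp[OF W(5) P(2)] rmU M.right_module_axioms)
    moreover have "insert x S \<subseteq> ?p ` carrier W"
    proof
      fix y assume "y \<in> insert x S"
      then consider "y = x" | "y \<in> S" by blast
      then show "y \<in> ?p ` carrier W"
      proof cases
        case 1
        then obtain u where u: "u \<in> carrier U" "y = h u" using h(2) by blast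
        have "?p (i u) = y" using u W(6,9) module_hom_zero[OF rmU(2) M.right_module_axioms P(2)]
            module_hom_closed[OF h(1) u(1)] by simp
        then show ?thesis by (intro image_eqI[of _ _ "i u"]) (simp_all add: module_hom_closed[OF W(2) u(1)])
      next
        case 2
        then obtain u where u: "u \<in> carrier P" "y = p u" using P(3) by blast
        have "?p (j u) = y" using u W(7,8) module_hom_zero[OF rmU(1) M.right_module_axioms h(1)]
            module_hom_closed[OF P(2) u(1)] by simp
        then show ?thesis by (intro image_eqI[of _ _ "j u"]) (simp_all add: module_hom_closed[OF W(3) u(1)])
      qed
    qed
    ultimately show ?case by (intro exI conjI)
  qed
  then obtain P :: "'a umodule" and p where P: "projective_module A P" "p \<in> module_hom A P M" "S \<subseteq> p ` carrier P"
    by (elim exE conjE)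
  have rP: "right_module A P" using P(1) by (intro fg_module_right_module projective_fg)
  have "p ` carrier P = carrier M"
    using submodule_image[OF rP M.right_module_axioms P(2) right_module.submodule_carrier[OF rP]] P(3) by (rule gen)
  then show thesis by (rule that[OF P(1,2)])
qed

definition syzygy :: "'a umodule \<Rightarrow> 'a umodule \<Rightarrow> bool" where
  "syzygy M K \<longleftrightarrow> (\<exists>(P :: 'a umodule) i p. projective_module A P \<and> short_exact A K i P p M)"

lemma syzygy_exists:
  assumes "fg_module A M"
  shows "\<exists>K. syzygy M K"
proof -
  obtain P :: "'a umodule" and p where P: "projective_module A P" "p \<in> module_hom A P M"
    "p ` carrier P = carrier M" by (rule projective_presentation_exists[OF assms])
  show ?thesis unfolding syzygy_def
    using P(1) kernel_exact[OF projective_fg[OF P(1)] assms P(2,3)] by blast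
qed

lemma presentation_exists:
  fixes M :: "'a umodule"
  assumes "fg_module A M"
  obtains K P :: "'a umodule" and i p where "projective_module A P" "short_exact A K i P p M"
  using syzygy_exists[OF assms] by (auto simp: syzygy_def)

lemma syzygy_fg: "syzygy M K \<Longrightarrow> fg_module A M \<and> fg_module A K"
  by (auto simp: syzygy_def dest: short_exactD)

section \<open>Vanishing of Ext\<close>

text \<open>The vanishing of Ext^1(M, N), expressed without a group: restriction
  \<open>Hom(Y, N) -> Hom(X, N)\<close> is onto for every short exact sequence ending in
  \<open>M\<close>. With \<open>X = N\<close> this says that all extensions split.\<close>

definition ext1_zero :: "'a umodule \<Rightarrow> 'a umodule \<Rightarrow> bool" where
  "ext1_zero M N \<longleftrightarrow> (\<forall>(X :: 'a umodule) (Y :: 'a umodule) f g h.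
     short_exact A X f Y g M \<and> h \<in> module_hom A X N \<longrightarrow>
     (\<exists>h'\<in>module_hom A Y N. \<forall>x\<in>carrier X. h' (f x) = h x))"

lemma ext1_zeroD:
  fixes X Y :: "'a umodule"
  assumes "ext1_zero M N" "short_exact A X f Y g M" "h \<in> module_hom A X N"
  obtains h' where "h' \<in> module_hom A Y N" "\<And>x. x \<in> carrier X \<Longrightarrow> h' (f x) = h x"
  using assms unfolding ext1_zero_def by meson

text \<open>One projective presentation suffices. By projectivity it maps to any other sequence
  ending in \<open>M\<close>, and then \<open>Y\<close> is the pushout of \<open>P\<close> and
  \<open>X\<close> over \<open>K\<close>. The given map on \<open>X\<close> and the extension
  \<open>u\<close> on \<open>P\<close> agree on \<open>K\<close> and glue to a map on
  \<open>Y\<close>.\<close>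

lemma ext1_zeroI_presentation:
  fixes K P :: "'a umodule"
  assumes P: "projective_module A P" and e: "short_exact A K i P p M" and N: "fg_module A N"
    and ext: "\<And>h. h \<in> module_hom A K N \<Longrightarrow> \<exists>h'\<in>module_hom A P N. \<forall>x\<in>carrier K. h' (i x) = h x"
  shows "ext1_zero M N"
  unfolding ext1_zero_def
proof (intro allI impI, elim conjE)
  fix X Y :: "'a umodule" and f g h
  assume e': "short_exact A X f Y g M" and h: "h \<in> module_hom A X N"
  note E = short_exactD[OF e] and E' = short_exactD[OF e']
  interpret N: right_module A N using N by (rule fg_module_right_module)
  interpret Y: right_module A Y by (rule E'(11))
  interpret M: right_module A M by (rule E'(12))
  note rN = N.right_module_axioms
  obtain q where q: "q \<in> module_hom A P Y" "\<forall>x\<in>carrier P. g (q x) = p x"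
    using projective_moduleD[OF P E'(2,3,6,7) E(6)] by blast
  have "\<exists>q'\<in>module_hom A K X. \<forall>x\<in>carrier K. f (q' x) = q (i x)"
    by (rule short_exact_lift[OF e' E(10) module_hom_comp[OF E(4) q(1)]])
      (use q(2) E(9) module_hom_closed[OF E(4)] in simp)
  then obtain q' where q': "q' \<in> module_hom A K X" "\<forall>x\<in>carrier K. f (q' x) = q (i x)" by blast
  obtain u where u: "u \<in> module_hom A P N" "\<forall>x\<in>carrier K. u (i x) = h (q' x)"
    using ext[OF module_hom_comp[OF q'(1) h]] by blast
  let ?s = "\<lambda>(x, x'). f x \<oplus>\<^bsub>Y\<^esub> q x'" and ?t = "\<lambda>(x, x'). h x \<oplus>\<^bsub>N\<^esub> u x'"
  have "\<exists>h'\<in>module_hom A Y N. \<forall>z\<in>carrier (prod_module X P). h' (?s z) = ?t z"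
  proof (rule factor_through_surj)
    show "right_module A (prod_module X P)" by (rule right_module_prod[OF E'(10) E(11)])
    show "?s \<in> module_hom A (prod_module X P) Y" by (rule module_hom_prod[OF E'(11) E'(4) q(1)])
    show "?t \<in> module_hom A (prod_module X P) N" by (rule module_hom_prod[OF rN h u(1)])
    show "?s ` carrier (prod_module X P) = carrier Y"
    proof
      show "?s ` carrier (prod_module X P) \<subseteq> carrier Y"
        using module_hom_closed[OF E'(4)] module_hom_closed[OF q(1)] by auto
      show "carrier Y \<subseteq> ?s ` carrier (prod_module X P)"
      proof
        fix y assume y: "y \<in> carrier Y"
        have "g y \<in> p ` carrier P" using E(7) module_hom_closed[OF E'(6) y] by simp
        then obtain x' where x': "x' \<in> carrier P" "g y = p x'" by blast
        have c: "q x' \<in> carrier Y" by (rule module_hom_closed[OF q(1) x'(1)])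
        have "g (y \<ominus>\<^bsub>Y\<^esub> q x') = g y \<ominus>\<^bsub>M\<^esub> g (q x')" by (rule module_hom_minus[OF E'(11,12,6) y c])
        also have "\<dots> = \<zero>\<^bsub>M\<^esub>"
          using x' q(2) module_hom_closed[OF E(6) x'(1)] by (simp add: M.M.minus_self)
        finally obtain x where x: "x \<in> carrier X" "y \<ominus>\<^bsub>Y\<^esub> q x' = f x"
          using E'(8)[of "y \<ominus>\<^bsub>Y\<^esub> q x'"] y c by auto
        have "y = ?s (x, x')" using x(2)[symmetric] y c by (simp add: Y.M.minus_add_cancel)
        then show "y \<in> ?s ` carrier (prod_module X P)" by (rule image_eqI) (use x(1) x'(1) in simp)
      qed
    qed
  next
    fix z assume "z \<in> carrier (prod_module X P)" and z0: "?s z = \<zero>\<^bsub>Y\<^esub>"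
    then obtain x x' where z: "z = (x, x')" "x \<in> carrier X" "x' \<in> carrier P" by auto
    note c = module_hom_closed[OF E'(4) z(2)] module_hom_closed[OF q(1) z(3)]
    have fx: "f x \<oplus>\<^bsub>Y\<^esub> q x' = \<zero>\<^bsub>Y\<^esub>" using z0 z by simp
    have "g (f x \<oplus>\<^bsub>Y\<^esub> q x') = g (f x) \<oplus>\<^bsub>M\<^esub> g (q x')" using c by (simp add: module_hom_add[OF E'(6)])
    moreover have "g (q x') = p x'" using q(2) z(3) by blast
    moreover have "p x' \<in> carrier M" by (rule module_hom_closed[OF E(6) z(3)])
    ultimately have "p x' = \<zero>\<^bsub>M\<^esub>"
      unfolding fx E'(9)[OF z(2)] module_hom_zero[OF E'(11,12,6)] by simp
    from E(8)[OF z(3) this] obtain \<kappa> where \<kappa>: "\<kappa> \<in> carrier K" "x' = i \<kappa>" by (elim imageE)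
    have qc: "q' \<kappa> \<in> carrier X" by (rule module_hom_closed[OF q'(1) \<kappa>(1)])
    interpret X: right_module A X by (rule E'(10))
    have "f (x \<oplus>\<^bsub>X\<^esub> q' \<kappa>) = f \<zero>\<^bsub>X\<^esub>"
      using fx \<kappa> q'(2) z(2) qc by (simp add: module_hom_add[OF E'(4)] module_hom_zero[OF E'(10,11,4)])
    then have "x \<oplus>\<^bsub>X\<^esub> q' \<kappa> = \<zero>\<^bsub>X\<^esub>" by (rule inj_onD[OF E'(5)]) (use z(2) qc in simp_all)
    then have "h (x \<oplus>\<^bsub>X\<^esub> q' \<kappa>) = \<zero>\<^bsub>N\<^esub>" using module_hom_zero[OF E'(10) rN h] by simp
    then show "?t z = \<zero>\<^bsub>N\<^esub>" using z(1,2) \<kappa> u(2) qc by (simp add: module_hom_add[OF h])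
  qed (use E'(11) rN in auto)
  then obtain h' where h': "h' \<in> module_hom A Y N"
    "\<And>x x'. x \<in> carrier X \<Longrightarrow> x' \<in> carrier P \<Longrightarrow> h' (f x \<oplus>\<^bsub>Y\<^esub> q x') = h x \<oplus>\<^bsub>N\<^esub> u x'" by auto
  have "h' (f x) = h x" if x: "x \<in> carrier X" for x
  proof -
    interpret P: right_module A P by (rule E(11))
    show ?thesis
      using h'(2)[OF x P.M.zero_closed] module_hom_zero[OF E(11) E'(11) q(1)] module_hom_zero[OF E(11) rN u(1)]
        module_hom_closed[OF E'(4) x] module_hom_closed[OF h x] by simp
  qed
  then show "\<exists>h'\<in>module_hom A Y N. \<forall>x\<in>carrier X. h' (f x) = h x" using h'(1) by blast
qed

text \<open>The dual use of vanishing, in the second variable. Projectivity lifts the map on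
  \<open>P\<close>; the lift restricted to \<open>K\<close> has values in \<open>N'\<close>, and
  subtracting an extension of this restriction to \<open>P\<close> makes the lift descend to
  \<open>M\<close>.\<close>

lemma ext1_zero_lift:
  fixes N' N N'' :: "'a umodule"
  assumes M: "fg_module A M" and ext: "ext1_zero M N'" and e: "short_exact A N' a N b N''" and h: "h \<in> module_hom A M N''"
  obtains h' where "h' \<in> module_hom A M N" "\<And>x. x \<in> carrier M \<Longrightarrow> b (h' x) = h x"
proof -
  obtain K P :: "'a umodule" and i p where P: "projective_module A P" and e': "short_exact A K i P p M"
    by (rule presentation_exists[OF M])
  note E = short_exactD[OF e] and E' = short_exactD[OF e']
  interpret N: right_module A N by (rule E(11))
  interpret N'': right_module A N'' by (rule E(12))
  obtain u where u: "u \<in> module_hom A P N" "\<forall>x\<in>carrier P. b (u x) = h (p x)"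
    using projective_moduleD[OF P E(2,3,6,7) module_hom_comp[OF E'(6) h]] by blast
  have "\<exists>v\<in>module_hom A K N'. \<forall>x\<in>carrier K. a (v x) = u (i x)"
    by (rule short_exact_lift[OF e E'(10) module_hom_comp[OF E'(4) u(1)]])
      (use u(2) E'(9) module_hom_closed[OF E'(4)] module_hom_zero[OF E'(12) E(12) h] in simp)
  then obtain v where v: "v \<in> module_hom A K N'" "\<forall>x\<in>carrier K. a (v x) = u (i x)" by blast
  obtain w where w: "w \<in> module_hom A P N'" "\<And>x. x \<in> carrier K \<Longrightarrow> w (i x) = v x"
    by (rule ext1_zeroD[OF ext e' v(1)]) blast
  have d: "(\<lambda>x. u x \<ominus>\<^bsub>N\<^esub> a (w x)) \<in> module_hom A P N"
    by (rule module_hom_diff[OF E'(11) E(11) u(1) module_hom_comp[OF w(1) E(4)]])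
  have "\<exists>h'\<in>module_hom A M N. \<forall>x\<in>carrier P. h' (p x) = u x \<ominus>\<^bsub>N\<^esub> a (w x)"
    by (rule short_exact_factor[OF e' E(11) d])
      (use w(2) v(2) module_hom_closed[OF u(1)] module_hom_closed[OF E'(4)] in \<open>simp add: N.M.minus_self\<close>)
  then obtain h' where h': "h' \<in> module_hom A M N" "\<forall>x\<in>carrier P. h' (p x) = u x \<ominus>\<^bsub>N\<^esub> a (w x)" by blast
  show thesis
  proof (rule that[OF h'(1)])
    fix m assume "m \<in> carrier M"
    then obtain x where x: "x \<in> carrier P" "m = p x" using E'(7) by blast
    note c = module_hom_closed[OF u(1) x(1)] module_hom_closed[OF w(1) x(1)]
    have "b (u x \<ominus>\<^bsub>N\<^esub> a (w x)) = b (u x) \<ominus>\<^bsub>N''\<^esub> b (a (w x))"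
      using c module_hom_closed[OF E(4)] by (intro module_hom_minus[OF E(11,12,6)]) auto
    also have "\<dots> = h m" using u(2) x c E(9) module_hom_closed[OF E(6)] 
      by (simp add: a_minus_def N''.M.neg_zero) (metis N''.M.r_zero c(1) module_hom_closed[OF E(6)])
    finally show "b (h' m) = h m" using h'(2) x by simp
  qed
qed

lemma ext1_zero_projective:
  assumes P: "projective_module A P" and N: "fg_module A N"
  shows "ext1_zero P N"
proof -
  have fP: "fg_module A P" by (rule projective_fg[OF P])
  show ?thesis unfolding ext1_zero_def
  proof (intro allI impI, elim conjE)
    fix X Y :: "'a umodule" and f g h
    assume e: "short_exact A X f Y g P" and h: "h \<in> module_hom A X N"
    note E = short_exactD[OF e]
    interpret Y: right_module A Y by (rule E(11))
    obtain s where s: "s \<in> module_hom A P Y" "\<forall>x\<in>carrier P. g (s x) = x"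
      using projective_moduleD[OF P E(2,3,6,7) module_hom_id] by blast
    have d: "(\<lambda>y. y \<ominus>\<^bsub>Y\<^esub> s (g y)) \<in> module_hom A Y Y"
      by (rule module_hom_diff[OF E(11,11) module_hom_id module_hom_comp[OF E(6) s(1)]])
    have "\<exists>r\<in>module_hom A Y X. \<forall>y\<in>carrier Y. f (r y) = y \<ominus>\<^bsub>Y\<^esub> s (g y)"
    proof (rule short_exact_lift[OF e E(11) d])
      fix y assume y: "y \<in> carrier Y"
      have c: "g y \<in> carrier P" "s (g y) \<in> carrier Y"
        using y module_hom_closed[OF E(6)] module_hom_closed[OF s(1)] by auto
      interpret P: right_module A P by (rule E(12))
      show "g (y \<ominus>\<^bsub>Y\<^esub> s (g y)) = \<zero>\<^bsub>P\<^esub>"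
        using s(2) c y by (simp add: module_hom_minus[OF E(11,12,6)] P.M.minus_self)
    qed
    then obtain r where r: "r \<in> module_hom A Y X" "\<forall>y\<in>carrier Y. f (r y) = y \<ominus>\<^bsub>Y\<^esub> s (g y)" by blast
    have "r (f x) = x" if x: "x \<in> carrier X" for x
    proof (rule inj_onD[OF E(5)])
      have fx: "f x \<in> carrier Y" by (rule module_hom_closed[OF E(4) x])
      show "f (r (f x)) = f x"
        using r(2) fx E(9)[OF x] module_hom_zero[OF E(12,11) s(1)] by (simp add: a_minus_def Y.M.neg_zero)
      show "r (f x) \<in> carrier X" by (rule module_hom_closed[OF r(1) fx])
    qed fact
    then show "\<exists>h'\<in>module_hom A Y N. \<forall>x\<in>carrier X. h' (f x) = h x"
      by (intro bexI[OF _ module_hom_comp[OF r(1) h]]) simp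
  qed
qed

lemma ext1_zero_injective:
  assumes "injective_module A J"
  shows "ext1_zero M J"
  unfolding ext1_zero_def
proof (intro allI impI, elim conjE)
  fix X Y :: "'a umodule" and f g h
  assume e: "short_exact A X f Y g M" and h: "h \<in> module_hom A X J"
  then show "\<exists>h'\<in>module_hom A Y J. \<forall>x\<in>carrier X. h' (f x) = h x"
    using assms short_exactD[OF e] unfolding injective_module_def by blast
qed

text \<open>
  A short exact sequence \<open>X \<rightarrow> Y \<rightarrow> Z\<close> and a presentation of \<open>Y\<close> with syzygy \<open>K\<close> give a syzygy \<open>W\<close>
  of \<open>Z\<close> and a short exact sequence \<open>K \<rightarrow> W \<rightarrow> X\<close>. Iterating this rotation replaces the
  horseshoe lemma.
\<close>

lemma rotate:
  fixes X Y Z K P :: "'a umodule"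
  assumes e: "short_exact A X f Y g Z" and e': "short_exact A K i P p Y" and P: "projective_module A P"
  obtains W :: "'a umodule" and q where "short_exact A K i W q X" "short_exact A W (\<lambda>x. x) P (\<lambda>x. g (p x)) Z"
    "\<And>w. w \<in> carrier W \<Longrightarrow> f (q w) = p w"
proof -
  note E = short_exactD[OF e] and E' = short_exactD[OF e']
  have gp: "(\<lambda>x. g (p x)) \<in> module_hom A P Z" by (rule module_hom_comp[OF E'(6) E(6)])
  have "(\<lambda>x. g (p x)) ` carrier P = carrier Z" using E(7) E'(7) by (metis image_image)
  from kernel_exact[OF E'(2) E(3) gp this] have w: "short_exact A (restrict_module P {y \<in> carrier P. g (p y) = \<zero>\<^bsub>Z\<^esub>}) (\<lambda>x. x) P (\<lambda>x. g (p x)) Z" .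
  let ?W = "restrict_module P {y \<in> carrier P. g (p y) = \<zero>\<^bsub>Z\<^esub>}"
  note F = short_exactD[OF w]
  have pW: "p \<in> module_hom A ?W Y" using module_hom_comp[OF F(4) E'(6)] .
  have "\<exists>q\<in>module_hom A ?W X. \<forall>w\<in>carrier ?W. f (q w) = p w"
    by (rule short_exact_lift[OF e F(10) pW]) simp
  then obtain q where q: "q \<in> module_hom A ?W X" "\<forall>w\<in>carrier ?W. f (q w) = p w" by blast
  have iW: "i \<in> module_hom A K ?W"
  proof (rule module_homI)
    fix x assume "x \<in> carrier K"
    then show "i x \<in> carrier ?W"
      using module_hom_closed[OF E'(4)] E'(9) module_hom_zero[OF E(11,12,6)] by simp
  qed (simp_all add: module_hom_add[OF E'(4)] module_hom_smult[OF E'(4)])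
  have "short_exact A K i ?W q X"
    unfolding short_exact_def
  proof (intro conjI ballI)
    show "q ` carrier ?W = carrier X"
    proof
      show "carrier X \<subseteq> q ` carrier ?W"
      proof
        fix x assume x: "x \<in> carrier X"
        have "f x \<in> p ` carrier P" using E'(7) module_hom_closed[OF E(4) x] by simp
        then obtain y where y: "y \<in> carrier P" "f x = p y" by blast
        then have yW: "y \<in> carrier ?W" using E(9)[OF x] by simp
        have "q y = x" by (rule inj_onD[OF E(5)]) (use q y(2) yW x module_hom_closed[OF q(1)] in auto)
        then show "x \<in> q ` carrier ?W" using yW by blast
      qed
    qed (use module_hom_closed[OF q(1)] in auto)
  next
    fix y assume y: "y \<in> carrier ?W"
    have "q y = \<zero>\<^bsub>X\<^esub> \<longleftrightarrow> f (q y) = \<zero>\<^bsub>Y\<^esub>"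
      using inj_on_eq_iff[OF E(5), of "q y" "\<zero>\<^bsub>X\<^esub>"] module_hom_closed[OF q(1) y] module_hom_zero[OF E(10,11,4)]
        right_module.submodule_zero[OF E(10)] right_module.rm_submoduleD(1)[OF E(10)] by auto
    then show "q y = \<zero>\<^bsub>X\<^esub> \<longleftrightarrow> y \<in> i ` carrier K" using q(2) y E'(8,9) by auto
  qed (use E'(1,5) E(1) F(1) iW q(1) in simp_all)
  moreover have "f (q w) = p w" if "w \<in> carrier ?W" for w using q(2) that by blast
  ultimately show thesis by (rule that[OF _ w])
qed

end

section \<open>Pieces of the long exact sequences in vanishing form\<close>

context artin_algebra
begin

text \<open>The exact piece \<open>Hom(Y, N) -> Hom(X, N) -> Ext^1(Z, N) -> Ext^1(Y, N)\<close>.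
  After rotation a map on the syzygy \<open>W\<close> of \<open>Z\<close> is corrected by a map from
  \<open>P\<close> until it vanishes on \<open>K\<close>; it then comes from \<open>X\<close> and
  extends through \<open>Y\<close>.\<close>

lemma ext1_zero_third:
  fixes X Y Z :: "'a umodule"
  assumes e: "short_exact A X f Y g Z" and Y: "ext1_zero Y N" and N: "fg_module A N"
    and ext: "\<And>h. h \<in> module_hom A X N \<Longrightarrow> \<exists>h'\<in>module_hom A Y N. \<forall>x\<in>carrier X. h' (f x) = h x"
  shows "ext1_zero Z N"
proof -
  note E = short_exactD[OF e]
  obtain K P :: "'a umodule" and i p where P: "projective_module A P" and e': "short_exact A K i P p Y"
    by (rule presentation_exists[OF E(2)])
  obtain W :: "'a umodule" and q where W: "short_exact A K i W q X" "short_exact A W (\<lambda>x. x) P (\<lambda>x. g (p x)) Z"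
    "\<And>w. w \<in> carrier W \<Longrightarrow> f (q w) = p w" by (rule rotate[OF e e' P]) blast
  note E' = short_exactD[OF e'] and F = short_exactD[OF W(1)] and G = short_exactD[OF W(2)]
  interpret N: right_module A N using N by (rule fg_module_right_module)
  note rN = N.right_module_axioms
  show ?thesis
  proof (rule ext1_zeroI_presentation[OF P W(2) N])
    fix h assume h: "h \<in> module_hom A W N"
    obtain u where u: "u \<in> module_hom A P N" "\<And>x. x \<in> carrier K \<Longrightarrow> u (i x) = h (i x)"
      by (rule ext1_zeroD[OF Y e' module_hom_comp[OF F(4) h]]) blast
    have uW: "u \<in> module_hom A W N" using module_hom_comp[OF G(4) u(1)] .
    have d: "(\<lambda>w. h w \<ominus>\<^bsub>N\<^esub> u w) \<in> module_hom A W N"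
      by (rule module_hom_diff[OF F(11) rN h uW])
    have "\<exists>v\<in>module_hom A X N. \<forall>w\<in>carrier W. v (q w) = h w \<ominus>\<^bsub>N\<^esub> u w"
    proof (rule short_exact_factor[OF W(1) rN d])
      fix x assume x: "x \<in> carrier K"
      have "h (i x) \<in> carrier N" by (rule module_hom_closed[OF module_hom_comp[OF F(4) h] x])
      then show "h (i x) \<ominus>\<^bsub>N\<^esub> u (i x) = \<zero>\<^bsub>N\<^esub>" using u(2)[OF x] by (simp add: N.M.minus_self)
    qed
    then obtain v where v: "v \<in> module_hom A X N" "\<And>w. w \<in> carrier W \<Longrightarrow> v (q w) = h w \<ominus>\<^bsub>N\<^esub> u w" by blast
    obtain v' where v': "v' \<in> module_hom A Y N" "\<And>x. x \<in> carrier X \<Longrightarrow> v' (f x) = v x" using ext[OF v(1)] by blast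
    show "\<exists>h'\<in>module_hom A P N. \<forall>x\<in>carrier W. h' x = h x"
    proof (intro bexI ballI)
      show "(\<lambda>x. v' (p x) \<oplus>\<^bsub>N\<^esub> u x) \<in> module_hom A P N"
        by (rule module_hom_plus[OF E'(11) rN module_hom_comp[OF E'(6) v'(1)] u(1)])
      fix w assume w: "w \<in> carrier W"
      have "v' (p w) = v' (f (q w))" using W(3)[OF w] by simp
      also have "\<dots> = h w \<ominus>\<^bsub>N\<^esub> u w" using v'(2)[OF module_hom_closed[OF F(6) w]] v(2)[OF w] by simp
      finally show "v' (p w) \<oplus>\<^bsub>N\<^esub> u w = h w"
        using module_hom_closed[OF h w] module_hom_closed[OF uW w] by (simp add: N.M.minus_add_cancel)
    qed
  qed
qed

text \<open>The piece \<open>Ext^1(Y, N) -> Ext^1(X, N) -> Ext^2(Z, N)\<close>; the condition on all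
  syzygies of \<open>Z\<close> stands for the vanishing of the last term. Rotation reduces it to
  \<open>ext1_zero_third\<close> for \<open>K -> W -> X\<close>.\<close>

lemma ext1_zero_first:
  fixes X Y Z :: "'a umodule"
  assumes e: "short_exact A X f Y g Z" and Y: "ext1_zero Y N" and N: "fg_module A N"
    and K: "\<And>W. syzygy Z W \<Longrightarrow> ext1_zero W N"
  shows "ext1_zero X N"
proof -
  note E = short_exactD[OF e]
  obtain K P :: "'a umodule" and i p where P: "projective_module A P" and e': "short_exact A K i P p Y"
    by (rule presentation_exists[OF E(2)])
  obtain W :: "'a umodule" and q where W: "short_exact A K i W q X" "short_exact A W (\<lambda>x. x) P (\<lambda>x. g (p x)) Z"
    by (rule rotate[OF e e' P]) blast
  note G = short_exactD[OF W(2)]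
  have "ext1_zero W N" by (rule K) (use P W(2) in \<open>auto simp: syzygy_def\<close>)
  then show ?thesis
  proof (rule ext1_zero_third[OF W(1) _ N])
    fix h assume h: "h \<in> module_hom A K N"
    obtain u where u: "u \<in> module_hom A P N" "\<And>x. x \<in> carrier K \<Longrightarrow> u (i x) = h x"
      by (rule ext1_zeroD[OF Y e' h]) blast
    then show "\<exists>h'\<in>module_hom A W N. \<forall>x\<in>carrier K. h' (i x) = h x"
      using module_hom_comp[OF G(4) u(1)] by blast
  qed
qed

lemma ext1_zero_middle:
  fixes X Y Z :: "'a umodule"
  assumes e: "short_exact A X f Y g Z" and X: "ext1_zero X N" and Z: "ext1_zero Z N" and N: "fg_module A N"
  shows "ext1_zero Y N"
proof -
  note E = short_exactD[OF e]
  obtain K P :: "'a umodule" and i p where P: "projective_module A P" and e': "short_exact A K i P p Y"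
    by (rule presentation_exists[OF E(2)])
  obtain W :: "'a umodule" and q where W: "short_exact A K i W q X" "short_exact A W (\<lambda>x. x) P (\<lambda>x. g (p x)) Z"
    by (rule rotate[OF e e' P]) blast
  note F = short_exactD[OF W(1)]
  show ?thesis
  proof (rule ext1_zeroI_presentation[OF P e' N])
    fix h assume h: "h \<in> module_hom A K N"
    obtain u where u: "u \<in> module_hom A W N" "\<And>x. x \<in> carrier K \<Longrightarrow> u (i x) = h x"
      by (rule ext1_zeroD[OF X W(1) h]) blast
    obtain v where v: "v \<in> module_hom A P N" "\<And>x. x \<in> carrier W \<Longrightarrow> v x = u x"
      by (rule ext1_zeroD[OF Z W(2) u(1)]) blast
    show "\<exists>h'\<in>module_hom A P N. \<forall>x\<in>carrier K. h' (i x) = h x"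
      using u(2) v(2) module_hom_closed[OF F(4)] by (intro bexI[OF _ v(1)]) simp
  qed
qed

lemma ext1_zero_extension:
  fixes N' N N'' :: "'a umodule"
  assumes M: "fg_module A M" and e: "short_exact A N' a N b N''" and N': "ext1_zero M N'" and N'': "ext1_zero M N''"
  shows "ext1_zero M N"
proof -
  note E = short_exactD[OF e]
  obtain K P :: "'a umodule" and i p where P: "projective_module A P" and e': "short_exact A K i P p M"
    by (rule presentation_exists[OF M])
  note E' = short_exactD[OF e']
  interpret N: right_module A N by (rule E(11))
  interpret N'': right_module A N'' by (rule E(12))
  show ?thesis
  proof (rule ext1_zeroI_presentation[OF P e' E(2)])
    fix h assume h: "h \<in> module_hom A K N"
    obtain u where u: "u \<in> module_hom A P N''" "\<And>x. x \<in> carrier K \<Longrightarrow> u (i x) = b (h x)"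
      by (rule ext1_zeroD[OF N'' e' module_hom_comp[OF h E(6)]]) blast
    obtain t where t: "t \<in> module_hom A P N" "\<forall>x\<in>carrier P. b (t x) = u x"
      using projective_moduleD[OF P E(2,3,6,7) u(1)] by blast
    have ti: "(\<lambda>x. t (i x)) \<in> module_hom A K N" by (rule module_hom_comp[OF E'(4) t(1)])
    have d: "(\<lambda>x. h x \<ominus>\<^bsub>N\<^esub> t (i x)) \<in> module_hom A K N" by (rule module_hom_diff[OF E'(10) E(11) h ti])
    have "\<exists>v\<in>module_hom A K N'. \<forall>x\<in>carrier K. a (v x) = h x \<ominus>\<^bsub>N\<^esub> t (i x)"
    proof (rule short_exact_lift[OF e E'(10) d])
      fix x assume x: "x \<in> carrier K"
      note c = module_hom_closed[OF h x] module_hom_closed[OF ti x] module_hom_closed[OF E'(4) x]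
      show "b (h x \<ominus>\<^bsub>N\<^esub> t (i x)) = \<zero>\<^bsub>N''\<^esub>"
        using c u(2)[OF x] t(2) module_hom_closed[OF E(6) c(1)]
        by (simp add: module_hom_minus[OF E(11,12,6)] N''.M.minus_self)
    qed
    then obtain v where v: "v \<in> module_hom A K N'" "\<And>x. x \<in> carrier K \<Longrightarrow> a (v x) = h x \<ominus>\<^bsub>N\<^esub> t (i x)" by blast
    obtain w where w: "w \<in> module_hom A P N'" "\<And>x. x \<in> carrier K \<Longrightarrow> w (i x) = v x"
      by (rule ext1_zeroD[OF N' e' v(1)]) blast
    show "\<exists>h'\<in>module_hom A P N. \<forall>x\<in>carrier K. h' (i x) = h x"
    proof (intro bexI ballI)
      show "(\<lambda>x. a (w x) \<oplus>\<^bsub>N\<^esub> t x) \<in> module_hom A P N"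
        by (rule module_hom_plus[OF E'(11) E(11) module_hom_comp[OF w(1) E(4)] t(1)])
      fix x assume x: "x \<in> carrier K"
      show "a (w (i x)) \<oplus>\<^bsub>N\<^esub> t (i x) = h x"
        using w(2)[OF x] v(2)[OF x] module_hom_closed[OF h x] module_hom_closed[OF ti x]
        by (simp add: N.M.minus_add_cancel)
    qed
  qed
qed

text \<open>The piece \<open>Hom(M, N) -> Hom(M, N'') -> Ext^1(M, N') -> Ext^1(M, N)\<close>. A map
  into \<open>N'\<close> extends with values in \<open>N\<close>; the extension is corrected by
  lifting its composite with \<open>b\<close>, which factors through \<open>M\<close>.\<close>

lemma ext1_zero_kernel:
  fixes N' N N'' :: "'a umodule"
  assumes e: "short_exact A N' a N b N''" and N: "ext1_zero M N"
    and lift: "\<And>h. h \<in> module_hom A M N'' \<Longrightarrow> \<exists>h'\<in>module_hom A M N. \<forall>x\<in>carrier M. b (h' x) = h x"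
  shows "ext1_zero M N'"
  unfolding ext1_zero_def
proof (intro allI impI, elim conjE)
  fix X Y :: "'a umodule" and f g h
  assume e': "short_exact A X f Y g M" and h: "h \<in> module_hom A X N'"
  note E = short_exactD[OF e] and E' = short_exactD[OF e']
  interpret N: right_module A N by (rule E(11))
  interpret N'': right_module A N'' by (rule E(12))
  obtain u where u: "u \<in> module_hom A Y N" "\<And>x. x \<in> carrier X \<Longrightarrow> u (f x) = a (h x)"
    by (rule ext1_zeroD[OF N e' module_hom_comp[OF h E(4)]]) blast
  have "\<exists>v\<in>module_hom A M N''. \<forall>y\<in>carrier Y. v (g y) = b (u y)"
    by (rule short_exact_factor[OF e' E(12) module_hom_comp[OF u(1) E(6)]])
      (use u(2) E(9) module_hom_closed[OF h] in simp)
  then obtain v where v: "v \<in> module_hom A M N''" "\<And>y. y \<in> carrier Y \<Longrightarrow> v (g y) = b (u y)" by blast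
  obtain w where w: "w \<in> module_hom A M N" "\<And>x. x \<in> carrier M \<Longrightarrow> b (w x) = v x" using lift[OF v(1)] by blast
  have wg: "(\<lambda>y. w (g y)) \<in> module_hom A Y N" by (rule module_hom_comp[OF E'(6) w(1)])
  have d: "(\<lambda>y. u y \<ominus>\<^bsub>N\<^esub> w (g y)) \<in> module_hom A Y N" by (rule module_hom_diff[OF E'(11) E(11) u(1) wg])
  have "\<exists>h'\<in>module_hom A Y N'. \<forall>y\<in>carrier Y. a (h' y) = u y \<ominus>\<^bsub>N\<^esub> w (g y)"
  proof (rule short_exact_lift[OF e E'(11) d])
    fix y assume y: "y \<in> carrier Y"
    note c = module_hom_closed[OF u(1) y] module_hom_closed[OF wg y] module_hom_closed[OF E'(6) y]
    show "b (u y \<ominus>\<^bsub>N\<^esub> w (g y)) = \<zero>\<^bsub>N''\<^esub>"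
      using c v(2)[OF y] w(2)[OF c(3)] module_hom_closed[OF E(6) c(1)]
      by (simp add: module_hom_minus[OF E(11,12,6)] N''.M.minus_self)
  qed
  then obtain h' where h': "h' \<in> module_hom A Y N'" "\<And>y. y \<in> carrier Y \<Longrightarrow> a (h' y) = u y \<ominus>\<^bsub>N\<^esub> w (g y)" by blast
  have "h' (f x) = h x" if x: "x \<in> carrier X" for x
  proof (rule inj_onD[OF E(5)])
    have fx: "f x \<in> carrier Y" by (rule module_hom_closed[OF E'(4) x])
    have "a (h x) \<in> carrier N" by (rule module_hom_closed[OF module_hom_comp[OF h E(4)] x])
    then show "a (h' (f x)) = a (h x)"
      using h'(2)[OF fx] u(2)[OF x] E'(9)[OF x] module_hom_zero[OF E'(12) E(11) w(1)]
      by (simp add: a_minus_def N.M.neg_zero)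
    show "h' (f x) \<in> carrier N'" by (rule module_hom_closed[OF h'(1) fx])
    show "h x \<in> carrier N'" by (rule module_hom_closed[OF h x])
  qed
  then show "\<exists>h'\<in>module_hom A Y N'. \<forall>x\<in>carrier X. h' (f x) = h x" using h'(1) by blast
qed

text \<open>Maps from a syzygy extend to the projective module, where they lift. This provides the
  lifting hypothesis of \<open>ext1_zero_kernel\<close> in degrees above one.\<close>

lemma syzygy_hom_lift:
  fixes N N'' :: "'a umodule"
  assumes K: "syzygy M K" and N'': "ext1_zero M N''" and N: "fg_module A N" "fg_module A N''"
    and b: "b \<in> module_hom A N N''" "b ` carrier N = carrier N''" and h: "h \<in> module_hom A K N''"
  shows "\<exists>h'\<in>module_hom A K N. \<forall>x\<in>carrier K. b (h' x) = h x"
proof -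
  obtain P :: "'a umodule" and i p where P: "projective_module A P" and e: "short_exact A K i P p M"
    using K by (auto simp: syzygy_def)
  note E = short_exactD[OF e]
  obtain u where u: "u \<in> module_hom A P N''" "\<And>x. x \<in> carrier K \<Longrightarrow> u (i x) = h x"
    by (rule ext1_zeroD[OF N'' e h]) blast
  obtain t where t: "t \<in> module_hom A P N" "\<And>x. x \<in> carrier P \<Longrightarrow> b (t x) = u x"
    using projective_moduleD[OF P N b u(1)] by blast
  show ?thesis
    by (rule bexI[OF _ module_hom_comp[OF E(4) t(1)]])
      (use u(2) t(2) module_hom_closed[OF E(4)] in simp)
qed

text \<open>The piece \<open>Ext^1(M, N) -> Ext^1(M, N'') -> Ext^2(M, N')\<close>, with the last
  term written as Ext^1 of the syzygy \<open>K\<close>.\<close>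

lemma ext1_zero_cokernel:
  fixes N' N N'' :: "'a umodule"
  assumes M: "syzygy M K" and e: "short_exact A N' a N b N''" and N: "ext1_zero M N" and N': "ext1_zero K N'"
  shows "ext1_zero M N''"
proof -
  obtain P :: "'a umodule" and i p where P: "projective_module A P" and e': "short_exact A K i P p M"
    using M by (auto simp: syzygy_def)
  note E = short_exactD[OF e] and E' = short_exactD[OF e']
  show ?thesis
  proof (rule ext1_zeroI_presentation[OF P e' E(3)])
    fix h assume h: "h \<in> module_hom A K N''"
    obtain t where t: "t \<in> module_hom A K N" "\<And>x. x \<in> carrier K \<Longrightarrow> b (t x) = h x"
      by (rule ext1_zero_lift[OF E'(1) N' e h]) blast
    obtain u where u: "u \<in> module_hom A P N" "\<And>x. x \<in> carrier K \<Longrightarrow> u (i x) = t x"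
      by (rule ext1_zeroD[OF N e' t(1)]) blast
    show "\<exists>h'\<in>module_hom A P N''. \<forall>x\<in>carrier K. h' (i x) = h x"
      by (rule bexI[OF _ module_hom_comp[OF u(1) E(6)]]) (use t(2) u(2) in simp)
  qed
qed

text \<open>
  A module \<open>M\<close> with \<open>stable_summand M M'\<close> is a direct summand of a finite direct sum of copies of \<open>M'\<close>
  in the stable category. This relation passes to syzygies, so it yields at once that Ext does not
  depend on the resolution and that its vanishing passes from \<open>M'\<close> to \<open>add M'\<close>.
\<close>

definition stable_summand :: "'a umodule \<Rightarrow> 'a umodule \<Rightarrow> bool" where
  "stable_summand M M' \<longleftrightarrow> (\<exists>c (Q :: 'a umodule) v u. factors_add A M' M M c \<and> projective_module A Q \<and>
     v \<in> module_hom A M Q \<and> u \<in> module_hom A Q M \<and> (\<forall>x\<in>carrier M. x = c x \<oplus>\<^bsub>M\<^esub> u (v x)))"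

text \<open>\<open>C\<close> and \<open>k\<close> lift \<open>c\<close> to the presentation, one
  summand at a time. The final clause holds because \<open>k\<close> passes through
  \<open>K'\<close>: there a map into \<open>N\<close> extends to \<open>P'\<close> and is pulled
  back to \<open>P\<close>. It says that \<open>k\<close> acts as zero on Ext^1(M, N).\<close>

lemma factors_add_syzygy:
  fixes K P M K' P' M' :: "'a umodule"
  assumes P: "projective_module A P" and e: "short_exact A K i P p M"
    and P': "projective_module A P'" and e': "short_exact A K' i' P' p' M'"
    and c: "factors_add A M' M M c"
  shows "\<exists>C\<in>module_hom A P P. \<exists>k. factors_add A K' K K k \<and> (\<forall>x\<in>carrier P. p (C x) = c (p x)) \<and>
    (\<forall>x\<in>carrier K. i (k x) = C (i x)) \<and>
    (\<forall>N h. fg_module A N \<and> ext1_zero M' N \<and> h \<in> module_hom A K N \<longrightarrow> (\<exists>w\<in>module_hom A P N. \<forall>x\<in>carrier K. w (i x) = h (k x)))"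
  using c
proof (induction)
  case (zero c)
  note E = short_exactD[OF e]
  interpret P: right_module A P by (rule E(11))
  interpret K: right_module A K by (rule E(10))
  have 1: "factors_add A K' K K (\<lambda>x. \<zero>\<^bsub>K\<^esub>)" by (rule factors_add.zero) simp
  have 2: "\<forall>x\<in>carrier P. p \<zero>\<^bsub>P\<^esub> = c (p x)"
    using zero module_hom_closed[OF E(6)] module_hom_zero[OF E(11,12,6)] by simp
  have 3: "\<exists>w\<in>module_hom A P N. \<forall>x\<in>carrier K. w (i x) = h \<zero>\<^bsub>K\<^esub>"
    if "fg_module A N" "h \<in> module_hom A K N" for N :: "'a umodule" and h
    using module_hom_0[OF fg_module_right_module[OF that(1)]]
      module_hom_zero[OF E(10) fg_module_right_module[OF that(1)] that(2)] by (intro bexI) auto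
  show ?case
    by (rule bexI[OF _ module_hom_0[OF E(11)]], rule exI[of _ "\<lambda>x. \<zero>\<^bsub>K\<^esub>"])
      (use 1 2 3 module_hom_zero[OF E(10,11,4)] in auto)
next
  case (step c a b c')
  note E = short_exactD[OF e] and E' = short_exactD[OF e']
  interpret P: right_module A P by (rule E(11))
  interpret K: right_module A K by (rule E(10))
  from step.IH obtain C k where C: "C \<in> module_hom A P P" and k: "factors_add A K' K K k"
    and pC': "\<forall>x\<in>carrier P. p (C x) = c (p x)" and ik': "\<forall>x\<in>carrier K. i (k x) = C (i x)"
    and w': "\<forall>N h. fg_module A N \<and> ext1_zero M' N \<and> h \<in> module_hom A K N \<longrightarrow>
      (\<exists>w\<in>module_hom A P N. \<forall>x\<in>carrier K. w (i x) = h (k x))"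
    by (elim bexE exE conjE) (rule that)
  note pC = pC'[rule_format] and ik = ik'[rule_format]
  have w: "\<exists>w\<in>module_hom A P N. \<forall>x\<in>carrier K. w (i x) = h (k x)"
    if "fg_module A N" "ext1_zero M' N" "h \<in> module_hom A K N" for N :: "'a umodule" and h
    using that by (intro w'[rule_format] conjI)
  obtain \<alpha> where \<alpha>: "\<alpha> \<in> module_hom A P P'" "\<And>x. x \<in> carrier P \<Longrightarrow> p' (\<alpha> x) = a (p x)"
    using projective_moduleD[OF P E'(2,3,6,7) module_hom_comp[OF E(6) step.hyps(2)]] by blast
  obtain \<beta> where \<beta>: "\<beta> \<in> module_hom A P' P" "\<And>x. x \<in> carrier P' \<Longrightarrow> p (\<beta> x) = b (p' x)"
    using projective_moduleD[OF P' E(2,3,6,7) module_hom_comp[OF E'(6) step.hyps(3)]] by blast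
  have "\<exists>a'\<in>module_hom A K K'. \<forall>x\<in>carrier K. i' (a' x) = \<alpha> (i x)"
    by (rule short_exact_lift[OF e' E(10) module_hom_comp[OF E(4) \<alpha>(1)]])
      (use \<alpha>(2) E(9) module_hom_closed[OF E(4)] module_hom_zero[OF E(12) E'(12) step.hyps(2)] in simp)
  then obtain a' where a': "a' \<in> module_hom A K K'" "\<And>x. x \<in> carrier K \<Longrightarrow> i' (a' x) = \<alpha> (i x)" by blast
  have "\<exists>b'\<in>module_hom A K' K. \<forall>x\<in>carrier K'. i (b' x) = \<beta> (i' x)"
    by (rule short_exact_lift[OF e E'(10) module_hom_comp[OF E'(4) \<beta>(1)]])
      (use \<beta>(2) E'(9) module_hom_closed[OF E'(4)] module_hom_zero[OF E'(12) E(12) step.hyps(3)] in simp)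
  then obtain b' where b': "b' \<in> module_hom A K' K" "\<And>x. x \<in> carrier K' \<Longrightarrow> i (b' x) = \<beta> (i' x)" by blast
  have khom: "k \<in> module_hom A K K" by (rule factors_add_hom[OF E(10,10) k])
  note \<beta>\<alpha> = module_hom_comp[OF \<alpha>(1) \<beta>(1)] and b'a' = module_hom_comp[OF a'(1) b'(1)]
  let ?C = "\<lambda>x. \<beta> (\<alpha> x) \<oplus>\<^bsub>P\<^esub> C x" and ?k = "\<lambda>x. b' (a' x) \<oplus>\<^bsub>K\<^esub> k x"
  have 1: "?C \<in> module_hom A P P" by (rule module_hom_plus[OF E(11,11) \<beta>\<alpha> C])
  have 2: "factors_add A K' K K ?k" by (rule factors_add.step[OF k a'(1) b'(1)]) simp
  have 3: "p (?C x) = c' (p x)" if x: "x \<in> carrier P" for x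
    using module_hom_closed[OF \<beta>\<alpha> x] module_hom_closed[OF C x] \<beta>(2)[OF module_hom_closed[OF \<alpha>(1) x]] \<alpha>(2)[OF x] pC[OF x]
      step.hyps(4)[OF module_hom_closed[OF E(6) x]] by (simp add: module_hom_add[OF E(6)])
  have 4: "i (?k x) = ?C (i x)" if x: "x \<in> carrier K" for x
    using module_hom_closed[OF b'a' x] module_hom_closed[OF khom x] b'(2)[OF module_hom_closed[OF a'(1) x]] a'(2)[OF x] ik[OF x]
    by (simp add: module_hom_add[OF E(4)])
  have 5: "\<exists>w\<in>module_hom A P N. \<forall>x\<in>carrier K. w (i x) = h (?k x)"
    if N: "fg_module A N" "ext1_zero M' N" and h: "h \<in> module_hom A K N" for N :: "'a umodule" and h
  proof -
    have rN: "right_module A N" by (rule fg_module_right_module[OF N(1)])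
    obtain w0 where w0: "w0 \<in> module_hom A P N" "\<And>x. x \<in> carrier K \<Longrightarrow> w0 (i x) = h (k x)" using w[OF N h] by blast
    obtain w1 where w1: "w1 \<in> module_hom A P' N" "\<And>x. x \<in> carrier K' \<Longrightarrow> w1 (i' x) = h (b' x)"
      by (rule ext1_zeroD[OF N(2) e' module_hom_comp[OF b'(1) h]]) blast
    show ?thesis
    proof (intro bexI ballI)
      show "(\<lambda>x. w1 (\<alpha> x) \<oplus>\<^bsub>N\<^esub> w0 x) \<in> module_hom A P N"
        by (rule module_hom_plus[OF E(11) rN module_hom_comp[OF \<alpha>(1) w1(1)] w0(1)])
      fix x assume x: "x \<in> carrier K"
      show "w1 (\<alpha> (i x)) \<oplus>\<^bsub>N\<^esub> w0 (i x) = h (?k x)"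
        using w0(2)[OF x] w1(2)[OF module_hom_closed[OF a'(1) x]] a'(2)[OF x]
          module_hom_closed[OF b'a' x] module_hom_closed[OF khom x] by (simp add: module_hom_add[OF h])
    qed
  qed
  show ?case
    by (rule bexI[OF _ 1], rule exI[of _ ?k], intro conjI ballI allI impI, rule 2, erule 3, erule 4,
        elim conjE, rule 5)
qed

text \<open>The identity \<open>1 = c + u v\<close> of \<open>M\<close> is lifted to
  \<open>P\<close>. The error of the lift lies in the kernel of \<open>p\<close> and is therefore a
  map \<open>\<theta>\<close> into \<open>K\<close>; on \<open>K\<close> the term through the
  projective module \<open>Q\<close> vanishes, which leaves
  \<open>1 = \<kappa> + \<theta> i\<close>.\<close>

lemma stable_summand_presentation:
  fixes K P M K' P' M' :: "'a umodule"
  assumes st: "stable_summand M M'" and P: "projective_module A P" and e: "short_exact A K i P p M"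
    and P': "projective_module A P'" and e': "short_exact A K' i' P' p' M'"
  obtains \<kappa> \<theta> where "factors_add A K' K K \<kappa>" "\<theta> \<in> module_hom A P K"
    "\<And>x. x \<in> carrier K \<Longrightarrow> x = \<kappa> x \<oplus>\<^bsub>K\<^esub> \<theta> (i x)"
    "\<And>N h. fg_module A N \<Longrightarrow> ext1_zero M' N \<Longrightarrow> h \<in> module_hom A K N \<Longrightarrow>
      \<exists>w\<in>module_hom A P N. \<forall>x\<in>carrier K. w (i x) = h (\<kappa> x)"
proof -
  note E = short_exactD[OF e]
  interpret P: right_module A P by (rule E(11))
  interpret K: right_module A K by (rule E(10))
  interpret M: right_module A M by (rule E(12))
  obtain c and Q :: "'a umodule" and v u where c: "factors_add A M' M M c" and Q: "projective_module A Q"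
    and v: "v \<in> module_hom A M Q" and u: "u \<in> module_hom A Q M"
    and id': "\<forall>x\<in>carrier M. x = c x \<oplus>\<^bsub>M\<^esub> u (v x)"
    using st unfolding stable_summand_def by (elim exE conjE) (rule that)
  note id = id'[rule_format]
  from factors_add_syzygy[OF P e P' e' c] obtain C k where C: "C \<in> module_hom A P P" and k: "factors_add A K' K K k"
    and pC': "\<forall>x\<in>carrier P. p (C x) = c (p x)" and ik': "\<forall>x\<in>carrier K. i (k x) = C (i x)"
    and w': "\<forall>N h. fg_module A N \<and> ext1_zero M' N \<and> h \<in> module_hom A K N \<longrightarrow>
      (\<exists>w\<in>module_hom A P N. \<forall>x\<in>carrier K. w (i x) = h (k x))"
    by (elim bexE exE conjE) (rule that)
  note pC = pC'[rule_format] and ik = ik'[rule_format]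
  have w: "\<exists>w\<in>module_hom A P N. \<forall>x\<in>carrier K. w (i x) = h (k x)"
    if "fg_module A N" "ext1_zero M' N" "h \<in> module_hom A K N" for N :: "'a umodule" and h
    using that by (intro w'[rule_format] conjI)
  obtain u' where u': "u' \<in> module_hom A Q P" "\<And>x. x \<in> carrier Q \<Longrightarrow> p (u' x) = u x"
    using projective_moduleD[OF Q E(2,3,6,7) u] by blast
  have u'vp: "(\<lambda>x. u' (v (p x))) \<in> module_hom A P P"
    by (rule module_hom_comp[OF module_hom_comp[OF E(6) v] u'(1)])
  have s: "(\<lambda>x. C x \<oplus>\<^bsub>P\<^esub> u' (v (p x))) \<in> module_hom A P P" by (rule module_hom_plus[OF E(11,11) C u'vp])
  have d: "(\<lambda>x. x \<ominus>\<^bsub>P\<^esub> (C x \<oplus>\<^bsub>P\<^esub> u' (v (p x)))) \<in> module_hom A P P"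
    by (rule module_hom_diff[OF E(11,11) module_hom_id s])
  have "\<exists>\<theta>\<in>module_hom A P K. \<forall>x\<in>carrier P. i (\<theta> x) = x \<ominus>\<^bsub>P\<^esub> (C x \<oplus>\<^bsub>P\<^esub> u' (v (p x)))"
  proof (rule short_exact_lift[OF e E(11) d])
    fix x assume x: "x \<in> carrier P"
    note cl = module_hom_closed[OF C x] module_hom_closed[OF u'vp x] module_hom_closed[OF s x] module_hom_closed[OF E(6) x]
    have "p (C x \<oplus>\<^bsub>P\<^esub> u' (v (p x))) = p x"
      using cl pC[OF x] u'(2)[OF module_hom_closed[OF v cl(4)]] id[OF cl(4)] by (simp add: module_hom_add[OF E(6)])
    then show "p (x \<ominus>\<^bsub>P\<^esub> (C x \<oplus>\<^bsub>P\<^esub> u' (v (p x)))) = \<zero>\<^bsub>M\<^esub>"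
      using cl x by (simp add: module_hom_minus[OF E(11,12,6)] M.M.minus_self)
  qed
  then obtain \<theta> where \<theta>: "\<theta> \<in> module_hom A P K"
    "\<And>x. x \<in> carrier P \<Longrightarrow> i (\<theta> x) = x \<ominus>\<^bsub>P\<^esub> (C x \<oplus>\<^bsub>P\<^esub> u' (v (p x)))" by blast
  have khom: "k \<in> module_hom A K K" by (rule factors_add_hom[OF E(10,10) k])
  have "x = k x \<oplus>\<^bsub>K\<^esub> \<theta> (i x)" if x: "x \<in> carrier K" for x
  proof (rule inj_onD[OF E(5)])
    have ix: "i x \<in> carrier P" by (rule module_hom_closed[OF E(4) x])
    note cl = module_hom_closed[OF khom x] module_hom_closed[OF \<theta>(1) ix] module_hom_closed[OF C ix]
    have z: "u' (v (p (i x))) = \<zero>\<^bsub>P\<^esub>"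
    proof -
      have rQ: "right_module A Q" by (rule fg_module_right_module[OF projective_fg[OF Q]])
      show ?thesis using E(9)[OF x] module_hom_zero[OF E(12) rQ v] module_hom_zero[OF rQ E(11) u'(1)] by simp
    qed
    have "i (k x \<oplus>\<^bsub>K\<^esub> \<theta> (i x)) = C (i x) \<oplus>\<^bsub>P\<^esub> (i x \<ominus>\<^bsub>P\<^esub> C (i x))"
      using cl \<theta>(2)[OF ix] ik[OF x] z by (simp add: module_hom_add[OF E(4)])
    also have "\<dots> = i x" using cl ix by (simp add: P.M.a_comm[of "C (i x)"] P.M.minus_add_cancel)
    finally show "i x = i (k x \<oplus>\<^bsub>K\<^esub> \<theta> (i x))" by simp
    show "k x \<oplus>\<^bsub>K\<^esub> \<theta> (i x) \<in> carrier K" using cl by simp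
  qed fact
  with k \<theta>(1) show thesis using w by (rule that)
qed

lemma stable_summand_syzygy:
  assumes "stable_summand M M'" "syzygy M K" "syzygy M' K'"
  shows "stable_summand K K'"
proof -
  obtain P :: "'a umodule" and i p where P: "projective_module A P" "short_exact A K i P p M"
    using assms(2) by (auto simp: syzygy_def)
  obtain P' :: "'a umodule" and i' p' where P': "projective_module A P'" "short_exact A K' i' P' p' M'"
    using assms(3) by (auto simp: syzygy_def)
  obtain k \<theta> where "factors_add A K' K K k" "\<theta> \<in> module_hom A P K"
    "\<And>x. x \<in> carrier K \<Longrightarrow> x = k x \<oplus>\<^bsub>K\<^esub> \<theta> (i x)"
    by (rule stable_summand_presentation[OF assms(1) P P']) blast
  then show ?thesis unfolding stable_summand_def using P(1) short_exactD(4)[OF P(2)] by blast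
qed

lemma stable_summand_ext1_zero:
  assumes st: "stable_summand M M'" and M: "fg_module A M" "fg_module A M'" and N: "fg_module A N" "ext1_zero M' N"
  shows "ext1_zero M N"
proof -
  obtain K P :: "'a umodule" and i p where P: "projective_module A P" and e: "short_exact A K i P p M"
    by (rule presentation_exists[OF M(1)])
  obtain K' P' :: "'a umodule" and i' p' where P': "projective_module A P'" and e': "short_exact A K' i' P' p' M'"
    by (rule presentation_exists[OF M(2)])
  note E = short_exactD[OF e]
  obtain k \<theta> where k: "factors_add A K' K K k" and \<theta>: "\<theta> \<in> module_hom A P K"
    and id: "\<And>x. x \<in> carrier K \<Longrightarrow> x = k x \<oplus>\<^bsub>K\<^esub> \<theta> (i x)"
    and w: "\<And>N h. fg_module A N \<Longrightarrow> ext1_zero M' N \<Longrightarrow> h \<in> module_hom A K N \<Longrightarrow>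
      \<exists>w\<in>module_hom A P N. \<forall>x\<in>carrier K. w (i x) = h (k x)"
    by (rule stable_summand_presentation[OF st P e P' e']) blast
  have khom: "k \<in> module_hom A K K" by (rule factors_add_hom[OF E(10,10) k])
  have rN: "right_module A N" by (rule fg_module_right_module[OF N(1)])
  show ?thesis
  proof (rule ext1_zeroI_presentation[OF P e N(1)])
    fix h assume h: "h \<in> module_hom A K N"
    obtain w0 where w0: "w0 \<in> module_hom A P N" "\<And>x. x \<in> carrier K \<Longrightarrow> w0 (i x) = h (k x)" using w[OF N h] by blast
    show "\<exists>h'\<in>module_hom A P N. \<forall>x\<in>carrier K. h' (i x) = h x"
    proof (intro bexI ballI)
      show "(\<lambda>x. w0 x \<oplus>\<^bsub>N\<^esub> h (\<theta> x)) \<in> module_hom A P N"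
        by (rule module_hom_plus[OF E(11) rN w0(1) module_hom_comp[OF \<theta> h]])
      fix x assume x: "x \<in> carrier K"
      have "w0 (i x) \<oplus>\<^bsub>N\<^esub> h (\<theta> (i x)) = h (k x \<oplus>\<^bsub>K\<^esub> \<theta> (i x))"
        using w0(2)[OF x] module_hom_closed[OF khom x] module_hom_closed[OF \<theta> module_hom_closed[OF E(4) x]]
        by (simp add: module_hom_add[OF h])
      then show "w0 (i x) \<oplus>\<^bsub>N\<^esub> h (\<theta> (i x)) = h x" using id[OF x] by simp
    qed
  qed
qed

lemma stable_summandI:
  fixes V T :: "'a umodule"
  assumes "fg_module A V" "factors_add A T V V (\<lambda>x. x)"
  shows "stable_summand V T"
proof -
  interpret V: right_module A V by (rule fg_module_right_module[OF assms(1)])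
  \<comment> \<open>A projective module is wanted only as a target for zero maps, so any one will
    do.\<close>
  obtain P :: "'a umodule" and p where P: "projective_module A P" "p \<in> module_hom A P V"
    by (rule projective_presentation_exists[OF assms(1)])
  have "right_module A P" by (rule fg_module_right_module[OF projective_fg[OF P(1)]])
  then have 0: "(\<lambda>x. \<zero>\<^bsub>P\<^esub>) \<in> module_hom A V P" "(\<lambda>x. \<zero>\<^bsub>V\<^esub>) \<in> module_hom A P V"
    by (auto intro: module_hom_0 V.right_module_axioms)
  have "\<forall>x\<in>carrier V. x = x \<oplus>\<^bsub>V\<^esub> \<zero>\<^bsub>V\<^esub>" by simp
  with assms(2) P(1) 0 show ?thesis unfolding stable_summand_def by blast
qed

lemma stable_summand_refl:
  assumes "fg_module A V"
  shows "stable_summand V V"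
  using stable_summandI[OF assms factors_add_basic[OF fg_module_right_module[OF assms] module_hom_id module_hom_id]] .

lemma stable_summand_syzygy_pow:
  "stable_summand M M' \<Longrightarrow> (syzygy ^^ i) M K \<Longrightarrow> (syzygy ^^ i) M' K' \<Longrightarrow> stable_summand K K'"
proof (induction i arbitrary: K K')
  case (Suc i)
  obtain L L' where "(syzygy ^^ i) M L" "syzygy L K" "(syzygy ^^ i) M' L'" "syzygy L' K'"
    using Suc.prems(2,3) by (auto elim!: relpowp_Suc_E)
  then show ?case using Suc.IH[OF Suc.prems(1)] stable_summand_syzygy by blast
qed simp

lemma syzygy_pow_fg: "(syzygy ^^ i) M K \<Longrightarrow> fg_module A M \<Longrightarrow> fg_module A K"
  by (cases i) (auto elim!: relpowp_Suc_E dest: syzygy_fg)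

lemma syzygy_pow_exists: "fg_module A M \<Longrightarrow> \<exists>K. (syzygy ^^ i) M K"
proof (induction i)
  case (Suc i)
  then obtain K where "(syzygy ^^ i) M K" by blast
  with syzygy_exists[OF syzygy_pow_fg[OF this Suc.prems]] show ?case by auto
qed auto

text \<open>The shift of degrees: \<open>ext_zero i M N\<close> means that \<open>Ext\<close> vanishes in degree \<open>i + 1\<close>.\<close>

definition ext_zero :: "nat \<Rightarrow> 'a umodule \<Rightarrow> 'a umodule \<Rightarrow> bool" where
  "ext_zero i M N \<longleftrightarrow> (\<forall>K. (syzygy ^^ i) M K \<longrightarrow> ext1_zero K N)"

lemma ext_zero_0 [simp]: "ext_zero 0 M N \<longleftrightarrow> ext1_zero M N"
  by (auto simp: ext_zero_def)

lemma ext_zeroI_stable: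
  assumes "stable_summand M M'" "fg_module A M" "fg_module A M'" "fg_module A N" "(syzygy ^^ i) M' K" "ext1_zero K N"
  shows "ext_zero i M N"
  unfolding ext_zero_def
proof (intro allI impI)
  fix L assume L: "(syzygy ^^ i) M L"
  show "ext1_zero L N"
    by (rule stable_summand_ext1_zero[OF stable_summand_syzygy_pow[OF assms(1) L assms(5)]
      syzygy_pow_fg[OF L assms(2)] syzygy_pow_fg[OF assms(5,3)] assms(4,6)])
qed

text \<open>\<open>M\<close> is a stable summand of itself, so any two of its \<open>i\<close>-th
  syzygies are stable summands of one another, and testing a single one is enough.\<close>

lemma ext_zeroI:
  "fg_module A M \<Longrightarrow> fg_module A N \<Longrightarrow> (syzygy ^^ i) M K \<Longrightarrow> ext1_zero K N \<Longrightarrow> ext_zero i M N"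
  using ext_zeroI_stable[OF stable_summand_refl] by blast

lemma ext_zero_add:
  assumes "fg_module A V" "factors_add A T V V (\<lambda>x. x)" "fg_module A T" "fg_module A N" "ext_zero i T N"
  shows "ext_zero i V N"
proof -
  obtain K where "(syzygy ^^ i) T K" using syzygy_pow_exists[OF assms(3)] by blast
  moreover from this assms(5) have "ext1_zero K N" by (simp add: ext_zero_def)
  ultimately show ?thesis
    by (rule ext_zeroI_stable[OF stable_summandI[OF assms(1,2)] assms(1,3,4)])
qed

lemma ext_zero_Suc:
  assumes "syzygy M K" "fg_module A N"
  shows "ext_zero (Suc i) M N \<longleftrightarrow> ext_zero i K N"
proof
  assume "ext_zero (Suc i) M N"
  then show "ext_zero i K N" unfolding ext_zero_def using relpowp_Suc_I2[of syzygy, OF assms(1)] by blast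
next
  assume *: "ext_zero i K N"
  have K: "fg_module A M" "fg_module A K" using syzygy_fg[OF assms(1)] by auto
  obtain L where L: "(syzygy ^^ i) K L" using syzygy_pow_exists[OF K(2)] by blast
  show "ext_zero (Suc i) M N"
    by (rule ext_zeroI[OF K(1) assms(2) relpowp_Suc_I2[of syzygy, OF assms(1) L]]) (use * L in \<open>auto simp: ext_zero_def\<close>)
qed

text \<open>Two pieces of the long exact sequence, proved together because rotation exchanges them.
  One rotation reduces the first claim in degree \<open>Suc i\<close> to the second in degree
  \<open>i\<close>; two rotations reduce the second claim to the first.\<close>

lemma ext_zero_middle_first:
  assumes "fg_module A N"
  shows "(\<forall>(X :: 'a umodule) f (Y :: 'a umodule) g (Z :: 'a umodule). short_exact A X f Y g Z \<longrightarrow>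
      ext_zero i X N \<longrightarrow> ext_zero i Z N \<longrightarrow> ext_zero i Y N) \<and>
    (\<forall>(X :: 'a umodule) f (Y :: 'a umodule) g (Z :: 'a umodule). short_exact A X f Y g Z \<longrightarrow>
      ext_zero i Y N \<longrightarrow> ext_zero (Suc i) Z N \<longrightarrow> ext_zero i X N)"
proof (induction i)
  case 0
  show ?case
  proof (intro conjI allI impI)
    fix X Y Z :: "'a umodule" and f g
    assume e: "short_exact A X f Y g Z"
    show "ext_zero 0 Y N" if "ext_zero 0 X N" "ext_zero 0 Z N"
      using ext1_zero_middle[OF e _ _ assms] that by simp
    show "ext_zero 0 X N" if "ext_zero 0 Y N" "ext_zero (Suc 0) Z N"
      using ext1_zero_first[OF e _ assms] that ext_zero_Suc[OF _ assms, of Z _ 0] by simp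
  qed
next
  case (Suc i)
  have mid: "ext_zero i Y N" if "short_exact A X f Y g Z" "ext_zero i X N" "ext_zero i Z N"
    for X Y Z :: "'a umodule" and f g using Suc.IH that by blast
  have fst: "ext_zero i X N" if "short_exact A X f Y g Z" "ext_zero i Y N" "ext_zero (Suc i) Z N"
    for X Y Z :: "'a umodule" and f g using Suc.IH that by blast
  have mid': "ext_zero (Suc i) Y N"
    if e: "short_exact A X f Y g Z" and XZ: "ext_zero (Suc i) X N" "ext_zero (Suc i) Z N"
    for X Y Z :: "'a umodule" and f g
  proof -
    obtain K P :: "'a umodule" and s p where P: "projective_module A P" and e': "short_exact A K s P p Y"
      by (rule presentation_exists[OF short_exactD(2)[OF e]])
    obtain W :: "'a umodule" and q where W: "short_exact A K s W q X" "short_exact A W (\<lambda>x. x) P (\<lambda>x. g (p x)) Z"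
      by (rule rotate[OF e e' P]) blast
    have "syzygy Z W" "syzygy Y K" using P e' W(2) by (auto simp: syzygy_def)
    then show ?thesis using fst[OF W(1)] XZ ext_zero_Suc[OF _ assms] by blast
  qed
  have fst': "ext_zero (Suc i) X N"
    if e: "short_exact A X f Y g Z" and YZ: "ext_zero (Suc i) Y N" "ext_zero (Suc (Suc i)) Z N"
    for X Y Z :: "'a umodule" and f g
  proof -
    obtain K P :: "'a umodule" and s p where P: "projective_module A P" and e': "short_exact A K s P p Y"
      by (rule presentation_exists[OF short_exactD(2)[OF e]])
    obtain W :: "'a umodule" and q where W: "short_exact A K s W q X" "short_exact A W (\<lambda>x. x) P (\<lambda>x. g (p x)) Z"
      by (rule rotate[OF e e' P]) blast
    obtain K' P' :: "'a umodule" and s' p' where P': "projective_module A P'" and e'': "short_exact A K' s' P' p' W"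
      by (rule presentation_exists[OF short_exactD(2)[OF W(1)]])
    obtain W' :: "'a umodule" and q' where W': "short_exact A K' s' W' q' K" "short_exact A W' (\<lambda>x. x) P' (\<lambda>x. q (p' x)) X"
      by (rule rotate[OF W(1) e'' P']) blast
    have s: "syzygy Z W" "syzygy Y K" "syzygy W K'" "syzygy X W'"
      using P e' W(2) P' e'' W'(2) by (auto simp: syzygy_def)
    show ?thesis using mid[OF W'(1)] YZ s ext_zero_Suc[OF _ assms] by blast
  qed
  show ?case using mid' fst' by blast
qed

lemma ext_zero_first:
  fixes X Y Z :: "'a umodule"
  assumes "short_exact A X f Y g Z" "fg_module A N" "ext_zero i Y N" "ext_zero (Suc i) Z N"
  shows "ext_zero i X N"
  using ext_zero_middle_first[OF assms(2)] assms by blast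

lemma ext_zero_extension:
  fixes N' N N'' :: "'a umodule"
  assumes "fg_module A M" "short_exact A N' a N b N''" "ext_zero i M N'" "ext_zero i M N''"
  shows "ext_zero i M N"
  unfolding ext_zero_def
proof (intro allI impI)
  fix K assume K: "(syzygy ^^ i) M K"
  show "ext1_zero K N"
    by (rule ext1_zero_extension[OF syzygy_pow_fg[OF K assms(1)] assms(2)]) (use assms(3,4) K in \<open>auto simp: ext_zero_def\<close>)
qed

lemma ext_zero_cokernel:
  fixes N' N N'' :: "'a umodule"
  assumes "fg_module A M" "short_exact A N' a N b N''" "ext_zero i M N" "ext_zero (Suc i) M N'"
  shows "ext_zero i M N''"
  unfolding ext_zero_def
proof (intro allI impI)
  fix K assume K: "(syzygy ^^ i) M K"
  obtain L where L: "syzygy K L" using syzygy_exists[OF syzygy_pow_fg[OF K assms(1)]] by blast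
  have "(syzygy ^^ Suc i) M L" using K L by auto
  then show "ext1_zero K N''"
    using ext1_zero_cokernel[OF L assms(2)] assms(3,4) K unfolding ext_zero_def by blast
qed

text \<open>In the lowest degree the required lifting is the hypothesis on maps from
  \<open>M\<close>. In higher degrees it follows from the vanishing for \<open>N''\<close> one
  degree below.\<close>

lemma ext_zero_kernel:
  fixes N' N N'' :: "'a umodule"
  assumes M: "fg_module A M" and e: "short_exact A N' a N b N''"
    and N: "\<And>i. ext_zero i M N" and N'': "\<And>i. ext_zero i M N''"
    and lift: "\<And>h. h \<in> module_hom A M N'' \<Longrightarrow> \<exists>h'\<in>module_hom A M N. \<forall>x\<in>carrier M. b (h' x) = h x"
  shows "ext_zero i M N'"
  unfolding ext_zero_def
proof (intro allI impI)
  fix K assume K: "(syzygy ^^ i) M K"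
  note E = short_exactD[OF e]
  have KN: "ext1_zero K N" using N K unfolding ext_zero_def by blast
  show "ext1_zero K N'"
  proof (cases i)
    case 0
    then show ?thesis using ext1_zero_kernel[OF e KN] lift K by simp
  next
    case (Suc l)
    then obtain L where L: "(syzygy ^^ l) M L" "syzygy L K" using K by (auto elim!: relpowp_Suc_E)
    have "ext1_zero L N''" using N'' L(1) unfolding ext_zero_def by blast
    then show ?thesis
      using syzygy_hom_lift[OF L(2) _ E(2,3,6,7)] by (intro ext1_zero_kernel[OF e KN]) blast
  qed
qed

end

section \<open>Resolutions, dimensions and Ext groups\<close>

text \<open>When the subset is the whole carrier, closure and solvability of equations force every
  coset to be that subset. This reaches the quotient directly, without first making the cocycles a
  group.\<close>

lemma trivial_group_factgroupI:
  assumes "B \<noteq> {}" "carrier G = B" "\<And>x y. x \<in> B \<Longrightarrow> y \<in> B \<Longrightarrow> x \<otimes>\<^bsub>G\<^esub> y \<in> B"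
    "\<And>x z. x \<in> B \<Longrightarrow> z \<in> B \<Longrightarrow> \<exists>y\<in>B. y \<otimes>\<^bsub>G\<^esub> x = z"
  shows "trivial_group (G Mod B)"
proof -
  have coset: "B #>\<^bsub>G\<^esub> x = B" if "x \<in> B" for x
    using assms(3,4) that by (fastforce simp: r_coset_def)
  have car: "carrier (G Mod B) = {B}"
    using assms(1,2) coset by (auto simp: FactGroup_def RCOSETS_def)
  have mul: "B <#>\<^bsub>G\<^esub> B = B"
    using assms(1,3,4) by (fastforce simp: set_mult_def)
  have ops: "B \<otimes>\<^bsub>G Mod B\<^esub> B = B" "\<one>\<^bsub>G Mod B\<^esub> = B" by (simp_all add: FactGroup_def mul)
  have "group (G Mod B)"
    by (rule groupI) (simp_all add: car ops mul)
  then show ?thesis by (simp add: trivial_group_def car ops)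
qed

context artin_algebra
begin

lemma projective_resolutionD:
  assumes "projective_resolution A M P e d"
  shows "fg_module A M" "projective_module A (P i)" "e \<in> module_hom A (P 0) M" "e ` carrier (P 0) = carrier M"
    "d i \<in> module_hom A (P (Suc i)) (P i)"
    "d 0 ` carrier (P (Suc 0)) = {x \<in> carrier (P 0). e x = \<zero>\<^bsub>M\<^esub>}"
    "d (Suc i) ` carrier (P (Suc (Suc i))) = {x \<in> carrier (P (Suc i)). d i x = \<zero>\<^bsub>P i\<^esub>}"
proof -
  have r: "right_exact_seq A m M P e d" for m
    using assms by (simp add: projective_resolution_def resolution_def)
  show "fg_module A M" "e \<in> module_hom A (P 0) M" "e ` carrier (P 0) = carrier M"
    using r[of 1] by (simp_all add: right_exact_seq_def)
  show "projective_module A (P i)" using assms by (simp add: projective_resolution_def)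
  have *: "d i \<in> module_hom A (P (Suc i)) (P i) \<and> d i ` carrier (P (Suc i)) =
    (case i of 0 \<Rightarrow> a_kernel (P 0) M e | Suc j \<Rightarrow> a_kernel (P (Suc j)) (P j) (d j))" for i
    using r[of "Suc (Suc i)"] by (simp add: right_exact_seq_def)
  show "d i \<in> module_hom A (P (Suc i)) (P i)" using * by blast
  show "d 0 ` carrier (P (Suc 0)) = {x \<in> carrier (P 0). e x = \<zero>\<^bsub>M\<^esub>}"
    using *[of 0] by (simp add: a_kernel_def')
  show "d (Suc i) ` carrier (P (Suc (Suc i))) = {x \<in> carrier (P (Suc i)). d i x = \<zero>\<^bsub>P i\<^esub>}"
    using *[of "Suc i"] by (simp add: a_kernel_def')
qed

definition resolution_syzygy :: "'a umodule \<Rightarrow> (nat \<Rightarrow> 'a umodule) \<Rightarrow>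
    (nat \<Rightarrow> (nat \<Rightarrow> 'a) set \<Rightarrow> (nat \<Rightarrow> 'a) set) \<Rightarrow> nat \<Rightarrow> 'a umodule" where
  "resolution_syzygy M P d j = (case j of 0 \<Rightarrow> M | Suc l \<Rightarrow> restrict_module (P l) (d l ` carrier (P (Suc l))))"

lemma resolution_syzygy_exact:
  assumes r: "projective_resolution A M P e d"
  shows "short_exact A (resolution_syzygy M P d (Suc j)) (\<lambda>x. x) (P j) (case j of 0 \<Rightarrow> e | Suc l \<Rightarrow> d l)
    (resolution_syzygy M P d j)"
proof (cases j)
  case 0
  show ?thesis
    using kernel_exact[OF projective_fg[OF projective_resolutionD(2)[OF r]] projective_resolutionD(1,3,4)[OF r]]
    by (simp add: 0 resolution_syzygy_def projective_resolutionD(6)[OF r])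
next
  case (Suc l)
  note R = projective_resolutionD[OF r]
  have fg: "fg_module A (P i)" for i by (rule projective_fg[OF R(2)])
  have rm: "right_module A (P i)" for i by (rule fg_module_right_module[OF fg])
  have sub: "submodule (d l ` carrier (P (Suc l))) A (P l)"
    by (rule submodule_image[OF rm rm R(5) right_module.submodule_carrier[OF rm]])
  have "d l \<in> module_hom A (P (Suc l)) (restrict_module (P l) (d l ` carrier (P (Suc l))))"
    using R(5)[of l] by (simp add: module_hom_def)
  from kernel_exact[OF fg fg_module_restrict[OF fg sub] this]
  show ?thesis by (simp add: Suc resolution_syzygy_def R(7))
qed

lemma resolution_syzygy_pow:
  assumes r: "projective_resolution A M P e d"
  shows "(syzygy ^^ j) M (resolution_syzygy M P d j)"
proof (induction j)
  case 0
  show ?case by (simp add: resolution_syzygy_def)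
next
  case (Suc j)
  then show ?case
    using resolution_syzygy_exact[OF r, of j] projective_resolutionD(2)[OF r]
    by (auto simp: syzygy_def)
qed

text \<open>A presentation is chosen for all modules at once, so that the syzygy becomes a function
  \<open>Om\<close> that can be iterated. Existence also gives the choice inside \<open>Ext\<close>
  its meaning.\<close>

lemma projective_resolution_exists:
  fixes M :: "'a umodule"
  assumes "fg_module A M"
  shows "\<exists>P e d. projective_resolution A M P e d"
proof -
  have "\<forall>N :: 'a umodule. \<exists>Pp. fg_module A N \<longrightarrow> projective_module A (fst Pp :: 'a umodule) \<and>
    snd Pp \<in> module_hom A (fst Pp) N \<and> snd Pp ` carrier (fst Pp) = carrier N"
  proof (intro allI)
    fix N :: "'a umodule"
    show "\<exists>Pp. fg_module A N \<longrightarrow> projective_module A (fst Pp :: 'a umodule) \<and>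
      snd Pp \<in> module_hom A (fst Pp) N \<and> snd Pp ` carrier (fst Pp) = carrier N"
    proof (cases "fg_module A N")
      case True
      obtain P :: "'a umodule" and p where "projective_module A P" "p \<in> module_hom A P N" "p ` carrier P = carrier N"
        by (rule projective_presentation_exists[OF True])
      then show ?thesis by (intro exI[of _ "(P, p)"]) simp
    qed simp
  qed
  then obtain C where C: "\<And>N :: 'a umodule. fg_module A N \<Longrightarrow> projective_module A (fst (C N) :: 'a umodule) \<and>
    snd (C N) \<in> module_hom A (fst (C N)) N \<and> snd (C N) ` carrier (fst (C N)) = carrier N" by metis
  define Om where "Om N = restrict_module (fst (C N)) {y \<in> carrier (fst (C N)). snd (C N) y = \<zero>\<^bsub>N\<^esub>}" for N
  have ex: "short_exact A (Om N) (\<lambda>y. y) (fst (C N)) (snd (C N)) N" if "fg_module A N" for N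
    unfolding Om_def by (rule kernel_exact) (use C[OF that] that projective_fg in auto)
  define K where "K j = (Om ^^ j) M" for j
  have fgK: "fg_module A (K j)" for j
  proof (induction j)
    case (Suc j)
    then show ?case using short_exactD(1)[OF ex] by (simp add: K_def)
  qed (simp add: K_def assms)
  note E = short_exactD[OF ex[OF fgK]]
  have K: "K (Suc j) = Om (K j)" "K 0 = M" for j by (simp_all add: K_def)
  define P where "P j = fst (C (K j))" for j
  define d where "d j = snd (C (K (Suc j)))" for j
  have zeroK: "\<zero>\<^bsub>K (Suc j)\<^esub> = \<zero>\<^bsub>P j\<^esub>" and carK: "carrier (K (Suc j)) = {y \<in> carrier (P j). snd (C (K j)) y = \<zero>\<^bsub>K j\<^esub>}" for j
    by (simp_all add: K Om_def P_def)
  have hom: "d j \<in> module_hom A (P (Suc j)) (P j)" for j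
    using module_hom_comp[OF E(6)[of "Suc j"] E(4)[of j, folded K]] by (simp add: d_def P_def)
  have im: "d j ` carrier (P (Suc j)) = {y \<in> carrier (P j). snd (C (K j)) y = \<zero>\<^bsub>K j\<^esub>}" for j
    using E(7)[of "Suc j"] by (simp add: d_def P_def carK)
  have "projective_resolution A M P (snd (C M)) d"
    unfolding projective_resolution_def resolution_def right_exact_seq_def
  proof (intro conjI allI impI)
    fix m i :: nat
    show "fg_module A M" by (rule assms)
    show proj: "projective_module A (P i)" for i using C[OF fgK] by (simp add: P_def)
    show "fg_module A (P i)" by (rule projective_fg[OF proj])
    show "snd (C M) \<in> module_hom A (P 0) M" "snd (C M) ` carrier (P 0) = carrier M"
      using C[OF assms] by (simp_all add: P_def K)
    show "d i \<in> module_hom A (P (Suc i)) (P i)" by (rule hom)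
    show "d i ` carrier (P (Suc i)) =
      (case i of 0 \<Rightarrow> a_kernel (P 0) M (snd (C M)) | Suc j \<Rightarrow> a_kernel (P (Suc j)) (P j) (d j))"
      unfolding im by (cases i) (simp_all add: a_kernel_def' K(2) d_def zeroK)
  qed
  then show ?thesis by blast
qed

lemma proj_dim_resolution:
  assumes "proj_dim A M \<le> enat n"
  obtains P e d where "projective_resolution A M P e d" "\<And>i. i > n \<Longrightarrow> zero_module (P i)"
proof -
  let ?S = "{enat n | n. \<exists>P e d. projective_resolution A M P e d \<and> (\<forall>i>n. zero_module (P i))}"
  have ne: "?S \<noteq> {}"
  proof
    assume "?S = {}"
    then have "proj_dim A M = \<infinity>" by (simp add: proj_dim_def Inf_enat_def)
    then show False using assms by simp
  qed
  \<comment> \<open>The extended naturals are well-ordered, so the infimum defining the projective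
    dimension is attained by an actual resolution.\<close>
  then have "Inf ?S \<in> ?S" by (rule wellorder_InfI[OF ex_in_conv[THEN iffD2, THEN someI_ex]])
  then obtain m P e d where m: "proj_dim A M = enat m" "projective_resolution A M P e d" "\<forall>i>m. zero_module (P i)"
    unfolding proj_dim_def by auto
  then show thesis using assms by (intro that[of P e d]) auto
qed

lemma ext1_zero_zero_syzygy:
  fixes K P :: "'a umodule"
  assumes "projective_module A P" "short_exact A K i P p M" "zero_module K" "fg_module A N"
  shows "ext1_zero M N"
proof (rule ext1_zeroI_presentation[OF assms(1,2,4)])
  fix h assume h: "h \<in> module_hom A K N"
  note E = short_exactD[OF assms(2)]
  have rN: "right_module A N" by (rule fg_module_right_module[OF assms(4)])
  show "\<exists>h'\<in>module_hom A P N. \<forall>x\<in>carrier K. h' (i x) = h x"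
    by (rule bexI[OF _ module_hom_0[OF rN]]) (use zero_module_hom[OF E(10) rN assms(3) h] in simp)
qed

text \<open>The degree shift explains the bound: \<open>ext_zero i\<close> is degree
  \<open>i + 1\<close>, and the syzygy after the \<open>i\<close>-th one is an image of
  \<open>P (Suc i)\<close>, which is zero as soon as \<open>n <= i\<close>.\<close>

lemma proj_dim_ext_zero:
  fixes M :: "'a umodule"
  assumes "proj_dim A M \<le> enat n" "n \<le> i" "fg_module A N"
  shows "ext_zero i M N"
proof -
  obtain P e d where r: "projective_resolution A M P e d" and z: "\<And>i. i > n \<Longrightarrow> zero_module (P i)"
    by (rule proj_dim_resolution[OF assms(1)]) blast
  note R = projective_resolutionD[OF r]
  have rm: "right_module A (P i)" for i by (rule fg_module_right_module[OF projective_fg[OF R(2)]])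
  have "zero_module (resolution_syzygy M P d (Suc i))"
    using z[of "Suc i"] assms(2) module_hom_zero[OF rm rm R(5), of i]
    by (simp add: zero_module_def resolution_syzygy_def)
  from ext1_zero_zero_syzygy[OF R(2) resolution_syzygy_exact[OF r] this assms(3)]
  show ?thesis by (rule ext_zeroI[OF R(1) assms(3) resolution_syzygy_pow[OF r]])
qed

lemma hom_cohomology_coboundaries:
  fixes N :: "'a umodule"
  assumes r: "projective_resolution A M P e d" and N: "fg_module A N"
  shows "hom_differential P d j ` carrier (hom_group A (P j) N) =
    {f \<in> extensional (carrier (P (Suc j))). \<exists>g\<in>module_hom A (P j) N. \<forall>x\<in>carrier (P (Suc j)). f x = g (d j x)}"
    (is "?L = ?R")
proof
  note R = projective_resolutionD[OF r]
  have rm: "right_module A (P i)" for i by (rule fg_module_right_module[OF projective_fg[OF R(2)]])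
  show "?L \<subseteq> ?R"
  proof
    fix f assume "f \<in> ?L"
    then obtain g where g: "g \<in> module_hom A (P j) N" "f = compose (carrier (P (Suc j))) g (d j)"
      by (auto simp: hom_differential_def hom_group_def)
    then have "f \<in> extensional (carrier (P (Suc j)))" "\<forall>x\<in>carrier (P (Suc j)). f x = g (d j x)"
      by (simp_all add: compose_def)
    then show "f \<in> ?R" using g(1) by blast
  qed
  show "?R \<subseteq> ?L"
  proof
    fix f assume "f \<in> ?R"
    then have *: "f \<in> extensional (carrier (P (Suc j))) \<and>
      (\<exists>g\<in>module_hom A (P j) N. \<forall>x\<in>carrier (P (Suc j)). f x = g (d j x))" by (rule CollectD)
    note f = conjunct1[OF *]
    from conjunct2[OF *] obtain g where g: "g \<in> module_hom A (P j) N" "\<forall>x\<in>carrier (P (Suc j)). f x = g (d j x)" by (elim bexE)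
    let ?g = "restrict g (carrier (P j))"
    have "?g \<in> module_hom A (P j) N" by (rule module_hom_cong[OF rm g(1)]) simp
    then have "?g \<in> carrier (hom_group A (P j) N)" by (simp add: hom_group_def)
    moreover have "f = hom_differential P d j ?g"
      unfolding hom_differential_def
      by (rule extensionalityI[OF f]) (use g(2) module_hom_closed[OF R(5)[of j]] in \<open>auto simp: compose_def\<close>)
    ultimately show "f \<in> ?L" by blast
  qed
qed

text \<open>Cocycles in degree \<open>Suc j\<close> are maps that vanish on the image of the next
  differential, hence maps on the syzygy of index \<open>Suc j\<close>. Coboundaries are those that
  extend to \<open>P j\<close>. So vanishing is \<open>ext1_zero\<close> for the \<open>j\<close>-th
  syzygy, tested on one presentation.\<close>

lemma trivial_hom_cohomology_iff:
  fixes N :: "'a umodule"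
  assumes r: "projective_resolution A M P e d" and N: "fg_module A N"
  shows "trivial_group (hom_cohomology A P d (Suc j) N) \<longleftrightarrow> ext_zero j M N"
proof -
  note R = projective_resolutionD[OF r]
  interpret N: right_module A N by (rule fg_module_right_module[OF N])
  have rm: "right_module A (P i)" for i by (rule fg_module_right_module[OF projective_fg[OF R(2)]])
  let ?P = "P (Suc j)" and ?G = "hom_group A (P (Suc j)) N"
  let ?Z = "kernel ?G (hom_group A (P (Suc (Suc j))) N) (hom_differential P d (Suc j))"
  let ?B = "hom_differential P d j ` carrier (hom_group A (P j) N)"
  let ?G' = "?G\<lparr>carrier := ?Z\<rparr>"
  have H: "hom_cohomology A P d (Suc j) N = ?G' Mod ?B" by (simp add: hom_cohomology_def)
  have Z: "f \<in> ?Z \<longleftrightarrow> f \<in> module_hom A ?P N \<and> f \<in> extensional (carrier ?P) \<and>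
    (\<forall>x\<in>carrier (P (Suc (Suc j))). f (d (Suc j) x) = \<zero>\<^bsub>N\<^esub>)" for f
  proof -
    have "compose (carrier (P (Suc (Suc j)))) f (d (Suc j)) = (\<lambda>x\<in>carrier (P (Suc (Suc j))). \<zero>\<^bsub>N\<^esub>) \<longleftrightarrow>
      (\<forall>x\<in>carrier (P (Suc (Suc j))). f (d (Suc j) x) = \<zero>\<^bsub>N\<^esub>)"
      by (auto simp: compose_def fun_eq_iff)
    then show ?thesis by (auto simp: kernel_def hom_group_def hom_differential_def)
  qed
  have B: "f \<in> ?B \<longleftrightarrow> f \<in> extensional (carrier ?P) \<and> (\<exists>g\<in>module_hom A (P j) N. \<forall>x\<in>carrier ?P. f x = g (d j x))" for f
    by (simp add: hom_cohomology_coboundaries[OF r N])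
  have dd: "d j (d (Suc j) x) = \<zero>\<^bsub>P j\<^esub>" if "x \<in> carrier (P (Suc (Suc j)))" for x
  proof -
    have "d (Suc j) x \<in> d (Suc j) ` carrier (P (Suc (Suc j)))" using that by (rule imageI)
    then show ?thesis unfolding R(7) by simp
  qed
  have BZ: "f \<in> ?Z" if "f \<in> ?B" for f
  proof -
    from that[unfolded B] obtain g where f: "f \<in> extensional (carrier ?P)"
      and g: "g \<in> module_hom A (P j) N" "\<forall>x\<in>carrier ?P. f x = g (d j x)" by (elim conjE bexE)
    have "f \<in> module_hom A ?P N"
      by (rule module_hom_cong[OF rm module_hom_comp[OF R(5) g(1)]]) (use g(2) in blast)
    then show ?thesis unfolding Z using f g(2) dd module_hom_closed[OF R(5)] module_hom_zero[OF rm N.right_module_axioms g(1)]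
      by simp
  qed
  have "trivial_group (?G' Mod ?B) \<longleftrightarrow> (\<forall>f. f \<in> ?Z \<longrightarrow> f \<in> ?B)"
  proof
    assume t: "trivial_group (?G' Mod ?B)"
    show "\<forall>f. f \<in> ?Z \<longrightarrow> f \<in> ?B"
    proof (intro allI impI)
      fix f assume f: "f \<in> ?Z"
      have "?B #>\<^bsub>?G'\<^esub> f \<in> carrier (?G' Mod ?B)" using f by (auto simp: FactGroup_def RCOSETS_def)
      then have *: "?B #>\<^bsub>?G'\<^esub> f = ?B" using t by (simp add: trivial_group_def FactGroup_def)
      have f': "f \<in> module_hom A ?P N" "f \<in> extensional (carrier ?P)" using f Z by auto
      let ?o = "\<lambda>x\<in>carrier ?P. \<zero>\<^bsub>N\<^esub>"
      have "?o \<in> ?B" unfolding B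
        using module_hom_0[OF N.right_module_axioms, of "P j"] by (auto intro!: bexI[of _ "\<lambda>x. \<zero>\<^bsub>N\<^esub>"])
      moreover have "f = ?o \<otimes>\<^bsub>?G'\<^esub> f"
        by (rule extensionalityI[OF f'(2)])
          (use module_hom_closed[OF f'(1)] in \<open>auto simp: hom_group_def\<close>)
      ultimately have "f \<in> ?B #>\<^bsub>?G'\<^esub> f" unfolding r_coset_def by blast
      then show "f \<in> ?B" unfolding * .
    qed
  next
    assume ZB: "\<forall>f. f \<in> ?Z \<longrightarrow> f \<in> ?B"
    show "trivial_group (?G' Mod ?B)"
    proof (rule trivial_group_factgroupI)
      show "?B \<noteq> {}" using module_hom_0[OF N.right_module_axioms, of "P j"] B[of "\<lambda>x\<in>carrier ?P. \<zero>\<^bsub>N\<^esub>"]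
        by (auto intro!: bexI[of _ "\<lambda>x. \<zero>\<^bsub>N\<^esub>"])
      show "carrier ?G' = ?B" using ZB BZ by auto
    next
      fix f g assume "f \<in> ?B" "g \<in> ?B"
      then obtain f' g' where f: "f' \<in> module_hom A (P j) N" "\<forall>x\<in>carrier ?P. f x = f' (d j x)"
        and g: "g' \<in> module_hom A (P j) N" "\<forall>x\<in>carrier ?P. g x = g' (d j x)" using B by metis
      show "f \<otimes>\<^bsub>?G'\<^esub> g \<in> ?B" unfolding B
        using module_hom_plus[OF rm N.right_module_axioms f(1) g(1)] f(2) g(2)
        by (intro conjI bexI[of _ "\<lambda>x. f' x \<oplus>\<^bsub>N\<^esub> g' x"]) (auto simp: hom_group_def)
    next
      fix f g assume fB: "f \<in> ?B" and gB: "g \<in> ?B"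
      then obtain f' g' where f: "f' \<in> module_hom A (P j) N" "\<forall>x\<in>carrier ?P. f x = f' (d j x)"
        and g: "g' \<in> module_hom A (P j) N" "\<forall>x\<in>carrier ?P. g x = g' (d j x)" using B by metis
      have ext: "g \<in> extensional (carrier ?P)" using gB B by blast
      let ?h = "\<lambda>x\<in>carrier ?P. g x \<ominus>\<^bsub>N\<^esub> f x"
      have "?h \<in> ?B" unfolding B
        using module_hom_diff[OF rm N.right_module_axioms g(1) f(1)] f(2) g(2)
        by (intro conjI bexI[of _ "\<lambda>x. g' x \<ominus>\<^bsub>N\<^esub> f' x"]) auto
      moreover have "f x \<in> carrier N" "g x \<in> carrier N" if "x \<in> carrier ?P" for x
        using that f(2) g(2) module_hom_closed[OF R(5) that] module_hom_closed[OF f(1)] module_hom_closed[OF g(1)] by auto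
      then have "?h \<otimes>\<^bsub>?G'\<^esub> f = g"
        by (intro extensionalityI[OF _ ext]) (auto simp: hom_group_def N.M.minus_add_cancel)
      ultimately show "\<exists>y\<in>?B. y \<otimes>\<^bsub>?G'\<^esub> f = g" by blast
    qed
  qed
  also have "\<dots> \<longleftrightarrow> ext1_zero (resolution_syzygy M P d j) N"
  proof
    let ?K = "resolution_syzygy M P d"
    note ex = resolution_syzygy_exact[OF r]
    assume ZB: "\<forall>f. f \<in> ?Z \<longrightarrow> f \<in> ?B"
    show "ext1_zero (?K j) N"
    proof (rule ext1_zeroI_presentation[OF R(2) ex N])
      fix h assume h: "h \<in> module_hom A (?K (Suc j)) N"
      have dK: "d j \<in> module_hom A ?P (?K (Suc j))" using short_exactD(6)[OF ex[of "Suc j"]] by simp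
      let ?f = "\<lambda>x\<in>carrier ?P. h (d j x)"
      have "?f \<in> module_hom A ?P N" by (rule module_hom_cong[OF rm module_hom_comp[OF dK h]]) simp
      moreover have "h \<zero>\<^bsub>P j\<^esub> = \<zero>\<^bsub>N\<^esub>"
        using module_hom_zero[OF short_exactD(10)[OF ex] N.right_module_axioms h] by (simp add: resolution_syzygy_def)
      ultimately have "?f \<in> ?Z" unfolding Z using dd module_hom_closed[OF R(5)[of "Suc j"]] by simp
      then have "?f \<in> ?B" using ZB by blast
      then obtain g where g: "g \<in> module_hom A (P j) N" "\<forall>x\<in>carrier ?P. ?f x = g (d j x)" using B by metis
      have "g x = h x" if "x \<in> carrier (?K (Suc j))" for x
        using that g(2) by (auto simp: resolution_syzygy_def)
      then show "\<exists>h'\<in>module_hom A (P j) N. \<forall>x\<in>carrier (?K (Suc j)). h' x = h x" using g(1) by blast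
    qed
  next
    let ?K = "resolution_syzygy M P d"
    note ex = resolution_syzygy_exact[OF r]
    assume e1: "ext1_zero (?K j) N"
    show "\<forall>f. f \<in> ?Z \<longrightarrow> f \<in> ?B"
    proof (intro allI impI)
      fix f assume "f \<in> ?Z"
      then have f: "f \<in> module_hom A ?P N" "f \<in> extensional (carrier ?P)"
        "\<forall>x\<in>carrier (P (Suc (Suc j))). f (d (Suc j) x) = \<zero>\<^bsub>N\<^esub>" unfolding Z by blast+
      have exS: "short_exact A (?K (Suc (Suc j))) (\<lambda>x. x) ?P (d j) (?K (Suc j))"
        using ex[of "Suc j"] by simp
      have "\<exists>h\<in>module_hom A (?K (Suc j)) N. \<forall>x\<in>carrier ?P. h (d j x) = f x"
      proof (rule short_exact_factor[OF exS N.right_module_axioms f(1)])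
        fix x assume "x \<in> carrier (?K (Suc (Suc j)))"
        then obtain y where "y \<in> carrier (P (Suc (Suc j)))" "x = d (Suc j) y" by (auto simp: resolution_syzygy_def)
        then show "f x = \<zero>\<^bsub>N\<^esub>" using f(3) by simp
      qed
      then obtain h where h: "h \<in> module_hom A (?K (Suc j)) N" "\<forall>x\<in>carrier ?P. h (d j x) = f x" by blast
      obtain g where g: "g \<in> module_hom A (P j) N" "\<And>x. x \<in> carrier (?K (Suc j)) \<Longrightarrow> g x = h x"
        by (rule ext1_zeroD[OF e1 ex h(1)]) blast
      have "\<forall>x\<in>carrier ?P. f x = g (d j x)"
        using g(2) h(2) by (auto simp: resolution_syzygy_def)
      then show "f \<in> ?B" unfolding B using f(2) g(1) by blast
    qed
  qed
  also have "\<dots> \<longleftrightarrow> ext_zero j M N"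
    using ext_zeroI[OF R(1) N resolution_syzygy_pow[OF r]] resolution_syzygy_pow[OF r]
    by (auto simp: ext_zero_def)
  finally show ?thesis unfolding H .
qed

lemma trivial_Ext_iff:
  fixes M N :: "'a umodule"
  assumes "fg_module A M" "fg_module A N"
  shows "trivial_group (Ext A (Suc j) M N) \<longleftrightarrow> ext_zero j M N"
proof -
  let ?Q = "\<lambda>(P, e, d). projective_resolution A M P e d"
  have "\<exists>x. ?Q x" using projective_resolution_exists[OF assms(1)] by auto
  then have "?Q (SOME x. ?Q x)" by (rule someI_ex)
  then obtain P e d where *: "(SOME x. ?Q x) = (P, e, d)" "projective_resolution A M P e d"
    by (metis (no_types, lifting) case_prodE)
  then show ?thesis using trivial_hom_cohomology_iff[OF *(2) assms(2)] by (simp add: Ext_def)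
qed

end

section \<open>The category add Q and approximations by it\<close>

lemma power_module_simps [simp]:
  "carrier (power_module Q n) = {..<n} \<rightarrow>\<^sub>E carrier Q"
  "\<zero>\<^bsub>power_module Q n\<^esub> = (\<lambda>i\<in>{..<n}. \<zero>\<^bsub>Q\<^esub>)"
  "x \<oplus>\<^bsub>power_module Q n\<^esub> y = (\<lambda>i\<in>{..<n}. x i \<oplus>\<^bsub>Q\<^esub> y i)"
  "a \<odot>\<^bsub>power_module Q n\<^esub> x = (\<lambda>i\<in>{..<n}. a \<odot>\<^bsub>Q\<^esub> x i)"
  by (simp_all add: power_module_def)

lemma right_module_power:
  assumes "right_module A Q"
  shows "right_module A (power_module Q n)"
proof -
  interpret Q: right_module A Q by fact
  have "abelian_group (power_module Q n)"
  proof (rule abelian_groupI)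
    fix x assume "x \<in> carrier (power_module Q n)"
    then show "\<exists>y\<in>carrier (power_module Q n). y \<oplus>\<^bsub>power_module Q n\<^esub> x = \<zero>\<^bsub>power_module Q n\<^esub>"
      by (intro bexI[of _ "\<lambda>i\<in>{..<n}. \<ominus>\<^bsub>Q\<^esub> x i"]) (auto simp: PiE_iff Q.M.l_neg intro!: restrict_ext)
  next
    fix x assume "x \<in> carrier (power_module Q n)"
    then show "\<zero>\<^bsub>power_module Q n\<^esub> \<oplus>\<^bsub>power_module Q n\<^esub> x = x"
      by (auto simp: PiE_iff fun_eq_iff extensional_def)
  qed (auto simp: PiE_iff Q.M.a_ac intro!: restrict_ext)
  moreover have "right_module_axioms A (power_module Q n)"
  proof
    fix x assume "x \<in> carrier (power_module Q n)"
    then show "\<one>\<^bsub>A\<^esub> \<odot>\<^bsub>power_module Q n\<^esub> x = x"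
      by (auto simp: PiE_iff fun_eq_iff extensional_def Q.smult_one)
  qed (auto simp: PiE_iff Q.smult_closed Q.smult_l_distr Q.smult_r_distr Q.smult_assoc intro!: restrict_ext)
  ultimately show ?thesis by (simp add: right_module_def Q.R.ring_axioms)
qed

lemma factors_add_power_id:
  assumes "right_module A Q"
  shows "factors_add A Q (power_module Q n) (power_module Q n) (\<lambda>x. x)"
proof -
  interpret Q: right_module A Q by fact
  let ?P = "power_module Q n"
  \<comment> \<open>Truncation to the first \<open>j\<close> coordinates: passing to
    \<open>Suc j\<close> adds one composite through \<open>Q\<close>, and for \<open>j = n\<close>
    the identity is reached.\<close>
  have "factors_add A Q ?P ?P (\<lambda>x. \<lambda>i\<in>{..<n}. if i < j then x i else \<zero>\<^bsub>Q\<^esub>)" if "j \<le> n" for j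
    using that
  proof (induction j)
    case 0
    show ?case by (rule factors_add.zero) (simp add: restrict_def)
  next
    case (Suc j)
    have a: "(\<lambda>x. x j) \<in> module_hom A ?P Q"
      by (rule module_homI) (use Suc.prems in \<open>auto simp: PiE_iff\<close>)
    have b: "(\<lambda>q. \<lambda>i\<in>{..<n}. if i = j then q else \<zero>\<^bsub>Q\<^esub>) \<in> module_hom A Q ?P"
      by (rule module_homI) (auto simp: Q.smult_zero_right intro!: restrict_ext)
    show ?case
    proof (rule factors_add.step[OF Suc.IH a b])
      fix x assume "x \<in> carrier ?P"
      then show "(\<lambda>i\<in>{..<n}. if i < Suc j then x i else \<zero>\<^bsub>Q\<^esub>) =
        (\<lambda>i\<in>{..<n}. if i = j then x j else \<zero>\<^bsub>Q\<^esub>) \<oplus>\<^bsub>?P\<^esub> (\<lambda>i\<in>{..<n}. if i < j then x i else \<zero>\<^bsub>Q\<^esub>)"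
        by (auto simp: PiE_iff less_Suc_eq intro!: restrict_ext)
    qed (use Suc.prems in simp)
  qed
  from this[OF order_refl] show ?thesis
    by (rule factors_add_cong) (auto simp: PiE_iff fun_eq_iff extensional_def)
qed

lemma factors_add_through_power:
  assumes "right_module A Q" "right_module A M" "right_module A N" "factors_add A Q M N h"
  shows "\<exists>n. \<exists>\<alpha>\<in>module_hom A M (power_module Q n). \<exists>\<beta>\<in>module_hom A (power_module Q n) N.
    \<forall>x\<in>carrier M. h x = \<beta> (\<alpha> x)"
  using assms(4)
proof (induction)
  case (zero h)
  have "(\<lambda>x. \<zero>\<^bsub>power_module Q 0\<^esub>) \<in> module_hom A M (power_module Q 0)"
    by (rule module_hom_0[OF right_module_power[OF assms(1)]])
  then show ?case using zero module_hom_0[OF assms(3), of "power_module Q 0"]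
    by (intro exI[of _ 0] bexI) auto
next
  case (step h a b h')
  interpret Q: right_module A Q by fact
  interpret N: right_module A N by fact
  obtain n \<alpha> \<beta> where \<alpha>: "\<alpha> \<in> module_hom A M (power_module Q n)" and \<beta>: "\<beta> \<in> module_hom A (power_module Q n) N"
    and h: "\<And>x. x \<in> carrier M \<Longrightarrow> h x = \<beta> (\<alpha> x)" using step.IH by blast
  let ?P = "power_module Q n" and ?P' = "power_module Q (Suc n)"
  let ?\<alpha> = "\<lambda>x. \<lambda>i\<in>{..<Suc n}. if i < n then \<alpha> x i else a x"
  let ?\<beta> = "\<lambda>y. b (y n) \<oplus>\<^bsub>N\<^esub> \<beta> (restrict y {..<n})"
  note a = step.hyps(2) and b = step.hyps(3)
  have \<alpha>c: "\<alpha> x i \<in> carrier Q" if "x \<in> carrier M" "i < n" for x i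
    using module_hom_closed[OF \<alpha> that(1)] that(2) by (auto simp: PiE_iff)
  have 1: "?\<alpha> \<in> module_hom A M ?P'"
  proof (rule module_homI)
    fix x assume "x \<in> carrier M"
    then show "?\<alpha> x \<in> carrier ?P'" using \<alpha>c module_hom_closed[OF a] by (auto simp: PiE_iff)
  next
    fix x y assume "x \<in> carrier M" "y \<in> carrier M"
    then show "?\<alpha> (x \<oplus>\<^bsub>M\<^esub> y) = ?\<alpha> x \<oplus>\<^bsub>?P'\<^esub> ?\<alpha> y"
      by (auto simp: module_hom_add[OF \<alpha>] module_hom_add[OF a] intro!: restrict_ext)
  next
    fix r x assume "r \<in> carrier A" "x \<in> carrier M"
    then show "?\<alpha> (r \<odot>\<^bsub>M\<^esub> x) = r \<odot>\<^bsub>?P'\<^esub> ?\<alpha> x"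
      by (auto simp: module_hom_smult[OF \<alpha>] module_hom_smult[OF a] intro!: restrict_ext)
  qed
  have r: "(\<lambda>y. restrict y {..<n}) \<in> module_hom A ?P' ?P"
    by (rule module_homI) (auto simp: PiE_iff intro!: restrict_ext)
  have s: "(\<lambda>y. y n) \<in> module_hom A ?P' Q" by (rule module_homI) (auto simp: PiE_iff)
  have 2: "?\<beta> \<in> module_hom A ?P' N"
    by (rule module_hom_plus[OF right_module_power[OF assms(1)] assms(3) module_hom_comp[OF s b] module_hom_comp[OF r \<beta>]])
  have 3: "\<forall>x\<in>carrier M. h' x = ?\<beta> (?\<alpha> x)"
  proof
    fix x assume x: "x \<in> carrier M"
    have "restrict (?\<alpha> x) {..<n} = \<alpha> x"
      using module_hom_closed[OF \<alpha> x] by (auto simp: PiE_iff extensional_def fun_eq_iff)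
    then show "h' x = ?\<beta> (?\<alpha> x)" using step.hyps(4)[OF x] h[OF x] by simp
  qed
  show ?case by (rule exI[of _ "Suc n"], rule bexI[OF _ 1], rule bexI[OF _ 2], rule 3)
qed

lemma retract_direct_summand:
  assumes "right_module A X" "right_module A Y" and a: "a \<in> module_hom A X Y" and b: "b \<in> module_hom A Y X"
    and ba: "\<And>x. x \<in> carrier X \<Longrightarrow> b (a x) = x"
  shows "direct_summand A X Y"
proof -
  interpret X: right_module A X by fact
  interpret Y: right_module A Y by fact
  let ?Y = "a ` carrier X" and ?Z = "{y \<in> carrier Y. b y = \<zero>\<^bsub>X\<^esub>}"
  have sub: "submodule ?Y A Y" "submodule ?Z A Y"
    by (rule submodule_image[OF assms(1,2) a X.submodule_carrier], rule submodule_ker[OF assms(2,1) b])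
  have "?Y \<inter> ?Z \<subseteq> {\<zero>\<^bsub>Y\<^esub>}" using ba module_hom_zero[OF assms(1,2) a] by auto
  moreover have "\<exists>y\<in>?Y. \<exists>z\<in>?Z. x = y \<oplus>\<^bsub>Y\<^esub> z" if x: "x \<in> carrier Y" for x
  proof -
    have c: "b x \<in> carrier X" "a (b x) \<in> carrier Y"
      using x module_hom_closed[OF b] module_hom_closed[OF a] by auto
    have "b (x \<ominus>\<^bsub>Y\<^esub> a (b x)) = \<zero>\<^bsub>X\<^esub>"
      using x c ba by (simp add: module_hom_minus[OF assms(2,1) b] X.M.minus_self)
    then have "x \<ominus>\<^bsub>Y\<^esub> a (b x) \<in> ?Z" using x c by simp
    moreover have "x = a (b x) \<oplus>\<^bsub>Y\<^esub> (x \<ominus>\<^bsub>Y\<^esub> a (b x))"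
      using x c by (simp add: Y.M.a_comm[of "a (b x)"] Y.M.minus_add_cancel)
    ultimately show ?thesis using c(1) by blast
  qed
  ultimately have "bij_betw (\<lambda>(y, z). y \<oplus>\<^bsub>Y\<^esub> z) (?Y \<times> ?Z) (carrier Y)"
    by (rule bij_betw_complement[OF assms(2) sub])
  moreover have "module_iso A X (restrict_module Y ?Y)"
    unfolding module_iso_def
  proof (rule bexI)
    show "bij_betw a (carrier X) (carrier (restrict_module Y ?Y))"
      using ba by (auto simp: bij_betw_def inj_on_def dest: arg_cong[of _ _ b])
    show "a \<in> module_hom A X (restrict_module Y ?Y)" using a by (auto simp: module_hom_def)
  qed
  ultimately show ?thesis unfolding direct_summand_def using sub by blast
qed

lemma complement_projection:
  assumes "right_module A M" "submodule Y A M" "submodule Z A M"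
    and bij: "bij_betw (\<lambda>(y, z). y \<oplus>\<^bsub>M\<^esub> z) (Y \<times> Z) (carrier M)"
  obtains p where "p \<in> module_hom A M (restrict_module M Y)" "\<And>y. y \<in> Y \<Longrightarrow> p y = y"
proof -
  interpret M: right_module A M by fact
  note Y = M.rm_submoduleD[OF assms(2)] and Z = M.rm_submoduleD[OF assms(3)]
  define p where "p x = fst (inv_into (Y \<times> Z) (\<lambda>(y, z). y \<oplus>\<^bsub>M\<^esub> z) x)" for x
  have p: "p (y \<oplus>\<^bsub>M\<^esub> z) = y" if "y \<in> Y" "z \<in> Z" for y z
    using inv_into_f_f[OF bij_betw_imp_inj_on[OF bij], of "(y, z)"] that by (simp add: p_def)
  have ex: "\<exists>y\<in>Y. \<exists>z\<in>Z. x = y \<oplus>\<^bsub>M\<^esub> z" if "x \<in> carrier M" for x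
    using that bij_betw_imp_surj_on[OF bij] by (auto simp: image_iff set_eq_iff)
  have hom: "p \<in> module_hom A M (restrict_module M Y)"
  proof (rule module_homI)
    fix x assume "x \<in> carrier M"
    then show "p x \<in> carrier (restrict_module M Y)" using ex[of x] p by auto
  next
    fix x y assume "x \<in> carrier M" "y \<in> carrier M"
    then obtain u v u' v' where *: "u \<in> Y" "v \<in> Z" "x = u \<oplus>\<^bsub>M\<^esub> v" "u' \<in> Y" "v' \<in> Z" "y = u' \<oplus>\<^bsub>M\<^esub> v'"
      using ex by meson
    then have "x \<oplus>\<^bsub>M\<^esub> y = (u \<oplus>\<^bsub>M\<^esub> u') \<oplus>\<^bsub>M\<^esub> (v \<oplus>\<^bsub>M\<^esub> v')"
      using Y(1) Z(1) by (simp add: M.M.a_ac subset_iff)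
    then show "p (x \<oplus>\<^bsub>M\<^esub> y) = p x \<oplus>\<^bsub>restrict_module M Y\<^esub> p y" using * p Y(3) Z(3) by simp
  next
    fix r x assume r: "r \<in> carrier A" and "x \<in> carrier M"
    then obtain u v where *: "u \<in> Y" "v \<in> Z" "x = u \<oplus>\<^bsub>M\<^esub> v" using ex by meson
    then have "r \<odot>\<^bsub>M\<^esub> x = r \<odot>\<^bsub>M\<^esub> u \<oplus>\<^bsub>M\<^esub> r \<odot>\<^bsub>M\<^esub> v"
      using Y(1) Z(1) r by (simp add: M.smult_r_distr subset_iff)
    then show "p (r \<odot>\<^bsub>M\<^esub> x) = r \<odot>\<^bsub>restrict_module M Y\<^esub> p x" using * p Y(4) Z(4) r by simp
  qed
  have "p y = y" if y: "y \<in> Y" for y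
    using p[OF y Z(2)] Y(1) y by auto
  with hom show thesis by (rule that)
qed

text \<open>The link between the definition of add Q and \<open>factors_add\<close>. A retract of a
  power of \<open>Q\<close> splits its identity along the coordinates; conversely the maps of a
  decomposition assemble into a map to a power of \<open>Q\<close> and one back.\<close>

lemma in_add_iff:
  assumes Q: "right_module A Q"
  shows "in_add A Q X \<longleftrightarrow> fg_module A X \<and> factors_add A Q X X (\<lambda>x. x)"
proof
  assume "in_add A Q X"
  then obtain n Y Z where X: "fg_module A X" and Y: "submodule Y A (power_module Q n)"
    and Z: "submodule Z A (power_module Q n)"
    and bij: "bij_betw (\<lambda>(y, z). y \<oplus>\<^bsub>power_module Q n\<^esub> z) (Y \<times> Z) (carrier (power_module Q n))"
    and iso: "module_iso A X (restrict_module (power_module Q n) Y)"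
    unfolding in_add_def direct_summand_def by blast
  let ?P = "power_module Q n"
  let ?Y = "restrict_module ?P Y"
  have rX: "right_module A X" by (rule fg_module_right_module[OF X])
  have rP: "right_module A ?P" by (rule right_module_power[OF Q])
  interpret P: right_module A ?P by fact
  have rY: "right_module A ?Y" by (rule P.right_module_restrict[OF Y])
  obtain p where p: "p \<in> module_hom A ?P ?Y" "\<And>y. y \<in> Y \<Longrightarrow> p y = y"
    by (rule complement_projection[OF rP Y Z bij]) blast
  obtain f where f: "f \<in> module_hom A X ?Y" "bij_betw f (carrier X) (carrier ?Y)"
    using iso unfolding module_iso_def by blast
  note g = module_hom_inv_into[OF rX f]
  have fP: "f \<in> module_hom A X ?P" using f(1) P.rm_submoduleD(1)[OF Y] by (auto simp: module_hom_def)
  have "factors_add A Q X X (\<lambda>x. inv_into (carrier X) f (p (f x)))"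
    using factors_add_comp_left[OF rX rP rX factors_add_comp_right[OF factors_add_power_id[OF Q] fP]
      module_hom_comp[OF p(1) g]] .
  then have "factors_add A Q X X (\<lambda>x. x)"
  proof (rule factors_add_cong)
    fix x assume x: "x \<in> carrier X"
    have "f x \<in> Y" using module_hom_closed[OF f(1) x] by simp
    then show "x = inv_into (carrier X) f (p (f x))"
      using p(2) inv_into_f_f[OF bij_betw_imp_inj_on[OF f(2)] x] by simp
  qed
  with X show "fg_module A X \<and> factors_add A Q X X (\<lambda>x. x)" by simp
next
  assume *: "fg_module A X \<and> factors_add A Q X X (\<lambda>x. x)"
  then have rX: "right_module A X" by (simp add: fg_module_right_module)
  obtain n \<alpha> \<beta> where "\<alpha> \<in> module_hom A X (power_module Q n)" "\<beta> \<in> module_hom A (power_module Q n) X"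
    "\<And>x. x \<in> carrier X \<Longrightarrow> \<beta> (\<alpha> x) = x"
    using factors_add_through_power[OF Q rX rX, of "\<lambda>x. x"] * by metis
  then have "direct_summand A X (power_module Q n)"
    by (rule retract_direct_summand[OF rX right_module_power[OF Q]])
  with * show "in_add A Q X" by (auto simp: in_add_def)
qed

lemma factors_add_iso:
  assumes "right_module A Q" "module_iso A Q Q'"
  shows "factors_add A Q' Q Q (\<lambda>x. x)"
proof -
  obtain f where f: "f \<in> module_hom A Q Q'" "bij_betw f (carrier Q) (carrier Q')"
    using assms(2) by (auto simp: module_iso_def)
  from factors_add_basic[OF assms(1) f(1) module_hom_inv_into[OF assms(1) f]] show ?thesis
    by (rule factors_add_cong) (use inv_into_f_f[OF bij_betw_imp_inj_on[OF f(2)]] in simp)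
qed

text \<open>A left exact sequence cut into short exact ones. The base case asks only for finite
  generation, so the last cokernel is arbitrary; this matches the absence of an exactness condition
  at the last term of the sequence.\<close>

primrec sub_rec :: "'a ring \<Rightarrow> ('a, 'q) module \<Rightarrow> nat \<Rightarrow> 'a umodule \<Rightarrow> bool" where
  "sub_rec A Q 0 X \<longleftrightarrow> fg_module A X"
| "sub_rec A Q (Suc m) X \<longleftrightarrow> (\<exists>f (J :: 'a umodule) g Z. short_exact A X f J g Z \<and>
     factors_add A Q J J (\<lambda>x. x) \<and> sub_rec A Q m Z)"

primrec fac_rec :: "'a ring \<Rightarrow> ('a, 'q) module \<Rightarrow> nat \<Rightarrow> 'a umodule \<Rightarrow> bool" where
  "fac_rec A Q 0 Y \<longleftrightarrow> fg_module A Y"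
| "fac_rec A Q (Suc m) Y \<longleftrightarrow> (\<exists>Z f (J :: 'a umodule) g. short_exact A Z f J g Y \<and>
     factors_add A Q J J (\<lambda>x. x) \<and> fac_rec A Q m Z)"

lemma sub_rec_in_Sub:
  assumes Q: "right_module A Q"
  shows "sub_rec A Q m X \<Longrightarrow> in_Sub A m Q X"
proof (induction m arbitrary: X)
  case 0
  then show ?case by (simp add: in_Sub_def left_exact_seq_def)
next
  case (Suc m)
  then obtain f g and J Z :: "'a umodule" where e: "short_exact A X f J g Z"
    and J: "factors_add A Q J J (\<lambda>x. x)" and Z: "sub_rec A Q m Z" by auto
  note E = short_exactD[OF e]
  obtain P :: "nat \<Rightarrow> 'a umodule" and e' d where P: "left_exact_seq A m Z P e' d" "\<And>i. i < m \<Longrightarrow> in_add A Q (P i)"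
    using Suc.IH[OF Z] unfolding in_Sub_def by blast
  \<comment> \<open>Splicing: the new first differential is the cokernel map of the short exact
    sequence followed by the embedding of that cokernel.\<close>
  let ?P = "case_nat J P" and ?d = "case_nat (\<lambda>x. e' (g x)) d"
  have "left_exact_seq A (Suc m) X ?P f ?d"
    unfolding left_exact_seq_def
  proof (intro conjI allI impI)
    show "fg_module A X" by (rule E(1))
    fix i assume "i < Suc m"
    then show "fg_module A (?P i)" using P(1) E(2) by (cases i) (auto simp: left_exact_seq_def)
  next
    show "f \<in> module_hom A X (?P 0)" "inj_on f (carrier X)" using E(4,5) by simp_all
  next
    fix i assume i: "Suc i < Suc m"
    show "?d i \<in> module_hom A (?P i) (?P (Suc i))"
    proof (cases i)
      case 0
      then show ?thesis using i P(1) module_hom_comp[OF E(6), of e' "P 0"] by (simp add: left_exact_seq_def)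
    next
      case (Suc l)
      then show ?thesis using i P(1) by (simp add: left_exact_seq_def)
    qed
    show "a_kernel (?P i) (?P (Suc i)) (?d i) = (case i of 0 \<Rightarrow> f ` carrier X | Suc j \<Rightarrow> ?d j ` carrier (?P j))"
    proof (cases i)
      case 0
      have e': "e' \<in> module_hom A Z (P 0)" "inj_on e' (carrier Z)"
        using i 0 P(1) by (auto simp: left_exact_seq_def)
      have rP: "right_module A (P 0)" using i 0 P(1) by (auto simp: left_exact_seq_def fg_module_right_module)
      interpret Z: right_module A Z by (rule E(12))
      have "e' (g x) = \<zero>\<^bsub>P 0\<^esub> \<longleftrightarrow> x \<in> f ` carrier X" if x: "x \<in> carrier J" for x
      proof -
        have "e' (g x) = e' \<zero>\<^bsub>Z\<^esub> \<longleftrightarrow> g x = \<zero>\<^bsub>Z\<^esub>"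
          by (rule inj_on_eq_iff[OF e'(2)]) (use module_hom_closed[OF E(6) x] in auto)
        then show ?thesis using module_hom_zero[OF E(12) rP e'(1)] E(8)[OF x] E(9) by auto
      qed
      then show ?thesis using 0 module_hom_closed[OF E(4)] by (auto simp: a_kernel_def')
    next
      case (Suc l)
      have *: "a_kernel (P l) (P (Suc l)) (d l) = (case l of 0 \<Rightarrow> e' ` carrier Z | Suc j \<Rightarrow> d j ` carrier (P j))"
        using i Suc P(1) by (simp add: left_exact_seq_def)
      have "(\<lambda>x. e' (g x)) ` carrier J = e' ` carrier Z" using E(7) by (metis image_image)
      with * Suc show ?thesis by (cases l) simp_all
    qed
  qed
  moreover have "in_add A Q (?P i)" if "i < Suc m" for i
    using that P(2) J E(2) in_add_iff[OF Q, of J] by (cases i) auto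
  ultimately show ?case unfolding in_Sub_def by blast
qed

lemma in_Sub_sub_rec:
  assumes Q: "right_module A Q"
  shows "in_Sub A m Q X \<Longrightarrow> sub_rec A Q m X"
proof (induction m arbitrary: X)
  case 0
  then show ?case by (auto simp: in_Sub_def left_exact_seq_def)
next
  case (Suc m)
  then obtain P :: "nat \<Rightarrow> 'a umodule" and e d where P: "left_exact_seq A (Suc m) X P e d" "\<And>i. i < Suc m \<Longrightarrow> in_add A Q (P i)"
    unfolding in_Sub_def by blast
  have fg: "fg_module A X" "\<And>i. i < Suc m \<Longrightarrow> fg_module A (P i)"
    and e: "e \<in> module_hom A X (P 0)" "inj_on e (carrier X)"
    and d: "\<And>i. i < m \<Longrightarrow> d i \<in> module_hom A (P i) (P (Suc i))"
      "\<And>i. i < m \<Longrightarrow> a_kernel (P i) (P (Suc i)) (d i) = (case i of 0 \<Rightarrow> e ` carrier X | Suc j \<Rightarrow> d j ` carrier (P j))"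
    using P(1) by (auto simp: left_exact_seq_def)
  obtain Z :: "'a umodule" and g where Z: "short_exact A X e (P 0) g Z"
    using cokernel_exists[OF fg(1) fg(2) e] by auto
  note E = short_exactD[OF Z]
  have "in_Sub A m Q Z"
  proof (cases m)
    case 0
    then show ?thesis using E(3) by (simp add: in_Sub_def left_exact_seq_def)
  next
    case (Suc m')
    have rm: "right_module A (P i)" if "i < Suc m" for i using fg(2)[OF that] by (rule fg_module_right_module)
    have d0: "d 0 \<in> module_hom A (P 0) (P 1)" "{x \<in> carrier (P 0). d 0 x = \<zero>\<^bsub>P 1\<^esub>} = e ` carrier X"
      using d[of 0] Suc by (simp_all add: a_kernel_def')
    have "\<exists>h\<in>module_hom A Z (P 1). \<forall>x\<in>carrier (P 0). h (g x) = d 0 x"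
      by (rule short_exact_factor[OF Z _ d0(1)]) (use rm[of 1] Suc d0(2) in auto)
    then obtain h where h: "h \<in> module_hom A Z (P 1)" "\<And>x. x \<in> carrier (P 0) \<Longrightarrow> h (g x) = d 0 x" by blast
    have rP: "right_module A (P 0)" "right_module A (P 1)" using rm[of 0] rm[of 1] Suc by simp_all
    interpret P0: right_module A "P 0" by fact
    interpret P1: right_module A "P (Suc 0)" using rP(2) by simp
    interpret Z: right_module A Z by (rule E(12))
    have inj: "inj_on h (carrier Z)"
    proof (rule inj_onI)
      fix u v assume "u \<in> carrier Z" "v \<in> carrier Z" and huv: "h u = h v"
      then obtain x y where xy: "x \<in> carrier (P 0)" "u = g x" "y \<in> carrier (P 0)" "v = g y"
        unfolding E(7)[symmetric] by (elim imageE)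
      have "d 0 (x \<ominus>\<^bsub>P 0\<^esub> y) = \<zero>\<^bsub>P 1\<^esub>"
        using xy huv h(2) module_hom_closed[OF d0(1)] by (simp add: module_hom_minus[OF rP d0(1)] P1.M.minus_self)
      then have "x \<ominus>\<^bsub>P 0\<^esub> y \<in> e ` carrier X" using xy unfolding d0(2)[symmetric] by simp
      then have "g (x \<ominus>\<^bsub>P 0\<^esub> y) = \<zero>\<^bsub>Z\<^esub>" using E(9) by auto
      then show "u = v" using xy module_hom_closed[OF E(6)] by (simp add: module_hom_minus[OF E(11,12,6)] Z.M.minus_zero_iff)
    qed
    have him: "h ` carrier Z = d 0 ` carrier (P 0)"
    proof -
      have "h ` g ` carrier (P 0) = d 0 ` carrier (P 0)" using h(2) by (auto simp: image_iff)
      then show ?thesis using E(7) by simp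
    qed
    have "left_exact_seq A m Z (\<lambda>i. P (Suc i)) h (\<lambda>i. d (Suc i))"
      unfolding left_exact_seq_def
    proof (intro conjI allI impI)
      fix i assume i: "Suc i < m"
      show "a_kernel (P (Suc i)) (P (Suc (Suc i))) (d (Suc i)) =
        (case i of 0 \<Rightarrow> h ` carrier Z | Suc j \<Rightarrow> d (Suc j) ` carrier (P (Suc j)))"
        using d(2)[of "Suc i"] i him by (cases i) simp_all
    qed (use E(3) fg(2) h(1) inj d(1) in auto)
    then show ?thesis unfolding in_Sub_def using P(2)
      by (intro exI[of _ "\<lambda>i. P (Suc i)"] exI conjI allI impI) auto
  qed
  then have "sub_rec A Q m Z" by (rule Suc.IH)
  moreover have "factors_add A Q (P 0) (P 0) (\<lambda>x. x)" using P(2)[of 0] in_add_iff[OF Q] by blast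
  ultimately show ?case using Z by auto
qed

lemma in_Sub_iso:
  fixes X :: "('a, 'x) module" and X' :: "('a, 'y) module"
  assumes "in_Sub A m Q X" "fg_module A X'" "\<theta> \<in> module_hom A X' X" "bij_betw \<theta> (carrier X') (carrier X)"
  shows "in_Sub A m Q X'"
proof -
  obtain P :: "nat \<Rightarrow> 'a umodule" and e d where P: "left_exact_seq A m X P e d" "\<forall>i<m. in_add A Q (P i)"
    using assms(1) unfolding in_Sub_def by blast
  have "(\<lambda>x. e (\<theta> x)) ` carrier X' = e ` carrier X"
    using bij_betw_imp_surj_on[OF assms(4)] by (metis image_image)
  moreover have "inj_on (\<lambda>x. e (\<theta> x)) (carrier X')" if "inj_on e (carrier X)"
    using comp_inj_on[OF bij_betw_imp_inj_on[OF assms(4)], of e] that bij_betw_imp_surj_on[OF assms(4)]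
    by (simp add: comp_def)
  ultimately have "left_exact_seq A m X' P (\<lambda>x. e (\<theta> x)) d"
    using P(1) assms(2) module_hom_comp[OF assms(3), of e "P 0"] unfolding left_exact_seq_def
    by (auto split: nat.splits)
  then show ?thesis unfolding in_Sub_def using P(2) by blast
qed

context artin_algebra
begin

lemma in_Fac_fac_rec:
  assumes Q: "right_module A Q"
  shows "in_Fac A m Q Y \<Longrightarrow> fac_rec A Q m Y"
proof (induction m arbitrary: Y)
  case 0
  then show ?case by (auto simp: in_Fac_def right_exact_seq_def)
next
  case (Suc m)
  then obtain P :: "nat \<Rightarrow> 'a umodule" and e d where P: "right_exact_seq A (Suc m) Y P e d" "\<And>i. i < Suc m \<Longrightarrow> in_add A Q (P i)"
    unfolding in_Fac_def by blast
  have fg: "fg_module A Y" "\<And>i. i < Suc m \<Longrightarrow> fg_module A (P i)"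
    and e: "e \<in> module_hom A (P 0) Y" "e ` carrier (P 0) = carrier Y"
    and d: "\<And>i. i < m \<Longrightarrow> d i \<in> module_hom A (P (Suc i)) (P i)"
      "\<And>i. i < m \<Longrightarrow> d i ` carrier (P (Suc i)) =
        (case i of 0 \<Rightarrow> a_kernel (P 0) Y e | Suc j \<Rightarrow> a_kernel (P (Suc j)) (P j) (d j))"
    using P(1) by (auto simp: right_exact_seq_def)
  let ?Z = "restrict_module (P 0) {x \<in> carrier (P 0). e x = \<zero>\<^bsub>Y\<^esub>}"
  have Z: "short_exact A ?Z (\<lambda>x. x) (P 0) e Y" by (rule kernel_exact[OF fg(2) fg(1) e]) simp
  note E = short_exactD[OF Z]
  have "right_exact_seq A m ?Z (\<lambda>i. P (Suc i)) (d 0) (\<lambda>i. d (Suc i))"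
    unfolding right_exact_seq_def
  proof (intro conjI allI impI)
    assume m: "0 < m"
    have im: "d 0 ` carrier (P (Suc 0)) = {x \<in> carrier (P 0). e x = \<zero>\<^bsub>Y\<^esub>}"
      using d(2)[OF m] by (simp add: a_kernel_def')
    then show "d 0 ` carrier (P (Suc 0)) = carrier ?Z" by simp
    show "d 0 \<in> module_hom A (P (Suc 0)) ?Z"
      using d(1)[OF m] im by (auto simp: module_hom_def)
  next
    fix i assume i: "Suc i < m"
    show "d (Suc i) ` carrier (P (Suc (Suc i))) = (case i of 0 \<Rightarrow> a_kernel (P (Suc 0)) ?Z (d 0) |
      Suc j \<Rightarrow> a_kernel (P (Suc (Suc j))) (P (Suc j)) (d (Suc j)))"
      using d(2)[OF i] by (cases i) (simp_all add: a_kernel_def')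
  qed (use E(1) fg(2) d(1) in auto)
  then have "in_Fac A m Q ?Z" unfolding in_Fac_def using P(2)
    by (intro exI[of _ "\<lambda>i. P (Suc i)"] exI conjI allI impI) auto
  then have "fac_rec A Q m ?Z" by (rule Suc.IH)
  moreover have "factors_add A Q (P 0) (P 0) (\<lambda>x. x)" using P(2)[of 0] in_add_iff[OF Q] by blast
  ultimately show ?case using Z by auto
qed

section \<open>Transport of the hypotheses along isomorphisms\<close>

lemma proj_dim_leI:
  assumes "projective_resolution A M P e d" "\<And>i. i > n \<Longrightarrow> zero_module (P i)"
  shows "proj_dim A M \<le> enat n"
  unfolding proj_dim_def by (rule Inf_lower) (use assms in blast)

lemma proj_dim_iso:
  assumes "proj_dim A M \<le> enat n" "fg_module A M'" "right_module A M" "module_iso A M M'"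
  shows "proj_dim A M' \<le> enat n"
proof -
  obtain \<theta> where \<theta>: "\<theta> \<in> module_hom A M M'" "bij_betw \<theta> (carrier M) (carrier M')"
    using assms(4) by (auto simp: module_iso_def)
  obtain P e d where r: "projective_resolution A M P e d" and z: "\<And>i. i > n \<Longrightarrow> zero_module (P i)"
    using assms(1) unfolding proj_dim_def
    by (metis (no_types, lifting) assms(1) proj_dim_resolution)
  have R: "right_exact_seq A m M P e d" for m
    using r by (simp add: projective_resolution_def resolution_def)
  have e: "e \<in> module_hom A (P 0) M" "e ` carrier (P 0) = carrier M"
    using R[of 1] by (simp_all add: right_exact_seq_def)
  have "(\<lambda>x. \<theta> (e x)) ` carrier (P 0) = carrier M'"
    using e(2) bij_betw_imp_surj_on[OF \<theta>(2)] by (metis image_image)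
  moreover have "a_kernel (P 0) M' (\<lambda>x. \<theta> (e x)) = a_kernel (P 0) M e"
  proof -
    interpret M: right_module A M by fact
    have "\<theta> (e x) = \<theta> \<zero>\<^bsub>M\<^esub> \<longleftrightarrow> e x = \<zero>\<^bsub>M\<^esub>" if "x \<in> carrier (P 0)" for x
      by (rule inj_on_eq_iff[OF bij_betw_imp_inj_on[OF \<theta>(2)]]) (use module_hom_closed[OF e(1) that] in auto)
    then show ?thesis
      using module_hom_zero[OF assms(3) fg_module_right_module[OF assms(2)] \<theta>(1)] by (auto simp: a_kernel_def')
  qed
  ultimately have "right_exact_seq A m M' P (\<lambda>x. \<theta> (e x)) d" for m
    using R[of m] assms(2) module_hom_comp[OF e(1) \<theta>(1)]
    by (auto simp: right_exact_seq_def split: nat.splits)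
  then have "projective_resolution A M' P (\<lambda>x. \<theta> (e x)) d"
    using r by (simp add: projective_resolution_def resolution_def)
  then show ?thesis using z by (rule proj_dim_leI)
qed

end

text \<open>The module \<open>I\<close> of the theorem may have elements of any type, whereas
  \<open>ext1_zero\<close> speaks of the universal type. An isomorphic copy has to inherit the
  injectivity.\<close>

lemma injective_module_iso:
  assumes "injective_module A I" "fg_module A I'" "module_iso A I I'"
  shows "injective_module A I'"
  unfolding injective_module_def
proof (intro conjI allI impI assms(2))
  have rI: "right_module A I" using assms(1) by (simp add: injective_module_def fg_module_right_module)
  obtain \<theta> where \<theta>: "\<theta> \<in> module_hom A I I'" "bij_betw \<theta> (carrier I) (carrier I')"
    using assms(3) by (auto simp: module_iso_def)
  note \<psi> = module_hom_inv_into[OF rI \<theta>]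
  fix X Y :: "'a umodule" and j f
  assume *: "fg_module A X \<and> fg_module A Y \<and> j \<in> module_hom A X Y \<and> inj_on j (carrier X) \<and> f \<in> module_hom A X I'"
  then have "(\<lambda>x. inv_into (carrier I) \<theta> (f x)) \<in> module_hom A X I" using module_hom_comp[OF _ \<psi>] by blast
  then obtain g where g: "g \<in> module_hom A Y I" "\<forall>x\<in>carrier X. g (j x) = inv_into (carrier I) \<theta> (f x)"
    using assms(1) * unfolding injective_module_def by blast
  have "f x \<in> carrier I'" if "x \<in> carrier X" for x using * that by (auto dest: module_hom_closed)
  then show "\<exists>g\<in>module_hom A Y I'. \<forall>x\<in>carrier X. g (j x) = f x"
    using g(2) bij_betw_inv_into_right[OF \<theta>(2)] by (intro bexI[OF _ module_hom_comp[OF g(1) \<theta>(1)]]) auto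
qed

lemma indecomposable_module_iso:
  assumes "right_module A M" "right_module A N" "module_iso A M N" "indecomposable_module A M"
  shows "indecomposable_module A N"
proof -
  obtain \<theta> where \<theta>: "\<theta> \<in> module_hom A M N" "bij_betw \<theta> (carrier M) (carrier N)"
    using assms(3) by (auto simp: module_iso_def)
  interpret M: right_module A M by fact
  interpret N: right_module A N by fact
  note \<theta>0 = module_hom_zero[OF assms(1,2) \<theta>(1)] and inj = bij_betw_imp_inj_on[OF \<theta>(2)]
  have ker: "x = \<zero>\<^bsub>M\<^esub>" if "x \<in> carrier M" "\<theta> x = \<zero>\<^bsub>N\<^esub>" for x
    using inj_onD[OF inj, of x "\<zero>\<^bsub>M\<^esub>"] that \<theta>0 by simp
  have nz: "\<not> zero_module N"
  proof
    assume "zero_module N"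
    then have "\<theta> x = \<zero>\<^bsub>N\<^esub>" if "x \<in> carrier M" for x
      using module_hom_closed[OF \<theta>(1) that] by (simp add: zero_module_def)
    then have "carrier M = {\<zero>\<^bsub>M\<^esub>}" using ker by auto
    then show False using assms(4) by (simp add: indecomposable_module_def zero_module_def)
  qed
  have "Y = {\<zero>\<^bsub>N\<^esub>} \<or> Z = {\<zero>\<^bsub>N\<^esub>}"
    if Y: "submodule Y A N" and Z: "submodule Z A N"
      and bij: "bij_betw (\<lambda>(y, z). y \<oplus>\<^bsub>N\<^esub> z) (Y \<times> Z) (carrier N)" for Y Z
  proof -
    let ?Y = "{x \<in> carrier M. \<theta> x \<in> Y}" and ?Z = "{x \<in> carrier M. \<theta> x \<in> Z}"
    note Y' = N.rm_submoduleD[OF Y] and Z' = N.rm_submoduleD[OF Z]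
    have sub: "submodule ?Y A M" "submodule ?Z A M"
      by (rule submodule_vimage[OF assms(1,2) \<theta>(1) Y], rule submodule_vimage[OF assms(1,2) \<theta>(1) Z])
    \<comment> \<open>A common element \<open>w\<close> has the two decompositions
      \<open>w + 0\<close> and \<open>0 + w\<close>, which must be equal.\<close>
    have YZ: "w = \<zero>\<^bsub>N\<^esub>" if "w \<in> Y" "w \<in> Z" for w
    proof -
      have c: "w \<in> carrier N" using subsetD[OF Y'(1) that(1)] .
      have m: "(w, \<zero>\<^bsub>N\<^esub>) \<in> Y \<times> Z" "(\<zero>\<^bsub>N\<^esub>, w) \<in> Y \<times> Z"
        by (rule SigmaI, rule that(1), rule Z'(2), rule SigmaI, rule Y'(2), rule that(2))
      have "(case (w, \<zero>\<^bsub>N\<^esub>) of (y, z) \<Rightarrow> y \<oplus>\<^bsub>N\<^esub> z) = (case (\<zero>\<^bsub>N\<^esub>, w) of (y, z) \<Rightarrow> y \<oplus>\<^bsub>N\<^esub> z)"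
        unfolding prod.case N.M.l_zero[OF c] N.M.r_zero[OF c] ..
      from inj_onD[OF bij_betw_imp_inj_on[OF bij] this m] show ?thesis by (rule Pair_inject)
    qed
    have "?Y \<inter> ?Z \<subseteq> {\<zero>\<^bsub>M\<^esub>}" using YZ ker by blast
    moreover have "\<exists>y\<in>?Y. \<exists>z\<in>?Z. x = y \<oplus>\<^bsub>M\<^esub> z" if x: "x \<in> carrier M" for x
    proof -
      have "\<theta> x \<in> (\<lambda>(y, z). y \<oplus>\<^bsub>N\<^esub> z) ` (Y \<times> Z)"
        using module_hom_closed[OF \<theta>(1) x] bij_betw_imp_surj_on[OF bij] by simp
      then obtain y z where yz: "y \<in> Y" "z \<in> Z" "\<theta> x = y \<oplus>\<^bsub>N\<^esub> z" by auto
      have "y \<in> \<theta> ` carrier M" "z \<in> \<theta> ` carrier M"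
        unfolding bij_betw_imp_surj_on[OF \<theta>(2)] using subsetD[OF Y'(1) yz(1)] subsetD[OF Z'(1) yz(2)] .
      then obtain u v where uv: "u \<in> carrier M" "y = \<theta> u" "v \<in> carrier M" "z = \<theta> v" by (elim imageE)
      have "x = u \<oplus>\<^bsub>M\<^esub> v"
        by (rule inj_onD[OF inj]) (use uv x yz(3) in \<open>auto simp: module_hom_add[OF \<theta>(1)]\<close>)
      then show ?thesis using uv yz by blast
    qed
    ultimately have "bij_betw (\<lambda>(y, z). y \<oplus>\<^bsub>M\<^esub> z) (?Y \<times> ?Z) (carrier M)"
      by (rule bij_betw_complement[OF assms(1) sub])
    then have "?Y = {\<zero>\<^bsub>M\<^esub>} \<or> ?Z = {\<zero>\<^bsub>M\<^esub>}"
      using assms(4) sub unfolding indecomposable_module_def by blast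
    moreover have "H = {\<zero>\<^bsub>N\<^esub>}" if "{x \<in> carrier M. \<theta> x \<in> H} = {\<zero>\<^bsub>M\<^esub>}" "H \<subseteq> carrier N" "\<zero>\<^bsub>N\<^esub> \<in> H" for H
    proof -
      have "w = \<zero>\<^bsub>N\<^esub>" if w: "w \<in> H" for w
      proof -
        obtain u where u: "u \<in> carrier M" "w = \<theta> u"
          using w \<open>H \<subseteq> carrier N\<close> bij_betw_imp_surj_on[OF \<theta>(2)] by blast
        then have "u \<in> {x \<in> carrier M. \<theta> x \<in> H}" using w by simp
        then have "u = \<zero>\<^bsub>M\<^esub>" unfolding \<open>{x \<in> carrier M. \<theta> x \<in> H} = {\<zero>\<^bsub>M\<^esub>}\<close> by simp
        then show ?thesis using u \<theta>0 by simp
      qed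
      then show ?thesis using \<open>\<zero>\<^bsub>N\<^esub> \<in> H\<close> by blast
    qed
    ultimately show ?thesis using Y'(1,2) Z'(1,2) by blast
  qed
  then show ?thesis using nz unfolding indecomposable_module_def by blast
qed

lemma basic_module_iso_transport:
  assumes "basic_module A M" "fg_module A N" "module_iso A M N"
  shows "basic_module A N"
proof -
  obtain n S where M: "fg_module A M" "direct_sum_of A M n S"
    "\<And>i. i < n \<Longrightarrow> indecomposable_module A (restrict_module M (S i))"
    "\<And>i j. i < n \<Longrightarrow> j < n \<Longrightarrow> i \<noteq> j \<Longrightarrow> \<not> module_iso A (restrict_module M (S i)) (restrict_module M (S j))"
    using assms(1) by (auto simp: basic_module_def)
  obtain \<theta> where \<theta>: "\<theta> \<in> module_hom A M N" "bij_betw \<theta> (carrier M) (carrier N)"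
    using assms(3) by (auto simp: module_iso_def)
  have rm: "right_module A M" "right_module A N" using M(1) assms(2) by (auto intro: fg_module_right_module)
  interpret M: right_module A M by fact
  interpret N: right_module A N by fact
  note inj = bij_betw_imp_inj_on[OF \<theta>(2)]
  have S: "submodule (S i) A M" if "i < n" for i using M(2) that by (simp add: direct_sum_of_def)
  have SC: "S i \<subseteq> carrier M" if "i < n" for i using M.rm_submoduleD(1)[OF S[OF that]] .
  have bij: "bij_betw (\<lambda>x. finsum M x {..<n}) (\<Pi>\<^sub>E i\<in>{..<n}. S i) (carrier M)"
    using M(2) by (simp add: direct_sum_of_def)
  let ?S = "\<lambda>i. \<theta> ` S i"
  have S': "submodule (?S i) A N" if "i < n" for i by (rule submodule_image[OF rm \<theta>(1) S[OF that]])
  have \<theta>sum: "\<theta> (finsum M x {..<n}) = finsum N (\<lambda>i\<in>{..<n}. \<theta> (x i)) {..<n}" if x: "x \<in> (\<Pi>\<^sub>E i\<in>{..<n}. S i)" for x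
  proof -
    have c: "x i \<in> carrier M" if "i < n" for i using x SC[OF that] that by (auto simp: PiE_iff)
    have "\<theta> (finsum M x {..<n}) = finsum N (\<lambda>i. \<theta> (x i)) {..<n}"
      by (rule module_hom_finsum[OF rm \<theta>(1)]) (use c in auto)
    also have "\<dots> = finsum N (\<lambda>i\<in>{..<n}. \<theta> (x i)) {..<n}"
      by (rule N.M.finsum_cong') (use c module_hom_closed[OF \<theta>(1)] in auto)
    finally show ?thesis .
  qed
  let ?F = "\<lambda>x. \<lambda>i\<in>{..<n}. \<theta> (x i)"
  have Fbij: "bij_betw ?F (\<Pi>\<^sub>E i\<in>{..<n}. S i) (\<Pi>\<^sub>E i\<in>{..<n}. ?S i)"
  proof (rule bij_betw_imageI)
    show "inj_on ?F (\<Pi>\<^sub>E i\<in>{..<n}. S i)"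
    proof (rule inj_onI)
      fix x y assume x: "x \<in> (\<Pi>\<^sub>E i\<in>{..<n}. S i)" and y: "y \<in> (\<Pi>\<^sub>E i\<in>{..<n}. S i)" and eq: "?F x = ?F y"
      have "x i = y i" if i: "i < n" for i
      proof (rule inj_onD[OF inj])
        show "\<theta> (x i) = \<theta> (y i)" using fun_cong[OF eq, of i] i by simp
      qed (use x y i SC in auto)
      then show "x = y" using x y by (intro PiE_ext) auto
    qed
    show "?F ` (\<Pi>\<^sub>E i\<in>{..<n}. S i) = (\<Pi>\<^sub>E i\<in>{..<n}. ?S i)"
    proof
      show "(\<Pi>\<^sub>E i\<in>{..<n}. ?S i) \<subseteq> ?F ` (\<Pi>\<^sub>E i\<in>{..<n}. S i)"
      proof
        fix y assume y: "y \<in> (\<Pi>\<^sub>E i\<in>{..<n}. ?S i)"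
        let ?x = "\<lambda>i\<in>{..<n}. inv_into (S i) \<theta> (y i)"
        have yi: "y i \<in> \<theta> ` S i" if "i < n" for i using y that by (auto simp: PiE_iff)
        have "?x \<in> (\<Pi>\<^sub>E i\<in>{..<n}. S i)" using yi by (auto intro: inv_into_into)
        moreover have "y = ?F ?x"
        proof (rule extensionalityI[of _ "{..<n}"])
          fix i assume "i \<in> {..<n}"
          then show "y i = ?F ?x i" using f_inv_into_f[OF yi] by simp
        qed (use y in \<open>auto simp: PiE_iff\<close>)
        ultimately show "y \<in> ?F ` (\<Pi>\<^sub>E i\<in>{..<n}. S i)" by (rule rev_image_eqI[of ?x _ y ?F])
      qed
      show "?F ` (\<Pi>\<^sub>E i\<in>{..<n}. S i) \<subseteq> (\<Pi>\<^sub>E i\<in>{..<n}. ?S i)"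
      proof (rule image_subsetI)
        fix x assume "x \<in> (\<Pi>\<^sub>E i\<in>{..<n}. S i)"
        then have "x i \<in> S i" if "i < n" for i using that by (auto simp: PiE_iff)
        then show "?F x \<in> (\<Pi>\<^sub>E i\<in>{..<n}. ?S i)" by (simp add: restrict_PiE_iff)
      qed
    qed
  qed
  have "bij_betw (\<lambda>x. finsum N x {..<n}) (\<Pi>\<^sub>E i\<in>{..<n}. ?S i) (carrier N)"
  proof -
    have "bij_betw (\<theta> \<circ> (\<lambda>x. finsum M x {..<n})) (\<Pi>\<^sub>E i\<in>{..<n}. S i) (carrier N)"
      by (rule bij_betw_trans[OF bij \<theta>(2)])
    then have "bij_betw ((\<lambda>x. finsum N x {..<n}) \<circ> ?F) (\<Pi>\<^sub>E i\<in>{..<n}. S i) (carrier N)"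
      by (rule bij_betw_cong[THEN iffD1, rotated]) (use \<theta>sum in simp)
    then show ?thesis using bij_betw_comp_iff[OF Fbij] by blast
  qed
  then have ds: "direct_sum_of A N n ?S" using S' by (simp add: direct_sum_of_def)
  have iso: "module_iso A (restrict_module M (S i)) (restrict_module N (?S i))" if i: "i < n" for i
    unfolding module_iso_def
  proof (rule bexI)
    show "bij_betw \<theta> (carrier (restrict_module M (S i))) (carrier (restrict_module N (?S i)))"
      using inj_on_subset[OF inj SC[OF i]] by (simp add: bij_betw_def)
    show "\<theta> \<in> module_hom A (restrict_module M (S i)) (restrict_module N (?S i))"
      using \<theta>(1) SC[OF i] by (auto simp: module_hom_def subset_iff)
  qed
  have rS: "right_module A (restrict_module M (S i))" "right_module A (restrict_module N (?S i))" if "i < n" for i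
    using M.right_module_restrict[OF S[OF that]] N.right_module_restrict[OF S'[OF that]] by auto
  have "indecomposable_module A (restrict_module N (?S i))" if "i < n" for i
    by (rule indecomposable_module_iso[OF rS[OF that] iso[OF that] M(3)[OF that]])
  moreover have "\<not> module_iso A (restrict_module N (?S i)) (restrict_module N (?S j))"
    if ij: "i < n" "j < n" "i \<noteq> j" for i j
  proof
    assume "module_iso A (restrict_module N (?S i)) (restrict_module N (?S j))"
    from module_iso_trans[OF iso[OF ij(1)] module_iso_trans[OF this module_iso_sym[OF rS(1)[OF ij(2)] iso[OF ij(2)]]]]
    have "module_iso A (restrict_module M (S i)) (restrict_module M (S j))" .
    then show False using M(4)[OF ij] by simp
  qed
  ultimately show ?thesis unfolding basic_module_def using assms(2) ds by blast
qed

text \<open>Each summand lifts through its second factor, a map out of \<open>Q\<close>, and the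
  lifts are added.\<close>

lemma factors_add_lift:
  fixes W X :: "'a umodule"
  assumes "right_module A W" "right_module A X" "right_module A M" "p \<in> module_hom A W X"
    and lift: "\<And>b. b \<in> module_hom A Q X \<Longrightarrow> \<exists>g\<in>module_hom A Q W. \<forall>x\<in>carrier Q. p (g x) = b x"
    and h: "factors_add A Q M X h"
  shows "\<exists>g\<in>module_hom A M W. \<forall>x\<in>carrier M. p (g x) = h x"
  using h
proof (induction)
  case (zero h)
  then show ?case
    using module_hom_0[OF assms(1)] module_hom_zero[OF assms(1,2,4)] by (intro bexI[of _ "\<lambda>x. \<zero>\<^bsub>W\<^esub>"]) auto
next
  case (step h a b h')
  obtain g where g: "g \<in> module_hom A M W" "\<forall>x\<in>carrier M. p (g x) = h x" using step.IH by blast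
  obtain u where u: "u \<in> module_hom A Q W" "\<forall>x\<in>carrier Q. p (u x) = b x" using lift[OF step.hyps(3)] by blast
  note ua = module_hom_comp[OF step.hyps(2) u(1)]
  show ?case
  proof (intro bexI ballI)
    show "(\<lambda>x. u (a x) \<oplus>\<^bsub>W\<^esub> g x) \<in> module_hom A M W" by (rule module_hom_plus[OF assms(3,1) ua g(1)])
    fix x assume x: "x \<in> carrier M"
    show "p (u (a x) \<oplus>\<^bsub>W\<^esub> g x) = h' x"
      using step.hyps(4)[OF x] g(2) u(2) x module_hom_closed[OF step.hyps(2) x] module_hom_closed[OF ua x]
        module_hom_closed[OF g(1) x] by (simp add: module_hom_add[OF assms(4)])
  qed
qed

text \<open>Each summand extends through its first factor, a map into \<open>Q\<close>. The
  extension is again a sum of maps through \<open>Q\<close>, which matters when it is used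
  further.\<close>

lemma factors_add_extend:
  fixes X Y :: "'a umodule"
  assumes "right_module A X" "right_module A Y" "right_module A N" "f \<in> module_hom A X Y"
    and ext: "\<And>a. a \<in> module_hom A X Q \<Longrightarrow> \<exists>a'\<in>module_hom A Y Q. \<forall>x\<in>carrier X. a' (f x) = a x"
    and h: "factors_add A Q X N h"
  shows "\<exists>h'. factors_add A Q Y N h' \<and> (\<forall>x\<in>carrier X. h' (f x) = h x)"
  using h
proof (induction)
  case (zero h)
  have "factors_add A Q Y N (\<lambda>x. \<zero>\<^bsub>N\<^esub>)" by (rule factors_add.zero) simp
  then show ?case using zero by auto
next
  case (step h a b h')
  obtain g where g: "factors_add A Q Y N g" "\<forall>x\<in>carrier X. g (f x) = h x" using step.IH by blast
  obtain a' where a': "a' \<in> module_hom A Y Q" "\<forall>x\<in>carrier X. a' (f x) = a x" using ext[OF step.hyps(2)] by blast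
  have "factors_add A Q Y N (\<lambda>y. b (a' y) \<oplus>\<^bsub>N\<^esub> g y)"
    by (rule factors_add.step[OF g(1) a'(1) step.hyps(3)]) simp
  moreover have "\<forall>x\<in>carrier X. b (a' (f x)) \<oplus>\<^bsub>N\<^esub> g (f x) = h' x"
    using step.hyps(4) g(2) a'(2) by simp
  ultimately show ?case by blast
qed

lemma biproduct_exact:
  fixes M N W :: "'a umodule"
  assumes "fg_module A M" "fg_module A N" "fg_module A W" "i \<in> module_hom A M W" "j \<in> module_hom A N W"
    "p \<in> module_hom A W M" "q \<in> module_hom A W N"
    "\<And>x. x \<in> carrier M \<Longrightarrow> p (i x) = x" "\<And>x. x \<in> carrier N \<Longrightarrow> q (j x) = x"
    "\<And>x. x \<in> carrier M \<Longrightarrow> q (i x) = \<zero>\<^bsub>N\<^esub>"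
    "\<And>w. w \<in> carrier W \<Longrightarrow> i (p w) \<oplus>\<^bsub>W\<^esub> j (q w) = w"
  shows "short_exact A M i W q N"
  unfolding short_exact_def
proof (intro conjI ballI assms)
  show "inj_on i (carrier M)" by (rule inj_on_inverseI[of _ p]) (rule assms(8))
  show "q ` carrier W = carrier N"
  proof
    show "carrier N \<subseteq> q ` carrier W"
    proof
      fix x assume "x \<in> carrier N"
      then show "x \<in> q ` carrier W"
        by (intro rev_image_eqI[of "j x"]) (simp_all add: assms(9) module_hom_closed[OF assms(5)])
    qed
  qed (use module_hom_closed[OF assms(7)] in auto)
  have rm: "right_module A N" "right_module A W" using assms(2,3) by (auto intro: fg_module_right_module)
  interpret W: right_module A W by fact
  fix w assume w: "w \<in> carrier W"
  note c = module_hom_closed[OF assms(6) w]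
  show "q w = \<zero>\<^bsub>N\<^esub> \<longleftrightarrow> w \<in> i ` carrier M"
  proof
    assume "q w = \<zero>\<^bsub>N\<^esub>"
    then have "w = i (p w)"
      using assms(11)[OF w] module_hom_zero[OF rm assms(5)] module_hom_closed[OF assms(4) c] by simp
    then show "w \<in> i ` carrier M" using c by (rule image_eqI)
  qed (auto simp: assms(10))
qed

text \<open>The dual horseshoe lemma, with a given extension \<open>z\<close> of \<open>f\<close> in place of the injectivity of \<open>J\<close>.\<close>

lemma horseshoe:
  fixes C W D V D' J C' :: "'a umodule"
  assumes e1: "short_exact A C m W q D" and e2: "short_exact A D v V w D'" and e3: "short_exact A C f J g C'"
    and z: "z \<in> module_hom A W J" "\<And>x. x \<in> carrier C \<Longrightarrow> z (m x) = f x"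
  obtains S W1 :: "'a umodule" and i p a b c e where "short_exact A J i S p V"
    "\<And>Q :: 'a umodule. factors_add A Q J J (\<lambda>x. x) \<Longrightarrow> factors_add A Q V V (\<lambda>x. x) \<Longrightarrow> factors_add A Q S S (\<lambda>x. x)"
    "short_exact A W a S b W1" "short_exact A C' c W1 e D'"
proof -
  note E1 = short_exactD[OF e1] and E2 = short_exactD[OF e2] and E3 = short_exactD[OF e3]
  interpret C: right_module A C by (rule E1(10))
  interpret W: right_module A W by (rule E1(11))
  interpret D: right_module A D by (rule E1(12))
  interpret V: right_module A V by (rule E2(11))
  interpret J: right_module A J by (rule E3(11))
  obtain S :: "'a umodule" and i j p r where S: "fg_module A S" "i \<in> module_hom A J S" "j \<in> module_hom A V S"
    "p \<in> module_hom A S J" "r \<in> module_hom A S V"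
    "\<And>x. x \<in> carrier J \<Longrightarrow> p (i x) = x" "\<And>x. x \<in> carrier V \<Longrightarrow> r (j x) = x"
    "\<And>x. x \<in> carrier V \<Longrightarrow> p (j x) = \<zero>\<^bsub>J\<^esub>" "\<And>x. x \<in> carrier J \<Longrightarrow> r (i x) = \<zero>\<^bsub>V\<^esub>"
    "\<And>s. s \<in> carrier S \<Longrightarrow> i (p s) \<oplus>\<^bsub>S\<^esub> j (r s) = s"
    by (rule biproduct_exists[OF E3(2) E2(2)]) blast
  have rS: "right_module A S" by (rule fg_module_right_module[OF S(1)])
  interpret S: right_module A S by fact
  have JSV: "short_exact A J i S r V"
    by (rule biproduct_exact[OF E3(2) E2(2) S(1) S(2,3,4,5) S(6) S(7) S(9) S(10)])
  have add: "factors_add A Q S S (\<lambda>x. x)"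
    if Q: "factors_add A Q J J (\<lambda>x. x)" "factors_add A Q V V (\<lambda>x. x)" for Q :: "'a umodule"
  proof -
    have "factors_add A Q S S (\<lambda>s. i (p s) \<oplus>\<^bsub>S\<^esub> j (r s))"
      by (intro factors_add_plus[OF rS rS] factors_add_comp_left[OF rS E3(11) rS factors_add_comp_right[OF Q(1) S(4)] S(2)]
          factors_add_comp_left[OF rS E2(11) rS factors_add_comp_right[OF Q(2) S(5)] S(3)])
    then show ?thesis by (rule factors_add_cong) (simp add: S(10))
  qed
  \<comment> \<open>The two components are \<open>z\<close> and \<open>v q\<close>. The second
    vanishes exactly on the image of \<open>C\<close>, where the first restricts to the injective
    \<open>f\<close>; hence \<open>?a\<close> is injective and compatible with both given
    embeddings.\<close>
  let ?a = "\<lambda>x. i (z x) \<oplus>\<^bsub>S\<^esub> j (v (q x))"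
  note vq = module_hom_comp[OF E1(6) E2(4)]
  note iz = module_hom_comp[OF z(1) S(2)] and jvq = module_hom_comp[OF vq S(3)]
  have a: "?a \<in> module_hom A W S" by (rule module_hom_plus[OF E1(11) rS iz jvq])
  have pa: "p (?a x) = z x" and ra: "r (?a x) = v (q x)" if x: "x \<in> carrier W" for x
  proof -
    note cl = module_hom_closed[OF z(1) x] module_hom_closed[OF vq x] module_hom_closed[OF iz x] module_hom_closed[OF jvq x]
    show "p (?a x) = z x" using cl S(6,8) by (simp add: module_hom_add[OF S(4)])
    show "r (?a x) = v (q x)" using cl S(7,9) by (simp add: module_hom_add[OF S(5)])
  qed
  have am: "?a (m x) = i (f x)" if x: "x \<in> carrier C" for x
    using z(2)[OF x] E1(9)[OF x] module_hom_zero[OF E2(10,11,4)] module_hom_zero[OF E2(11) rS S(3)]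
      module_hom_closed[OF S(2) module_hom_closed[OF E3(4) x]] by simp
  have qker: "\<exists>y\<in>carrier C. x = m y" if "x \<in> carrier W" "v (q x) = \<zero>\<^bsub>V\<^esub>" for x
  proof -
    have "q x = \<zero>\<^bsub>D\<^esub>"
      by (rule inj_onD[OF E2(5)]) (use that module_hom_zero[OF E2(10,11,4)] module_hom_closed[OF E1(6)] in auto)
    then show ?thesis using E1(8)[OF that(1)] by blast
  qed
  have inj: "inj_on ?a (carrier W)"
  proof (rule inj_onI)
    fix x y assume xy: "x \<in> carrier W" "y \<in> carrier W" "?a x = ?a y"
    have d: "x \<ominus>\<^bsub>W\<^esub> y \<in> carrier W" using xy by simp
    have "z (x \<ominus>\<^bsub>W\<^esub> y) = \<zero>\<^bsub>J\<^esub>"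
      using xy pa[OF xy(1)] pa[OF xy(2)] module_hom_closed[OF z(1)]
      by (simp add: module_hom_minus[OF E1(11) E3(11) z(1)] J.M.minus_self)
    moreover have "v (q (x \<ominus>\<^bsub>W\<^esub> y)) = \<zero>\<^bsub>V\<^esub>"
      using xy ra[OF xy(1)] ra[OF xy(2)] module_hom_closed[OF vq]
      by (simp add: module_hom_minus[OF E1(11) E2(11) vq] V.M.minus_self)
    then obtain u where u: "u \<in> carrier C" "x \<ominus>\<^bsub>W\<^esub> y = m u" using qker[OF d] by blast
    ultimately have "f u = \<zero>\<^bsub>J\<^esub>" using z(2)[OF u(1)] by simp
    then have "u = \<zero>\<^bsub>C\<^esub>"
      by (intro inj_onD[OF E3(5) _ u(1)]) (simp_all add: module_hom_zero[OF E3(10,11,4)])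
    then have "x \<ominus>\<^bsub>W\<^esub> y = \<zero>\<^bsub>W\<^esub>" using u(2) module_hom_zero[OF E1(10,11,4)] by simp
    then show "x = y" using xy by (simp add: W.M.minus_zero_iff)
  qed
  obtain W1 :: "'a umodule" and b where b: "short_exact A W ?a S b W1"
    using cokernel_exists[OF E1(2) S(1) a inj] by blast
  note B = short_exactD[OF b]
  interpret W1: right_module A W1 by (rule B(12))
  note bi = module_hom_comp[OF S(2) B(6)] and wr = module_hom_comp[OF S(5) E2(6)]
  have "\<exists>c\<in>module_hom A C' W1. \<forall>y\<in>carrier J. c (g y) = b (i y)"
    by (rule short_exact_factor[OF e3 B(12) bi]) (use B(9) module_hom_closed[OF E1(4)] am in metis)
  then obtain c where c: "c \<in> module_hom A C' W1" "\<And>y. y \<in> carrier J \<Longrightarrow> c (g y) = b (i y)" by blast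
  have "\<exists>e\<in>module_hom A W1 D'. \<forall>s\<in>carrier S. e (b s) = w (r s)"
    by (rule short_exact_factor[OF b E2(12) wr]) (simp add: ra E2(9) module_hom_closed[OF E1(6)])
  then obtain e where e: "e \<in> module_hom A W1 D'" "\<And>s. s \<in> carrier S \<Longrightarrow> e (b s) = w (r s)" by blast
  have "short_exact A C' c W1 e D'"
    unfolding short_exact_def
  proof (intro conjI ballI E3(3) E2(3) B(3) c(1) e(1))
    show "inj_on c (carrier C')"
    proof (rule inj_onI)
      fix x y assume x: "x \<in> carrier C'" and y: "y \<in> carrier C'" and eq: "c x = c y"
      interpret C': right_module A C' by (rule E3(12))
      have d: "x \<ominus>\<^bsub>C'\<^esub> y \<in> carrier C'" using x y by simp
      have cd: "c (x \<ominus>\<^bsub>C'\<^esub> y) = \<zero>\<^bsub>W1\<^esub>"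
        using x y eq module_hom_closed[OF c(1)] by (simp add: module_hom_minus[OF E3(12) B(12) c(1)] W1.M.minus_self)
      have "x \<ominus>\<^bsub>C'\<^esub> y \<in> g ` carrier J" unfolding E3(7) by (rule d)
      then obtain t where t: "t \<in> carrier J" "x \<ominus>\<^bsub>C'\<^esub> y = g t" by (elim imageE)
      have it: "i t \<in> carrier S" by (rule module_hom_closed[OF S(2) t(1)])
      have "b (i t) = \<zero>\<^bsub>W1\<^esub>" using cd c(2)[OF t(1)] t(2) by simp
      from B(8)[OF it this] obtain s where s: "i t = ?a s" "s \<in> carrier W" by (elim imageE)
      have "v (q s) = \<zero>\<^bsub>V\<^esub>" using ra[OF s(2)] S(9)[OF t(1)] s(1) by simp
      from qker[OF s(2) this] obtain u where u: "u \<in> carrier C" "s = m u" by blast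
      have "t = z s" using pa[OF s(2)] S(6)[OF t(1)] s(1) by simp
      then have "t = f u" using z(2)[OF u(1)] u(2) by simp
      then have "x \<ominus>\<^bsub>C'\<^esub> y = \<zero>\<^bsub>C'\<^esub>" using t(2) E3(9)[OF u(1)] by simp
      then show "x = y" using x y by (simp add: C'.M.minus_zero_iff)
    qed
    show "e ` carrier W1 = carrier D'"
    proof
      show "carrier D' \<subseteq> e ` carrier W1"
      proof
        fix x assume "x \<in> carrier D'"
        then obtain y where y: "y \<in> carrier V" "x = w y" unfolding E2(7)[symmetric] by (elim imageE)
        have jy: "j y \<in> carrier S" by (rule module_hom_closed[OF S(3) y(1)])
        have "x = e (b (j y))" using e(2)[OF jy] S(7)[OF y(1)] y(2) by simp
        then show "x \<in> e ` carrier W1" by (rule image_eqI) (rule module_hom_closed[OF B(6) jy])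
      qed
    qed (use module_hom_closed[OF e(1)] in auto)
  next
    fix x assume "x \<in> carrier W1"
    then obtain s where s: "s \<in> carrier S" "x = b s" unfolding B(7)[symmetric] by (elim imageE)
    show "e x = \<zero>\<^bsub>D'\<^esub> \<longleftrightarrow> x \<in> c ` carrier C'"
    proof
      assume "e x = \<zero>\<^bsub>D'\<^esub>"
      then have "w (r s) = \<zero>\<^bsub>D'\<^esub>" using e(2)[OF s(1)] s(2) by simp
      from E2(8)[OF module_hom_closed[OF S(5) s(1)] this]
      obtain \<delta> where \<delta>: "r s = v \<delta>" "\<delta> \<in> carrier D" by (elim imageE)
      obtain y where y: "\<delta> = q y" "y \<in> carrier W" using \<delta>(2) unfolding E1(7)[symmetric] by (elim imageE)
      have ay: "?a y \<in> carrier S" by (rule module_hom_closed[OF a y(2)])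
      let ?s = "s \<ominus>\<^bsub>S\<^esub> ?a y"
      have sc: "?s \<in> carrier S" using s(1) ay by simp
      have "r ?s = r s \<ominus>\<^bsub>V\<^esub> r (?a y)" by (rule module_hom_minus[OF rS E2(11) S(5) s(1) ay])
      also have "\<dots> = \<zero>\<^bsub>V\<^esub>"
        unfolding ra[OF y(2)] using \<delta> y module_hom_closed[OF S(5) s(1)] by (simp add: V.M.minus_self)
      finally have rs: "r ?s = \<zero>\<^bsub>V\<^esub>" .
      note ps = module_hom_closed[OF S(4) sc]
      have "?s = i (p ?s)"
        using S(10)[OF sc] rs module_hom_zero[OF E2(11) rS S(3)] module_hom_closed[OF S(2) ps] by simp
      then have "b ?s = c (g (p ?s))" using c(2)[OF ps] by simp
      moreover have "b ?s = b s \<ominus>\<^bsub>W1\<^esub> b (?a y)" by (rule module_hom_minus[OF rS B(12,6) s(1) ay])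
      then have "b ?s = x"
        using B(9)[OF y(2)] s module_hom_closed[OF B(6) s(1)] by (simp add: a_minus_def W1.M.neg_zero)
      ultimately have "x = c (g (p ?s))" by simp
      then show "x \<in> c ` carrier C'" by (rule image_eqI) (rule module_hom_closed[OF E3(6) ps])
    next
      assume "x \<in> c ` carrier C'"
      then obtain t where t: "t \<in> carrier C'" "x = c t" by (elim imageE)
      obtain y where y: "t = g y" "y \<in> carrier J" using t(1) unfolding E3(7)[symmetric] by (elim imageE)
      have iy: "i y \<in> carrier S" by (rule module_hom_closed[OF S(2) y(2)])
      have "e x = w (r (i y))" using t(2) y(1) c(2)[OF y(2)] e(2)[OF iy] by simp
      then show "e x = \<zero>\<^bsub>D'\<^esub>" using S(9)[OF y(2)] module_hom_zero[OF E2(11,12,6)] by simp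
    qed
  qed
  with JSV add b show thesis by (rule that)
qed

text \<open>The third isomorphism theorem for \<open>Y = W/C\<close>, \<open>E = J/C\<close> and
  \<open>D = J/W\<close>.\<close>

lemma quotient_exact:
  fixes C W Y J D E :: "'a umodule"
  assumes e1: "short_exact A C a W y Y" and e2: "short_exact A W f J g D"
    and e3: "short_exact A C (\<lambda>x. f (a x)) J e E"
  shows "\<exists>\<alpha> \<beta>. short_exact A Y \<alpha> E \<beta> D"
proof -
  note E1 = short_exactD[OF e1] and E2 = short_exactD[OF e2] and E3 = short_exactD[OF e3]
  interpret Y: right_module A Y by (rule E1(12))
  interpret E: right_module A E by (rule E3(12))
  note ef = module_hom_comp[OF E2(4) E3(6)]
  have "\<exists>\<alpha>\<in>module_hom A Y E. \<forall>x\<in>carrier W. \<alpha> (y x) = e (f x)"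
    by (rule short_exact_factor[OF e1 E3(12) ef]) (rule E3(9))
  then obtain \<alpha> where \<alpha>: "\<alpha> \<in> module_hom A Y E" "\<And>x. x \<in> carrier W \<Longrightarrow> \<alpha> (y x) = e (f x)" by blast
  have "\<exists>\<beta>\<in>module_hom A E D. \<forall>x\<in>carrier J. \<beta> (e x) = g x"
    by (rule short_exact_factor[OF e3 E2(12,6)]) (simp add: E2(9) module_hom_closed[OF E1(4)])
  then obtain \<beta> where \<beta>: "\<beta> \<in> module_hom A E D" "\<And>x. x \<in> carrier J \<Longrightarrow> \<beta> (e x) = g x" by blast
  have "short_exact A Y \<alpha> E \<beta> D"
    unfolding short_exact_def
  proof (intro conjI ballI E1(3) E3(3) E2(3) \<alpha>(1) \<beta>(1))
    show "inj_on \<alpha> (carrier Y)"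
    proof (rule inj_onI)
      fix s t assume st: "s \<in> carrier Y" "t \<in> carrier Y" "\<alpha> s = \<alpha> t"
      have d: "s \<ominus>\<^bsub>Y\<^esub> t \<in> carrier Y" using st by simp
      then obtain x where x: "s \<ominus>\<^bsub>Y\<^esub> t = y x" "x \<in> carrier W" unfolding E1(7)[symmetric] by (elim imageE)
      have "\<alpha> (s \<ominus>\<^bsub>Y\<^esub> t) = \<zero>\<^bsub>E\<^esub>"
        using st module_hom_closed[OF \<alpha>(1)] by (simp add: module_hom_minus[OF E1(12) E3(12) \<alpha>(1)] E.M.minus_self)
      then have "e (f x) = \<zero>\<^bsub>E\<^esub>" using \<alpha>(2)[OF x(2)] x(1) by simp
      from E3(8)[OF module_hom_closed[OF E2(4) x(2)] this] obtain c where c: "f x = f (a c)" "c \<in> carrier C" by (elim imageE)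
      have "x = a c" by (rule inj_onD[OF E2(5) c(1) x(2) module_hom_closed[OF E1(4) c(2)]])
      then have "s \<ominus>\<^bsub>Y\<^esub> t = \<zero>\<^bsub>Y\<^esub>" using x(1) E1(9)[OF c(2)] by simp
      then show "s = t" using st by (simp add: Y.M.minus_zero_iff)
    qed
    show "\<beta> ` carrier E = carrier D"
    proof -
      have "\<beta> ` e ` carrier J = g ` carrier J" using \<beta>(2) by (auto simp: image_iff)
      then show ?thesis unfolding E3(7) E2(7) .
    qed
  next
    fix x assume "x \<in> carrier E"
    then obtain j where j: "x = e j" "j \<in> carrier J" unfolding E3(7)[symmetric] by (elim imageE)
    show "\<beta> x = \<zero>\<^bsub>D\<^esub> \<longleftrightarrow> x \<in> \<alpha> ` carrier Y"
    proof
      assume "\<beta> x = \<zero>\<^bsub>D\<^esub>"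
      then have "g j = \<zero>\<^bsub>D\<^esub>" using \<beta>(2) j by simp
      from E2(8)[OF j(2) this] obtain w where w: "j = f w" "w \<in> carrier W" by (elim imageE)
      have "x = \<alpha> (y w)" using \<alpha>(2)[OF w(2)] j(1) w(1) by simp
      then show "x \<in> \<alpha> ` carrier Y" by (rule image_eqI) (rule module_hom_closed[OF E1(6) w(2)])
    next
      assume "x \<in> \<alpha> ` carrier Y"
      then obtain t where t: "x = \<alpha> t" "t \<in> carrier Y" by (elim imageE)
      then obtain w where w: "t = y w" "w \<in> carrier W" unfolding E1(7)[symmetric] by (elim imageE)
      have "\<beta> x = g (f w)" using t(1) w \<alpha>(2) \<beta>(2) module_hom_closed[OF E2(4)] by simp
      then show "\<beta> x = \<zero>\<^bsub>D\<^esub>" using E2(9)[OF w(2)] by simp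
    qed
  qed
  then show ?thesis by blast
qed

text \<open>A sum of maps through \<open>Q\<close> is realized by a single module \<open>W\<close>
  in add Q, enlarged by one copy of \<open>Q\<close> for each summand. The parameter
  \<open>R\<close> is any property that zero modules have and extensions by \<open>Q\<close> keep;
  it records what else \<open>W\<close> satisfies.\<close>

lemma factors_add_through_object:
  fixes Q M N :: "'a umodule"
  assumes Q: "fg_module A Q" and M: "fg_module A M" and N: "fg_module A N"
    and zero: "\<And>Z :: 'a umodule. fg_module A Z \<Longrightarrow> zero_module Z \<Longrightarrow> R Z"
    and ext: "\<And>(W :: 'a umodule) (V :: 'a umodule) i p. short_exact A Q i W p V \<Longrightarrow> R V \<Longrightarrow> R W"
    and h: "factors_add A Q M N h"
  shows "\<exists>(W :: 'a umodule) \<alpha> \<beta>. fg_module A W \<and> factors_add A Q W W (\<lambda>x. x) \<and> R W \<and> \<alpha> \<in> module_hom A M W \<and>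
    \<beta> \<in> module_hom A W N \<and> (\<forall>x\<in>carrier M. \<beta> (\<alpha> x) = h x)"
  using h
proof (induction)
  case (zero h)
  let ?Z = "restrict_module M {\<zero>\<^bsub>M\<^esub>}"
  note Z = zero_umodule_exists[OF M]
  have "factors_add A Q ?Z ?Z (\<lambda>x. x)" by (rule factors_add.zero) simp
  moreover have "(\<lambda>x. \<zero>\<^bsub>?Z\<^esub>) \<in> module_hom A M ?Z" "(\<lambda>x. \<zero>\<^bsub>N\<^esub>) \<in> module_hom A ?Z N"
    using module_hom_0 fg_module_right_module Z(1) N by blast+
  moreover have "\<forall>x\<in>carrier M. \<zero>\<^bsub>N\<^esub> = h x" using zero by simp
  ultimately show ?case using Z assms(4)[OF Z] by (intro exI[of _ ?Z] exI conjI)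
next
  case (step h a b h')
  obtain W :: "'a umodule" and \<alpha> \<beta> where W: "fg_module A W" "factors_add A Q W W (\<lambda>x. x)" "R W"
    "\<alpha> \<in> module_hom A M W" "\<beta> \<in> module_hom A W N" "\<forall>x\<in>carrier M. \<beta> (\<alpha> x) = h x"
    using step.IH by (elim exE conjE) (rule that)
  obtain S :: "'a umodule" and i j p r where S: "fg_module A S" "i \<in> module_hom A Q S" "j \<in> module_hom A W S"
    "p \<in> module_hom A S Q" "r \<in> module_hom A S W"
    "\<And>x. x \<in> carrier Q \<Longrightarrow> p (i x) = x" "\<And>x. x \<in> carrier W \<Longrightarrow> r (j x) = x"
    "\<And>x. x \<in> carrier W \<Longrightarrow> p (j x) = \<zero>\<^bsub>Q\<^esub>" "\<And>x. x \<in> carrier Q \<Longrightarrow> r (i x) = \<zero>\<^bsub>W\<^esub>"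
    "\<And>s. s \<in> carrier S \<Longrightarrow> i (p s) \<oplus>\<^bsub>S\<^esub> j (r s) = s"
    by (rule biproduct_exists[OF Q W(1)]) blast
  have rm: "right_module A S" "right_module A Q" "right_module A W" "right_module A M" "right_module A N"
    using S(1) Q W(1) M N by (auto intro: fg_module_right_module)
  interpret Q: right_module A Q by fact
  interpret W: right_module A W by fact
  have QSW: "short_exact A Q i S r W"
    by (rule biproduct_exact[OF Q W(1) S(1) S(2,3,4,5) S(6) S(7) S(9) S(10)])
  have "factors_add A Q S S (\<lambda>s. i (p s) \<oplus>\<^bsub>S\<^esub> j (r s))"
    by (rule factors_add_plus[OF rm(1,1) factors_add_basic[OF rm(1) S(4) S(2)]
        factors_add_comp_left[OF rm(1,3,1) factors_add_comp_right[OF W(2) S(5)] S(3)]])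
  then have add: "factors_add A Q S S (\<lambda>x. x)" by (rule factors_add_cong) (simp add: S(10))
  note ia = module_hom_comp[OF step.hyps(2) S(2)] and j\<alpha> = module_hom_comp[OF W(4) S(3)]
  note bp = module_hom_comp[OF S(4) step.hyps(3)] and \<beta>r = module_hom_comp[OF S(5) W(5)]
  let ?\<alpha> = "\<lambda>x. i (a x) \<oplus>\<^bsub>S\<^esub> j (\<alpha> x)" and ?\<beta> = "\<lambda>s. b (p s) \<oplus>\<^bsub>N\<^esub> \<beta> (r s)"
  have 1: "?\<alpha> \<in> module_hom A M S" by (rule module_hom_plus[OF rm(4,1) ia j\<alpha>])
  have 2: "?\<beta> \<in> module_hom A S N" by (rule module_hom_plus[OF rm(1,5) bp \<beta>r])
  have 3: "\<forall>x\<in>carrier M. ?\<beta> (?\<alpha> x) = h' x"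
  proof
    fix x assume x: "x \<in> carrier M"
    note c = module_hom_closed[OF ia x] module_hom_closed[OF j\<alpha> x] module_hom_closed[OF step.hyps(2) x] module_hom_closed[OF W(4) x]
    show "?\<beta> (?\<alpha> x) = h' x"
      using c S(6-9) W(6) x step.hyps(4)[OF x] by (simp add: module_hom_add[OF S(4)] module_hom_add[OF S(5)])
  qed
  show ?case using S(1) add ext[OF QSW W(3)] 1 2 3 by (intro exI[of _ S] exI conjI)
qed

section \<open>Closure properties of \<open>Sub^m(I)\<close> for an injective module\<close>

lemma sub_rec_fg: "sub_rec A Q m X \<Longrightarrow> fg_module A X"
  by (cases m) (auto dest: short_exactD)

lemma sub_rec_Suc: "sub_rec A Q (Suc m) X \<Longrightarrow> sub_rec A Q m X"
proof (induction m arbitrary: X)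
  case 0
  then show ?case using sub_rec_fg[OF 0] by simp
next
  case (Suc m)
  then obtain f g and J Z :: "'a umodule" where "short_exact A X f J g Z" "factors_add A Q J J (\<lambda>x. x)" "sub_rec A Q (Suc m) Z"
    by (subst (asm) sub_rec.simps(2)) blast
  with Suc.IH[of Z] show ?case by auto
qed

lemma fac_rec_fg: "fac_rec A Q m X \<Longrightarrow> fg_module A X"
  by (cases m) (auto dest: short_exactD)

lemma fac_rec_Suc: "fac_rec A Q (Suc m) X \<Longrightarrow> fac_rec A Q m X"
proof (induction m arbitrary: X)
  case 0
  then show ?case using fac_rec_fg[OF 0] by simp
next
  case (Suc m)
  then obtain f g and J Z :: "'a umodule" where "short_exact A Z f J g X" "factors_add A Q J J (\<lambda>x. x)" "fac_rec A Q (Suc m) Z"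
    by (subst (asm) fac_rec.simps(2)) blast
  with Suc.IH[of Z] show ?case by auto
qed

lemma fac_rec_mono:
  assumes "fac_rec A Q m X" "n \<le> m"
  shows "fac_rec A Q n X"
proof -
  have "fac_rec A Q (n + l) X \<Longrightarrow> fac_rec A Q n X" for l
  proof (induction l)
    case (Suc l)
    then show ?case using fac_rec_Suc[of A Q "n + l" X] by (simp del: fac_rec.simps)
  qed simp
  then show ?thesis using assms le_Suc_ex by blast
qed

lemma injective_extend:
  fixes I :: "'a umodule" and X Y :: "'a umodule"
  assumes I: "injective_module A I" and e: "short_exact A X f Y g Z" and N: "right_module A N" and h: "factors_add A I X N h"
  shows "\<exists>h'. factors_add A I Y N h' \<and> (\<forall>x\<in>carrier X. h' (f x) = h x)"
proof -
  note E = short_exactD[OF e]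
  show ?thesis
  proof (rule factors_add_extend[OF E(10,11) N E(4) _ h])
    fix a assume "a \<in> module_hom A X I"
    then show "\<exists>a'\<in>module_hom A Y I. \<forall>x\<in>carrier X. a' (f x) = a x"
      using I E(1,2,4,5) unfolding injective_module_def by blast
  qed
qed

text \<open>Injectivity of \<open>I\<close> extends the embedding of \<open>Y\<close> over
  \<open>E\<close>, which is the datum that the horseshoe asks for. The cokernels then form a
  sequence of the same kind with one step fewer.\<close>

lemma sub_rec_extension:
  fixes I :: "'a umodule"
  assumes I: "injective_module A I"
  shows "short_exact A Y f E g D \<Longrightarrow> sub_rec A I m Y \<Longrightarrow> sub_rec A I m D \<Longrightarrow> sub_rec A I m E"
proof (induction m arbitrary: Y f E g D)
  case 0
  then show ?case by (simp add: short_exact_def)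
next
  case (Suc m)
  obtain s t and J Y1 :: "'a umodule" where Y: "short_exact A Y s J t Y1" "factors_add A I J J (\<lambda>x. x)" "sub_rec A I m Y1"
    using Suc.prems(2) by (subst (asm) sub_rec.simps(2)) blast
  obtain s' t' and J' D1 :: "'a umodule" where D: "short_exact A D s' J' t' D1" "factors_add A I J' J' (\<lambda>x. x)" "sub_rec A I m D1"
    using Suc.prems(3) by (subst (asm) sub_rec.simps(2)) blast
  note E = short_exactD[OF Suc.prems(1)] and F = short_exactD[OF Y(1)]
  obtain z where z: "factors_add A I E J z" "\<forall>x\<in>carrier Y. z (f x) = s x"
    using injective_extend[OF I Suc.prems(1) F(11) factors_add_comp_right[OF Y(2) F(4)]] by blast
  have zh: "z \<in> module_hom A E J" by (rule factors_add_hom[OF E(11) F(11) z(1)])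
  obtain S W1 :: "'a umodule" and a b c e where *:
    "factors_add A I J J (\<lambda>x. x) \<Longrightarrow> factors_add A I J' J' (\<lambda>x. x) \<Longrightarrow> factors_add A I S S (\<lambda>x. x)"
    "short_exact A E a S b W1" "short_exact A Y1 c W1 e D1"
    by (rule horseshoe[OF Suc.prems(1) D(1) Y(1) zh]) (use z(2) in blast)+
  have "sub_rec A I m W1" by (rule Suc.IH[OF *(3) Y(3) D(3)])
  then show ?case using *(1)[OF Y(2) D(2)] *(2) by auto
qed

text \<open>Embed \<open>C\<close> into \<open>J\<close> through \<open>W\<close>. The cokernel is
  an extension of \<open>J/W\<close> by the complement \<open>W/C\<close>, which is again a retract
  of \<open>W\<close> and covered by the induction hypothesis in the lower degree. No coresolution
  of the summand itself has to be extracted from that of \<open>W\<close>.\<close>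

lemma sub_rec_retract:
  fixes I :: "'a umodule"
  assumes I: "injective_module A I"
  shows "sub_rec A I m W \<Longrightarrow> fg_module A C \<Longrightarrow> a \<in> module_hom A C W \<Longrightarrow> b \<in> module_hom A W C \<Longrightarrow>
    (\<And>x. x \<in> carrier C \<Longrightarrow> b (a x) = x) \<Longrightarrow> sub_rec A I m C"
proof (induction m arbitrary: C W a b)
  case 0
  then show ?case by simp
next
  case (Suc m)
  obtain f g and J D :: "'a umodule" where W: "short_exact A W f J g D" "factors_add A I J J (\<lambda>x. x)" "sub_rec A I m D"
    using Suc.prems(1) by (subst (asm) sub_rec.simps(2)) blast
  note E = short_exactD[OF W(1)]
  interpret W: right_module A W by (rule E(10))
  have rC: "right_module A C" by (rule fg_module_right_module[OF Suc.prems(2)])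
  note ah = Suc.prems(3) and bh = Suc.prems(4) and ba = Suc.prems(5)
  have inj: "inj_on a (carrier C)" by (rule inj_on_inverseI[of _ b]) (rule ba)
  obtain Y :: "'a umodule" and y where Y: "short_exact A C a W y Y"
    using cokernel_exists[OF Suc.prems(2) E(1) ah inj] by blast
  note F = short_exactD[OF Y]
  interpret Y: right_module A Y by (rule F(12))
  note ab = module_hom_comp[OF bh ah]
  have d: "(\<lambda>x. x \<ominus>\<^bsub>W\<^esub> a (b x)) \<in> module_hom A W W" by (rule module_hom_diff[OF E(10,10) module_hom_id ab])
  \<comment> \<open>The idempotent \<open>1 - a b\<close> vanishes on the image of \<open>a\<close>,
    so it descends to the cokernel and gives a section of \<open>y\<close>.\<close>
  have "\<exists>s\<in>module_hom A Y W. \<forall>x\<in>carrier W. s (y x) = x \<ominus>\<^bsub>W\<^esub> a (b x)"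
    by (rule short_exact_factor[OF Y E(10) d]) (simp add: ba W.M.minus_self module_hom_closed[OF ah])
  then obtain s where s: "s \<in> module_hom A Y W" "\<And>x. x \<in> carrier W \<Longrightarrow> s (y x) = x \<ominus>\<^bsub>W\<^esub> a (b x)" by blast
  have ys: "y (s t) = t" if t: "t \<in> carrier Y" for t
  proof -
    obtain x where x: "t = y x" "x \<in> carrier W" using t unfolding F(7)[symmetric] by (elim imageE)
    have "y (s t) = y x \<ominus>\<^bsub>Y\<^esub> y (a (b x))"
      unfolding x(1) s(2)[OF x(2)] by (rule module_hom_minus[OF F(11,12,6) x(2) module_hom_closed[OF ab x(2)]])
    then show ?thesis
      using F(9)[OF module_hom_closed[OF bh x(2)]] x module_hom_closed[OF F(6) x(2)] by (simp add: a_minus_def Y.M.neg_zero)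
  qed
  have subY: "sub_rec A I m Y"
    by (rule Suc.IH[OF sub_rec_Suc[OF Suc.prems(1)] F(3) s(1) F(6) ys])
  have fa: "(\<lambda>x. f (a x)) \<in> module_hom A C J" by (rule module_hom_comp[OF ah E(4)])
  have "inj_on (\<lambda>x. f (a x)) (carrier C)"
    using inj E(5) module_hom_closed[OF ah] by (auto simp: inj_on_def)
  then obtain X :: "'a umodule" and e where X: "short_exact A C (\<lambda>x. f (a x)) J e X"
    using cokernel_exists[OF Suc.prems(2) E(2) fa] by blast
  obtain \<alpha> \<beta> where "short_exact A Y \<alpha> X \<beta> D" using quotient_exact[OF Y W(1) X] by blast
  then have "sub_rec A I m X" by (rule sub_rec_extension[OF I _ subY W(3)])
  then show ?case using X W(2) by auto
qed

lemma sub_rec_zero: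
  assumes "fg_module A Z" "zero_module Z"
  shows "sub_rec A Q m Z"
proof (induction m)
  case (Suc m)
  have "short_exact A Z (\<lambda>x. x) Z (\<lambda>x. x) Z"
    using assms by (auto simp: short_exact_def zero_module_def module_hom_id)
  moreover have "factors_add A Q Z Z (\<lambda>x. x)"
    by (rule factors_add.zero) (use assms(2) in \<open>simp add: zero_module_def\<close>)
  ultimately show ?case using Suc by auto
qed (simp add: assms(1))

text \<open>A module in add T is a retract of an iterated extension of copies of \<open>T\<close>;
  both closure properties above apply.\<close>

lemma sub_rec_add:
  fixes I T C :: "'a umodule"
  assumes I: "injective_module A I" and T: "sub_rec A I m T" and C: "fg_module A C" "factors_add A T C C (\<lambda>x. x)"
  shows "sub_rec A I m C"
proof -
  have "\<exists>(W :: 'a umodule) \<alpha> \<beta>. fg_module A W \<and> factors_add A T W W (\<lambda>x. x) \<and> sub_rec A I m W \<and>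
    \<alpha> \<in> module_hom A C W \<and> \<beta> \<in> module_hom A W C \<and> (\<forall>x\<in>carrier C. \<beta> (\<alpha> x) = x)"
  proof (rule factors_add_through_object[OF sub_rec_fg[OF T] C(1,1) _ _ C(2)])
    fix Z :: "'a umodule" assume "fg_module A Z" "zero_module Z"
    then show "sub_rec A I m Z" by (rule sub_rec_zero)
  next
    fix W V :: "'a umodule" and i p assume "short_exact A T i W p V" "sub_rec A I m V"
    then show "sub_rec A I m W" using sub_rec_extension[OF I _ T] by blast
  qed
  then obtain W :: "'a umodule" and \<alpha> \<beta> where W: "sub_rec A I m W" "\<alpha> \<in> module_hom A C W" "\<beta> \<in> module_hom A W C"
    "\<forall>x\<in>carrier C. \<beta> (\<alpha> x) = x" by (elim exE conjE) (rule that)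
  show ?thesis by (rule sub_rec_retract[OF I W(1) C(1) W(2,3)]) (use W(4) in blast)
qed

lemma in_add_iso:
  assumes "right_module A Q" "right_module A Q'" "module_iso A Q Q'"
  shows "in_add A Q = in_add A Q'"
proof
  fix X :: "('a, 'd) module"
  show "in_add A Q X \<longleftrightarrow> in_add A Q' X"
    unfolding in_add_iff[OF assms(1)] in_add_iff[OF assms(2)]
    using factors_add_trans[OF _ _ assms(1) _ factors_add_iso[OF assms(1,3)], of X X "\<lambda>x. x"]
      factors_add_trans[OF _ _ assms(2) _ factors_add_iso[OF assms(2) module_iso_sym[OF assms(1,3)]], of X X "\<lambda>x. x"]
      fg_module_right_module[of A X] by blast
qed

lemma projective_zero_module:
  assumes Z: "fg_module A Z" "zero_module Z"
  shows "projective_module A Z"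
  unfolding projective_module_def
proof (intro conjI allI impI Z(1), elim conjE)
  have rZ: "right_module A Z" by (rule fg_module_right_module[OF Z(1)])
  fix X Y :: "'a umodule" and p f
  assume X: "fg_module A X" "fg_module A Y" and p: "p \<in> module_hom A X Y" and f: "f \<in> module_hom A Z Y"
  have rm: "right_module A X" "right_module A Y" using X by (auto intro: fg_module_right_module)
  show "\<exists>g\<in>module_hom A Z X. \<forall>x\<in>carrier Z. p (g x) = f x"
    using module_hom_0[OF rm(1)] module_hom_zero[OF rm p] zero_module_hom[OF rZ rm(2) Z(2) f]
    by (intro bexI[of _ "\<lambda>x. \<zero>\<^bsub>X\<^esub>"]) auto
qed

section \<open>Coresolutions by add T and right approximations\<close>

context artin_algebra
begin

lemma ext1_zero_add_right:
  fixes V N :: "'a umodule"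
  assumes M: "ext1_zero M N" and V: "fg_module A V" "factors_add A N V V (\<lambda>x. x)"
  shows "ext1_zero M V"
  unfolding ext1_zero_def
proof (intro allI impI, elim conjE)
  fix X Y :: "'a umodule" and f g h
  assume e: "short_exact A X f Y g M" and h: "h \<in> module_hom A X V"
  note E = short_exactD[OF e]
  have rV: "right_module A V" by (rule fg_module_right_module[OF V(1)])
  have "\<exists>h'. factors_add A N Y V h' \<and> (\<forall>x\<in>carrier X. h' (f x) = h x)"
  proof (rule factors_add_extend[OF E(10,11) rV E(4) _ factors_add_comp_right[OF V(2) h]])
    fix a assume a: "a \<in> module_hom A X N"
    obtain a' where "a' \<in> module_hom A Y N" "\<And>x. x \<in> carrier X \<Longrightarrow> a' (f x) = a x"
      by (rule ext1_zeroD[OF M e a]) blast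
    then show "\<exists>a'\<in>module_hom A Y N. \<forall>x\<in>carrier X. a' (f x) = a x" by blast
  qed
  then show "\<exists>h'\<in>module_hom A Y V. \<forall>x\<in>carrier X. h' (f x) = h x"
    using factors_add_hom[OF E(11) rV] by blast
qed

lemma ext_zero_add_right:
  fixes V N :: "'a umodule"
  assumes "ext_zero i M N" "fg_module A V" "factors_add A N V V (\<lambda>x. x)"
  shows "ext_zero i M V"
  using assms ext1_zero_add_right unfolding ext_zero_def by blast

lemma ext_zero_zero_module:
  fixes Z N :: "'a umodule"
  assumes Z: "fg_module A Z" "zero_module Z" and N: "fg_module A N"
  shows "ext_zero i Z N"
proof -
  have P: "projective_module A Z" by (rule projective_zero_module[OF Z])
  have "short_exact A Z (\<lambda>x. x) Z (\<lambda>x. x) Z"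
    using Z by (auto simp: short_exact_def zero_module_def module_hom_id)
  then have "syzygy Z Z" using P by (auto simp: syzygy_def)
  then have "(syzygy ^^ i) Z Z" by (induction i) auto
  then show ?thesis by (rule ext_zeroI[OF Z(1) N]) (rule ext1_zero_projective[OF P N])
qed

lemma coresolution_cosyzygies:
  fixes X :: "'a umodule" and Q :: "nat \<Rightarrow> 'a umodule"
  assumes r: "coresolution A X Q e d"
  obtains B v where "B 0 = X" "\<And>j. short_exact A (B j) (v j) (Q j) (d j) (B (Suc j))"
    "\<And>j. B (Suc j) = restrict_module (Q (Suc j)) (d j ` carrier (Q j))"
proof -
  have R: "left_exact_seq A m X Q e d" for m using r by (simp add: coresolution_def)
  have fgX: "fg_module A X" and e: "e \<in> module_hom A X (Q 0)" "inj_on e (carrier X)"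
    using R[of 1] by (simp_all add: left_exact_seq_def)
  have fg: "fg_module A (Q j)" for j using R[of "Suc j"] by (simp add: left_exact_seq_def)
  have rm: "right_module A (Q j)" for j by (rule fg_module_right_module[OF fg])
  have d: "d j \<in> module_hom A (Q j) (Q (Suc j))" for j
    using R[of "Suc (Suc j)"] by (simp add: left_exact_seq_def)
  have ker: "{x \<in> carrier (Q j). d j x = \<zero>\<^bsub>Q (Suc j)\<^esub>} = (case j of 0 \<Rightarrow> e ` carrier X | Suc l \<Rightarrow> d l ` carrier (Q l))" for j
    using R[of "Suc (Suc j)"] by (simp add: left_exact_seq_def a_kernel_def')
  define B where "B j = (case j of 0 \<Rightarrow> X | Suc l \<Rightarrow> restrict_module (Q (Suc l)) (d l ` carrier (Q l)))" for j
  define v where "v j = (case j of 0 \<Rightarrow> e | Suc l \<Rightarrow> (\<lambda>x. x))" for j :: nat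
  have fgB: "fg_module A (B j)" for j
  proof (cases j)
    case (Suc l)
    have "submodule (d l ` carrier (Q l)) A (Q (Suc l))"
      by (rule submodule_image[OF rm rm d right_module.submodule_carrier[OF rm]])
    then show ?thesis unfolding B_def Suc nat.case by (rule fg_module_restrict[OF fg])
  qed (simp add: B_def fgX)
  have v1: "v j \<in> module_hom A (B j) (Q j)" for j
  proof (cases j)
    case (Suc l)
    have "\<And>x. x \<in> carrier (Q l) \<Longrightarrow> d l x \<in> carrier (Q (Suc l))" by (rule module_hom_closed[OF d])
    then show ?thesis by (auto simp: v_def B_def Suc module_hom_def)
  qed (simp add: v_def B_def e)
  have v2: "inj_on (v j) (carrier (B j))" for j
    by (cases j) (simp_all add: v_def B_def e)
  have v3: "v j ` carrier (B j) = {x \<in> carrier (Q j). d j x = \<zero>\<^bsub>Q (Suc j)\<^esub>}" for j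
    unfolding ker by (cases j) (simp_all add: v_def B_def)
  have dB: "d j \<in> module_hom A (Q j) (B (Suc j))" for j
    using d[of j] by (auto simp: B_def module_hom_def)
  have "short_exact A (B j) (v j) (Q j) (d j) (B (Suc j))" for j
    unfolding short_exact_def v3 by (intro conjI fgB fg v1 v2 dB) (simp_all add: B_def)
  then show thesis by (rule that[rotated]) (simp_all add: B_def)
qed

text \<open>Descending induction from the end where the cosyzygies are zero: \<open>B j\<close> is
  the kernel of the map from \<open>V j\<close> onto \<open>B (Suc j)\<close>. All degrees are
  treated together because each step uses the next higher one.\<close>

lemma cosyzygy_ext_zero:
  fixes T X :: "'a umodule" and B V :: "nat \<Rightarrow> 'a umodule"
  assumes T: "fg_module A T" and X: "fg_module A X" "\<And>i. ext_zero i T X"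
    and ex: "\<And>j. short_exact A (B j) (v j) (V j) (w j) (B (Suc j))"
    and V: "\<And>j. factors_add A T (V j) (V j) (\<lambda>x. x)" and z: "\<And>j. j \<ge> r \<Longrightarrow> zero_module (B j)"
  shows "ext_zero i (B j) X"
proof -
  note E = short_exactD[OF ex]
  have z': "ext_zero i (B j) X" if "j \<ge> r" for i j
    by (rule ext_zero_zero_module[OF E(1) z[OF that] X(1)])
  have "\<forall>i. ext_zero i (B j) X" if "j \<le> r" for j
    using that
  proof (induction rule: inc_induct)
    case base
    show ?case using z' by simp
  next
    case (step j)
    show ?case
      using ext_zero_first[OF ex X(1) ext_zero_add[OF E(2) V T X(1) X(2)]] step.IH by blast
  qed
  then show ?thesis using z' by (cases "j \<le> r") auto
qed

text \<open>\<open>W\<close> takes one copy of \<open>T\<close> for each of finitely many maps that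
  generate \<open>Hom(T, X)\<close> over \<open>k\<close>, with \<open>p\<close> given by these
  maps.\<close>

lemma right_approximation:
  fixes T X :: "'a umodule"
  assumes T: "fg_module A T" and X: "fg_module A X"
  obtains W :: "'a umodule" and p where "fg_module A W" "factors_add A T W W (\<lambda>x. x)" "p \<in> module_hom A W X"
    "\<And>f. f \<in> module_hom A T X \<Longrightarrow> \<exists>g\<in>module_hom A T W. \<forall>x\<in>carrier T. p (g x) = f x"
proof -
  have rT: "right_module A T" and rX: "right_module A X" using T X by (auto intro: fg_module_right_module)
  interpret X: right_module A X by fact
  let ?ok = "\<lambda>W p f. \<exists>g\<in>module_hom A T W. \<forall>x\<in>carrier T. p (g x) = f x"
  obtain F where F: "finite F" "F \<subseteq> module_hom A T X"
    "\<forall>C. hom_subspace T X C \<and> F \<subseteq> C \<longrightarrow> (\<forall>f\<in>module_hom A T X. \<exists>h\<in>C. \<forall>x\<in>carrier T. h x = f x)"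
    using hom_finitely_generated[OF T X] by (elim exE conjE) (rule that)
  have "\<exists>(W :: 'a umodule) p. fg_module A W \<and> factors_add A T W W (\<lambda>x. x) \<and> p \<in> module_hom A W X \<and> (\<forall>f\<in>F. ?ok W p f)"
    using F(1,2)
  proof (induction F)
    case empty
    let ?Z = "restrict_module X {\<zero>\<^bsub>X\<^esub>}"
    have "factors_add A T ?Z ?Z (\<lambda>x. x)" by (rule factors_add.zero) simp
    then show ?case using zero_umodule_exists(1)[OF X] module_hom_0[OF rX] by blast
  next
    case (insert f F)
    then obtain W :: "'a umodule" and p where W: "fg_module A W" "factors_add A T W W (\<lambda>x. x)" "p \<in> module_hom A W X"
      "\<forall>f\<in>F. ?ok W p f" by auto
    have f: "f \<in> module_hom A T X" using insert.prems by simp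
    obtain S :: "'a umodule" and i j s t where S: "fg_module A S" "i \<in> module_hom A T S" "j \<in> module_hom A W S"
      "s \<in> module_hom A S T" "t \<in> module_hom A S W"
      "\<And>x. x \<in> carrier T \<Longrightarrow> s (i x) = x" "\<And>x. x \<in> carrier W \<Longrightarrow> t (j x) = x"
      "\<And>x. x \<in> carrier W \<Longrightarrow> s (j x) = \<zero>\<^bsub>T\<^esub>" "\<And>x. x \<in> carrier T \<Longrightarrow> t (i x) = \<zero>\<^bsub>W\<^esub>"
      "\<And>x. x \<in> carrier S \<Longrightarrow> i (s x) \<oplus>\<^bsub>S\<^esub> j (t x) = x"
      by (rule biproduct_exists[OF T W(1)]) blast
    have rm: "right_module A S" "right_module A W" using S(1) W(1) by (auto intro: fg_module_right_module)
    have "factors_add A T S S (\<lambda>x. i (s x) \<oplus>\<^bsub>S\<^esub> j (t x))"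
      by (rule factors_add_plus[OF rm(1,1) factors_add_basic[OF rm(1) S(4) S(2)]
        factors_add_comp_left[OF rm(1,2,1) factors_add_comp_right[OF W(2) S(5)] S(3)]])
    then have add: "factors_add A T S S (\<lambda>x. x)" by (rule factors_add_cong) (simp add: S(10))
    note fs = module_hom_comp[OF S(4) f] and pt = module_hom_comp[OF S(5) W(3)]
    let ?p = "\<lambda>x. f (s x) \<oplus>\<^bsub>X\<^esub> p (t x)"
    have p: "?p \<in> module_hom A S X" by (rule module_hom_plus[OF rm(1) rX fs pt])
    have okf: "?ok S ?p f"
    proof (rule bexI[OF _ S(2)], rule ballI)
      fix x assume x: "x \<in> carrier T"
      then show "?p (i x) = f x"
        using S(6,9) module_hom_zero[OF rm(2) rX W(3)] module_hom_closed[OF f x] by simp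
    qed
    have okF: "?ok S ?p f'" if f': "f' \<in> F" for f'
    proof -
      obtain g where g: "g \<in> module_hom A T W" "\<forall>x\<in>carrier T. p (g x) = f' x" using W(4) f' by blast
      have "f' \<in> module_hom A T X" using insert.prems f' by blast
      then have "?p (j (g x)) = f' x" if "x \<in> carrier T" for x
        using S(7,8) module_hom_closed[OF g(1) that] g(2) that module_hom_zero[OF rT rX f] module_hom_closed[of f' A T X x] by simp
      then show ?thesis by (intro bexI[OF _ module_hom_comp[OF g(1) S(3)]]) simp
    qed
    show ?case by (rule exI[of _ S], rule exI[of _ ?p], intro conjI S(1) add p ballI)
        (use okf okF in blast)
  qed
  then obtain W :: "'a umodule" and p where W: "fg_module A W" "factors_add A T W W (\<lambda>x. x)" "p \<in> module_hom A W X"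
    "\<forall>f\<in>F. ?ok W p f" by (elim exE conjE) (rule that)
  have rW: "right_module A W" by (rule fg_module_right_module[OF W(1)])
  note TW = hom_subspace_all[OF rT rW, unfolded hom_subspace_def] and TX = hom_subspace_all[OF rT rX, unfolded hom_subspace_def]
  note \<phi> = ring_hom_axioms_simps[OF structure_map]
  \<comment> \<open>The maps that lift through \<open>p\<close> are closed under sums and scalars
    and contain the generators, so up to values off the carrier they are all maps from
    \<open>T\<close> to \<open>X\<close>.\<close>
  let ?C = "{f \<in> module_hom A T X. ?ok W p f}"
  have "hom_subspace T X ?C"
    unfolding hom_subspace_def
  proof (intro conjI ballI)
    show "?C \<subseteq> module_hom A T X" by blast
    show "(\<lambda>x. \<zero>\<^bsub>X\<^esub>) \<in> ?C"
      using module_hom_0[OF rX] module_hom_0[OF rW] module_hom_zero[OF rW rX W(3)]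
      by (intro CollectI conjI bexI[of _ "\<lambda>x. \<zero>\<^bsub>W\<^esub>"]) auto
  next
    fix f g assume "f \<in> ?C" "g \<in> ?C"
    then obtain f' g' where f: "f \<in> module_hom A T X" "f' \<in> module_hom A T W" "\<forall>x\<in>carrier T. p (f' x) = f x"
      and g: "g \<in> module_hom A T X" "g' \<in> module_hom A T W" "\<forall>x\<in>carrier T. p (g' x) = g x"
      by (elim CollectE conjE bexE)
    show "(\<lambda>x. f x \<oplus>\<^bsub>X\<^esub> g x) \<in> ?C"
    proof (intro CollectI conjI)
      show "(\<lambda>x. f x \<oplus>\<^bsub>X\<^esub> g x) \<in> module_hom A T X" by (rule module_hom_plus[OF rT rX f(1) g(1)])
      show "?ok W p (\<lambda>x. f x \<oplus>\<^bsub>X\<^esub> g x)"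
        by (rule bexI[OF _ module_hom_plus[OF rT rW f(2) g(2)]])
          (use f(3) g(3) module_hom_closed[OF f(2)] module_hom_closed[OF g(2)] in \<open>simp add: module_hom_add[OF W(3)]\<close>)
    qed
  next
    fix c f assume c: "c \<in> carrier k" and "f \<in> ?C"
    then obtain f' where f: "f \<in> module_hom A T X" "f' \<in> module_hom A T W" "\<forall>x\<in>carrier T. p (f' x) = f x"
      by (elim CollectE conjE bexE)
    have 1: "(\<lambda>x. \<phi> c \<odot>\<^bsub>X\<^esub> f x) \<in> module_hom A T X" using TX c f(1) by blast
    have 2: "(\<lambda>x. \<phi> c \<odot>\<^bsub>W\<^esub> f' x) \<in> module_hom A T W" using TW c f(2) by blast
    have "?ok W p (\<lambda>x. \<phi> c \<odot>\<^bsub>X\<^esub> f x)"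
      by (rule bexI[OF _ 2])
        (use f(3) module_hom_closed[OF f(2)] \<phi>(1)[OF c c] in \<open>simp add: module_hom_smult[OF W(3)]\<close>)
    with 1 show "(\<lambda>x. \<phi> c \<odot>\<^bsub>X\<^esub> f x) \<in> ?C" by blast
  qed
  moreover have "F \<subseteq> ?C" using F(2) W(4) by blast
  ultimately have C: "\<forall>f\<in>module_hom A T X. \<exists>h\<in>?C. \<forall>x\<in>carrier T. h x = f x" using F(3)[rule_format, of ?C] by blast
  show thesis
  proof (rule that[OF W(1-3)])
    fix f assume "f \<in> module_hom A T X"
    from bspec[OF C this] obtain h where h: "h \<in> ?C" "\<forall>x\<in>carrier T. h x = f x" by (elim bexE)
    from h(1) obtain g where g: "g \<in> module_hom A T W" "\<forall>x\<in>carrier T. p (g x) = h x"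
      by (elim CollectE conjE bexE)
    show "?ok W p f" by (rule bexI[OF _ g(1)]) (use g(2) h(2) in simp)
  qed
qed

end

section \<open>The coresolution of the algebra by the injective module\<close>

text \<open>The data of the converse for positive \<open>d\<close>, with dimensions turned into
  vanishing conditions; because of the degree shift, \<open>ext_zero 1\<close> for \<open>I\<close>
  is Ext^2. \<open>U\<close> is a copy of the regular module, \<open>V\<close> the terms of its
  coresolution by add T, and \<open>B\<close> the cosyzygies of that coresolution.\<close>

locale tilting_setup = artin_algebra k \<phi> A
  for k :: "'k ring" and \<phi> :: "'k \<Rightarrow> 'a" and A :: "'a ring" (structure) +
  fixes I T U :: "'a umodule" and d r :: nat and B V :: "nat \<Rightarrow> 'a umodule"
    and v w :: "nat \<Rightarrow> (nat \<Rightarrow> 'a) set \<Rightarrow> (nat \<Rightarrow> 'a) set"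
  assumes I: "injective_module A I" and pd_I: "\<And>N. fg_module A N \<Longrightarrow> ext_zero 1 I N"
    and T: "fg_module A T" and ext_T: "\<And>i. ext_zero i T T"
    and pd_T: "\<And>i N. d \<le> i \<Longrightarrow> fg_module A N \<Longrightarrow> ext_zero i T N"
    and d: "0 < d" and fac_T: "fac_rec A I d T"
    and U: "projective_module A U"
    and gen_U: "\<And>(M :: 'a umodule) x. fg_module A M \<Longrightarrow> x \<in> carrier M \<Longrightarrow> \<exists>h\<in>module_hom A U M. x \<in> h ` carrier U"
    and B0: "B 0 = U" and exact: "\<And>j. short_exact A (B j) (v j) (V j) (w j) (B (Suc j))"
    and add_V: "\<And>j. factors_add A T (V j) (V j) (\<lambda>x. x)" and zero_B: "\<And>j. r \<le> j \<Longrightarrow> zero_module (B j)"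
begin

definition perp :: "'a umodule \<Rightarrow> bool" where
  "perp X \<longleftrightarrow> fg_module A X \<and> (\<forall>i. ext_zero i T X)"

definition all_through_I :: "'a umodule \<Rightarrow> 'a umodule \<Rightarrow> bool" where
  "all_through_I C Y \<longleftrightarrow> (\<forall>h\<in>module_hom A C Y. factors_add A I C Y h)"

lemma fg_I: "fg_module A I"
  using I by (simp add: injective_module_def)

lemma perp_add_T: "fg_module A X \<Longrightarrow> factors_add A T X X (\<lambda>x. x) \<Longrightarrow> perp X"
  unfolding perp_def using ext_zero_add_right[OF ext_T] by blast

lemma perp_add_I: "fg_module A X \<Longrightarrow> factors_add A I X X (\<lambda>x. x) \<Longrightarrow> perp X"
  unfolding perp_def using ext_zero_add_right[of _ T I X] ext1_zero_injective[OF I]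
  by (auto simp: ext_zero_def)

text \<open>A right approximation by add T. It is onto because a map from \<open>U\<close> to
  \<open>X\<close> extends to \<open>V 0\<close>, as Ext^1(B 1, X) vanishes, and then lifts. Its
  kernel stays in \<open>perp\<close> because all maps from \<open>T\<close> lift.\<close>

lemma perp_approximation:
  assumes X: "perp X"
  obtains X' W :: "'a umodule" and a p where "short_exact A X' a W p X" "factors_add A T W W (\<lambda>x. x)" "perp X'"
proof -
  have fgX: "fg_module A X" and ext: "\<And>i. ext_zero i T X" using X by (auto simp: perp_def)
  obtain W :: "'a umodule" and p where W: "fg_module A W" "factors_add A T W W (\<lambda>x. x)" and p: "p \<in> module_hom A W X"
    and lift: "\<And>f. f \<in> module_hom A T X \<Longrightarrow> \<exists>g\<in>module_hom A T W. \<forall>x\<in>carrier T. p (g x) = f x"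
    by (rule right_approximation[OF T fgX]) blast
  note E0 = short_exactD[OF exact[of 0]]
  have rX: "right_module A X" and rW: "right_module A W" using fgX W(1) by (auto intro: fg_module_right_module)
  have e1: "ext1_zero (B 1) X"
    using cosyzygy_ext_zero[where B = B and V = V and v = v and w = w and r = r and i = 0 and j = 1,
      OF T fgX ext exact add_V zero_B] by simp
  have "carrier X \<subseteq> p ` carrier W"
  proof
    fix x assume "x \<in> carrier X"
    then obtain h u where h: "h \<in> module_hom A U X" and u: "u \<in> carrier U" "x = h u" using gen_U[OF fgX] by blast
    have h': "h \<in> module_hom A (B 0) X" using h by (simp add: B0)
    obtain h1 where h1: "h1 \<in> module_hom A (V 0) X" "\<And>x. x \<in> carrier (B 0) \<Longrightarrow> h1 (v 0 x) = h x"
      by (rule ext1_zeroD[OF e1[unfolded One_nat_def] exact h']) blast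
    have "factors_add A T (V 0) X h1" using factors_add_comp_left[OF E0(11,11) rX add_V h1(1)] .
    from factors_add_lift[OF rW rX E0(11) p lift this] obtain g where
      g: "g \<in> module_hom A (V 0) W" "\<forall>x\<in>carrier (V 0). p (g x) = h1 x" by blast
    have u0: "u \<in> carrier (B 0)" using u(1) by (simp add: B0)
    have vu: "v 0 u \<in> carrier (V 0)" by (rule module_hom_closed[OF E0(4) u0])
    have "x = p (g (v 0 u))" using g(2) vu h1(2)[OF u0] u(2) by simp
    then show "x \<in> p ` carrier W" by (rule image_eqI) (rule module_hom_closed[OF g(1) vu])
  qed
  then have surj: "p ` carrier W = carrier X" using module_hom_closed[OF p] by blast
  let ?K = "restrict_module W {y \<in> carrier W. p y = \<zero>\<^bsub>X\<^esub>}"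
  have e: "short_exact A ?K (\<lambda>y. y) W p X" by (rule kernel_exact[OF W(1) fgX p surj])
  have "perp W" by (rule perp_add_T[OF W])
  then have "ext_zero i T ?K" for i
    using ext_zero_kernel[OF T e _ ext lift] by (simp add: perp_def)
  then have "perp ?K" using short_exactD(1)[OF e] by (simp add: perp_def)
  with e W(2) show thesis by (rule that)
qed

text \<open>Vanishing of Ext^1(C, Z) lifts every map from \<open>C\<close> to \<open>Y\<close> into
  \<open>J\<close>, which lies in add I.\<close>

lemma all_through_I_fac:
  fixes Z J Y :: "'a umodule"
  assumes e: "short_exact A Z f J g Y" and J: "factors_add A I J J (\<lambda>x. x)"
    and C: "fg_module A C" "ext1_zero C Z"
  shows "all_through_I C Y"
  unfolding all_through_I_def
proof
  fix h assume h: "h \<in> module_hom A C Y"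
  note E = short_exactD[OF e]
  have rC: "right_module A C" by (rule fg_module_right_module[OF C(1)])
  obtain h' where h': "h' \<in> module_hom A C J" "\<And>x. x \<in> carrier C \<Longrightarrow> g (h' x) = h x"
    by (rule ext1_zero_lift[OF C e h]) blast
  have "factors_add A I C Y (\<lambda>x. g (h' x))"
    using factors_add_comp_left[OF rC E(11,12) factors_add_comp_right[OF J h'(1)] E(6)] .
  then show "factors_add A I C Y h" by (rule factors_add_cong) (simp add: h'(2))
qed

text \<open>The map lifts to an add T cover of \<open>X\<close> since the kernel of the cover is in
  \<open>perp\<close>. There it is a sum of maps through \<open>T\<close>, and each first factor
  \<open>C -> T\<close> passes through add I by hypothesis.\<close>

lemma all_through_I_perp:
  assumes C: "fg_module A C" "all_through_I C T" and X: "perp X" and ext: "\<And>X'. perp X' \<Longrightarrow> ext1_zero C X'"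
  shows "all_through_I C X"
  unfolding all_through_I_def
proof
  fix h assume h: "h \<in> module_hom A C X"
  obtain X' W :: "'a umodule" and a p where e: "short_exact A X' a W p X" and W: "factors_add A T W W (\<lambda>x. x)"
    and X': "perp X'" by (rule perp_approximation[OF X])
  note E = short_exactD[OF e]
  have rC: "right_module A C" and rT: "right_module A T" using C T by (auto intro: fg_module_right_module)
  obtain h' where h': "h' \<in> module_hom A C W" "\<And>x. x \<in> carrier C \<Longrightarrow> p (h' x) = h x"
    by (rule ext1_zero_lift[OF C(1) ext[OF X'] e h]) blast
  have *: "factors_add A I C W g" if "factors_add A T C W g" for g
    using that
  proof (induction)
    case (zero g)
    then show ?case by (rule factors_add.zero)
  next
    case (step g b c g')
    have "factors_add A I C T b" using C(2) step.hyps(2) by (simp add: all_through_I_def)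
    from factors_add_plus[OF rC E(11) factors_add_comp_left[OF rC rT E(11) this step.hyps(3)] step.IH]
    show ?case by (rule factors_add_cong) (rule step.hyps(4))
  qed
  have "factors_add A I C W h'" by (rule *) (rule factors_add_comp_right[OF W h'(1)])
  from factors_add_comp_left[OF rC E(11,12) this E(6)]
  show "factors_add A I C X h" by (rule factors_add_cong) (simp add: h'(2))
qed

text \<open>Here \<open>pd I \<le> 1\<close> enters: the syzygy of \<open>I\<close> has vanishing Ext.\<close>

lemma ext1_zero_I:
  assumes Y: "fg_module A Y"
    and through: "\<And>C. fg_module A C \<Longrightarrow> (\<And>N. fg_module A N \<Longrightarrow> ext1_zero C N) \<Longrightarrow> all_through_I C Y"
  shows "ext1_zero I Y"
proof -
  obtain K P :: "'a umodule" and i p where P: "projective_module A P" and e: "short_exact A K i P p I"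
    by (rule presentation_exists[OF fg_I])
  note E = short_exactD[OF e]
  have syz: "syzygy I K" using P e by (auto simp: syzygy_def)
  have "ext1_zero K N" if "fg_module A N" for N
    using pd_I[OF that] ext_zero_Suc[OF syz that, of 0] by simp
  then have K: "all_through_I K Y" by (rule through[OF E(1)])
  have rY: "right_module A Y" by (rule fg_module_right_module[OF Y])
  show ?thesis
  proof (rule ext1_zeroI_presentation[OF P e Y])
    fix h assume "h \<in> module_hom A K Y"
    then have "factors_add A I K Y h" using K by (simp add: all_through_I_def)
    \<comment> \<open>A map that passes through add I extends along the embedding of
      \<open>K\<close>, because its first factors are maps into the injective module
      \<open>I\<close>.\<close>
    from injective_extend[OF I e rY this]
    show "\<exists>h'\<in>module_hom A P Y. \<forall>x\<in>carrier K. h' (i x) = h x"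
      using factors_add_hom[OF E(11) rY] by blast
  qed
qed

lemma fac_Suc_T: "j < d \<Longrightarrow> fac_rec A I (Suc j) T"
  using fac_T by (rule fac_rec_mono) simp

lemma ext1_zero_I_fac:
  assumes "fac_rec A I (Suc j) Y"
  shows "ext1_zero I Y"
proof (rule ext1_zero_I[OF fac_rec_fg[OF assms]])
  fix C assume C: "fg_module A C" "\<And>N. fg_module A N \<Longrightarrow> ext1_zero C N"
  obtain f g and Z J :: "'a umodule" where Z: "short_exact A Z f J g Y" "factors_add A I J J (\<lambda>x. x)"
    using assms by auto
  show "all_through_I C Y" by (rule all_through_I_fac[OF Z C(1) C(2)[OF short_exactD(1)[OF Z(1)]]])
qed

lemma ext1_zero_I_perp:
  assumes X: "perp X"
  shows "ext1_zero I X"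
proof (rule ext1_zero_I)
  show "fg_module A X" using X by (simp add: perp_def)
  fix C assume C: "fg_module A C" "\<And>N. fg_module A N \<Longrightarrow> ext1_zero C N"
  \<comment> \<open>Positivity of \<open>d\<close> makes \<open>T\<close> a quotient of a module in
    add I.\<close>
  obtain f g and Z J :: "'a umodule" where Z: "short_exact A Z f J g T" "factors_add A I J J (\<lambda>x. x)"
    using fac_Suc_T[OF d] by auto
  have "all_through_I C T" by (rule all_through_I_fac[OF Z C(1) C(2)[OF short_exactD(1)[OF Z(1)]]])
  then show "all_through_I C X" by (rule all_through_I_perp[OF C(1) _ X]) (use C(2) in \<open>simp add: perp_def\<close>)
qed

text \<open>
  \<open>C\<close> plays the \<open>j\<close>-th cosyzygy of a coresolution of the algebra by \<open>add I\<close>. The embedding of \<open>C\<close> into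
  an object \<open>W\<close> of \<open>perp\<close> is what turns an \<open>add I\<close>-factorization into a monomorphism.
\<close>

definition I_cosyzygy :: "nat \<Rightarrow> 'a umodule \<Rightarrow> bool" where
  "I_cosyzygy j C \<longleftrightarrow> fg_module A C \<and> (\<forall>Z. fac_rec A I j Z \<longrightarrow> ext1_zero C Z) \<and>
     (\<forall>X. perp X \<longrightarrow> ext1_zero C X) \<and> (\<forall>i. d \<le> i + j \<longrightarrow> ext_zero i T C) \<and>
     (\<exists>(W :: 'a umodule) m q. perp W \<and> short_exact A C m W q (B (Suc j)))"

lemma I_cosyzygy_0: "I_cosyzygy 0 U"
proof -
  have fgU: "fg_module A U" by (rule projective_fg[OF U])
  have "perp (V 0)" by (rule perp_add_T[OF short_exactD(2)[OF exact] add_V])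
  moreover have "short_exact A U (v 0) (V 0) (w 0) (B (Suc 0))" using exact[of 0] by (simp add: B0)
  ultimately show ?thesis
    unfolding I_cosyzygy_def using fgU ext1_zero_projective[OF U] pd_T[OF _ fgU]
    by (auto simp: perp_def)
qed

text \<open>The inductive step. The embedding of \<open>C\<close> into \<open>W\<close> passes
  through some \<open>J\<close> in add I, so \<open>C\<close> embeds into \<open>J\<close>; its
  cokernel \<open>C'\<close> is the next cosyzygy, and all the invariants are rechecked for
  it.\<close>

lemma I_cosyzygy_Suc:
  assumes C: "I_cosyzygy j C" and j: "j < d"
  shows "\<exists>(J :: 'a umodule) f g C'. short_exact A C f J g C' \<and> factors_add A I J J (\<lambda>x. x) \<and> I_cosyzygy (Suc j) C'"
proof -
  have fgC: "fg_module A C" and extF: "\<And>Z. fac_rec A I j Z \<Longrightarrow> ext1_zero C Z"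
    and extP: "\<And>X. perp X \<Longrightarrow> ext1_zero C X" and extT: "\<And>i. d \<le> i + j \<Longrightarrow> ext_zero i T C"
    using C by (auto simp: I_cosyzygy_def)
  obtain W :: "'a umodule" and m q where W: "perp W" and eW: "short_exact A C m W q (B (Suc j))"
    using C by (auto simp: I_cosyzygy_def)
  note EW = short_exactD[OF eW]
  \<comment> \<open>A module in \<open>Fac\<close> of index \<open>Suc j\<close> is covered by add I
    with kernel of index \<open>j\<close>, for which Ext^1(C, -) vanishes by the invariant.\<close>
  have thF: "all_through_I C Z" if fac: "fac_rec A I (Suc j) Z" for Z
  proof -
    obtain f g and Z' J :: "'a umodule" where Z: "short_exact A Z' f J g Z" "factors_add A I J J (\<lambda>x. x)" "fac_rec A I j Z'"
      using fac by auto
    show ?thesis by (rule all_through_I_fac[OF Z(1,2) fgC extF[OF Z(3)]])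
  qed
  \<comment> \<open>As \<open>j < d\<close>, the module \<open>T\<close> itself is of index
    \<open>Suc j\<close>, so maps from \<open>C\<close> to \<open>T\<close> pass through add
    I.\<close>
  have thP: "all_through_I C X" if "perp X" for X
    by (rule all_through_I_perp[OF fgC thF[OF fac_Suc_T[OF j]] that extP])
  have "factors_add A I C W m" using thP[OF W] EW(4) by (simp add: all_through_I_def)
  \<comment> \<open>The factorization of the mono \<open>m\<close> through one object of add I; its
    first factor is then mono as well.\<close>
  then have "\<exists>(J :: 'a umodule) \<alpha> \<beta>. fg_module A J \<and> factors_add A I J J (\<lambda>x. x) \<and> True \<and> \<alpha> \<in> module_hom A C J \<and>
    \<beta> \<in> module_hom A J W \<and> (\<forall>x\<in>carrier C. \<beta> (\<alpha> x) = m x)"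
    by (rule factors_add_through_object[OF fg_I fgC EW(2), of "\<lambda>_. True", OF TrueI TrueI])
  then obtain J :: "'a umodule" and f \<beta> where J: "fg_module A J" "factors_add A I J J (\<lambda>x. x)"
    and f: "f \<in> module_hom A C J" and \<beta>: "\<beta> \<in> module_hom A J W" "\<forall>x\<in>carrier C. \<beta> (f x) = m x"
    by (elim exE conjE) (rule that)
  have "inj_on f (carrier C)"
  proof (rule inj_onI)
    fix x y assume "x \<in> carrier C" "y \<in> carrier C" "f x = f y"
    then show "x = y" using \<beta>(2) inj_onD[OF EW(5), of x y] by metis
  qed
  then obtain C' :: "'a umodule" and g where e: "short_exact A C f J g C'"
    using cokernel_exists[OF fgC J(1) f] by blast
  note E = short_exactD[OF e]
  have perpJ: "perp J" by (rule perp_add_I[OF J])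
  \<comment> \<open>Maps from \<open>C\<close> to \<open>Y\<close> pass through add I and so extend
    over \<open>J\<close>. Together with Ext^1(J, Y) = 0, which comes from \<open>I\<close>, this
    leaves no Ext^1(C', Y).\<close>
  have third: "ext1_zero C' Y" if Y: "fg_module A Y" "all_through_I C Y" "ext1_zero I Y" for Y
  proof (rule ext1_zero_third[OF e _ Y(1)])
    show "ext1_zero J Y" using ext_zero_add[OF J fg_I Y(1), of 0] Y(3) by simp
    have rY: "right_module A Y" by (rule fg_module_right_module[OF Y(1)])
    fix h assume "h \<in> module_hom A C Y"
    then have "factors_add A I C Y h" using Y(2) by (simp add: all_through_I_def)
    from injective_extend[OF I e rY this]
    show "\<exists>h'\<in>module_hom A J Y. \<forall>x\<in>carrier C. h' (f x) = h x"
      using factors_add_hom[OF E(11) rY] by blast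
  qed
  have 1: "ext1_zero C' Z" if "fac_rec A I (Suc j) Z" for Z
    by (rule third[OF fac_rec_fg[OF that] thF[OF that] ext1_zero_I_fac[OF that]])
  have 2: "ext1_zero C' X" if "perp X" for X
    by (rule third[OF _ thP[OF that] ext1_zero_I_perp[OF that]]) (use that in \<open>simp add: perp_def\<close>)
  \<comment> \<open>Ext(T, C') lies between Ext(T, J), which vanishes, and Ext(T, C) one degree
    higher; this is the gain of one degree.\<close>
  have 3: "ext_zero i T C'" if "d \<le> i + Suc j" for i
    by (rule ext_zero_cokernel[OF T e]) (use perpJ extT[of "Suc i"] that in \<open>auto simp: perp_def\<close>)
  have "factors_add A I C J f" using factors_add_comp_right[OF J(2) f] .
  from injective_extend[OF I eW E(11) this] obtain z where z: "factors_add A I W J z" "\<forall>x\<in>carrier C. z (m x) = f x"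
    by blast
  have zh: "z \<in> module_hom A W J" by (rule factors_add_hom[OF EW(11) E(11) z(1)])
  \<comment> \<open>\<open>C'\<close> needs its own embedding into \<open>perp\<close>. The
    horseshoe builds it from the coresolutions of \<open>C\<close> by \<open>J\<close> and of
    \<open>B (Suc j)\<close> by \<open>V (Suc j)\<close>, and \<open>W1\<close> is in
    \<open>perp\<close> as the cokernel of a map between members of \<open>perp\<close>.\<close>
  obtain S W1 :: "'a umodule" and i p a b c e' where S: "short_exact A J i S p (V (Suc j))"
    "short_exact A W a S b W1" "short_exact A C' c W1 e' (B (Suc (Suc j)))"
    by (rule horseshoe[OF eW exact e zh]) (use z(2) in blast)+
  have perpV: "perp (V (Suc j))" by (rule perp_add_T[OF short_exactD(2)[OF exact] add_V])
  have perpS: "ext_zero i T S" for i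
    by (rule ext_zero_extension[OF T S(1)]) (use perpJ perpV in \<open>auto simp: perp_def\<close>)
  have "ext_zero i T W1" for i
    by (rule ext_zero_cokernel[OF T S(2) perpS]) (use W in \<open>auto simp: perp_def\<close>)
  then have "perp W1" using short_exactD(3)[OF S(2)] by (simp add: perp_def)
  then have "I_cosyzygy (Suc j) C'"
    unfolding I_cosyzygy_def using E(3) 1 2 3 S(3) by blast
  then show ?thesis using e J(2) by blast
qed

text \<open>At index \<open>d\<close> the degree condition holds in every degree, so
  \<open>C\<close> is itself in \<open>perp\<close>. Ext^1 from \<open>C\<close> into
  \<open>perp\<close> vanishes, hence its add T approximation splits.\<close>

lemma I_cosyzygy_d:
  assumes "I_cosyzygy d C"
  shows "factors_add A T C C (\<lambda>x. x)"
proof -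
  have fgC: "fg_module A C" and extP: "\<And>X. perp X \<Longrightarrow> ext1_zero C X" and perpC: "perp C"
    using assms by (auto simp: I_cosyzygy_def perp_def)
  obtain X' W :: "'a umodule" and a p where e: "short_exact A X' a W p C" and W: "factors_add A T W W (\<lambda>x. x)"
    and X': "perp X'" by (rule perp_approximation[OF perpC])
  note E = short_exactD[OF e]
  obtain s where s: "s \<in> module_hom A C W" "\<And>x. x \<in> carrier C \<Longrightarrow> p (s x) = x"
    by (rule ext1_zero_lift[OF fgC extP[OF X'] e module_hom_id]) blast
  from factors_add_comp_left[OF E(12,11,12) factors_add_comp_right[OF W s(1)] E(6)]
  show ?thesis by (rule factors_add_cong) (simp add: s(2))
qed

text \<open>Downward induction from the \<open>d\<close>-th cosyzygy, which lies in add T and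
  inherits the hypothesis on \<open>T\<close>; each step back prepends one term of add I.\<close>

lemma sub_rec_algebra:
  assumes sub: "sub_rec A I (m - d) T" and dm: "d \<le> m"
  shows "sub_rec A I m U"
proof -
  have "\<forall>C. I_cosyzygy j C \<longrightarrow> sub_rec A I (m - j) C" if "j \<le> d" for j
    using that
  proof (induction rule: inc_induct)
    case base
    show ?case using sub_rec_add[OF I sub] I_cosyzygy_d by (auto simp: I_cosyzygy_def)
  next
    case (step j)
    show ?case
    proof (intro allI impI)
      fix C assume C: "I_cosyzygy j C"
      obtain J C' :: "'a umodule" and f g where J: "short_exact A C f J g C'" "factors_add A I J J (\<lambda>x. x)" "I_cosyzygy (Suc j) C'"
        using I_cosyzygy_Suc[OF C step.hyps(2)] by blast
      have "sub_rec A I (m - Suc j) C'" using step.IH J(3) by blast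
      \<comment> \<open>Here \<open>d <= m\<close> keeps the subtraction of natural numbers from
        truncating.\<close>
      moreover have "m - j = Suc (m - Suc j)" using step.hyps(2) dm by simp
      ultimately show "sub_rec A I (m - j) C" using J(1,2) by auto
    qed
  qed
  from this[of 0] show ?thesis using I_cosyzygy_0 by simp
qed

end

section \<open>The regular module, its tilting coresolution and the theorem\<close>

lemma in_Sub_module_iso:
  assumes "right_module A Q" "right_module A Q'" "module_iso A Q Q'"
  shows "in_Sub A m Q X \<longleftrightarrow> in_Sub A m Q' X"
  by (simp add: in_Sub_def in_add_iso[OF assms])

lemma in_Fac_module_iso:
  assumes "right_module A Q" "right_module A Q'" "module_iso A Q Q'"
  shows "in_Fac A m Q X \<longleftrightarrow> in_Fac A m Q' X"
  by (simp add: in_Fac_def in_add_iso[OF assms])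

text \<open>The regular module has elements of the type of \<open>A\<close>; the copy
  \<open>U\<close> represents it in the universal type, where all Ext arguments take place.\<close>

locale regular_copy = artin_algebra k \<phi> A
  for k :: "'k ring" and \<phi> :: "'k \<Rightarrow> 'a" and A :: "'a ring" (structure) +
  fixes U :: "'a umodule" and \<theta> :: "'a \<Rightarrow> (nat \<Rightarrow> 'a) set"
  assumes fg_U: "fg_module A U" and \<theta>: "\<theta> \<in> module_hom A (regular_module A) U"
    and \<theta>_bij: "bij_betw \<theta> (carrier A) (carrier U)"
begin

lemma rm_regular: "right_module A (regular_module A)"
  by (rule right_module_regular[OF ring_axioms])

lemma rm_U: "right_module A U"
  by (rule fg_module_right_module[OF fg_U])

lemma iso_U: "module_iso A (regular_module A) U"
  using \<theta> \<theta>_bij unfolding module_iso_def by auto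

lemma projective_U: "projective_module A U"
  by (rule projective_regular_copy[OF ring_axioms fg_U \<theta> \<theta>_bij])

lemma generator_U:
  fixes M :: "'a umodule"
  assumes "fg_module A M" "x \<in> carrier M"
  shows "\<exists>h\<in>module_hom A U M. x \<in> h ` carrier U"
  by (rule regular_copy_generator[OF \<theta> \<theta>_bij fg_module_right_module[OF assms(1)] assms(2)])

lemma in_Sub_regular: "in_Sub A m Q (regular_module A) \<longleftrightarrow> in_Sub A m Q U"
proof
  have "bij_betw (inv_into (carrier A) \<theta>) (carrier U) (carrier (regular_module A))"
    using bij_betw_inv_into[OF \<theta>_bij] by simp
  moreover have "inv_into (carrier A) \<theta> \<in> module_hom A U (regular_module A)"
    using module_hom_inv_into[OF rm_regular \<theta>] \<theta>_bij by simp
  moreover assume "in_Sub A m Q (regular_module A)"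
  ultimately show "in_Sub A m Q U" using in_Sub_iso[OF _ fg_U] by blast
next
  assume "in_Sub A m Q U"
  then show "in_Sub A m Q (regular_module A)"
    using in_Sub_iso[OF _ fg_module_regular[OF ring_axioms] \<theta>] \<theta>_bij by simp
qed

lemma tilting_cosyzygies:
  fixes T :: "'a umodule"
  assumes T: "tilting_module A T"
  obtains B V :: "nat \<Rightarrow> 'a umodule" and v w :: "nat \<Rightarrow> (nat \<Rightarrow> 'a) set \<Rightarrow> (nat \<Rightarrow> 'a) set" and r
  where "B 0 = U" "\<And>j. short_exact A (B j) (v j) (V j) (w j) (B (Suc j))"
    "\<And>j. factors_add A T (V j) (V j) (\<lambda>x. x)" "\<And>j. r \<le> j \<Longrightarrow> zero_module (B j)"
proof -
  have fgT: "fg_module A T" using T by (simp add: tilting_module_def)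
  have rT: "right_module A T" by (rule fg_module_right_module[OF fgT])
  obtain s and Q :: "nat \<Rightarrow> 'a umodule" and e d where co: "coresolution A (regular_module A) Q e d"
    and add: "\<forall>i\<le>s. in_add A T (Q i)" and z: "\<forall>i>s. zero_module (Q i)"
    using T unfolding tilting_module_def by blast
  let ?\<psi> = "inv_into (carrier A) \<theta>"
  have \<psi>: "?\<psi> \<in> module_hom A U (regular_module A)"
    using module_hom_inv_into[OF rm_regular \<theta>] \<theta>_bij by simp
  have \<psi>b: "bij_betw ?\<psi> (carrier U) (carrier A)" by (rule bij_betw_inv_into[OF \<theta>_bij])
  have im: "(\<lambda>x. e (?\<psi> x)) ` carrier U = e ` carrier A"
    using bij_betw_imp_surj_on[OF \<psi>b] by (metis image_image)
  have "coresolution A U Q (\<lambda>x. e (?\<psi> x)) d"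
    unfolding coresolution_def
  proof
    fix m
    have L: "left_exact_seq A m (regular_module A) Q e d" using co by (simp add: coresolution_def)
    have "inj_on (\<lambda>x. e (?\<psi> x)) (carrier U)" if "inj_on e (carrier A)"
      using comp_inj_on[OF bij_betw_imp_inj_on[OF \<psi>b], of e] that bij_betw_imp_surj_on[OF \<psi>b]
      by (simp add: comp_def)
    then show "left_exact_seq A m U Q (\<lambda>x. e (?\<psi> x)) d"
      using L fg_U module_hom_comp[OF \<psi>, of e "Q 0"] im unfolding left_exact_seq_def
      by (auto split: nat.splits)
  qed
  then obtain B v where B: "B 0 = U" "\<And>j. short_exact A (B j) (v j) (Q j) (d j) (B (Suc j))"
    "\<And>j. B (Suc j) = restrict_module (Q (Suc j)) (d j ` carrier (Q j))"
    by (rule coresolution_cosyzygies) blast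
  note E = short_exactD[OF B(2)]
  have "factors_add A T (Q j) (Q j) (\<lambda>x. x)" for j
  proof (cases "j \<le> s")
    case True
    then show ?thesis using add in_add_iff[OF rT] by blast
  next
    case False
    then show ?thesis using z by (intro factors_add.zero) (auto simp: zero_module_def)
  qed
  \<comment> \<open>The terms vanish beyond \<open>s\<close>, and \<open>B (Suc l)\<close> is the
    image of the \<open>l\<close>-th term; so vanishing of the cosyzygies is certain from
    \<open>s + 2\<close> on.\<close>
  moreover have "zero_module (B j)" if j: "Suc (Suc s) \<le> j" for j
  proof -
    obtain l where l: "j = Suc l" "s < l" using j by (cases j) auto
    have "zero_module (Q l)" using z l(2) by simp
    then have "d l ` carrier (Q l) = {\<zero>\<^bsub>B (Suc l)\<^esub>}"
      using module_hom_zero[OF E(11,12) E(6), of l] by (simp add: zero_module_def)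
    then show ?thesis unfolding l(1) zero_module_def using E(7)[of l] by simp
  qed
  ultimately show thesis by (rule that[OF B(1,2)])
qed

lemma tilting_ext_zero:
  fixes T :: "'a umodule"
  assumes "tilting_module A T"
  shows "ext_zero i T T"
proof -
  have fg: "fg_module A T" and "trivial_group (Ext A (Suc i) T T)"
    using assms by (auto simp: tilting_module_def)
  then show ?thesis using trivial_Ext_iff[OF fg fg] by simp
qed

text \<open>Both approximations split. All Ext from \<open>T\<close> vanishes, so a cover of
  \<open>T\<close> by add U has a section. The same vanishing reaches the cosyzygy
  \<open>B 1\<close>, so the embedding of \<open>U\<close> into \<open>V 0\<close>, which lies in
  add T, has a retraction.\<close>

lemma tilting_projective_add:
  fixes T :: "'a umodule"
  assumes T: "tilting_module A T" and pd: "proj_dim A T = enat 0"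
  shows "factors_add A U T T (\<lambda>x. x)" "factors_add A T U U (\<lambda>x. x)"
proof -
  have fgT: "fg_module A T" using T by (simp add: tilting_module_def)
  have rT: "right_module A T" by (rule fg_module_right_module[OF fgT])
  have ext: "ext_zero i T N" if "fg_module A N" for i N
    by (rule proj_dim_ext_zero[where n = 0]) (use pd that in auto)
  obtain W :: "'a umodule" and p where W: "fg_module A W" "factors_add A U W W (\<lambda>x. x)" "p \<in> module_hom A W T"
    "\<And>f. f \<in> module_hom A U T \<Longrightarrow> \<exists>g\<in>module_hom A U W. \<forall>x\<in>carrier U. p (g x) = f x"
    by (rule right_approximation[OF fg_U fgT]) blast
  have rW: "right_module A W" by (rule fg_module_right_module[OF W(1)])
  have "carrier T \<subseteq> p ` carrier W"
  proof
    fix x assume "x \<in> carrier T"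
    then obtain h u where h: "h \<in> module_hom A U T" "u \<in> carrier U" "x = h u" using generator_U[OF fgT] by blast
    obtain g where g: "g \<in> module_hom A U W" "\<forall>x\<in>carrier U. p (g x) = h x" using W(4)[OF h(1)] by blast
    have "x = p (g u)" using g(2) h(2,3) by simp
    then show "x \<in> p ` carrier W" by (rule image_eqI) (rule module_hom_closed[OF g(1) h(2)])
  qed
  then have "p ` carrier W = carrier T" using module_hom_closed[OF W(3)] by blast
  from kernel_exact[OF W(1) fgT W(3) this]
  have e: "short_exact A (restrict_module W {y \<in> carrier W. p y = \<zero>\<^bsub>T\<^esub>}) (\<lambda>y. y) W p T" .
  have "ext1_zero T (restrict_module W {y \<in> carrier W. p y = \<zero>\<^bsub>T\<^esub>})"
    using ext[OF short_exactD(1)[OF e], of 0] by simp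
  then obtain s where s: "s \<in> module_hom A T W" "\<And>x. x \<in> carrier T \<Longrightarrow> p (s x) = x"
    by (rule ext1_zero_lift[OF fgT _ e module_hom_id]) blast
  from factors_add_comp_left[OF rT rW rT factors_add_comp_right[OF W(2) s(1)] W(3)]
  show "factors_add A U T T (\<lambda>x. x)" by (rule factors_add_cong) (simp add: s(2))
next
  have fgT: "fg_module A T" using T by (simp add: tilting_module_def)
  have ext: "ext_zero i T N" if "fg_module A N" for i N
    by (rule proj_dim_ext_zero[where n = 0]) (use pd that in auto)
  obtain B V :: "nat \<Rightarrow> 'a umodule" and v w :: "nat \<Rightarrow> (nat \<Rightarrow> 'a) set \<Rightarrow> (nat \<Rightarrow> 'a) set" and r
    where B: "B 0 = U" "\<And>j. short_exact A (B j) (v j) (V j) (w j) (B (Suc j))"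
    "\<And>j. factors_add A T (V j) (V j) (\<lambda>x. x)" "\<And>j. r \<le> j \<Longrightarrow> zero_module (B j)"
    by (rule tilting_cosyzygies[OF T]) (rule that, assumption, assumption, assumption, assumption)
  note E = short_exactD[OF B(2)[of 0], unfolded B(1)]
  have "ext_zero 0 (B (Suc 0)) U"
    by (rule cosyzygy_ext_zero[where B = B and V = V and v = v and w = w and r = r, OF fgT fg_U ext[OF fg_U] B(2,3,4)])
  then have e1: "ext1_zero (B (Suc 0)) U" by simp
  have ex: "short_exact A U (v 0) (V 0) (w 0) (B (Suc 0))" using B(2)[of 0] by (simp add: B(1))
  obtain \<rho> where \<rho>: "\<rho> \<in> module_hom A (V 0) U" "\<And>x. x \<in> carrier U \<Longrightarrow> \<rho> (v 0 x) = x"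
    by (rule ext1_zeroD[OF e1 ex module_hom_id]) blast
  from factors_add_comp_left[OF rm_U E(11) rm_U factors_add_comp_right[OF B(3) E(4)] \<rho>(1)]
  show "factors_add A T U U (\<lambda>x. x)" by (rule factors_add_cong) (simp add: \<rho>(2))
qed

lemma proj_dim_U: "proj_dim A U = enat 0"
proof -
  let ?Z = "restrict_module U {\<zero>\<^bsub>U\<^esub>}"
  interpret U: right_module A U by (rule rm_U)
  note Z = zero_umodule_exists[OF fg_U]
  have PZ: "projective_module A ?Z" by (rule projective_zero_module[OF Z])
  let ?P = "\<lambda>i::nat. if i = 0 then U else ?Z"
  have "projective_resolution A U ?P (\<lambda>x. x) (\<lambda>i x. x)"
    unfolding projective_resolution_def resolution_def right_exact_seq_def
    using fg_U Z(1) projective_U PZ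
    by (auto simp: module_hom_def a_kernel_def' U.smult_zero_right split: nat.splits)
  then have "proj_dim A U \<le> enat 0" by (rule proj_dim_leI) (simp add: Z(2))
  then show ?thesis by (simp add: zero_enat_def[symmetric])
qed

lemma tilting_U: "tilting_module A U"
proof -
  let ?Z = "restrict_module U {\<zero>\<^bsub>U\<^esub>}"
  interpret U: right_module A U by (rule rm_U)
  note Z = zero_umodule_exists[OF fg_U]
  have "ext_zero i U U" for i
    by (rule proj_dim_ext_zero[where n = 0]) (simp_all add: proj_dim_U fg_U)
  then have "trivial_group (Ext A (Suc i) U U)" for i using trivial_Ext_iff[OF fg_U fg_U] by simp
  then have ext: "\<forall>i\<ge>1. trivial_group (Ext A i U U)" by (metis One_nat_def Suc_le_D)
  let ?Q = "\<lambda>i::nat. if i = 0 then U else ?Z"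
  have "coresolution A (regular_module A) ?Q \<theta> (\<lambda>i x. \<zero>\<^bsub>U\<^esub>)"
    unfolding coresolution_def left_exact_seq_def
    using fg_U Z(1) \<theta> \<theta>_bij fg_module_regular[OF ring_axioms]
    by (auto simp: module_hom_def a_kernel_def' U.smult_zero_right bij_betw_def split: nat.splits)
  moreover have "in_add A U U"
    unfolding in_add_iff[OF rm_U] using fg_U factors_add_basic[OF rm_U module_hom_id module_hom_id] by simp
  ultimately show ?thesis
    unfolding tilting_module_def using fg_U ext Z(2) proj_dim_U
    by (intro conjI exI[of _ 0] exI[of _ ?Q] exI) auto
qed

lemma tilting_projective_iso:
  fixes T :: "'a umodule"
  assumes "basic_module A (regular_module A)" "basic_module A T" "tilting_module A T" "proj_dim A T = enat 0"
  shows "module_iso A T U"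
proof -
  have "basic_module A U" by (rule basic_module_iso_transport[OF assms(1) fg_U iso_U])
  then show ?thesis by (rule basic_module_iso[OF assms(2) _ tilting_projective_add[OF assms(3,4)]])
qed

lemma in_Sub_of_tilting:
  fixes I T :: "'a umodule"
  assumes I: "injective_module A I" "proj_dim A I \<le> 1"
    and T: "tilting_module A T" "proj_dim A T = enat d" and d_pos: "0 < d" and d_le: "d \<le> m"
    and Fac: "in_Fac A d I T" and Sub: "in_Sub A (m - d) I T"
  shows "in_Sub A m I U"
proof -
  have fgT: "fg_module A T" using T(1) by (simp add: tilting_module_def)
  have rI: "right_module A I" using I(1) by (simp add: injective_module_def fg_module_right_module)
  obtain B V :: "nat \<Rightarrow> 'a umodule" and v w :: "nat \<Rightarrow> (nat \<Rightarrow> 'a) set \<Rightarrow> (nat \<Rightarrow> 'a) set" and r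
    where B: "B 0 = U" "\<And>j. short_exact A (B j) (v j) (V j) (w j) (B (Suc j))"
    "\<And>j. factors_add A T (V j) (V j) (\<lambda>x. x)" "\<And>j. r \<le> j \<Longrightarrow> zero_module (B j)"
    by (rule tilting_cosyzygies[OF T(1)]) (rule that, assumption, assumption, assumption, assumption)
  \<comment> \<open>The bounds on projective dimension are handed over as vanishing conditions:
    dimension at most one becomes vanishing from \<open>ext_zero 1\<close> on, dimension
    \<open>d\<close> vanishing from \<open>ext_zero d\<close> on.\<close>
  interpret tilting_setup k \<phi> A I T U d r B V v w
  proof
    show "ext_zero 1 I N" if "fg_module A N" for N
      by (rule proj_dim_ext_zero[where n = 1]) (use I(2) that in \<open>simp_all add: one_enat_def\<close>)
    show "ext_zero i T N" if "d \<le> i" "fg_module A N" for i N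
      by (rule proj_dim_ext_zero[where n = d]) (use T(2) that in auto)
    show "fac_rec A I d T" by (rule in_Fac_fac_rec[OF rI Fac])
    show "\<exists>h\<in>module_hom A U M. x \<in> h ` carrier U" if "fg_module A M" "x \<in> carrier M" for M :: "'a umodule" and x
      by (rule generator_U[OF that])
  qed (use I(1) fgT tilting_ext_zero[OF T(1)] d_pos projective_U B in auto)
  have "sub_rec A I m U" by (rule sub_rec_algebra[OF in_Sub_sub_rec[OF rI Sub] d_le])
  then show ?thesis by (rule sub_rec_in_Sub[OF rI])
qed

end

theorem theorem1p3:
  fixes n :: nat and k :: "'k ring" and \<phi> :: "'k \<Rightarrow> 'a" and A :: "'a ring"
    and I :: "('a, 'i) module"
  assumes "artin_algebra k \<phi> A" and "basic_algebra A" and "\<not> semisimple_algebra A"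
    and "injective_module A I" and "proj_dim A I \<le> 1"
  shows "domdim_ge A I (regular_module A) (n + 1) \<longleftrightarrow>
    (\<exists>d::nat. enat d \<le> min (inj_dim A (regular_module A)) (enat (n + 1)) \<and>
      (\<exists>T :: 'a umodule.
        basic_module A T \<and> tilting_module A T \<and> proj_dim A T = enat d \<and>
          in_Fac A d I T \<and> in_Sub A (n + 1 - d) I T \<and>
        (\<forall>T' :: 'a umodule.
          basic_module A T' \<and> tilting_module A T' \<and> proj_dim A T' = enat d \<and>
            in_Fac A d I T' \<and> in_Sub A (n + 1 - d) I T' \<longrightarrow> module_iso A T' T)))"
proof -
  interpret artin_algebra k \<phi> A by fact
  obtain U :: "'a umodule" and \<theta> where U: "fg_module A U" "\<theta> \<in> module_hom A (regular_module A) U"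
    "bij_betw \<theta> (carrier A) (carrier U)" by (rule regular_copy_exists)
  interpret regular_copy k \<phi> A U \<theta> by unfold_locales (rule U)+
  have fgI: "fg_module A I" using assms(4) by (simp add: injective_module_def)
  \<comment> \<open>A copy of \<open>I\<close> in the universal type, with the same add, Sub and Fac
    classes.\<close>
  obtain J :: "'a umodule" where J: "fg_module A J" "module_iso A I J"
    using fg_module_representable[OF fgI] by blast
  have rI: "right_module A I" "right_module A J" using fgI J(1) by (auto intro: fg_module_right_module)
  have injJ: "injective_module A J" by (rule injective_module_iso[OF assms(4) J])
  have pdJ: "proj_dim A J \<le> 1"
    using proj_dim_iso[OF _ J(1) rI(1) J(2), of 1] assms(5) by (simp add: one_enat_def)
  have basic: "basic_module A (regular_module A)" using assms(2) by (simp add: basic_algebra_def)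
  show ?thesis
  proof
    assume "domdim_ge A I (regular_module A) (n + 1)"
    then have "in_Sub A (n + 1) I U" by (simp add: domdim_ge_def in_Sub_regular)
    moreover have "in_Fac A 0 I U" using fg_U by (simp add: in_Fac_def right_exact_seq_def)
    moreover have "basic_module A U" by (rule basic_module_iso_transport[OF basic fg_U iso_U])
    \<comment> \<open>The witness is \<open>d = 0\<close> with \<open>U\<close>: membership in
      \<open>Fac\<close> of index 0 is no restriction, and any competitor of projective dimension 0
      is isomorphic to \<open>U\<close> by Krull-Schmidt.\<close>
    ultimately show "\<exists>d::nat. enat d \<le> min (inj_dim A (regular_module A)) (enat (n + 1)) \<and>
      (\<exists>T :: 'a umodule.
        basic_module A T \<and> tilting_module A T \<and> proj_dim A T = enat d \<and>
          in_Fac A d I T \<and> in_Sub A (n + 1 - d) I T \<and>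
        (\<forall>T' :: 'a umodule.
          basic_module A T' \<and> tilting_module A T' \<and> proj_dim A T' = enat d \<and>
            in_Fac A d I T' \<and> in_Sub A (n + 1 - d) I T' \<longrightarrow> module_iso A T' T))"
      using tilting_U proj_dim_U tilting_projective_iso[OF basic]
      by (intro exI[of _ 0] exI[of _ U] conjI allI impI) (auto simp: zero_enat_def[symmetric])
  next
    assume "\<exists>d::nat. enat d \<le> min (inj_dim A (regular_module A)) (enat (n + 1)) \<and>
      (\<exists>T :: 'a umodule.
        basic_module A T \<and> tilting_module A T \<and> proj_dim A T = enat d \<and>
          in_Fac A d I T \<and> in_Sub A (n + 1 - d) I T \<and>
        (\<forall>T' :: 'a umodule.
          basic_module A T' \<and> tilting_module A T' \<and> proj_dim A T' = enat d \<and>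
            in_Fac A d I T' \<and> in_Sub A (n + 1 - d) I T' \<longrightarrow> module_iso A T' T))"
    then obtain d and T :: "'a umodule" where d: "d \<le> n + 1" and T: "basic_module A T" "tilting_module A T"
      "proj_dim A T = enat d" "in_Fac A d I T" "in_Sub A (n + 1 - d) I T" by auto
    have "in_Sub A (n + 1) J U"
    proof (cases "d = 0")
      case True
      then have Sub: "in_Sub A (n + 1) J T" using T(5) by (simp add: in_Sub_module_iso[OF rI J(2)])
      have rT: "right_module A T" using T(2) by (simp add: tilting_module_def fg_module_right_module)
      \<comment> \<open>For \<open>d = 0\<close> the condition on \<open>T\<close> is already the
        one on the regular module, up to this isomorphism.\<close>
      have "module_iso A T U" using tilting_projective_iso[OF basic T(1,2)] T(3) True by simp
      then obtain f where "f \<in> module_hom A U T" "bij_betw f (carrier U) (carrier T)"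
        using module_iso_sym[OF rT] unfolding module_iso_def by blast
      then show ?thesis using in_Sub_iso[OF Sub fg_U] by blast
    next
      case False
      then show ?thesis
        using in_Sub_of_tilting[OF injJ pdJ T(2,3) _ d] T(4,5)
        by (simp add: in_Sub_module_iso[OF rI J(2)] in_Fac_module_iso[OF rI J(2)])
    qed
    then show "domdim_ge A I (regular_module A) (n + 1)"
      by (simp add: in_Sub_module_iso[OF rI J(2)] domdim_ge_def in_Sub_regular)
  qed
qed

end
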